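(* Let $L\in\mathbb{N}$, $L\ge2$. Suppose $\psi\in L^2(\mathbb{R})$ has the following properties: $\int_{\mathbb{R}}|t|^k|\psi(t)|\,dt<\infty$ for $k=0,\dots,L$; $\int_{\mathbb{R}}t^k\psi(t)\,dt=0$ for $k=0,\dots,L-1$; $\psi$ is $L$-times differentiable with $\psi^{(k)}\in L^1(\mathbb{R})$ for $k=0,\dots,L$; and $\int_{\mathbb{R}}\sup_{(\delta,\tau)\in U}|\psi^{(L)}(\tau t+\delta)|\,dt<\infty$ for some compact neighbourhood $U$ of $(0,1)$ in the affine group $\mathcal{A}ff$. Suppose further that the family $(\psi_{j,k})_{j,k\in\mathbb{Z}}$, $\psi_{j,k}(x)=2^{j/2}\psi(2^jx+k)$, is a tight frame for $L^2(\mathbb{R})$, that is, for some constant $c>0$, $$c\|f\|_{L^2(\mathbb{R})}=\Big(\sum_{j,k\in\mathbb{Z}}|\langle f,\psi_{j,k}\rangle_{L^2(\mathbb{R})}|^2\Big)^{1/2}\quad\text{for all }f\in L^2(\mathbb{R}).$$ Then for all $s\in\mathbb{R}$ with $|s|<L-\tfrac32$ and all $1\le p\le\infty$, $(\psi_{j,k})_{j,k\in\mathbb{Z}}$ is a Banach frame for the coorbit space $\mathcal{C}o^p_{m_s}$ with respect to the sequence space $$\Big\{(c_{j,k})_{j,k\in\mathbb{Z}}: \|(c_{j,k})\|=\Big(\sum_{j,k\in\mathbb{Z}}|c_{j,k}|^p2^{jsp}\Big)^{1/p}<\infty\Big\}$$ (with the supremum $\sup_{j,k}|c_{j,k}|2^{js}$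 if $p=\infty$).
   Context: The affine group $\mathcal{A}ff$ is $\mathbb{R}\times(\mathbb{R}\setminus\{0\})$ with $(b_1,a_1)(b_2,a_2)=(b_1+a_1b_2,a_1a_2)$, neutral element $(0,1)$, left Haar measure $db\,da/a^2$. The wavelet representation on $L^2(\mathbb{R})$ is $\pi(b,a)f(x)=|a|^{-1/2}f((x-b)/a)$ and the wavelet transform is $W_gf(b,a)=\langle f,\pi(b,a)g\rangle_{L^2(\mathbb{R})}$. Weights: $m_s(b,a)=|a|^{-s}$, $w_\rho(b,a)=|a|^\rho+|a|^{-\rho}$; $L^p_v(\mathcal{A}ff)$ has norm $\|F\|_{L^p_v}=\|Fv\|_{L^p(\mathcal{A}ff)}$. Coorbit space: put $\rho=|s|+1$. Let $\mathcal{A}_{w_\rho}=\{\eta\in L^2(\mathbb{R}): W_\eta\eta\in L^1_{w_\rho}(\mathcal{A}ff)\}$ and fix $\eta\in\mathcal{A}_{w_\rho}\setminus\{0\}$. Let $\mathcal{H}^1_{w_\rho}=\{f\in L^2(\mathbb{R}):W_\eta f\in L^1_{w_\rho}(\mathcal{A}ff)\}$ with norm $\|W_\eta f\|_{L^1_{w_\rho}}$ (a $\pi$-invariant Banach space containing $\mathcal{A}_{w_\rho}$), and let $\mathcal{R}_{w_\rho}$ be its antidual (bounded antilinear functionals), with pairing $\langle f,g\rangle=f(g)$. For $f\in\mathcal{R}_{w_\rho}$ put $W_\eta f(b,a)=\langle f,\pi(b,a)\eta\rangle$. Then $\mathcal{C}o^p_{m_s}=\{f\in\mathcal{R}_{w_\rho}: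 W_\eta f\in L^p_{m_s}(\mathcal{A}ff)\}$ with norm $\|W_\eta f\|_{L^p_{m_s}}$; up to equivalent norms it does not depend on $\eta$. A family $(g_i)_{i\in I}$ is a Banach frame for $\mathcal{C}o^p_{m_s}$ with respect to a Banach space $B_d$ of sequences on $I$ if $f\mapsto\|(\langle f,g_i\rangle)_i\|_{B_d}$ (pairing of $\mathcal{R}_{w_\rho}$ and $\mathcal{H}^1_{w_\rho}$) is a well-defined norm on $\mathcal{C}o^p_{m_s}$ equivalent to its given norm and there is a bounded linear $R:B_d\to\mathcal{C}o^p_{m_s}$ with $R((\langle f,g_i\rangle)_i)=f$ for all $f$. *)

theory Defs
  imports "HOL-Probability.Probability"
begin

section \<open>Lebesgue spaces\<close>

text \<open>
  Elements of \<open>L\<^sup>p\<close> are represented by measurable functions rather than by classes of functions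
  modulo equality almost everywhere. The exponent ranges over \<open>[1, \<infinity>]\<close>, hence the type
  \<^typ>\<open>ennreal\<close>.
\<close>

definition Lp_space :: "ennreal \<Rightarrow> 'a measure \<Rightarrow> ('a \<Rightarrow> complex) set" where
  "Lp_space p M = {F \<in> borel_measurable M.
     if p = \<infinity> then esssup M (\<lambda>x. ennreal (norm (F x))) < \<infinity>
     else integrable M (\<lambda>x. norm (F x) powr enn2real p)}"

definition Lp_norm :: "ennreal \<Rightarrow> 'a measure \<Rightarrow> ('a \<Rightarrow> complex) \<Rightarrow> real" where
  "Lp_norm p M F =
     (if p = \<infinity> then enn2real (esssup M (\<lambda>x. ennreal (norm (F x))))
      else (\<integral>x. norm (F x) powr enn2real p \<partial>M) powr (1 / enn2real p))"

definition wLp_space :: "ennreal \<Rightarrow> ('a \<Rightarrow> real) \<Rightarrow> 'a measure \<Rightarrow> ('a \<Rightarrow> complex) set" where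
  "wLp_space p v M = {F. (\<lambda>x. F x * of_real (v x)) \<in> Lp_space p M}"

definition wLp_norm :: "ennreal \<Rightarrow> ('a \<Rightarrow> real) \<Rightarrow> 'a measure \<Rightarrow> ('a \<Rightarrow> complex) \<Rightarrow> real" where
  "wLp_norm p v M F = Lp_norm p M (\<lambda>x. F x * of_real (v x))"

abbreviation L2 :: "(real \<Rightarrow> complex) set" where
  "L2 \<equiv> Lp_space 2 lborel"

definition L2_inner :: "(real \<Rightarrow> complex) \<Rightarrow> (real \<Rightarrow> complex) \<Rightarrow> complex" where
  "L2_inner f g = (\<integral>x. f x * cnj (g x) \<partial>lborel)"


section \<open>The affine group and the wavelet transform\<close>

text \<open>
  The affine group consists of the pairs \<open>(b, a)\<close> with \<open>a \<noteq> 0\<close>. Its left Haar measure is taken on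
  the whole plane, where the line \<open>a = 0\<close> is a null set.
\<close>

definition aff_carrier :: "(real \<times> real) set" where
  "aff_carrier = {(b, a). a \<noteq> 0}"

definition aff_haar :: "(real \<times> real) measure" where
  "aff_haar = density lborel (\<lambda>(b, a). ennreal (1 / a\<^sup>2))"

definition wav_rep :: "real \<times> real \<Rightarrow> (real \<Rightarrow> complex) \<Rightarrow> real \<Rightarrow> complex" where
  "wav_rep = (\<lambda>(b, a) f x. of_real (\<bar>a\<bar> powr (- 1 / 2)) * f ((x - b) / a))"

definition wav_trans :: "(real \<Rightarrow> complex) \<Rightarrow> (real \<Rightarrow> complex) \<Rightarrow> real \<times> real \<Rightarrow> complex" where
  "wav_trans g f z = L2_inner f (wav_rep z g)"

definition wt_m :: "real \<Rightarrow> real \<times> real \<Rightarrow> real" where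
  "wt_m s = (\<lambda>(b, a). \<bar>a\<bar> powr (- s))"

definition wt_w :: "real \<Rightarrow> real \<times> real \<Rightarrow> real" where
  "wt_w \<rho> = (\<lambda>(b, a). \<bar>a\<bar> powr \<rho> + \<bar>a\<bar> powr (- \<rho>))"


section \<open>Coorbit spaces\<close>

definition analyzing :: "real \<Rightarrow> (real \<Rightarrow> complex) set" where
  "analyzing \<rho> = {\<eta> \<in> L2. wav_trans \<eta> \<eta> \<in> wLp_space 1 (wt_w \<rho>) aff_haar}"

definition H1_space :: "(real \<Rightarrow> complex) \<Rightarrow> real \<Rightarrow> (real \<Rightarrow> complex) set" where
  "H1_space \<eta> \<rho> = {f \<in> L2. wav_trans \<eta> f \<in> wLp_space 1 (wt_w \<rho>) aff_haar}"

definition H1_norm :: "(real \<Rightarrow> complex) \<Rightarrow> real \<Rightarrow> (real \<Rightarrow> complex) \<Rightarrow> real" where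
  "H1_norm \<eta> \<rho> f = wLp_norm 1 (wt_w \<rho>) aff_haar (wav_trans \<eta> f)"

text \<open>
  The antidual of \<open>H1_space \<eta> \<rho>\<close>. Functionals are extended by 0 outside this space, so that equality
  of functionals is equality of functions. Boundedness forces a functional to take equal values on
  functions that agree almost everywhere.
\<close>

definition reservoir :: "(real \<Rightarrow> complex) \<Rightarrow> real \<Rightarrow> ((real \<Rightarrow> complex) \<Rightarrow> complex) set" where
  "reservoir \<eta> \<rho> = {f.
     (\<forall>g\<in>H1_space \<eta> \<rho>. \<forall>h\<in>H1_space \<eta> \<rho>. f (\<lambda>x. g x + h x) = f g + f h) \<and>
     (\<forall>c. \<forall>g\<in>H1_space \<eta> \<rho>. f (\<lambda>x. c * g x) = cnj c * f g) \<and>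
     (\<exists>C. \<forall>g\<in>H1_space \<eta> \<rho>. norm (f g) \<le> C * H1_norm \<eta> \<rho> g) \<and>
     (\<forall>g. g \<notin> H1_space \<eta> \<rho> \<longrightarrow> f g = 0)}"

definition ext_wav_trans ::
    "(real \<Rightarrow> complex) \<Rightarrow> ((real \<Rightarrow> complex) \<Rightarrow> complex) \<Rightarrow> real \<times> real \<Rightarrow> complex" where
  "ext_wav_trans \<eta> f z = f (wav_rep z \<eta>)"

definition Co_space ::
    "(real \<Rightarrow> complex) \<Rightarrow> ennreal \<Rightarrow> real \<Rightarrow> ((real \<Rightarrow> complex) \<Rightarrow> complex) set" where
  "Co_space \<eta> p s =
     {f \<in> reservoir \<eta> (\<bar>s\<bar> + 1). ext_wav_trans \<eta> f \<in> wLp_space p (wt_m s) aff_haar}"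

definition Co_norm ::
    "(real \<Rightarrow> complex) \<Rightarrow> ennreal \<Rightarrow> real \<Rightarrow> ((real \<Rightarrow> complex) \<Rightarrow> complex) \<Rightarrow> real" where
  "Co_norm \<eta> p s f = wLp_norm p (wt_m s) aff_haar (ext_wav_trans \<eta> f)"


section \<open>Banach frames\<close>

text \<open>
  The vector spaces below, of sequences and of functionals, are sets of complex-valued functions
  with pointwise operations.
\<close>

definition normed_fun_space :: "('a \<Rightarrow> complex) set \<Rightarrow> (('a \<Rightarrow> complex) \<Rightarrow> real) \<Rightarrow> bool" where
  "normed_fun_space V N \<longleftrightarrow>
     (\<lambda>_. 0) \<in> V \<and>
     (\<forall>u\<in>V. \<forall>v\<in>V. (\<lambda>x. u x + v x) \<in> V \<and> N (\<lambda>x. u x + v x) \<le> N u + N v) \<and>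
     (\<forall>c. \<forall>u\<in>V. (\<lambda>x. c * u x) \<in> V \<and> N (\<lambda>x. c * u x) = norm c * N u) \<and>
     (\<forall>u\<in>V. 0 \<le> N u \<and> (N u = 0 \<longleftrightarrow> u = (\<lambda>_. 0)))"

definition banach_fun_space :: "('a \<Rightarrow> complex) set \<Rightarrow> (('a \<Rightarrow> complex) \<Rightarrow> real) \<Rightarrow> bool" where
  "banach_fun_space V N \<longleftrightarrow>
     normed_fun_space V N \<and>
     (\<forall>u :: nat \<Rightarrow> 'a \<Rightarrow> complex.
        (\<forall>n. u n \<in> V) \<and>
        (\<forall>e>0. \<exists>K. \<forall>m\<ge>K. \<forall>n\<ge>K. N (\<lambda>x. u m x - u n x) < e) \<longrightarrow>
        (\<exists>l\<in>V. (\<lambda>n. N (\<lambda>x. u n x - l x)) \<longlonglongrightarrow> 0))"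

definition bounded_linear_on ::
    "('a \<Rightarrow> complex) set \<Rightarrow> (('a \<Rightarrow> complex) \<Rightarrow> real) \<Rightarrow>
     ('b \<Rightarrow> complex) set \<Rightarrow> (('b \<Rightarrow> complex) \<Rightarrow> real) \<Rightarrow>
     (('a \<Rightarrow> complex) \<Rightarrow> 'b \<Rightarrow> complex) \<Rightarrow> bool" where
  "bounded_linear_on V N W N' T \<longleftrightarrow>
     (\<forall>u\<in>V. T u \<in> W) \<and>
     (\<forall>u\<in>V. \<forall>v\<in>V. T (\<lambda>x. u x + v x) = (\<lambda>y. T u y + T v y)) \<and>
     (\<forall>c. \<forall>u\<in>V. T (\<lambda>x. c * u x) = (\<lambda>y. c * T u y)) \<and>
     (\<exists>C. \<forall>u\<in>V. N' (T u) \<le> C * N u)"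

definition banach_frame ::
    "(real \<Rightarrow> complex) \<Rightarrow> ennreal \<Rightarrow> real \<Rightarrow>
     ('i \<Rightarrow> complex) set \<Rightarrow> (('i \<Rightarrow> complex) \<Rightarrow> real) \<Rightarrow>
     ('i \<Rightarrow> real \<Rightarrow> complex) \<Rightarrow> bool" where
  "banach_frame \<eta> p s Bd N g \<longleftrightarrow>
     banach_fun_space Bd N \<and>
     (\<forall>i. g i \<in> H1_space \<eta> (\<bar>s\<bar> + 1)) \<and>
     (\<forall>f\<in>Co_space \<eta> p s. (\<lambda>i. f (g i)) \<in> Bd) \<and>
     normed_fun_space (Co_space \<eta> p s) (\<lambda>f. N (\<lambda>i. f (g i))) \<and>
     (\<exists>A>0. \<exists>B>0. \<forall>f\<in>Co_space \<eta> p s.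
        A * Co_norm \<eta> p s f \<le> N (\<lambda>i. f (g i)) \<and>
        N (\<lambda>i. f (g i)) \<le> B * Co_norm \<eta> p s f) \<and>
     (\<exists>R. bounded_linear_on Bd N (Co_space \<eta> p s) (Co_norm \<eta> p s) R \<and>
        (\<forall>f\<in>Co_space \<eta> p s. R (\<lambda>i. f (g i)) = f))"

definition dyadic_seq_space :: "ennreal \<Rightarrow> real \<Rightarrow> (int \<times> int \<Rightarrow> complex) set" where
  "dyadic_seq_space p s = {c.
     if p = \<infinity> then bdd_above (range (\<lambda>(j, k). norm (c (j, k)) * 2 powr (j * s)))
     else (\<lambda>(j, k). norm (c (j, k)) powr enn2real p * 2 powr (j * s * enn2real p)) summable_on UNIV}"

definition dyadic_seq_norm :: "ennreal \<Rightarrow> real \<Rightarrow> (int \<times> int \<Rightarrow> complex) \<Rightarrow> real" where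
  "dyadic_seq_norm p s c =
     (if p = \<infinity> then (SUP (j, k)\<in>UNIV. norm (c (j, k)) * 2 powr (j * s))
      else (\<Sum>\<^sub>\<infinity>(j, k)\<in>UNIV. norm (c (j, k)) powr enn2real p * 2 powr (j * s * enn2real p))
             powr (1 / enn2real p))"


section \<open>Wavelet systems\<close>

definition wavelet :: "(real \<Rightarrow> complex) \<Rightarrow> int \<times> int \<Rightarrow> real \<Rightarrow> complex" where
  "wavelet \<psi> = (\<lambda>(j, k) x. of_real (2 powr (j / 2)) * \<psi> (2 powr j * x + k))"

text \<open>
  An infinite sum has the value 0 when the family is not summable, so summability is required
  separately.
\<close>

definition tight_frame :: "('i \<Rightarrow> real \<Rightarrow> complex) \<Rightarrow> bool" where
  "tight_frame g \<longleftrightarrow> (\<exists>c>0. \<forall>f\<in>L2.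
     (\<lambda>i. (norm (L2_inner f (g i)))\<^sup>2) summable_on UNIV \<and>
     c * Lp_norm 2 lborel f = sqrt (\<Sum>\<^sub>\<infinity>i. (norm (L2_inner f (g i)))\<^sup>2))"

definition nderiv :: "nat \<Rightarrow> (real \<Rightarrow> complex) \<Rightarrow> real \<Rightarrow> complex" where
  "nderiv k f = ((\<lambda>h x. vector_derivative h (at x)) ^^ k) f"

definition times_differentiable :: "nat \<Rightarrow> (real \<Rightarrow> complex) \<Rightarrow> bool" where
  "times_differentiable n f \<longleftrightarrow> (\<forall>k<n. \<forall>x. nderiv k f differentiable (at x))"

definition compact_nbhd_one :: "(real \<times> real) set \<Rightarrow> bool" where
  "compact_nbhd_one U \<longleftrightarrow> compact U \<and> U \<subseteq> aff_carrier \<and> (0, 1) \<in> interior U"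

end

theory Submission
  imports Defs "HOL-Real_Asymp.Real_Asymp"
begin

text \<open>
  The analysing vector \<open>\<eta>\<close> is arbitrary, so it is paired with an explicit window, the rational function
  \<open>\<phi>\<close> whose conjugate is \<open>1 / (x - w)\<^sup>m\<close> with \<open>m = L + 2\<close>. The reproducing formula
  \<open>\<integral> \<langle>\<xi>, \<pi>(z) \<phi>\<rangle> \<langle>\<pi>(z) \<eta>, h\<rangle> dz = K \<langle>\<xi>, h\<rangle>\<close> holds with \<open>K\<close> a non-zero multiple of \<open>\<integral> \<eta>(s) / (s - w)\<^bsup>m-1\<^esup> ds\<close>.
  This is non-zero for some \<open>w\<close>, since otherwise all Poisson integrals of \<open>\<eta>\<close> would vanish.

  Integration by parts for small \<open>\<bar>a\<bar>\<close>, and the vanishing moments of \<open>\<psi>\<close> for large \<open>\<bar>a\<bar>\<close>,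
  show that the matrix \<open>\<langle>\<psi>\<^sub>i, \<pi>(z) \<phi>\<rangle>\<close> has rows and columns summable against \<open>\<bar>a\<bar> powr \<sigma>\<close>
  whenever \<open>\<bar>\<sigma>\<bar> < L - 1/2\<close>. The range \<open>\<bar>\<sigma>\<bar> \<le> \<bar>s\<bar> + 1\<close> is thus admissible. Composing with the reproducing formula,
  the matrix \<open>\<langle>\<psi>\<^sub>i, \<pi>(z) \<eta>\<rangle>\<close> inherits these bounds, because \<open>W\<^sub>\<eta> \<eta>\<close> is integrable against \<open>w\<^sub>\<rho>\<close>. The frame expansion
  \<open>g = c\<^sup>-\<^sup>2 \<Sum> \<langle>g, \<psi>\<^sub>i\<rangle> \<psi>\<^sub>i\<close> therefore converges in the space \<open>H\<^sup>1\<close>, so it extends to the antidual, and analysis and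
  synthesis are bounded between the weighted Lebesgue and sequence spaces by Schur's test.
\<close>

section \<open>Square integrable functions\<close>

text \<open>An admissible \<eta> carries only the integrability of \<open>W_\<eta> \<eta>\<close>,
  which gives no direct control of its transform between sampling points. All sampling over the
  dyadic lattice is therefore done with the atom, where it is explicit: differentiating an atom, in
  space, translation, scale or pole, gives a multiple of the atom of the next order, so the
  estimates and the reproducing formula become statements about raising or lowering the order. Order
  L + 2 leaves an integrable atom, of order 2, after L integrations by parts. The bound L - 1/2
  comes from counting powers at small scales: \<open>|a| powr (- 1/2)\<close> from the
  representation, \<open>|a|\<close> from the translation integral, \<open>1 / a^2\<close> from the
  Haar measure and \<open>|a|^L\<close> from the derivatives leave the exponent
  \<open>\<sigma> - 3/2 + L\<close>, which has to exceed -1. With |\<sigma>| up to |s| + 1 this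
  reads |s| < L - 3/2. The reproducing formula is first available on L2 only. On the antidual it is
  recovered from the frame expansion, which turns an abstract functional into an absolutely
  convergent series.\<close>

definition l2 :: "(real \<Rightarrow> complex) \<Rightarrow> real" where
  "l2 f = sqrt (\<integral>x. (norm (f x))\<^sup>2 \<partial>lborel)"

lemma L2_iff: "f \<in> L2 \<longleftrightarrow> f \<in> borel_measurable borel \<and> integrable lborel (\<lambda>x. (norm (f x))\<^sup>2)"
  by (simp add: Lp_space_def powr_numeral)

lemma Lp_norm_2: "Lp_norm 2 lborel f = l2 f"
  by (simp add: Lp_norm_def l2_def powr_numeral powr_half_sqrt)

lemma L2_measurable: "f \<in> L2 \<Longrightarrow> f \<in> borel_measurable borel"
  by (simp add: L2_iff)

lemma l2_nonneg [simp]: "0 \<le> l2 f"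
  by (simp add: l2_def)

lemma l2_power2: "(l2 f)\<^sup>2 = (\<integral>x. (norm (f x))\<^sup>2 \<partial>lborel)"
  by (simp add: l2_def)

lemma L2_nn_integral: "f \<in> L2 \<Longrightarrow> (\<integral>\<^sup>+x. ennreal ((norm (f x))\<^sup>2) \<partial>lborel) = ennreal ((l2 f)\<^sup>2)"
  by (subst nn_integral_eq_integral) (auto simp: L2_iff l2_power2)

lemma ennreal_power2_le_imp_le:
  fixes x :: ennreal
  assumes "x\<^sup>2 \<le> (ennreal b)\<^sup>2" "0 \<le> b"
  shows "x \<le> ennreal b"
proof (cases x rule: ennreal_cases)
  case (real a)
  with assms show ?thesis
    by (auto simp: ennreal_power ennreal_le_iff intro!: power2_le_imp_le)
next
  case top
  with assms show ?thesis
    by (simp add: ennreal_power top_unique)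
qed

lemma L2_nn_Cauchy_Schwarz:
  assumes f: "f \<in> L2" and g: "g \<in> L2"
  shows "(\<integral>\<^sup>+x. ennreal (norm (f x) * norm (g x)) \<partial>lborel) \<le> ennreal (l2 f * l2 g)"
proof (rule ennreal_power2_le_imp_le)
  note [measurable] = L2_measurable[OF f] L2_measurable[OF g]
  let ?I = "\<integral>\<^sup>+x. ennreal (norm (f x) * norm (g x)) \<partial>lborel"
  have "?I\<^sup>2 = (\<integral>\<^sup>+x. ennreal (norm (f x)) * ennreal (norm (g x)) \<partial>lborel)\<^sup>2"
    by (simp add: ennreal_mult)
  also have "\<dots> \<le> (\<integral>\<^sup>+x. (ennreal (norm (f x)))\<^sup>2 \<partial>lborel) * (\<integral>\<^sup>+x. (ennreal (norm (g x)))\<^sup>2 \<partial>lborel)"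
    by (rule Cauchy_Schwarz_nn_integral) auto
  also have "\<dots> = (ennreal (l2 f * l2 g))\<^sup>2"
    by (simp add: L2_nn_integral f g ennreal_power flip: ennreal_mult power_mult_distrib)
  finally show "?I\<^sup>2 \<le> (ennreal (l2 f * l2 g))\<^sup>2" .
qed simp

lemma L2_mult_integrable:
  assumes f: "f \<in> L2" and g: "g \<in> L2"
  shows "integrable lborel (\<lambda>x. f x * g x)"
proof -
  note [measurable] = L2_measurable[OF f] L2_measurable[OF g]
  show ?thesis
    using L2_nn_Cauchy_Schwarz[OF f g]
    by (auto simp: integrable_iff_bounded norm_mult intro: le_less_trans)
qed

lemma borel_measurable_cnj [measurable]: "cnj \<in> borel_measurable borel"
  by (intro borel_measurable_continuous_onI continuous_intros)

lemma L2_cnj: "f \<in> L2 \<Longrightarrow> (\<lambda>x. cnj (f x)) \<in> L2"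
  by (auto simp: L2_iff)

lemma l2_cnj [simp]: "l2 (\<lambda>x. cnj (f x)) = l2 f"
  by (simp add: l2_def)

lemma L2_mult_cnj_integrable:
  assumes f: "f \<in> L2" and g: "g \<in> L2"
  shows "integrable lborel (\<lambda>x. f x * cnj (g x))"
  using L2_mult_integrable[OF f L2_cnj[OF g]] .

lemma L2_mult_bound:
  assumes f: "f \<in> L2" and g: "g \<in> L2"
  shows "norm (\<integral>x. f x * g x \<partial>lborel) \<le> l2 f * l2 g"
proof -
  have "ennreal (norm (\<integral>x. f x * g x \<partial>lborel)) \<le> (\<integral>\<^sup>+x. ennreal (norm (f x * g x)) \<partial>lborel)"
    by (rule integral_norm_bound_ennreal[OF L2_mult_integrable[OF f g]])
  also have "\<dots> \<le> ennreal (l2 f * l2 g)"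
    using L2_nn_Cauchy_Schwarz[OF f g] by (simp add: norm_mult)
  finally show ?thesis
    by (simp add: ennreal_le_iff)
qed

lemma L2_inner_bound:
  assumes f: "f \<in> L2" and g: "g \<in> L2"
  shows "norm (L2_inner f g) \<le> l2 f * l2 g"
  using L2_mult_bound[OF f L2_cnj[OF g]] by (simp add: L2_inner_def)

lemma L2_add:
  assumes f: "f \<in> L2" and g: "g \<in> L2"
  shows "(\<lambda>x. f x + g x) \<in> L2"
proof -
  note [measurable] = L2_measurable[OF f] L2_measurable[OF g]
  have "norm ((norm (f x + g x))\<^sup>2) \<le> norm (2 * (norm (f x))\<^sup>2 + 2 * (norm (g x))\<^sup>2)" for x
  proof -
    have "(norm (f x + g x))\<^sup>2 \<le> (norm (f x) + norm (g x))\<^sup>2"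
      by (intro power_mono norm_triangle_ineq) simp
    also have "\<dots> \<le> 2 * (norm (f x))\<^sup>2 + 2 * (norm (g x))\<^sup>2"
      using sum_squares_bound[of "norm (f x)" "norm (g x)"] by (simp add: power2_sum)
    finally show ?thesis by simp
  qed
  moreover have "integrable lborel (\<lambda>x. 2 * (norm (f x))\<^sup>2 + 2 * (norm (g x))\<^sup>2)"
    using f g by (simp add: L2_iff)
  ultimately show ?thesis
    by (auto simp: L2_iff intro: Bochner_Integration.integrable_bound)
qed

lemma L2_cmult: "f \<in> L2 \<Longrightarrow> (\<lambda>x. c * f x) \<in> L2"
  by (auto simp: L2_iff norm_mult power_mult_distrib)

lemma L2_zero: "(\<lambda>_. 0) \<in> L2"
  by (simp add: L2_iff)

lemma L2_inner_add_left:
  assumes "f \<in> L2" "g \<in> L2" "h \<in> L2"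
  shows "L2_inner (\<lambda>x. f x + g x) h = L2_inner f h + L2_inner g h"
  unfolding L2_inner_def
  by (subst Bochner_Integration.integral_add[symmetric])
     (auto simp: distrib_right intro!: L2_mult_cnj_integrable assms)

lemma L2_inner_cmult_left: "L2_inner (\<lambda>x. c * f x) h = c * L2_inner f h"
  by (simp add: L2_inner_def mult.assoc)

lemma L2_inner_cnj: "cnj (L2_inner f g) = L2_inner g f"
  unfolding L2_inner_def by (subst Bochner_Integration.integral_cnj[symmetric]) (simp add: mult.commute)

lemma L2_inner_norm_commute: "norm (L2_inner f g) = norm (L2_inner g f)"
  by (metis L2_inner_cnj complex_mod_cnj)

lemma L2_inner_add_right:
  assumes "f \<in> L2" "g \<in> L2" "h \<in> L2"
  shows "L2_inner h (\<lambda>x. f x + g x) = L2_inner h f + L2_inner h g"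
  using L2_inner_add_left[OF assms] by (metis L2_inner_cnj complex_cnj_add)

lemma L2_inner_cmult_right: "L2_inner h (\<lambda>x. c * f x) = cnj c * L2_inner h f"
  using L2_inner_cmult_left[of c f h] by (metis L2_inner_cnj complex_cnj_mult)

lemma L2_affine:
  assumes f: "f \<in> L2" and c: "c \<noteq> 0"
  shows "(\<lambda>x. f (t + c * x)) \<in> L2"
proof -
  note [measurable] = L2_measurable[OF f]
  have "integrable lborel (\<lambda>x. (norm (f (t + c * x)))\<^sup>2)"
    using lborel_integrable_real_affine[of "\<lambda>x. (norm (f x))\<^sup>2" c t] f c by (simp add: L2_iff)
  then show ?thesis by (simp add: L2_iff)
qed

lemma l2_affine:
  assumes c: "c \<noteq> 0"
  shows "(l2 (\<lambda>x. f (t + c * x)))\<^sup>2 = (l2 f)\<^sup>2 / \<bar>c\<bar>"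
  using lborel_integral_real_affine[OF c, of "\<lambda>x. (norm (f x))\<^sup>2" t] c
  by (simp add: l2_power2 field_simps)

lemma l2_cmult: "l2 (\<lambda>x. c * f x) = norm c * l2 f"
  by (simp add: l2_def norm_mult power_mult_distrib real_sqrt_mult)

section \<open>The wavelet representation\<close>

lemma wav_rep_apply: "wav_rep (b, a) f x = of_real (\<bar>a\<bar> powr (- 1 / 2)) * f ((x - b) / a)"
  by (simp add: wav_rep_def)

text \<open>\<open>0 powr x\<close> is 0, so on the line a = 0, which is not part of the group, the
  representation yields the zero function. Pointwise bounds hold there trivially, and the line never
  has to be removed from the domain.\<close>

lemma wav_rep_0: "wav_rep (b, 0) f = (\<lambda>_. 0)"
  by (simp add: wav_rep_def fun_eq_iff)

lemma wav_rep_affine: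
  "a \<noteq> 0 \<Longrightarrow> wav_rep (b, a) f = (\<lambda>x. of_real (\<bar>a\<bar> powr (- 1 / 2)) * f (- b / a + (1 / a) * x))"
  by (simp add: wav_rep_def fun_eq_iff diff_divide_distrib)

lemma wav_rep_L2:
  assumes "f \<in> L2"
  shows "wav_rep z f \<in> L2"
proof (cases z)
  case (Pair b a)
  show ?thesis
  proof (cases "a = 0")
    case False
    show ?thesis
      unfolding Pair wav_rep_affine[OF False] by (intro L2_cmult L2_affine assms) (use False in simp)
  qed (simp add: Pair wav_rep_0 L2_zero)
qed

lemma l2_wav_rep:
  assumes "a \<noteq> 0"
  shows "l2 (wav_rep (b, a) f) = l2 f"
proof -
  have "(l2 (wav_rep (b, a) f))\<^sup>2 = (\<bar>a\<bar> powr (- 1 / 2))\<^sup>2 * ((l2 f)\<^sup>2 / \<bar>1 / a\<bar>)"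
    using assms unfolding wav_rep_affine[OF assms] l2_cmult power_mult_distrib
    by (subst l2_affine) auto
  also have "(\<bar>a\<bar> powr (- 1 / 2))\<^sup>2 = 1 / \<bar>a\<bar>"
    using assms by (simp add: power2_eq_square powr_add[symmetric] powr_minus_divide)
  finally have "(l2 (wav_rep (b, a) f))\<^sup>2 = (l2 f)\<^sup>2"
    using assms by simp
  then show ?thesis
    by (simp add: power2_eq_iff_nonneg)
qed

lemma l2_wav_rep_le: "l2 (wav_rep z f) \<le> l2 f"
proof (cases z)
  case (Pair b a)
  then show ?thesis
    by (cases "a = 0") (simp_all add: l2_wav_rep wav_rep_0 l2_def[of "\<lambda>_. 0"])
qed

lemma wav_trans_bound:
  assumes "f \<in> L2" "g \<in> L2"
  shows "norm (wav_trans g f z) \<le> l2 f * l2 g"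
proof -
  have "norm (wav_trans g f z) \<le> l2 f * l2 (wav_rep z g)"
    unfolding wav_trans_def by (intro L2_inner_bound assms wav_rep_L2)
  also have "\<dots> \<le> l2 f * l2 g"
    by (intro mult_left_mono l2_wav_rep_le) simp
  finally show ?thesis .
qed

lemma wav_trans_apply:
  "wav_trans g f (b, a) = of_real (\<bar>a\<bar> powr (- 1 / 2)) * (\<integral>x. f x * cnj (g ((x - b) / a)) \<partial>lborel)"
proof -
  have "wav_trans g f (b, a) = (\<integral>x. of_real (\<bar>a\<bar> powr (- 1 / 2)) * (f x * cnj (g ((x - b) / a))) \<partial>lborel)"
    unfolding wav_trans_def L2_inner_def wav_rep_apply by (intro Bochner_Integration.integral_cong) auto
  then show ?thesis by simp
qed

text \<open>Since \<pi> is unitary, the coefficient depends only on the quotient of the two group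
  elements, \<open>(b, a)^-1 (b', a') = ((b' - b) / a, a' / a)\<close>; the substitution t = b + a x
  makes this explicit. Together with the invariance of the Haar measure it reduces all rows of a
  kernel to one integral.\<close>

lemma wav_trans_covariant:
  assumes a: "a \<noteq> 0"
  shows "L2_inner (wav_rep (b, a) f) (wav_rep (b', a') g) = wav_trans g f ((b' - b) / a, a' / a)"
proof (cases "a' = 0")
  case True
  then show ?thesis
    by (simp add: wav_trans_def wav_rep_0 L2_inner_def)
next
  case False
  have "L2_inner (wav_rep (b, a) f) (wav_rep (b', a') g) =
      \<bar>a\<bar> *\<^sub>R (\<integral>x. wav_rep (b, a) f (b + a * x) * cnj (wav_rep (b', a') g (b + a * x)) \<partial>lborel)"
    unfolding L2_inner_def by (rule lborel_integral_real_affine[OF a])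
  also have "(\<lambda>x. wav_rep (b, a) f (b + a * x) * cnj (wav_rep (b', a') g (b + a * x))) =
      (\<lambda>x. of_real (\<bar>a\<bar> powr (- 1 / 2) * \<bar>a'\<bar> powr (- 1 / 2)) *
        (f x * cnj (g ((x - (b' - b) / a) / (a' / a)))))"
  proof
    fix x
    have eq: "(b + a * x - b') / a' = (x - (b' - b) / a) / (a' / a)"
    proof -
      have "(x - (b' - b) / a) / (a' / a) = ((x - (b' - b) / a) * a) / a'"
        using a False by (simp add: divide_simps)
      also have "(x - (b' - b) / a) * a = b + a * x - b'"
        using a by (simp add: field_simps)
      finally show ?thesis ..
    qed
    show "wav_rep (b, a) f (b + a * x) * cnj (wav_rep (b', a') g (b + a * x)) =
      of_real (\<bar>a\<bar> powr (- 1 / 2) * \<bar>a'\<bar> powr (- 1 / 2)) * (f x * cnj (g ((x - (b' - b) / a) / (a' / a))))"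
      unfolding wav_rep_apply eq
      by (simp only: add_diff_cancel_left' nonzero_mult_div_cancel_left[OF a] of_real_mult complex_cnj_mult
          complex_cnj_complex_of_real mult_ac)
  qed
  also have "\<bar>a\<bar> *\<^sub>R (\<integral>x. of_real (\<bar>a\<bar> powr (- 1 / 2) * \<bar>a'\<bar> powr (- 1 / 2)) *
        (f x * cnj (g ((x - (b' - b) / a) / (a' / a)))) \<partial>lborel) =
      of_real (\<bar>a\<bar> * (\<bar>a\<bar> powr (- 1 / 2) * \<bar>a'\<bar> powr (- 1 / 2))) *
        (\<integral>x. f x * cnj (g ((x - (b' - b) / a) / (a' / a))) \<partial>lborel)"
    by (simp add: scaleR_conv_of_real)
  also have norms: "\<bar>a\<bar> * (\<bar>a\<bar> powr (- 1 / 2) * \<bar>a'\<bar> powr (- 1 / 2)) = \<bar>a' / a\<bar> powr (- 1 / 2)"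
  proof -
    have "\<bar>a\<bar> * \<bar>a\<bar> powr (- 1 / 2) = \<bar>a\<bar> powr (1 / 2)"
      using a powr_add[of "\<bar>a\<bar>" 1 "-1/2"] by simp
    moreover have "\<bar>a' / a\<bar> powr (- 1 / 2) = \<bar>a'\<bar> powr (- 1 / 2) / \<bar>a\<bar> powr (- 1 / 2)"
      by (simp add: abs_divide powr_divide)
    ultimately show ?thesis
      using a by (simp add: mult.assoc[symmetric]) (simp add: powr_minus_divide)
  qed
  finally show ?thesis
    by (simp add: wav_trans_apply)
qed

text \<open>The system samples the orbit of \<psi> at the points \<open>(- k 2^-j, 2^-j)\<close>.
  Hence \<open>|a| powr \<sigma>\<close> on the group becomes \<open>2 powr (- j \<sigma>)\<close>
  on the index set, and \<open>wt_m s\<close> becomes the weight \<open>2 powr (j s)\<close> of the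
  sequence space.\<close>

lemma wavelet_eq_wav_rep: "wavelet \<psi> (j, k) = wav_rep (- real_of_int k * 2 powr - real_of_int j, 2 powr - real_of_int j) \<psi>"
proof
  fix x
  have "(2 powr (- real_of_int j)) powr (- 1 / 2) = 2 powr (j / 2)"
    by (simp add: powr_powr)
  moreover have "(x + real_of_int k * 2 powr - real_of_int j) / 2 powr - real_of_int j = 2 powr real_of_int j * x + real_of_int k"
    by (simp add: powr_minus field_simps)
  ultimately show "wavelet \<psi> (j, k) x = wav_rep (- real_of_int k * 2 powr - real_of_int j, 2 powr - real_of_int j) \<psi> x"
    by (simp add: wavelet_def wav_rep_apply)
qed

section \<open>Haar measure of the affine group\<close>

lemma sets_aff_haar [measurable_cong, simp]: "sets aff_haar = sets borel"
  by (simp add: aff_haar_def)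

lemma space_aff_haar [simp]: "space aff_haar = UNIV"
  by (simp add: aff_haar_def)

lemma aff_density_measurable [measurable]: "(\<lambda>(b::real, a::real). ennreal (1 / a\<^sup>2)) \<in> borel_measurable borel"
  unfolding borel_prod[symmetric] by measurable

lemma sigma_finite_aff_haar: "sigma_finite_measure aff_haar"
  unfolding aff_haar_def
  by (subst sigma_finite_measure.sigma_finite_iff_density_finite[OF sigma_finite_lborel])
     (use aff_density_measurable in \<open>auto simp: case_prod_beta\<close>)

interpretation aff_haar: sigma_finite_measure aff_haar
  by (rule sigma_finite_aff_haar)

lemma nn_integral_aff_haar:
  assumes f: "f \<in> borel_measurable borel"
  shows "(\<integral>\<^sup>+z. f z \<partial>aff_haar) = (\<integral>\<^sup>+a. (\<integral>\<^sup>+b. f (b, a) \<partial>lborel) * ennreal (1 / a\<^sup>2) \<partial>lborel)"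
proof -
  have f'[measurable]: "f \<in> borel_measurable (borel \<Otimes>\<^sub>M borel)"
    using f by (simp add: borel_prod)
  have [measurable]: "(\<lambda>(b, a). ennreal (1 / a\<^sup>2) * f (b, a)) \<in> borel_measurable (lborel \<Otimes>\<^sub>M (lborel :: real measure))"
    by measurable
  have "(\<integral>\<^sup>+z. f z \<partial>aff_haar) = (\<integral>\<^sup>+z. (case z of (b, a) \<Rightarrow> ennreal (1 / a\<^sup>2) * f (b, a)) \<partial>(lborel \<Otimes>\<^sub>M lborel))"
    unfolding aff_haar_def lborel_prod
    by (subst nn_integral_density) (use f in \<open>auto simp: case_prod_beta intro!: nn_integral_cong\<close>)
  also have "\<dots> = (\<integral>\<^sup>+a. (\<integral>\<^sup>+b. ennreal (1 / a\<^sup>2) * f (b, a) \<partial>lborel) \<partial>lborel)"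
    by (subst lborel_pair.nn_integral_snd[symmetric]) auto
  also have "\<dots> = (\<integral>\<^sup>+a. (\<integral>\<^sup>+b. f (b, a) \<partial>lborel) * ennreal (1 / a\<^sup>2) \<partial>lborel)"
    by (intro nn_integral_cong, subst nn_integral_cmult) (auto simp: mult.commute)
  finally show ?thesis .
qed

text \<open>Left translation scales both coordinates by a0; the two Jacobians give a0^2, which the
  density \<open>1 / a^2\<close> cancels.\<close>

lemma nn_integral_aff_haar_left_invariant:
  fixes f :: "real \<times> real \<Rightarrow> ennreal"
  assumes f: "f \<in> borel_measurable borel" and a0: "a0 \<noteq> 0"
  shows "(\<integral>\<^sup>+z. f ((fst z - b0) / a0, snd z / a0) \<partial>aff_haar) = (\<integral>\<^sup>+z. f z \<partial>aff_haar)"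
proof -
  have f'[measurable]: "f \<in> borel_measurable (borel \<Otimes>\<^sub>M borel)"
    using f by (simp add: borel_prod)
  have m: "(\<lambda>z. f ((fst z - b0) / a0, snd z / a0)) \<in> borel_measurable borel"
    unfolding borel_prod[symmetric] by measurable
  have "(\<integral>\<^sup>+z. f ((fst z - b0) / a0, snd z / a0) \<partial>aff_haar) =
      (\<integral>\<^sup>+a. (\<integral>\<^sup>+b. f ((b - b0) / a0, a / a0) \<partial>lborel) * ennreal (1 / a\<^sup>2) \<partial>lborel)"
    by (subst nn_integral_aff_haar[OF m]) simp
  also have "\<dots> = (\<integral>\<^sup>+a. (\<bar>a0\<bar> * (\<integral>\<^sup>+b. f (b, a / a0) \<partial>lborel)) * ennreal (1 / a\<^sup>2) \<partial>lborel)"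
  proof (intro nn_integral_cong arg_cong2[where f="(*)"] refl)
    fix a
    show "(\<integral>\<^sup>+b. f ((b - b0) / a0, a / a0) \<partial>lborel) = \<bar>a0\<bar> * (\<integral>\<^sup>+b. f (b, a / a0) \<partial>lborel)"
      using a0 by (subst nn_integral_real_affine[of _ a0 b0]) auto
  qed
  also have "\<dots> = \<bar>a0\<bar> * (\<integral>\<^sup>+a. (\<bar>a0\<bar> * (\<integral>\<^sup>+b. f (b, a) \<partial>lborel)) * ennreal (1 / (a0 * a)\<^sup>2) \<partial>lborel)"
    using a0 by (subst nn_integral_real_affine[of _ a0 0]) auto
  also have "\<dots> = (\<integral>\<^sup>+a. \<bar>a0\<bar> * ((\<bar>a0\<bar> * (\<integral>\<^sup>+b. f (b, a) \<partial>lborel)) * ennreal (1 / (a0 * a)\<^sup>2)) \<partial>lborel)"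
    by (subst nn_integral_cmult) auto
  also have "\<dots> = (\<integral>\<^sup>+a. (\<integral>\<^sup>+b. f (b, a) \<partial>lborel) * ennreal (1 / a\<^sup>2) \<partial>lborel)"
  proof (intro nn_integral_cong)
    fix a
    have "ennreal \<bar>a0\<bar> * (ennreal \<bar>a0\<bar> * I * ennreal (1 / (a0 * a)\<^sup>2)) =
        I * (ennreal (\<bar>a0\<bar> * \<bar>a0\<bar> * (1 / (a0 * a)\<^sup>2)))" for I
      by (simp add: ennreal_mult mult_ac del: abs_mult_self_eq times_divide_eq_right)
    moreover have "\<bar>a0\<bar> * \<bar>a0\<bar> * (1 / (a0 * a)\<^sup>2) = 1 / a\<^sup>2"
      using a0 by (simp add: power_mult_distrib power2_eq_square)
    ultimately show "\<bar>a0\<bar> * (\<bar>a0\<bar> * (\<integral>\<^sup>+b. f (b, a) \<partial>lborel) * ennreal (1 / (a0 * a)\<^sup>2)) =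
        (\<integral>\<^sup>+b. f (b, a) \<partial>lborel) * ennreal (1 / a\<^sup>2)"
      by (simp add: ennreal_mult)
  qed
  also have "\<dots> = (\<integral>\<^sup>+z. f z \<partial>aff_haar)"
    by (rule nn_integral_aff_haar[OF f, symmetric])
  finally show ?thesis .
qed

lemma wav_rep_measurable:
  assumes f: "f \<in> borel_measurable borel"
  shows "(\<lambda>(z, x). wav_rep z f x) \<in> borel_measurable (borel \<Otimes>\<^sub>M borel)"
proof -
  note [measurable] = f
  have "(\<lambda>p. of_real (\<bar>snd (fst p)\<bar> powr (- 1 / 2)) * f ((snd p - fst (fst p)) / snd (fst p)))
      \<in> borel_measurable ((borel \<Otimes>\<^sub>M borel) \<Otimes>\<^sub>M borel)"
    by measurable
  then show ?thesis
    by (simp add: borel_prod wav_rep_def case_prod_beta)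
qed

lemma wav_trans_measurable:
  assumes f: "f \<in> borel_measurable borel" and g: "g \<in> borel_measurable borel"
  shows "wav_trans g f \<in> borel_measurable borel"
proof -
  note [measurable] = f wav_rep_measurable[OF g]
  have "(\<lambda>z. \<integral>x. f x * cnj (case (z, x) of (z, x) \<Rightarrow> wav_rep z g x) \<partial>lborel) \<in> borel_measurable borel"
    by measurable
  then show ?thesis
    by (simp add: wav_trans_def[abs_def] L2_inner_def)
qed

section \<open>Integration on the line\<close>

lemma pair_integrableI:
  fixes f :: "'a \<Rightarrow> 'b \<Rightarrow> 'c::{banach,second_countable_topology}"
  assumes "sigma_finite_measure M" "sigma_finite_measure N"
    and f: "case_prod f \<in> borel_measurable (M \<Otimes>\<^sub>M N)"
    and "(\<integral>\<^sup>+x. \<integral>\<^sup>+y. ennreal (norm (f x y)) \<partial>N \<partial>M) < \<infinity>"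
  shows "integrable (M \<Otimes>\<^sub>M N) (case_prod f)"
proof -
  interpret pair_sigma_finite M N using assms by (simp add: pair_sigma_finite_def)
  have [measurable]: "case_prod f \<in> borel_measurable (M \<Otimes>\<^sub>M N)" by fact
  have "(\<integral>\<^sup>+p. ennreal (norm (case_prod f p)) \<partial>(M \<Otimes>\<^sub>M N)) = (\<integral>\<^sup>+x. \<integral>\<^sup>+y. ennreal (norm (f x y)) \<partial>N \<partial>M)"
    by (subst M2.nn_integral_fst[symmetric]) auto
  with assms show ?thesis by (auto simp: integrable_iff_bounded)
qed

lemma integrable_iterated_integral:
  fixes f :: "'a \<Rightarrow> 'b \<Rightarrow> 'c::{banach,second_countable_topology}"
  assumes "sigma_finite_measure M" "sigma_finite_measure N"
    and "integrable (M \<Otimes>\<^sub>M N) (case_prod f)"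
  shows "integrable M (\<lambda>x. \<integral>y. f x y \<partial>N)" "integrable N (\<lambda>y. \<integral>x. f x y \<partial>M)"
    "(\<integral>x. \<integral>y. f x y \<partial>N \<partial>M) = (\<integral>y. \<integral>x. f x y \<partial>M \<partial>N)"
proof -
  interpret pair_sigma_finite M N using assms by (simp add: pair_sigma_finite_def)
  show "integrable M (\<lambda>x. \<integral>y. f x y \<partial>N)"
    using integrable_fst[of "f"] assms by simp
  show "integrable N (\<lambda>y. \<integral>x. f x y \<partial>M)"
    using integrable_snd[of "f"] assms by simp
  show "(\<integral>x. \<integral>y. f x y \<partial>N \<partial>M) = (\<integral>y. \<integral>x. f x y \<partial>M \<partial>N)"
    using Fubini_integral[of f] assms by simp
qed

text \<open>The gauge integral of an everywhere defined derivative is the increment of F even if F'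
  is discontinuous; integrability of F' identifies it with the Lebesgue integral. The top derivative
  of \<psi> is only known to be integrable.\<close>

lemma FTC_indicator:
  fixes F :: "real \<Rightarrow> complex"
  assumes "a \<le> b" and F: "\<And>x. (F has_vector_derivative F' x) (at x)" and F': "set_integrable lborel {a..b} F'"
  shows "(\<integral>x. indicator {a..b} x *\<^sub>R F' x \<partial>lborel) = F b - F a"
proof -
  have "(F' has_integral (F b - F a)) {a..b}"
    using assms by (intro fundamental_theorem_of_calculus) (auto intro: has_vector_derivative_at_within)
  moreover have "(LINT x : {a..b} | lborel. F' x) = integral {a..b} F'"
    by (rule set_borel_integral_eq_integral) fact
  ultimately show ?thesis
    by (simp add: set_lebesgue_integral_def integral_unique)
qed

text \<open>Averaging the translation invariance of the integral over shifts t in [0, 1] turns the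
  integral of F' into that of F (x + 1) - F x, which is 0. Integration by parts on the line thus
  rests on integrability alone, without limits of F at infinity.\<close>

lemma integral_derivative_eq_0:
  fixes F :: "real \<Rightarrow> complex"
  assumes F: "\<And>x. (F has_vector_derivative F' x) (at x)"
    and iF: "integrable lborel F" and iF': "integrable lborel F'"
  shows "(\<integral>x. F' x \<partial>lborel) = 0"
proof -
  note [measurable] = borel_measurable_integrable[OF iF']
  have int: "integrable (lborel \<Otimes>\<^sub>M lborel) (\<lambda>(t::real, x). indicator {0..1} t *\<^sub>R F' (x + t))"
  proof (rule pair_integrableI)
    have "(\<integral>\<^sup>+t. \<integral>\<^sup>+x. ennreal (norm (indicator {0..1::real} t *\<^sub>R F' (x + t))) \<partial>lborel \<partial>lborel) =
        (\<integral>\<^sup>+t. indicator {0..1::real} t * (\<integral>\<^sup>+x. ennreal (norm (F' x)) \<partial>lborel) \<partial>lborel)"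
    proof (rule nn_integral_cong)
      fix t :: real
      have "(\<integral>\<^sup>+x. ennreal (norm (F' (x + t))) \<partial>lborel) = (\<integral>\<^sup>+x. ennreal (norm (F' x)) \<partial>lborel)"
        by (subst nn_integral_real_affine[of "\<lambda>x. ennreal (norm (F' x))" 1 t]) (auto simp: add.commute)
      then show "(\<integral>\<^sup>+x. ennreal (norm (indicator {0..1::real} t *\<^sub>R F' (x + t))) \<partial>lborel) =
          indicator {0..1::real} t * (\<integral>\<^sup>+x. ennreal (norm (F' x)) \<partial>lborel)"
        by (auto simp: indicator_def)
    qed
    also have "\<dots> = (\<integral>\<^sup>+x. ennreal (norm (F' x)) \<partial>lborel)"
      by (subst nn_integral_multc) auto
    also have "\<dots> < \<infinity>" using iF' by (simp add: integrable_iff_bounded)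
    finally show "(\<integral>\<^sup>+t. \<integral>\<^sup>+x. ennreal (norm (indicator {0..1::real} t *\<^sub>R F' (x + t))) \<partial>lborel \<partial>lborel) < \<infinity>" .
  qed (auto intro: sigma_finite_lborel)
  have aff: "(\<integral>x. F' (x + t) \<partial>lborel) = (\<integral>x. F' x \<partial>lborel)" for t
    using lborel_integral_real_affine[of 1 F' t] by (simp add: add.commute)
  have affF: "(\<integral>x. F (x + t) \<partial>lborel) = (\<integral>x. F x \<partial>lborel)" for t
    using lborel_integral_real_affine[of 1 F t] by (simp add: add.commute)
  have iaffF: "integrable lborel (\<lambda>x. F (x + t))" for t
    using lborel_integrable_real_affine[OF iF, of 1 t] by (simp add: add.commute)
  have "(\<integral>x. F' x \<partial>lborel) = (\<integral>t. indicator {0..1::real} t *\<^sub>R (\<integral>x. F' x \<partial>lborel) \<partial>lborel)"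
    by simp
  also have "\<dots> = (\<integral>t. (\<integral>x. indicator {0..1::real} t *\<^sub>R F' (x + t) \<partial>lborel) \<partial>lborel)"
    by (simp only: integral_scaleR_right aff)
  also have "\<dots> = (\<integral>x. (\<integral>t. indicator {0..1::real} t *\<^sub>R F' (x + t) \<partial>lborel) \<partial>lborel)"
    by (rule integrable_iterated_integral(3)[OF sigma_finite_lborel sigma_finite_lborel int])
  also have "\<dots> = (\<integral>x. F (x + 1) - F (x + 0) \<partial>lborel)"
  proof (intro Bochner_Integration.integral_cong refl FTC_indicator)
    fix x
    show "((\<lambda>t. F (x + t)) has_vector_derivative F' (x + t)) (at t)" for t
      using F[of "x + t"] has_vector_derivative_shift[of F] 
      by (auto intro!: derivative_eq_intros vector_diff_chain_at[of "\<lambda>t. x + t" 1 t F, unfolded o_def, simplified])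
    show "set_integrable lborel {0..1} (\<lambda>t. F' (x + t))"
      unfolding set_integrable_def
      using lborel_integrable_real_affine[OF iF', of 1 x] by (intro integrable_mult_indicator) auto
  qed simp
  also have "\<dots> = 0"
    using iaffF[of 1] iF affF[of 1] by simp
  finally show ?thesis .
qed

text \<open>Half-open unit intervals starting at \<beta> + k tile the line. This compares a sum over
  integer translates with an integral, uniformly in the offset \<beta>.\<close>

lemma nn_integral_unit_intervals:
  fixes f :: "real \<Rightarrow> ennreal"
  assumes [measurable]: "f \<in> borel_measurable borel"
  shows "(\<integral>\<^sup>+k. (\<integral>\<^sup>+t. indicator {\<beta> + real_of_int k ..< \<beta> + real_of_int k + 1} t * f t \<partial>lborel) \<partial>count_space (UNIV :: int set)) = (\<integral>\<^sup>+t. f t \<partial>lborel)"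
proof -
  interpret pair_sigma_finite "count_space (UNIV::int set)" "lborel :: real measure"
    by (simp add: pair_sigma_finite_def sigma_finite_lborel sigma_finite_measure_count_space)
  have [measurable]: "(\<lambda>(k::int, t). indicator {\<beta> + real_of_int k ..< \<beta> + real_of_int k + 1} t * f t) \<in> borel_measurable (count_space UNIV \<Otimes>\<^sub>M lborel)"
    by (rule measurable_pair_measure_countable1) auto
  have "(\<integral>\<^sup>+k. (\<integral>\<^sup>+t. indicator {\<beta> + real_of_int k ..< \<beta> + real_of_int k + 1} t * f t \<partial>lborel) \<partial>count_space (UNIV :: int set)) =
      (\<integral>\<^sup>+t. (\<integral>\<^sup>+k. indicator {\<beta> + real_of_int k ..< \<beta> + real_of_int k + 1} t * f t \<partial>count_space (UNIV :: int set)) \<partial>lborel)"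
    by (rule Fubini'[symmetric]) auto
  also have "\<dots> = (\<integral>\<^sup>+t. f t \<partial>lborel)"
  proof (rule nn_integral_cong)
    fix t
    have "indicator {\<beta> + real_of_int k ..< \<beta> + real_of_int k + 1} t = (indicator {\<lfloor>t - \<beta>\<rfloor>} k :: ennreal)" for k
      by (auto simp: indicator_def floor_eq_iff) linarith+
    then show "(\<integral>\<^sup>+k. indicator {\<beta> + real_of_int k ..< \<beta> + real_of_int k + 1} t * f t \<partial>count_space (UNIV :: int set)) = f t"
      by (simp add: nn_integral_multc)
  qed
  finally show ?thesis .
qed

section \<open>Rational atoms\<close>

text \<open>Powers of the Cauchy kernel with pole w, taken off the real axis. \<open>atom 0\<close>
  is the constant 1 and serves as the base of recursions in the order.\<close>

definition atom :: "nat \<Rightarrow> complex \<Rightarrow> real \<Rightarrow> complex" where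
  "atom n w x = 1 / (of_real x - w) ^ n"

lemma atom_nz: "Im w \<noteq> 0 \<Longrightarrow> of_real x - w \<noteq> 0"
  by (auto simp: complex_eq_iff)

lemma atom_measurable [measurable]: "atom n w \<in> borel_measurable borel"
  unfolding atom_def[abs_def] by measurable

lemma atom_deriv:
  assumes "Im w \<noteq> 0"
  shows "((\<lambda>t. atom n w (c + d * t)) has_vector_derivative (- of_real d * of_nat n * atom (Suc n) w (c + d * t))) (at t within S)"
proof -
  have nz: "of_real (c + d * t) - w \<noteq> 0" by (rule atom_nz[OF assms])
  have "((\<lambda>z. inverse (of_real c + of_real d * z - w) ^ n) has_field_derivative
      (- of_real d * of_nat n * atom (Suc n) w (c + d * t))) (at (of_real t))"
  proof (cases n)
    case (Suc m)
    have eq: "atom (Suc (Suc m)) w (c + d * t) = inverse (of_real c + of_real d * of_real t - w) ^ Suc (Suc m)"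
      by (simp only: atom_def inverse_eq_divide of_real_add of_real_mult power_divide power_one)
    define u where "u = inverse (of_real c + of_real d * of_real t - w)"
    have "((\<lambda>z. inverse (of_real c + of_real d * z - w)) has_field_derivative - (u * of_real d * u)) (at (of_real t))"
      using nz by (auto intro!: derivative_eq_intros simp: u_def)
    from DERIV_power_Suc[OF this, of m] show ?thesis
      unfolding Suc eq u_def[symmetric] by (simp add: algebra_simps)
  qed (auto simp: atom_def)
  from has_vector_derivative_real_field[OF this] show ?thesis
    by (auto simp: atom_def inverse_eq_divide power_divide intro: has_vector_derivative_at_within)
qed

text \<open>One constant serves all orders, because only |x - w| has to be compared with
  \<open>sqrt (1 + x^2)\<close>.\<close>

lemma atom_bound:
  assumes "Im w \<noteq> 0"
  obtains C where "C \<ge> 1" "\<And>n x. norm (atom n w x) \<le> (C / sqrt (1 + x\<^sup>2)) ^ n"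
proof -
  \<comment> \<open>The 2 absorbs the factor in
    \<open>x^2 \<le> 2 (x - Re w)^2 + 2 (Re w)^2\<close>; the quotient lets the imaginary part pay
    for \<open>1 + 2 (Re w)^2\<close>.\<close>
  define C where "C = max 2 ((1 + 2 * (Re w)\<^sup>2) / (Im w)\<^sup>2)"
  have C: "C \<ge> 2" "1 + 2 * (Re w)\<^sup>2 \<le> C * (Im w)\<^sup>2"
    using assms by (auto simp: C_def max_def field_simps)
  have "1 + x\<^sup>2 \<le> C * (norm (of_real x - w))\<^sup>2" for x :: real
  proof -
    have "x\<^sup>2 \<le> 2 * (x - Re w)\<^sup>2 + 2 * (Re w)\<^sup>2"
      using zero_le_power2[of "x - 2 * Re w"] by (simp add: power2_eq_square algebra_simps)
    also have "2 * (x - Re w)\<^sup>2 \<le> C * (x - Re w)\<^sup>2"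
      using C by (intro mult_right_mono) auto
    finally have "1 + x\<^sup>2 \<le> C * ((x - Re w)\<^sup>2 + (Im w)\<^sup>2)"
      using C by (simp add: algebra_simps)
    also have "(x - Re w)\<^sup>2 + (Im w)\<^sup>2 = (norm (of_real x - w))\<^sup>2"
      by (simp add: cmod_power2)
    finally show ?thesis .
  qed
  then have sq: "sqrt (1 + x\<^sup>2) \<le> sqrt C * norm (of_real x - w)" for x :: real
    using real_sqrt_le_mono[of "1 + x\<^sup>2" "C * (norm (of_real x - w))\<^sup>2"] by (simp add: real_sqrt_mult)
  have "norm (atom n w x) \<le> (sqrt C / sqrt (1 + x\<^sup>2)) ^ n" for n x
  proof -
    have pos: "0 < sqrt (1 + x\<^sup>2)" by (simp add: add_pos_nonneg)
    have "1 / norm (of_real x - w) \<le> sqrt C / sqrt (1 + x\<^sup>2)"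
      using sq[of x] pos atom_nz[OF assms, of x] by (simp add: field_simps)
    then have "(1 / norm (of_real x - w)) ^ n \<le> (sqrt C / sqrt (1 + x\<^sup>2)) ^ n"
      by (intro power_mono) auto
    then show ?thesis
      by (simp add: atom_def norm_divide norm_power power_divide)
  qed
  moreover have "sqrt C \<ge> 1" using C by simp
  ultimately show ?thesis using that by blast
qed

lemma integrable_1_div_1_plus_square: "integrable lborel (\<lambda>x::real. 1 / (1 + x\<^sup>2))"
  using integrable_inverse_1_plus_square by (simp add: set_integrable_def einterval_def inverse_eq_divide)

lemma atom_bounded:
  assumes "Im w \<noteq> 0"
  obtains C where "C \<ge> 1" "\<And>x. norm (atom n w x) \<le> C" "n \<ge> 2 \<Longrightarrow> (\<And>x. norm (atom n w x) \<le> C / (1 + x\<^sup>2))"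
    "n \<ge> 1 \<Longrightarrow> (\<And>x. (norm (atom n w x))\<^sup>2 \<le> C / (1 + x\<^sup>2))"
proof -
  obtain C where C: "C \<ge> 1" "\<And>n x. norm (atom n w x) \<le> (C / sqrt (1 + x\<^sup>2)) ^ n"
    using atom_bound[OF assms] by blast
  have p1: "1 / (sqrt (1 + x\<^sup>2)) ^ k \<le> 1" for x :: real and k
    by (simp add: field_simps add_pos_nonneg)
  have p2: "1 / (sqrt (1 + x\<^sup>2)) ^ k \<le> 1 / (1 + x\<^sup>2)" if "k \<ge> 2" for x :: real and k
  proof -
    have "(sqrt (1 + x\<^sup>2)) ^ 2 \<le> (sqrt (1 + x\<^sup>2)) ^ k"
      using that by (intro power_increasing) auto
    then show ?thesis
      by (intro divide_left_mono) (auto simp: add_pos_nonneg)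
  qed
  have Cn: "C ^ n \<le> C ^ (2 * n)" "1 \<le> C ^ (2 * n)"
    using C by (auto intro: power_increasing)
  show ?thesis
  \<comment> \<open>The squared estimate produces the largest constant, and C \<ge> 1 makes it valid
    for the other estimates.\<close>
  proof (rule that[of "C ^ (2 * n)"])
    show "1 \<le> C ^ (2 * n)" by (rule Cn)
    show "norm (atom n w x) \<le> C ^ (2 * n)" for x
    proof -
      have "norm (atom n w x) \<le> C ^ n * (1 / (sqrt (1 + x\<^sup>2)) ^ n)"
        using C(2)[of n x] by (simp add: power_divide)
      also have "\<dots> \<le> C ^ (2 * n) * 1"
        using C(1) by (intro mult_mono Cn p1) auto
      finally show ?thesis by simp
    qed
    show "norm (atom n w x) \<le> C ^ (2 * n) / (1 + x\<^sup>2)" if "n \<ge> 2" for x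
    proof -
      have "norm (atom n w x) \<le> C ^ n * (1 / (sqrt (1 + x\<^sup>2)) ^ n)"
        using C(2)[of n x] by (simp add: power_divide)
      also have "\<dots> \<le> C ^ (2 * n) * (1 / (1 + x\<^sup>2))"
        using C(1) that by (intro mult_mono Cn p2) auto
      finally show ?thesis by simp
    qed
    show "(norm (atom n w x))\<^sup>2 \<le> C ^ (2 * n) / (1 + x\<^sup>2)" if "n \<ge> 1" for x
    proof -
      have "(norm (atom n w x))\<^sup>2 \<le> ((C / sqrt (1 + x\<^sup>2)) ^ n)\<^sup>2"
        by (intro power_mono C) auto
      also have "\<dots> = C ^ (2 * n) * (1 / (sqrt (1 + x\<^sup>2)) ^ (2 * n))"
        by (simp add: power_divide mult.commute flip: power_mult)
      also have "\<dots> \<le> C ^ (2 * n) * (1 / (1 + x\<^sup>2))"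
        using C(1) that by (intro mult_mono p2) auto
      finally show ?thesis by simp
    qed
  qed
qed

lemma atom_integrable:
  assumes "Im w \<noteq> 0" "n \<ge> 2"
  shows "integrable lborel (atom n w)"
proof -
  obtain C where C: "C \<ge> 1" "\<And>x. norm (atom n w x) \<le> C / (1 + x\<^sup>2)"
    using atom_bounded[OF assms(1), of n] assms(2) by metis
  have "integrable lborel (\<lambda>x::real. C * (1 / (1 + x\<^sup>2)))"
    by (intro integrable_mult_right integrable_1_div_1_plus_square)
  then show ?thesis
    by (rule Bochner_Integration.integrable_bound) (use C in auto)
qed

lemma atom_L2:
  assumes "Im w \<noteq> 0" "n \<ge> 1"
  shows "atom n w \<in> L2"
proof -
  obtain C where C: "C \<ge> 1" "\<And>x. (norm (atom n w x))\<^sup>2 \<le> C / (1 + x\<^sup>2)"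
    using atom_bounded[OF assms(1), of n] assms(2) by metis
  have "integrable lborel (\<lambda>x::real. C * (1 / (1 + x\<^sup>2)))"
    by (intro integrable_mult_right integrable_1_div_1_plus_square)
  then have "integrable lborel (\<lambda>x. (norm (atom n w x))\<^sup>2)"
    by (rule Bochner_Integration.integrable_bound) (use C in auto)
  then show ?thesis by (simp add: L2_iff)
qed

section \<open>Decay of the transform of a wavelet against an atom\<close>

text \<open>The wavelet transform of f with the conjugated atom as window, stripped of the factor
  \<open>|a| powr (- 1/2)\<close>. In b it is a correlation of f with a dilated atom.\<close>

definition cint :: "complex \<Rightarrow> (real \<Rightarrow> complex) \<Rightarrow> nat \<Rightarrow> real \<Rightarrow> real \<Rightarrow> complex" where
  "cint w f m b a = (\<integral>x. f x * atom m w ((x - b) / a) \<partial>lborel)"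

lemma atom_mult_integrable:
  assumes "Im w \<noteq> 0" and f: "integrable lborel f" and [measurable]: "g \<in> borel_measurable borel"
  shows "integrable lborel (\<lambda>x. f x * atom m w (g x))"
proof -
  obtain C where C: "C \<ge> 1" "\<And>x. norm (atom m w x) \<le> C"
    using atom_bounded[OF assms(1), of m] by metis
  note [measurable] = borel_measurable_integrable[OF f]
  show ?thesis
    by (rule Bochner_Integration.integrable_bound[OF integrable_mult_right[OF integrable_norm[OF f], of C]])
       (use C in \<open>auto simp: norm_mult intro!: AE_I2 mult_left_mono simp: mult.commute[of C]\<close>)
qed

text \<open>The x-derivative of \<open>atom m w ((x - b) / a)\<close> is \<open>- m / a\<close>
  times the next atom. Moving it onto f gains a factor a and lowers the order by one, so the initial
  order limits the number of repetitions.\<close>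

lemma cint_by_parts:
  assumes w: "Im w \<noteq> 0" and a: "a \<noteq> 0" and m: "m \<ge> 1"
    and f: "integrable lborel f" and f': "integrable lborel f'"
    and d: "\<And>x. (f has_vector_derivative f' x) (at x)"
  shows "cint w f (Suc m) b a = of_real (a / m) * cint w f' m b a"
proof -
  define A where "A = (\<lambda>n x. atom n w (- b / a + (1 / a) * x))"
  have A: "atom n w ((x - b) / a) = A n x" for n x
    by (simp add: A_def diff_divide_distrib)
  have [measurable]: "A n \<in> borel_measurable borel" for n
    unfolding A_def by measurable
  have Ad: "(A m has_vector_derivative (- of_real (1 / a) * of_nat m * A (Suc m) x)) (at x)" for x
    unfolding A_def by (rule atom_deriv[OF w])
  have i1: "integrable lborel (\<lambda>x. f' x * A m x)" and i2: "integrable lborel (\<lambda>x. f x * A (Suc m) x)"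
    and i3: "integrable lborel (\<lambda>x. f x * A m x)"
    unfolding A_def by (auto intro!: atom_mult_integrable w f f')
  have "(\<integral>x. f x * (- of_real (1 / a) * of_nat m * A (Suc m) x) + f' x * A m x \<partial>lborel) = 0"
  proof (rule integral_derivative_eq_0[of "\<lambda>x. f x * A m x"])
    show "((\<lambda>x. f x * A m x) has_vector_derivative
        (f x * (- of_real (1 / a) * of_nat m * A (Suc m) x) + f' x * A m x)) (at x)" for x
      by (rule has_vector_derivative_mult[OF d Ad])
    have "integrable lborel (\<lambda>x. (- of_real (1 / a) * of_nat m) * (f x * A (Suc m) x) + f' x * A m x)"
      by (intro Bochner_Integration.integrable_add i1 integrable_mult_right i2)
    then show "integrable lborel (\<lambda>x. f x * (- of_real (1 / a) * of_nat m * A (Suc m) x) + f' x * A m x)"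
      by (simp add: mult_ac)
  qed (rule i3)
  also have "(\<lambda>x. f x * (- of_real (1 / a) * of_nat m * A (Suc m) x) + f' x * A m x) =
      (\<lambda>x. (- of_real (1 / a) * of_nat m) * (f x * A (Suc m) x) + f' x * A m x)"
    by (simp add: mult_ac)
  also have "(\<integral>x. (- of_real (1 / a) * of_nat m) * (f x * A (Suc m) x) + f' x * A m x \<partial>lborel) =
      (- of_real (1 / a) * of_nat m) * cint w f (Suc m) b a + cint w f' m b a"
    unfolding cint_def A
    by (subst Bochner_Integration.integral_add[OF integrable_mult_right[OF i2] i1]) simp
  finally have "cint w f' m b a = of_real (1 / a) * of_nat m * cint w f (Suc m) b a"
    by (simp add: add_eq_0_iff2)
  then show ?thesis
    using a m by simp
qed

lemma nn_integral_atom_affine: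
  assumes "a \<noteq> 0"
  shows "(\<integral>\<^sup>+b. ennreal (norm (atom m w ((x - b) / a))) \<partial>lborel) = ennreal \<bar>a\<bar> * (\<integral>\<^sup>+x. ennreal (norm (atom m w x)) \<partial>lborel)"
  using assms
  by (subst nn_integral_real_affine[of "\<lambda>b. ennreal (norm (atom m w ((x - b) / a)))" "- a" x]) auto

text \<open>Young's inequality for the L1 norm of a correlation; the dilation of the atom
  contributes |a|.\<close>

lemma nn_integral_cint_le:
  assumes a: "a \<noteq> 0" and [measurable]: "f \<in> borel_measurable borel"
  shows "(\<integral>\<^sup>+b. ennreal (norm (cint w f m b a)) \<partial>lborel) \<le>
    ennreal \<bar>a\<bar> * (\<integral>\<^sup>+x. ennreal (norm (f x)) \<partial>lborel) * (\<integral>\<^sup>+x. ennreal (norm (atom m w x)) \<partial>lborel)"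
proof -
  have "(\<integral>\<^sup>+b. ennreal (norm (cint w f m b a)) \<partial>lborel) \<le>
      (\<integral>\<^sup>+b. (\<integral>\<^sup>+x. ennreal (norm (f x)) * ennreal (norm (atom m w ((x - b) / a))) \<partial>lborel) \<partial>lborel)"
  proof (rule nn_integral_mono)
    fix b
    have "ennreal (norm (cint w f m b a)) \<le> (\<integral>\<^sup>+x. ennreal (norm (f x * atom m w ((x - b) / a))) \<partial>lborel)"
      unfolding cint_def
      by (cases "integrable lborel (\<lambda>x. f x * atom m w ((x - b) / a))")
         (auto intro: integral_norm_bound_ennreal simp: not_integrable_integral_eq)
    then show "ennreal (norm (cint w f m b a)) \<le> (\<integral>\<^sup>+x. ennreal (norm (f x)) * ennreal (norm (atom m w ((x - b) / a))) \<partial>lborel)"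
      by (simp add: norm_mult ennreal_mult)
  qed
  also have "\<dots> = (\<integral>\<^sup>+x. (\<integral>\<^sup>+b. ennreal (norm (f x)) * ennreal (norm (atom m w ((x - b) / a))) \<partial>lborel) \<partial>lborel)"
    by (rule lborel_pair.Fubini') measurable
  also have "\<dots> = (\<integral>\<^sup>+x. ennreal (norm (f x)) * (ennreal \<bar>a\<bar> * (\<integral>\<^sup>+x. ennreal (norm (atom m w x)) \<partial>lborel)) \<partial>lborel)"
    by (intro nn_integral_cong, subst nn_integral_cmult) (auto simp: nn_integral_atom_affine[OF a])
  also have "\<dots> = (\<integral>\<^sup>+x. ennreal (norm (f x)) \<partial>lborel) * (ennreal \<bar>a\<bar> * (\<integral>\<^sup>+x. ennreal (norm (atom m w x)) \<partial>lborel))"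
    by (subst nn_integral_multc) auto
  finally show ?thesis
    by (simp add: mult_ac)
qed

text \<open>The expansion runs along the segment t x with t from 0 to 1. Its terms are monomials in
  x with coefficients free of x, which is what vanishing moments annihilate. The remainder stays an
  integral over t, so that a later integration in b can be carried out for each t
  separately.\<close>

lemma atom_Taylor:
  assumes w: "Im w \<noteq> 0" and L: "L \<ge> 1"
  shows "ennreal (norm (atom m w ((x - b) / a) -
      (\<Sum>i<L. of_real (x ^ i) * (of_real ((- 1 / a) ^ i * pochhammer (real m) i / fact i) * atom (m + i) w (- b / a)))))
    \<le> (\<integral>\<^sup>+t. indicator {0..1} t * ennreal (\<bar>x\<bar> ^ L * (pochhammer (real m) L / \<bar>a\<bar> ^ L) * norm (atom (m + L) w ((t * x - b) / a))) \<partial>lborel)"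
proof -
  \<comment> \<open>\<open>Df k\<close> is the k-th t-derivative of the atom at
    \<open>(t x - b) / a\<close>; the Pochhammer symbol collects the factors m, m + 1, ... that
    appear as the order rises.\<close>
  define Df where "Df = (\<lambda>k t. of_real ((- x / a) ^ k * pochhammer (real m) k) * atom (m + k) w (- b / a + (x / a) * t))"
  define r where "r = (\<lambda>t. ((1 - t) ^ (L - 1) / fact (L - 1)) *\<^sub>R Df L t)"
  have Dd: "(Df k has_vector_derivative Df (Suc k) t) (at t within S)" for k t S
  proof -
    have "(Df k has_vector_derivative of_real ((- x / a) ^ k * pochhammer (real m) k) *
        (- of_real (x / a) * of_nat (m + k) * atom (Suc (m + k)) w (- b / a + (x / a) * t))) (at t within S)"
      unfolding Df_def by (intro has_vector_derivative_mult_right atom_deriv[OF w])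
    also have "of_real ((- x / a) ^ k * pochhammer (real m) k) *
        (- of_real (x / a) * of_nat (m + k) * atom (Suc (m + k)) w (- b / a + (x / a) * t)) = Df (Suc k) t"
      by (simp add: Df_def pochhammer_Suc mult_ac)
    finally show ?thesis .
  qed
  have T: "Df 0 1 = (\<Sum>i<L. ((1 - 0) ^ i / fact i) *\<^sub>R Df i 0) + integral {0..1} r"
    unfolding r_def by (rule Taylor_integral) (use L Dd in auto)
  have eq: "atom m w ((x - b) / a) -
      (\<Sum>i<L. of_real (x ^ i) * (of_real ((- 1 / a) ^ i * pochhammer (real m) i / fact i) * atom (m + i) w (- b / a))) = integral {0..1} r"
  proof -
    have 1: "Df 0 1 = atom m w ((x - b) / a)"
      by (simp add: Df_def diff_divide_distrib)
    have 2: "((1 - 0) ^ i / fact i) *\<^sub>R Df i 0 =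
        of_real (x ^ i) * (of_real ((- 1 / a) ^ i * pochhammer (real m) i / fact i) * atom (m + i) w (- b / a))" for i
    proof -
      have "(- x / a) ^ i = x ^ i * (- 1 / a) ^ i"
        by (simp add: power_mult_distrib[symmetric])
      then show ?thesis
        unfolding Df_def scaleR_conv_of_real by (simp only:) (simp add: divide_simps)
    qed
    have "Df 0 1 - (\<Sum>i<L. ((1 - 0) ^ i / fact i) *\<^sub>R Df i 0) = integral {0..1} r"
      by (subst T) (rule add_diff_cancel_left')
    then show ?thesis unfolding 1 2 .
  qed
  have "continuous_on {0..1} (Df L)"
    by (rule continuous_on_vector_derivative) (rule Dd)
  then have "continuous_on {0..1} r"
    unfolding r_def by (intro continuous_intros) auto
  then have si: "set_integrable lborel {0..1} r"
    by (rule borel_integrable_atLeastAtMost')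
  have "ennreal (norm (integral {0..1} r)) = ennreal (norm (\<integral>t. indicator {0..1} t *\<^sub>R r t \<partial>lborel))"
    using set_borel_integral_eq_integral(2)[OF si] by (simp add: set_lebesgue_integral_def)
  also have "\<dots> \<le> (\<integral>\<^sup>+t. ennreal (norm (indicator {0..1} t *\<^sub>R r t)) \<partial>lborel)"
    by (rule integral_norm_bound_ennreal) (use si in \<open>simp add: set_integrable_def\<close>)
  also have "\<dots> \<le> (\<integral>\<^sup>+t. indicator {0..1} t * ennreal (\<bar>x\<bar> ^ L * (pochhammer (real m) L / \<bar>a\<bar> ^ L) * norm (atom (m + L) w ((t * x - b) / a))) \<partial>lborel)"
  proof (rule nn_integral_mono)
    fix t :: real
    show "ennreal (norm (indicator {0..1} t *\<^sub>R r t)) \<le>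
      indicator {0..1} t * ennreal (\<bar>x\<bar> ^ L * (pochhammer (real m) L / \<bar>a\<bar> ^ L) * norm (atom (m + L) w ((t * x - b) / a)))"
    proof (cases "t \<in> {0..1}")
      case True
      have "norm (r t) = \<bar>(1 - t) ^ (L - 1) / fact (L - 1)\<bar> * norm (Df L t)"
        by (simp add: r_def)
      also have "\<dots> \<le> 1 * norm (Df L t)"
      proof (rule mult_right_mono)
        have "\<bar>1 - t\<bar> ^ (L - 1) \<le> 1" using True by (intro power_le_one) auto
        moreover have "(1::real) \<le> fact (L - 1)" by (rule fact_ge_1)
        ultimately show "\<bar>(1 - t) ^ (L - 1) / fact (L - 1)\<bar> \<le> 1"
          by (simp add: abs_divide power_abs) (erule order_trans, rule fact_ge_1)
      qed simp
      also have "1 * norm (Df L t) = \<bar>x\<bar> ^ L * (pochhammer (real m) L / \<bar>a\<bar> ^ L) * norm (atom (m + L) w ((t * x - b) / a))"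
      proof -
        have "- b / a + (x / a) * t = (t * x - b) / a" by (simp add: diff_divide_distrib mult.commute)
        moreover have "\<bar>pochhammer (real m) L\<bar> = pochhammer (real m) L"
          by (simp add: pochhammer_nonneg pochhammer_prod prod_nonneg)
        ultimately show ?thesis
          by (simp add: Df_def norm_mult norm_divide norm_power power_divide abs_mult power_abs del: of_real_mult of_real_power of_real_divide)
      qed
      finally show ?thesis
        using True by (simp add: ennreal_leI)
    qed auto
  qed
  finally show ?thesis
    unfolding eq .
qed

text \<open>Subtracting the Taylor polynomial costs nothing because the moments of f below L vanish.
  In the remainder the integral over b, for fixed t and x, is that of an atom translated by t x and
  hence independent of both; only the L-th absolute moment of f survives.\<close>

lemma nn_integral_cint_le_moments:
  assumes w: "Im w \<noteq> 0" and L: "L \<ge> 1" and a: "a \<noteq> 0"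
    and f[measurable]: "f \<in> borel_measurable borel"
    and mom: "\<And>k. k \<le> L \<Longrightarrow> integrable lborel (\<lambda>t. \<bar>t\<bar> ^ k * norm (f t))"
    and van: "\<And>k. k < L \<Longrightarrow> (\<integral>t. of_real (t ^ k) * f t \<partial>lborel) = 0"
  shows "(\<integral>\<^sup>+b. ennreal (norm (cint w f m b a)) \<partial>lborel) \<le>
    ennreal (pochhammer (real m) L / \<bar>a\<bar> ^ L * \<bar>a\<bar>) *
      ((\<integral>\<^sup>+t. ennreal (\<bar>t\<bar> ^ L * norm (f t)) \<partial>lborel) * (\<integral>\<^sup>+x. ennreal (norm (atom (m + L) w x)) \<partial>lborel))"
proof -
  define P where "P = pochhammer (real m) L / \<bar>a\<bar> ^ L"
  have P: "P \<ge> 0"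
    by (auto simp: P_def pochhammer_prod intro!: divide_nonneg_nonneg prod_nonneg)
  define N where "N = (\<lambda>t x b. ennreal (norm (atom (m + L) w ((t * x - b) / a))))"
  have Nm[measurable]: "(\<lambda>p. N (fst (fst p)) (snd (fst p)) (snd p)) \<in> borel_measurable ((borel \<Otimes>\<^sub>M borel) \<Otimes>\<^sub>M borel)"
    unfolding N_def by measurable
  have if0: "integrable lborel f"
    using mom[of 0] by (simp add: integrable_norm_iff)
  have ifk: "integrable lborel (\<lambda>t. of_real (t ^ k) * f t)" if "k \<le> L" for k
    by (rule Bochner_Integration.integrable_bound[OF mom[OF that]]) (auto simp: norm_mult norm_power)
  have pt: "ennreal (norm (cint w f m b a)) \<le>
      (\<integral>\<^sup>+x. ennreal (norm (f x)) * (\<integral>\<^sup>+t. indicator {0..1} t * (ennreal (\<bar>x\<bar> ^ L * P) * N t x b) \<partial>lborel) \<partial>lborel)" for b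
  proof -
    define c where "c = (\<lambda>i. of_real ((- 1 / a) ^ i * pochhammer (real m) i / fact i) * atom (m + i) w (- b / a))"
    have "cint w f m b a = (\<integral>x. f x * atom m w ((x - b) / a) \<partial>lborel) - (\<integral>x. (\<Sum>i<L. c i * (of_real (x ^ i) * f x)) \<partial>lborel)"
      by (subst Bochner_Integration.integral_sum) (use van ifk in \<open>auto simp: cint_def\<close>)
    also have "\<dots> = (\<integral>x. f x * atom m w ((x - b) / a) - (\<Sum>i<L. c i * (of_real (x ^ i) * f x)) \<partial>lborel)"
      by (rule Bochner_Integration.integral_diff[symmetric])
         (use ifk in \<open>auto intro!: atom_mult_integrable w if0\<close>)
    also have "\<dots> = (\<integral>x. f x * (atom m w ((x - b) / a) - (\<Sum>i<L. of_real (x ^ i) * c i)) \<partial>lborel)"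
      by (simp add: right_diff_distrib sum_distrib_left mult_ac)
    finally have eq: "cint w f m b a = \<dots>" .
    have "integrable lborel (\<lambda>x. f x * atom m w ((x - b) / a) - (\<Sum>i<L. c i * (of_real (x ^ i) * f x)))"
      by (intro Bochner_Integration.integrable_diff Bochner_Integration.integrable_sum integrable_mult_right
          atom_mult_integrable w if0 ifk) auto
    then have "integrable lborel (\<lambda>x. f x * (atom m w ((x - b) / a) - (\<Sum>i<L. of_real (x ^ i) * c i)))"
      by (simp add: right_diff_distrib sum_distrib_left mult_ac)
    then have "ennreal (norm (cint w f m b a)) \<le>
        (\<integral>\<^sup>+x. ennreal (norm (f x * (atom m w ((x - b) / a) - (\<Sum>i<L. of_real (x ^ i) * c i)))) \<partial>lborel)"
      unfolding eq by (rule integral_norm_bound_ennreal)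
    also have "\<dots> = (\<integral>\<^sup>+x. ennreal (norm (f x)) * ennreal (norm (atom m w ((x - b) / a) - (\<Sum>i<L. of_real (x ^ i) * c i))) \<partial>lborel)"
      by (simp add: norm_mult ennreal_mult)
    also have "\<dots> \<le> (\<integral>\<^sup>+x. ennreal (norm (f x)) * (\<integral>\<^sup>+t. indicator {0..1} t * (ennreal (\<bar>x\<bar> ^ L * P) * N t x b) \<partial>lborel) \<partial>lborel)"
    proof (intro nn_integral_mono mult_left_mono)
      fix x
      show "ennreal (norm (atom m w ((x - b) / a) - (\<Sum>i<L. of_real (x ^ i) * c i))) \<le>
          (\<integral>\<^sup>+t. indicator {0..1} t * (ennreal (\<bar>x\<bar> ^ L * P) * N t x b) \<partial>lborel)"
        using atom_Taylor[OF w L, of m x b a] P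
        by (simp add: c_def N_def P_def[symmetric] ennreal_mult mult.assoc)
    qed simp
    finally show ?thesis .
  qed
  define A where "A = (\<integral>\<^sup>+x. ennreal (norm (atom (m + L) w x)) \<partial>lborel)"
  have "(\<integral>\<^sup>+b. ennreal (norm (cint w f m b a)) \<partial>lborel) \<le>
      (\<integral>\<^sup>+b. (\<integral>\<^sup>+x. ennreal (norm (f x)) * (\<integral>\<^sup>+t. indicator {0..1} t * (ennreal (\<bar>x\<bar> ^ L * P) * N t x b) \<partial>lborel) \<partial>lborel) \<partial>lborel)"
    by (intro nn_integral_mono pt)
  also have "\<dots> = (\<integral>\<^sup>+x. (\<integral>\<^sup>+b. ennreal (norm (f x)) * (\<integral>\<^sup>+t. indicator {0..1} t * (ennreal (\<bar>x\<bar> ^ L * P) * N t x b) \<partial>lborel) \<partial>lborel) \<partial>lborel)"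
    unfolding N_def by (rule lborel_pair.Fubini') measurable
  also have "\<dots> = (\<integral>\<^sup>+x. ennreal (norm (f x)) * (\<integral>\<^sup>+b. (\<integral>\<^sup>+t. indicator {0..1} t * (ennreal (\<bar>x\<bar> ^ L * P) * N t x b) \<partial>lborel) \<partial>lborel) \<partial>lborel)"
    unfolding N_def by (intro nn_integral_cong nn_integral_cmult) measurable
  also have "\<dots> = (\<integral>\<^sup>+x. ennreal (norm (f x)) * (\<integral>\<^sup>+t. (\<integral>\<^sup>+b. indicator {0..1} t * (ennreal (\<bar>x\<bar> ^ L * P) * N t x b) \<partial>lborel) \<partial>lborel) \<partial>lborel)"
    unfolding N_def by (intro nn_integral_cong arg_cong2[where f="(*)"] refl lborel_pair.Fubini') measurable
  also have "\<dots> = (\<integral>\<^sup>+x. ennreal (norm (f x)) * (\<integral>\<^sup>+t. indicator {0..1::real} t * (ennreal (\<bar>x\<bar> ^ L * P) * (ennreal \<bar>a\<bar> * A)) \<partial>lborel) \<partial>lborel)"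
  proof (intro nn_integral_cong arg_cong2[where f="(*)"] refl)
    fix x t
    have [measurable]: "N t x \<in> borel_measurable borel" unfolding N_def by measurable
    have "(\<integral>\<^sup>+b. N t x b \<partial>lborel) = ennreal \<bar>a\<bar> * A"
      unfolding N_def A_def by (rule nn_integral_atom_affine[OF a])
    then show "(\<integral>\<^sup>+b. indicator {0..1} t * (ennreal (\<bar>x\<bar> ^ L * P) * N t x b) \<partial>lborel) =
        indicator {0..1} t * (ennreal (\<bar>x\<bar> ^ L * P) * (ennreal \<bar>a\<bar> * A))"
      by (simp add: nn_integral_cmult)
  qed
  also have "\<dots> = (\<integral>\<^sup>+x. ennreal (norm (f x)) * (ennreal (\<bar>x\<bar> ^ L * P) * (ennreal \<bar>a\<bar> * A)) \<partial>lborel)"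
    by (simp add: nn_integral_multc)
  also have "\<dots> = (\<integral>\<^sup>+x. ennreal (\<bar>x\<bar> ^ L * norm (f x)) * (ennreal (P * \<bar>a\<bar>) * A) \<partial>lborel)"
    by (intro nn_integral_cong) (use P in \<open>simp add: ennreal_mult mult_ac\<close>)
  also have "\<dots> = (\<integral>\<^sup>+x. ennreal (\<bar>x\<bar> ^ L * norm (f x)) \<partial>lborel) * (ennreal (P * \<bar>a\<bar>) * A)"
    by (intro nn_integral_multc) measurable
  finally show ?thesis
    by (simp add: P_def A_def mult_ac)
qed

text \<open>A value at a point is bounded by the mean and the mean derivative over the adjacent unit interval.\<close>

lemma cint_periodised:
  assumes w: "Im w \<noteq> 0" and a: "a \<noteq> 0" and f: "integrable lborel f"
  shows "(\<integral>\<^sup>+k. ennreal (norm (cint w f m (\<beta> + real_of_int k) a)) \<partial>count_space UNIV) \<le>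
    (\<integral>\<^sup>+b. ennreal (norm (cint w f m b a)) \<partial>lborel) +
    ennreal (m / \<bar>a\<bar>) * (\<integral>\<^sup>+b. ennreal (norm (cint w f (Suc m) b a)) \<partial>lborel)"
proof -
  note [measurable] = borel_measurable_integrable[OF f]
  define G where "G = (\<lambda>b. cint w f m b a)"
  \<comment> \<open>Differentiating in b acts on the atom alone and raises its order with a factor m
    / a, so summing over translates consumes no derivative of f.\<close>
  define G1 where "G1 = (\<lambda>b. of_real (m / a) * cint w f (Suc m) b a)"
  have cm[measurable]: "(\<lambda>b. cint w f n b a) \<in> borel_measurable borel" for n
    unfolding cint_def by measurable
  have [measurable]: "G \<in> borel_measurable borel" "G1 \<in> borel_measurable borel"
    unfolding G_def G1_def by measurable
  obtain C where C: "C \<ge> 1" "\<And>x. norm (atom (Suc m) w x) \<le> C"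
    using atom_bounded[OF w, of "Suc m"] by metis
  have FTC: "G q - G p = (\<integral>t. indicator {p..q} t *\<^sub>R G1 t \<partial>lborel)" if "p \<le> q" for p q
  proof -
    define H where "H = (\<lambda>x t. indicator {p..q} t *\<^sub>R (f x * (of_real (m / a) * atom (Suc m) w ((x - t) / a))))"
    have "(\<integral>t. H x t \<partial>lborel) = f x * atom m w ((x - q) / a) - f x * atom m w ((x - p) / a)" for x
      unfolding H_def
    proof (rule FTC_indicator[OF that])
      have 1: "((x - t) / a) = x / a + (- 1 / a) * t" for t
        by (simp add: diff_divide_distrib)
      show "((\<lambda>t. f x * atom m w ((x - t) / a)) has_vector_derivative
          f x * (of_real (m / a) * atom (Suc m) w ((x - t) / a))) (at t)" for t
        using has_vector_derivative_mult_right[OF atom_deriv[OF w, of m "x / a" "- 1 / a" t UNIV], of "f x"]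
        unfolding 1 by simp
      have "continuous_on {p..q} (\<lambda>t. atom (Suc m) w (x / a + (- 1 / a) * t))"
        by (rule continuous_on_vector_derivative) (rule atom_deriv[OF w])
      then show "set_integrable lborel {p..q} (\<lambda>t. f x * (of_real (m / a) * atom (Suc m) w ((x - t) / a)))"
        unfolding 1 by (intro borel_integrable_atLeastAtMost' continuous_intros)
    qed
    then have "G q - G p = (\<integral>x. (\<integral>t. H x t \<partial>lborel) \<partial>lborel)"
      by (simp add: G_def cint_def Bochner_Integration.integral_diff atom_mult_integrable w f)
    also have "\<dots> = (\<integral>t. (\<integral>x. H x t \<partial>lborel) \<partial>lborel)"
    proof (rule integrable_iterated_integral(3)[OF sigma_finite_lborel sigma_finite_lborel pair_integrableI])
      show "case_prod H \<in> borel_measurable (lborel \<Otimes>\<^sub>M lborel)"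
        unfolding H_def by measurable
      have "(\<integral>\<^sup>+x. \<integral>\<^sup>+t. ennreal (norm (H x t)) \<partial>lborel \<partial>lborel) \<le>
          (\<integral>\<^sup>+x. \<integral>\<^sup>+t. ennreal (norm (f x)) * (ennreal (m / \<bar>a\<bar> * C) * indicator {p..q} t) \<partial>lborel \<partial>lborel)"
      proof (intro nn_integral_mono)
        fix x t
        have "norm (f x) * (m / \<bar>a\<bar> * norm (atom (Suc m) w ((x - t) / a))) \<le> norm (f x) * (m / \<bar>a\<bar> * C)"
          by (intro mult_left_mono C) auto
        then show "ennreal (norm (H x t)) \<le> ennreal (norm (f x)) * (ennreal (m / \<bar>a\<bar> * C) * indicator {p..q} t)"
          using C by (auto simp: H_def norm_mult norm_divide indicator_def ennreal_mult[symmetric] intro!: ennreal_leI)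
      qed
      also have "\<dots> = (\<integral>\<^sup>+x. ennreal (norm (f x)) \<partial>lborel) * (ennreal (m / \<bar>a\<bar> * C) * ennreal (q - p))"
        using that by (simp add: nn_integral_cmult nn_integral_multc nn_integral_cmult_indicator)
      also have "\<dots> < \<infinity>"
        using f by (auto simp: integrable_iff_bounded ennreal_mult_less_top)
      finally show "(\<integral>\<^sup>+x. \<integral>\<^sup>+t. ennreal (norm (H x t)) \<partial>lborel \<partial>lborel) < \<infinity>" .
    qed (rule sigma_finite_lborel)+
    also have "\<dots> = (\<integral>t. indicator {p..q} t *\<^sub>R G1 t \<partial>lborel)"
    proof (intro Bochner_Integration.integral_cong refl)
      fix t
      have "(\<integral>x. f x * (of_real (m / a) * atom (Suc m) w ((x - t) / a)) \<partial>lborel) = G1 t"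
        unfolding G1_def cint_def by (subst integral_mult_right_zero[symmetric]) (simp add: mult_ac)
      then show "(\<integral>x. H x t \<partial>lborel) = indicator {p..q} t *\<^sub>R G1 t"
        by (simp add: H_def)
    qed
    finally show ?thesis .
  qed
  have pt: "ennreal (norm (G p)) \<le> (\<integral>\<^sup>+t. indicator {p..<p+1} t * (ennreal (norm (G t)) + ennreal (norm (G1 t))) \<partial>lborel)" for p
  proof -
    define I where "I = (\<integral>\<^sup>+t. indicator {p..<p+1} t * ennreal (norm (G1 t)) \<partial>lborel)"
    have 1: "ennreal (norm (G p)) \<le> ennreal (norm (G t)) + I" if t: "t \<in> {p..<p+1}" for t
    proof -
      have "ennreal (norm (G p)) \<le> ennreal (norm (G t) + norm (G t - G p))"
        by (intro ennreal_leI) (metis norm_minus_commute norm_triangle_sub)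
      also have "\<dots> = ennreal (norm (G t)) + ennreal (norm (\<integral>u. indicator {p..t} u *\<^sub>R G1 u \<partial>lborel))"
        using FTC[of p t] t by simp
      also have "ennreal (norm (\<integral>u. indicator {p..t} u *\<^sub>R G1 u \<partial>lborel)) \<le> (\<integral>\<^sup>+u. ennreal (norm (indicator {p..t} u *\<^sub>R G1 u)) \<partial>lborel)"
        by (cases "integrable lborel (\<lambda>u. indicator {p..t} u *\<^sub>R G1 u)")
           (rule integral_norm_bound_ennreal, assumption, simp add: not_integrable_integral_eq)
      also have "\<dots> \<le> I"
        unfolding I_def using t by (intro nn_integral_mono) (auto simp: indicator_def)
      finally show ?thesis by simp
    qed
    have "ennreal (norm (G p)) = (\<integral>\<^sup>+t. indicator {p..<p+1} t * ennreal (norm (G p)) \<partial>lborel)"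
      by (simp add: nn_integral_multc)
    also have "\<dots> \<le> (\<integral>\<^sup>+t. indicator {p..<p+1} t * ennreal (norm (G t)) + indicator {p..<p+1} t * I \<partial>lborel)"
      by (intro nn_integral_mono) (auto simp: indicator_def intro!: 1)
    also have "\<dots> = (\<integral>\<^sup>+t. indicator {p..<p+1} t * ennreal (norm (G t)) \<partial>lborel) + I"
      by (subst nn_integral_add) (auto simp: nn_integral_multc)
    also have "\<dots> = (\<integral>\<^sup>+t. indicator {p..<p+1} t * ennreal (norm (G t)) + indicator {p..<p+1} t * ennreal (norm (G1 t)) \<partial>lborel)"
      unfolding I_def by (subst nn_integral_add) auto
    finally show ?thesis by (simp add: distrib_left)
  qed
  have "(\<integral>\<^sup>+k. ennreal (norm (G (\<beta> + real_of_int k))) \<partial>count_space UNIV) \<le>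
      (\<integral>\<^sup>+k. (\<integral>\<^sup>+t. indicator {\<beta> + real_of_int k..<\<beta> + real_of_int k + 1} t * (ennreal (norm (G t)) + ennreal (norm (G1 t))) \<partial>lborel) \<partial>count_space UNIV)"
    by (intro nn_integral_mono pt)
  also have "\<dots> = (\<integral>\<^sup>+t. ennreal (norm (G t)) + ennreal (norm (G1 t)) \<partial>lborel)"
    by (rule nn_integral_unit_intervals) measurable
  also have "\<dots> = (\<integral>\<^sup>+t. ennreal (norm (G t)) \<partial>lborel) + (\<integral>\<^sup>+t. ennreal (norm (G1 t)) \<partial>lborel)"
    by (rule nn_integral_add) auto
  also have "(\<integral>\<^sup>+t. ennreal (norm (G1 t)) \<partial>lborel) = ennreal (m / \<bar>a\<bar>) * (\<integral>\<^sup>+b. ennreal (norm (cint w f (Suc m) b a)) \<partial>lborel)"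
    unfolding G1_def by (subst nn_integral_cmult[symmetric]) (auto simp: norm_mult norm_divide ennreal_mult[symmetric])
  finally show ?thesis
    by (simp add: G_def)
qed

section \<open>Kernel bounds\<close>

lemma nn_integral_powr_finite:
  fixes e1 e2 :: real
  assumes e1: "e1 > -1" and e2: "e2 < -1"
  shows "(\<integral>\<^sup>+a. ennreal (if \<bar>a\<bar> \<le> 1 then \<bar>a\<bar> powr e1 else \<bar>a\<bar> powr e2) \<partial>lborel) < \<infinity>"
proof -
  define g where "g = (\<lambda>a. ennreal (indicator {0..1} a * a powr e1) + ennreal (indicator {1..} a * a powr e2))"
  have [measurable]: "g \<in> borel_measurable borel" unfolding g_def by measurable
  have "(\<integral>\<^sup>+a. g a \<partial>lborel) = ennreal (1 powr (e1 + 1) / (e1 + 1)) + ennreal (-(1 powr (e2 + 1)) / (e2 + 1))"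
    unfolding g_def
    by (subst nn_integral_add)
       (use nn_integral_has_integral_lebesgue[OF _ has_integral_powr_from_0[OF e1, of 1]]
            nn_integral_has_integral_lebesgue[OF _ has_integral_powr_to_inf[OF e2, of 1]] in auto)
  then have fin: "(\<integral>\<^sup>+a. g a \<partial>lborel) < \<infinity>" by simp
  have "(\<integral>\<^sup>+a. ennreal (if \<bar>a\<bar> \<le> 1 then \<bar>a\<bar> powr e1 else \<bar>a\<bar> powr e2) \<partial>lborel) \<le> (\<integral>\<^sup>+a. g a + g (- a) \<partial>lborel)"
    by (intro nn_integral_mono) (auto simp: g_def indicator_def)
  also have "\<dots> = (\<integral>\<^sup>+a. g a \<partial>lborel) + (\<integral>\<^sup>+a. g (- a) \<partial>lborel)"
    by (rule nn_integral_add) auto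
  also have "(\<integral>\<^sup>+a. g (- a) \<partial>lborel) = (\<integral>\<^sup>+a. g a \<partial>lborel)"
    by (subst nn_integral_real_affine[of g "-1" 0]) auto
  finally show ?thesis using fin
    by (auto simp: top_unique intro: le_less_trans)
qed

lemma nn_integral_count_space_int_geometric:
  fixes q :: real
  assumes q: "0 \<le> q" "q < 1"
  shows "(\<integral>\<^sup>+j. ennreal (q ^ nat \<bar>j\<bar>) \<partial>count_space (UNIV :: int set)) \<le> ennreal (2 / (1 - q))"
proof -
  have geo: "(\<integral>\<^sup>+n. ennreal (q ^ n) \<partial>count_space UNIV) = ennreal (1 / (1 - q))"
    unfolding nn_integral_count_space_nat
    using q by (subst suminf_ennreal2) (auto simp: suminf_geometric summable_geometric)
  have "bij_betw int UNIV {0..}"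
    by (rule bij_betwI[where g=nat]) auto
  from nn_integral_bij_count_space[OF this, of "\<lambda>j. ennreal (q ^ nat \<bar>j\<bar>)"]
  have 1: "(\<integral>\<^sup>+j. ennreal (q ^ nat \<bar>j\<bar>) * indicator {0..} j \<partial>count_space UNIV) = ennreal (1 / (1 - q))"
    by (simp add: geo nn_integral_count_space_indicator)
  have "bij_betw (\<lambda>n. - int n) UNIV {..0}"
    by (rule bij_betwI[where g="\<lambda>j. nat (- j)"]) auto
  from nn_integral_bij_count_space[OF this, of "\<lambda>j. ennreal (q ^ nat \<bar>j\<bar>)"]
  have 2: "(\<integral>\<^sup>+j. ennreal (q ^ nat \<bar>j\<bar>) * indicator {..0} j \<partial>count_space UNIV) = ennreal (1 / (1 - q))"
    by (simp add: geo nn_integral_count_space_indicator)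
  have "(\<integral>\<^sup>+j. ennreal (q ^ nat \<bar>j\<bar>) \<partial>count_space (UNIV :: int set)) \<le>
      (\<integral>\<^sup>+j. ennreal (q ^ nat \<bar>j\<bar>) * indicator {0..} j + ennreal (q ^ nat \<bar>j\<bar>) * indicator {..0} j \<partial>count_space UNIV)"
    by (intro nn_integral_mono) (auto simp: indicator_def)
  also have "\<dots> = ennreal (1 / (1 - q)) + ennreal (1 / (1 - q))"
    by (subst nn_integral_add) (auto simp: 1 2)
  also have "\<dots> = ennreal (2 / (1 - q))"
    using q by (subst ennreal_plus[symmetric]) (auto simp: field_simps)
  finally show ?thesis .
qed

text \<open>The summand depends on t only through j + log2 t, so an integer shift of j removes t up
  to rounding and leaves a two-sided geometric series. Rounding the logarithm moves the exponent by
  at most 1, whence the factor \<open>2 powr \<delta>\<close>.\<close>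

lemma dyadic_sum_bound:
  fixes \<delta> :: real
  assumes \<delta>: "\<delta> > 0"
  obtains C where "C \<ge> 0" "\<And>t. t > 0 \<Longrightarrow>
    (\<integral>\<^sup>+j. ennreal (min ((2 powr real_of_int j * t) powr \<delta>) ((2 powr real_of_int j * t) powr - \<delta>)) \<partial>count_space UNIV) \<le> ennreal C"
proof (rule that[of "2 powr \<delta> * (2 / (1 - 2 powr - \<delta>))"])
  define q where "q = 2 powr - \<delta>"
  have q: "0 < q" "q < 1" using \<delta> by (auto simp: q_def powr_less_one)
  show "0 \<le> 2 powr \<delta> * (2 / (1 - 2 powr - \<delta>))" using q by (auto simp: q_def)
  fix t :: real assume t: "t > 0"
  define n where "n = \<lfloor>log 2 t\<rfloor>"
  have pt: "min ((2 powr real_of_int j * t) powr \<delta>) ((2 powr real_of_int j * t) powr - \<delta>) \<le> 2 powr \<delta> * q ^ nat \<bar>j + n\<bar>" for j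
  proof -
    define u where "u = real_of_int j + log 2 t"
    have u: "2 powr real_of_int j * t = 2 powr u"
      using t by (simp add: u_def powr_add)
    have abs: "\<bar>u\<bar> \<ge> \<bar>real_of_int (j + n)\<bar> - 1"
      unfolding u_def n_def by linarith
    have "min ((2 powr real_of_int j * t) powr \<delta>) ((2 powr real_of_int j * t) powr - \<delta>) \<le> 2 powr (- \<delta> * \<bar>u\<bar>)"
      unfolding u powr_powr by (cases "u \<ge> 0") (auto simp: mult.commute min_le_iff_disj)
    also have "\<dots> \<le> 2 powr (- \<delta> * (\<bar>real_of_int (j + n)\<bar> - 1))"
      using abs \<delta> by (intro powr_mono mult_left_mono_neg) auto
    also have "\<dots> = 2 powr \<delta> * 2 powr (- \<delta> * real (nat \<bar>j + n\<bar>))"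
      by (simp add: powr_add[symmetric] algebra_simps)
    also have "2 powr (- \<delta> * real (nat \<bar>j + n\<bar>)) = q ^ nat \<bar>j + n\<bar>"
      unfolding q_def by (subst powr_powr[symmetric]) (rule powr_realpow, simp)
    finally show ?thesis .
  qed
  have "(\<integral>\<^sup>+j. ennreal (min ((2 powr real_of_int j * t) powr \<delta>) ((2 powr real_of_int j * t) powr - \<delta>)) \<partial>count_space UNIV)
      \<le> (\<integral>\<^sup>+j. ennreal (2 powr \<delta>) * ennreal (q ^ nat \<bar>j + n\<bar>) \<partial>count_space UNIV)"
    by (intro nn_integral_mono) (use pt in \<open>auto simp: ennreal_mult[symmetric] q less_imp_le intro!: ennreal_leI\<close>)
  also have "\<dots> = ennreal (2 powr \<delta>) * (\<integral>\<^sup>+j. ennreal (q ^ nat \<bar>j + n\<bar>) \<partial>count_space UNIV)"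
    by (rule nn_integral_cmult) auto
  also have "(\<integral>\<^sup>+j. ennreal (q ^ nat \<bar>j + n\<bar>) \<partial>count_space UNIV) = (\<integral>\<^sup>+j. ennreal (q ^ nat \<bar>j\<bar>) \<partial>count_space UNIV)"
    by (rule nn_integral_bij_count_space[where g="\<lambda>j. j + n"]) (rule bij_betwI[where g="\<lambda>j. j - n"], auto)
  also have "ennreal (2 powr \<delta>) * \<dots> \<le> ennreal (2 powr \<delta>) * ennreal (2 / (1 - q))"
    by (intro mult_left_mono nn_integral_count_space_int_geometric) (use q in auto)
  also have "\<dots> = ennreal (2 powr \<delta> * (2 / (1 - 2 powr - \<delta>)))"
    using q by (simp add: ennreal_mult[symmetric] q_def)
  finally show "(\<integral>\<^sup>+j. ennreal (min ((2 powr real_of_int j * t) powr \<delta>) ((2 powr real_of_int j * t) powr - \<delta>)) \<partial>count_space UNIV)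
      \<le> ennreal (2 powr \<delta> * (2 / (1 - 2 powr - \<delta>)))" .
qed

text \<open>Translating back to the origin makes k an additive shift of the first argument: at fixed
  j the sum over k is a periodisation in b, with offset \<open>2^j b\<close> and at scale
  \<open>2^j a\<close>.\<close>

lemma wavelet_covariant:
  "L2_inner (wavelet \<psi> (j, k)) (wav_rep (b, a) g) = wav_trans g \<psi> (2 powr real_of_int j * b + real_of_int k, 2 powr real_of_int j * a)"
proof -
  have 1: "(b - - real_of_int k * 2 powr - real_of_int j) / 2 powr - real_of_int j = 2 powr real_of_int j * b + real_of_int k"
    by (simp add: powr_minus field_simps)
  have 2: "a / 2 powr - real_of_int j = 2 powr real_of_int j * a"
    by (simp add: powr_minus field_simps)
  show ?thesis
    unfolding wavelet_eq_wav_rep by (subst wav_trans_covariant) (simp_all only: 1 2, simp)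
qed

text \<open>By covariance the integrand is a left translate of a single function, and the weight is
  multiplicative; so all points \<open>(b, a)\<close> give the same integral up to
  \<open>|a| powr \<sigma>\<close>.\<close>

lemma nn_integral_wav_trans_covariant:
  assumes f: "f \<in> L2" and g: "g \<in> L2" and a: "a \<noteq> 0"
  shows "(\<integral>\<^sup>+z. ennreal (norm (L2_inner (wav_rep (b, a) f) (wav_rep z g)) * \<bar>snd z\<bar> powr \<sigma>) \<partial>aff_haar) =
    ennreal (\<bar>a\<bar> powr \<sigma>) * (\<integral>\<^sup>+z. ennreal (norm (wav_trans g f z) * \<bar>snd z\<bar> powr \<sigma>) \<partial>aff_haar)"
proof -
  note [measurable] = wav_trans_measurable[OF L2_measurable[OF f] L2_measurable[OF g]]
  have snd_m[measurable]: "(snd :: real \<times> real \<Rightarrow> real) \<in> borel_measurable borel"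
    unfolding borel_prod[symmetric] by measurable
  have m: "(\<lambda>z. ennreal (norm (wav_trans g f z) * \<bar>snd z\<bar> powr \<sigma>)) \<in> borel_measurable borel"
    by measurable
  have "(\<integral>\<^sup>+z. ennreal (norm (L2_inner (wav_rep (b, a) f) (wav_rep z g)) * \<bar>snd z\<bar> powr \<sigma>) \<partial>aff_haar) =
      (\<integral>\<^sup>+z. ennreal (\<bar>a\<bar> powr \<sigma>) * ennreal (norm (wav_trans g f ((fst z - b) / a, snd z / a)) * \<bar>snd z / a\<bar> powr \<sigma>) \<partial>aff_haar)"
  proof (rule nn_integral_cong)
    fix z :: "real \<times> real"
    have "\<bar>snd z\<bar> powr \<sigma> = \<bar>a\<bar> powr \<sigma> * \<bar>snd z / a\<bar> powr \<sigma>"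
      using a by (simp add: abs_divide powr_divide)
    moreover have "L2_inner (wav_rep (b, a) f) (wav_rep z g) = wav_trans g f ((fst z - b) / a, snd z / a)"
      using wav_trans_covariant[OF a, of b f "fst z" "snd z" g] by simp
    ultimately show "ennreal (norm (L2_inner (wav_rep (b, a) f) (wav_rep z g)) * \<bar>snd z\<bar> powr \<sigma>) =
        ennreal (\<bar>a\<bar> powr \<sigma>) * ennreal (norm (wav_trans g f ((fst z - b) / a, snd z / a)) * \<bar>snd z / a\<bar> powr \<sigma>)"
      by (simp add: ennreal_mult[symmetric] mult_ac)
  qed
  also have "\<dots> = ennreal (\<bar>a\<bar> powr \<sigma>) * (\<integral>\<^sup>+z. ennreal (norm (wav_trans g f ((fst z - b) / a, snd z / a)) * \<bar>snd z / a\<bar> powr \<sigma>) \<partial>aff_haar)"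
  proof (rule nn_integral_cmult)
    have "(\<lambda>z. (\<lambda>z. ennreal (norm (wav_trans g f z) * \<bar>snd z\<bar> powr \<sigma>)) ((fst z - b) / a, snd z / a)) \<in> borel_measurable borel"
      using m unfolding borel_prod[symmetric] by measurable
    then show "(\<lambda>z. ennreal (norm (wav_trans g f ((fst z - b) / a, snd z / a)) * \<bar>snd z / a\<bar> powr \<sigma>)) \<in> borel_measurable aff_haar"
      by simp
  qed
  also have "(\<integral>\<^sup>+z. ennreal (norm (wav_trans g f ((fst z - b) / a, snd z / a)) * \<bar>snd z / a\<bar> powr \<sigma>) \<partial>aff_haar) =
      (\<integral>\<^sup>+z. ennreal (norm (wav_trans g f z) * \<bar>snd z\<bar> powr \<sigma>) \<partial>aff_haar)"
    using nn_integral_aff_haar_left_invariant[OF m a, of b] by simp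
  finally show ?thesis .
qed

lemma nn_integral_count_space_int_prod:
  fixes f :: "int \<Rightarrow> int \<Rightarrow> ennreal"
  shows "(\<integral>\<^sup>+p. f (fst p) (snd p) \<partial>count_space UNIV) = (\<integral>\<^sup>+j. \<integral>\<^sup>+k. f j k \<partial>count_space UNIV \<partial>count_space UNIV)"
proof -
  have "count_space (UNIV :: (int \<times> int) set) = count_space UNIV \<Otimes>\<^sub>M count_space UNIV"
    by (subst pair_measure_countable) auto
  moreover interpret sigma_finite_measure "count_space (UNIV :: int set)"
    by (rule sigma_finite_measure_count_space)
  have "(\<integral>\<^sup>+j. \<integral>\<^sup>+k. f (fst (j, k)) (snd (j, k)) \<partial>count_space UNIV \<partial>count_space UNIV) =
      (\<integral>\<^sup>+p. f (fst p) (snd p) \<partial>(count_space UNIV \<Otimes>\<^sub>M count_space UNIV))"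
    by (rule nn_integral_fst) (subst pair_measure_countable, auto)
  ultimately show ?thesis by simp
qed

section \<open>Matrix entries of a smooth wavelet with vanishing moments against an atom\<close>

locale regular_wavelet =
  fixes L :: nat and \<psi> :: "real \<Rightarrow> complex" and D :: "nat \<Rightarrow> real \<Rightarrow> complex"
  assumes L: "L \<ge> 1" and \<psi>_L2: "\<psi> \<in> L2"
    and mom: "\<And>k. k \<le> L \<Longrightarrow> integrable lborel (\<lambda>t. \<bar>t\<bar> ^ k * norm (\<psi> t))"
    and van: "\<And>k. k < L \<Longrightarrow> (\<integral>t. of_real (t ^ k) * \<psi> t \<partial>lborel) = 0"
    and D0: "D 0 = \<psi>"
    and Dd: "\<And>k x. k < L \<Longrightarrow> (D k has_vector_derivative D (Suc k) x) (at x)"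
    and Di: "\<And>k. k \<le> L \<Longrightarrow> integrable lborel (D k)"
begin

lemma \<psi>_measurable [measurable]: "\<psi> \<in> borel_measurable borel"
  by (rule L2_measurable[OF \<psi>_L2])

lemma \<psi>_integrable: "integrable lborel \<psi>"
  using Di[of 0] by (simp add: D0)

text \<open>Every integration by parts contributes a factor a and a number depending only on the
  order. The constant stays implicit, but it is independent of a and b, so \<open>|a|^k\<close> is
  the whole gain.\<close>

lemma cint_iterate:
  assumes w: "Im w \<noteq> 0" and k: "k \<le> L"
  shows "n \<ge> 1 \<Longrightarrow> \<exists>c. \<forall>a b. a \<noteq> 0 \<longrightarrow> cint w \<psi> (n + k) b a = of_real (c * a ^ k) * cint w (D k) n b a"
  using k
proof (induction k arbitrary: n)
  case 0
  show ?case by (intro exI[of _ 1]) (auto simp: D0)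
next
  case (Suc k)
  have "\<exists>c. \<forall>a b. a \<noteq> 0 \<longrightarrow> cint w \<psi> (Suc n + k) b a = of_real (c * a ^ k) * cint w (D k) (Suc n) b a"
    by (rule Suc.IH) (use Suc.prems in auto)
  then obtain c where c: "\<And>a b. a \<noteq> 0 \<Longrightarrow> cint w \<psi> (Suc n + k) b a = of_real (c * a ^ k) * cint w (D k) (Suc n) b a"
    by blast
  have "cint w \<psi> (n + Suc k) b a = of_real ((c / n) * a ^ Suc k) * cint w (D (Suc k)) n b a" if "a \<noteq> 0" for a b
    using c[OF that, of b] cint_by_parts[OF w that, of n "D k" "D (Suc k)" b] Suc.prems Di Dd
    by simp
  then show ?case by blast
qed

text \<open>Two competing estimates. Derivatives give the factor |a|^L at the price of lowering the
  order to m - L, which must be at least 2 for the atom to be integrable. Vanishing moments give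
  |a|^-L and raise the order to m + L.\<close>

lemma cint_decay:
  assumes w: "Im w \<noteq> 0" and m: "m \<ge> L + 2"
  obtains C where "C \<ge> 0" "\<And>a. a \<noteq> 0 \<Longrightarrow>
    (\<integral>\<^sup>+b. ennreal (norm (cint w \<psi> m b a)) \<partial>lborel) \<le> ennreal (C * (\<bar>a\<bar> * min (\<bar>a\<bar> ^ L) (1 / \<bar>a\<bar> ^ L)))"
proof -
  define A where "A = (\<lambda>n. enn2real (\<integral>\<^sup>+x. ennreal (norm (atom n w x)) \<partial>lborel))"
  have A: "(\<integral>\<^sup>+x. ennreal (norm (atom n w x)) \<partial>lborel) = ennreal (A n)" if "n \<ge> 2" for n
    using atom_integrable[OF w that] by (simp add: A_def integrable_iff_bounded)
  define B where "B = enn2real (\<integral>\<^sup>+x. ennreal (norm (D L x)) \<partial>lborel)"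
  have B: "(\<integral>\<^sup>+x. ennreal (norm (D L x)) \<partial>lborel) = ennreal B"
    using Di[of L] by (simp add: B_def integrable_iff_bounded)
  define M where "M = enn2real (\<integral>\<^sup>+t. ennreal (\<bar>t\<bar> ^ L * norm (\<psi> t)) \<partial>lborel)"
  have M: "(\<integral>\<^sup>+t. ennreal (\<bar>t\<bar> ^ L * norm (\<psi> t)) \<partial>lborel) = ennreal M"
    using mom[of L] by (simp add: M_def integrable_iff_bounded)
  have "\<exists>c. \<forall>a b. a \<noteq> 0 \<longrightarrow> cint w \<psi> (m - L + L) b a = of_real (c * a ^ L) * cint w (D L) (m - L) b a"
    by (rule cint_iterate[OF w]) (use m in auto)
  moreover have "m - L + L = m" using m by simp
  ultimately obtain c where c: "\<And>a b. a \<noteq> 0 \<Longrightarrow> cint w \<psi> m b a = of_real (c * a ^ L) * cint w (D L) (m - L) b a"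
    by metis
  have nonneg: "A n \<ge> 0" "B \<ge> 0" "M \<ge> 0" for n by (auto simp: A_def B_def M_def)
  define C1 where "C1 = \<bar>c\<bar> * (B * A (m - L))"
  define C2 where "C2 = pochhammer (real m) L * (M * A (m + L))"
  have C: "C1 \<ge> 0" "C2 \<ge> 0"
    using nonneg by (auto simp: C1_def C2_def pochhammer_prod intro!: mult_nonneg_nonneg prod_nonneg)
  have DLm: "D L \<in> borel_measurable borel"
    using borel_measurable_integrable[OF Di[of L]] by simp
  have cm: "(\<lambda>b. cint w (D L) n b a) \<in> borel_measurable borel" for n a
    using DLm unfolding cint_def by measurable
  have 1: "(\<integral>\<^sup>+b. ennreal (norm (cint w \<psi> m b a)) \<partial>lborel) \<le> ennreal (C1 * (\<bar>a\<bar> * \<bar>a\<bar> ^ L))" if a: "a \<noteq> 0" for a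
  proof -
    have "(\<integral>\<^sup>+b. ennreal (norm (cint w \<psi> m b a)) \<partial>lborel) =
        ennreal (\<bar>c\<bar> * \<bar>a\<bar> ^ L) * (\<integral>\<^sup>+b. ennreal (norm (cint w (D L) (m - L) b a)) \<partial>lborel)"
      using cm by (subst nn_integral_cmult[symmetric])
        (auto simp: c[OF a] norm_mult norm_power abs_mult power_abs ennreal_mult[symmetric])
    also have "\<dots> \<le> ennreal (\<bar>c\<bar> * \<bar>a\<bar> ^ L) * (ennreal \<bar>a\<bar> * ennreal B * ennreal (A (m - L)))"
      using nn_integral_cint_le[OF a DLm, of w "m - L"] A[of "m - L"] m B by (intro mult_left_mono) auto
    also have "\<dots> = ennreal (C1 * (\<bar>a\<bar> * \<bar>a\<bar> ^ L))"
      using nonneg by (simp add: ennreal_mult[symmetric] C1_def mult_ac)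
    finally show ?thesis .
  qed
  have 2: "(\<integral>\<^sup>+b. ennreal (norm (cint w \<psi> m b a)) \<partial>lborel) \<le> ennreal (C2 * (\<bar>a\<bar> * (1 / \<bar>a\<bar> ^ L)))" if a: "a \<noteq> 0" for a
  proof -
    have "(\<integral>\<^sup>+b. ennreal (norm (cint w \<psi> m b a)) \<partial>lborel) \<le>
        ennreal (pochhammer (real m) L / \<bar>a\<bar> ^ L * \<bar>a\<bar>) * (ennreal M * ennreal (A (m + L)))"
      using nn_integral_cint_le_moments[OF w L a \<psi>_measurable mom van, of m] A[of "m + L"] m M by simp
    also have "\<dots> = ennreal (C2 * (\<bar>a\<bar> * (1 / \<bar>a\<bar> ^ L)))"
      using nonneg by (subst ennreal_mult[symmetric] ennreal_mult''[symmetric], simp)+ (simp add: C2_def mult_ac)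
    finally show ?thesis .
  qed
  show ?thesis
  proof (rule that[of "max C1 C2"])
    show "0 \<le> max C1 C2" using C by simp
    fix a :: real assume a: "a \<noteq> 0"
    have "C1 * (\<bar>a\<bar> * \<bar>a\<bar> ^ L) \<le> max C1 C2 * (\<bar>a\<bar> * \<bar>a\<bar> ^ L)"
      "C2 * (\<bar>a\<bar> * (1 / \<bar>a\<bar> ^ L)) \<le> max C1 C2 * (\<bar>a\<bar> * (1 / \<bar>a\<bar> ^ L))"
      by (intro mult_right_mono; simp)+
    then show "(\<integral>\<^sup>+b. ennreal (norm (cint w \<psi> m b a)) \<partial>lborel) \<le> ennreal (max C1 C2 * (\<bar>a\<bar> * min (\<bar>a\<bar> ^ L) (1 / \<bar>a\<bar> ^ L)))"
      using 1[OF a] 2[OF a] by (auto simp: min_def intro: order_trans ennreal_leI simp del: times_divide_eq_right)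
  qed
qed

text \<open>Summation over translates replaces |a| by |a| + 1: the value term keeps its |a|, while
  in the derivative term m / |a| meets |a| and leaves a constant.\<close>

lemma cint_periodised_decay:
  assumes w: "Im w \<noteq> 0" and m: "m \<ge> L + 2"
  obtains C where "C \<ge> 0" "\<And>a \<beta>. a \<noteq> 0 \<Longrightarrow>
    (\<integral>\<^sup>+k. ennreal (norm (cint w \<psi> m (\<beta> + real_of_int k) a)) \<partial>count_space UNIV) \<le>
      ennreal (C * ((\<bar>a\<bar> + 1) * min (\<bar>a\<bar> ^ L) (1 / \<bar>a\<bar> ^ L)))"
proof -
  obtain C1 where C1: "C1 \<ge> 0" "\<And>a. a \<noteq> 0 \<Longrightarrow>
    (\<integral>\<^sup>+b. ennreal (norm (cint w \<psi> m b a)) \<partial>lborel) \<le> ennreal (C1 * (\<bar>a\<bar> * min (\<bar>a\<bar> ^ L) (1 / \<bar>a\<bar> ^ L)))"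
    using cint_decay[OF w m] by blast
  obtain C2 where C2: "C2 \<ge> 0" "\<And>a. a \<noteq> 0 \<Longrightarrow>
    (\<integral>\<^sup>+b. ennreal (norm (cint w \<psi> (Suc m) b a)) \<partial>lborel) \<le> ennreal (C2 * (\<bar>a\<bar> * min (\<bar>a\<bar> ^ L) (1 / \<bar>a\<bar> ^ L)))"
    using cint_decay[OF w, of "Suc m"] m by auto
  show ?thesis
  proof (rule that[of "max C1 (m * C2)"])
    show "0 \<le> max C1 (m * C2)" using C1 by simp
    fix a \<beta> :: real assume a: "a \<noteq> 0"
    define \<mu> where "\<mu> = min (\<bar>a\<bar> ^ L) (1 / \<bar>a\<bar> ^ L)"
    have \<mu>: "\<mu> \<ge> 0" by (simp add: \<mu>_def)
    have "(\<integral>\<^sup>+k. ennreal (norm (cint w \<psi> m (\<beta> + real_of_int k) a)) \<partial>count_space UNIV) \<le>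
      (\<integral>\<^sup>+b. ennreal (norm (cint w \<psi> m b a)) \<partial>lborel) +
      ennreal (m / \<bar>a\<bar>) * (\<integral>\<^sup>+b. ennreal (norm (cint w \<psi> (Suc m) b a)) \<partial>lborel)"
      by (rule cint_periodised[OF w a \<psi>_integrable])
    also have "\<dots> \<le> ennreal (C1 * (\<bar>a\<bar> * \<mu>)) + ennreal (m / \<bar>a\<bar>) * ennreal (C2 * (\<bar>a\<bar> * \<mu>))"
      unfolding \<mu>_def by (intro add_mono mult_left_mono C1 C2 a) auto
    also have "\<dots> = ennreal (C1 * (\<bar>a\<bar> * \<mu>) + m * C2 * \<mu>)"
      using a C1 C2 \<mu> by (simp add: ennreal_mult[symmetric] ennreal_plus[symmetric] del: ennreal_plus)
    also have "\<dots> \<le> ennreal (max C1 (m * C2) * ((\<bar>a\<bar> + 1) * \<mu>))"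
    proof (rule ennreal_leI)
      have "C1 * (\<bar>a\<bar> * \<mu>) \<le> max C1 (m * C2) * (\<bar>a\<bar> * \<mu>)" "m * C2 * \<mu> \<le> max C1 (m * C2) * \<mu>"
        using \<mu> by (intro mult_right_mono; simp)+
      then show "C1 * (\<bar>a\<bar> * \<mu>) + m * C2 * \<mu> \<le> max C1 (m * C2) * ((\<bar>a\<bar> + 1) * \<mu>)"
        by (simp add: algebra_simps)
    qed
    finally show "(\<integral>\<^sup>+k. ennreal (norm (cint w \<psi> m (\<beta> + real_of_int k) a)) \<partial>count_space UNIV) \<le>
      ennreal (max C1 (m * C2) * ((\<bar>a\<bar> + 1) * min (\<bar>a\<bar> ^ L) (1 / \<bar>a\<bar> ^ L)))"
      by (simp add: \<mu>_def)
  qed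
qed

lemma norm_wav_trans_atom:
  "norm (wav_trans (\<lambda>x. cnj (atom m w x)) \<psi> (b, a)) = \<bar>a\<bar> powr (- 1 / 2) * norm (cint w \<psi> m b a)"
  by (simp add: wav_trans_apply norm_mult cint_def)

lemma wav_trans_atom_integrable:
  assumes w: "Im w \<noteq> 0" and m: "m \<ge> L + 2" and \<sigma>: "\<bar>\<sigma>\<bar> < L - 1 / 2"
  shows "(\<integral>\<^sup>+z. ennreal (norm (wav_trans (\<lambda>x. cnj (atom m w x)) \<psi> z) * \<bar>snd z\<bar> powr \<sigma>) \<partial>aff_haar) < \<infinity>"
proof -
  define \<phi> where "\<phi> = (\<lambda>x. cnj (atom m w x))"
  have \<phi>m: "\<phi> \<in> borel_measurable borel" unfolding \<phi>_def by measurable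
  note [measurable] = wav_trans_measurable[OF \<psi>_measurable \<phi>m]
  have snd_m[measurable]: "(snd :: real \<times> real \<Rightarrow> real) \<in> borel_measurable borel"
    unfolding borel_prod[symmetric] by measurable
  obtain C where C: "C \<ge> 0" "\<And>a. a \<noteq> 0 \<Longrightarrow>
    (\<integral>\<^sup>+b. ennreal (norm (cint w \<psi> m b a)) \<partial>lborel) \<le> ennreal (C * (\<bar>a\<bar> * min (\<bar>a\<bar> ^ L) (1 / \<bar>a\<bar> ^ L)))"
    using cint_decay[OF w m] by blast
  have cm: "(\<lambda>b. cint w \<psi> m b a) \<in> borel_measurable borel" for a
    unfolding cint_def by measurable
  \<comment> \<open>The exponent collects \<sigma> from the weight, -1/2 from the normalisation, 1
    from the integral over b and -2 from the Haar density; the two decay estimates add or subtract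
    L. The condition at scale 0 is the sharper one and dictates L - 1/2.\<close>
  define e1 where "e1 = \<sigma> - 3 / 2 + L"
  define e2 where "e2 = \<sigma> - 3 / 2 - L"
  have "\<sigma> < real L - 1 / 2" "- \<sigma> < real L - 1 / 2"
    using \<sigma> by (auto simp: abs_less_iff)
  then have e: "e1 > -1" "e2 < -1" by (simp_all add: e1_def e2_def)
  define E where "E = (\<lambda>a. if \<bar>a\<bar> \<le> 1 then \<bar>a\<bar> powr e1 else \<bar>a\<bar> powr e2)"
  have [measurable]: "E \<in> borel_measurable borel" unfolding E_def by measurable
  have "(\<integral>\<^sup>+z. ennreal (norm (wav_trans \<phi> \<psi> z) * \<bar>snd z\<bar> powr \<sigma>) \<partial>aff_haar) =
      (\<integral>\<^sup>+a. (\<integral>\<^sup>+b. ennreal (norm (wav_trans \<phi> \<psi> (b, a)) * \<bar>a\<bar> powr \<sigma>) \<partial>lborel) * ennreal (1 / a\<^sup>2) \<partial>lborel)"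
    by (subst nn_integral_aff_haar) auto
  also have "\<dots> \<le> (\<integral>\<^sup>+a. ennreal C * ennreal (E a) \<partial>lborel)"
  proof (rule nn_integral_mono)
    fix a :: real
    show "(\<integral>\<^sup>+b. ennreal (norm (wav_trans \<phi> \<psi> (b, a)) * \<bar>a\<bar> powr \<sigma>) \<partial>lborel) * ennreal (1 / a\<^sup>2) \<le> ennreal C * ennreal (E a)"
    proof (cases "a = 0")
      case False
      have "(\<integral>\<^sup>+b. ennreal (norm (wav_trans \<phi> \<psi> (b, a)) * \<bar>a\<bar> powr \<sigma>) \<partial>lborel) =
          (\<integral>\<^sup>+b. ennreal (\<bar>a\<bar> powr (\<sigma> - 1 / 2)) * ennreal (norm (cint w \<psi> m b a)) \<partial>lborel)"
        unfolding \<phi>_def norm_wav_trans_atom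
        by (simp add: ennreal_mult[symmetric] powr_diff powr_minus_divide mult_ac)
      also have "\<dots> = ennreal (\<bar>a\<bar> powr (\<sigma> - 1 / 2)) * (\<integral>\<^sup>+b. ennreal (norm (cint w \<psi> m b a)) \<partial>lborel)"
        by (rule nn_integral_cmult) (use cm in measurable)
      also have "\<dots> \<le> ennreal (\<bar>a\<bar> powr (\<sigma> - 1 / 2)) * ennreal (C * (\<bar>a\<bar> * min (\<bar>a\<bar> ^ L) (1 / \<bar>a\<bar> ^ L)))"
        by (intro mult_left_mono C False) auto
      finally have "(\<integral>\<^sup>+b. ennreal (norm (wav_trans \<phi> \<psi> (b, a)) * \<bar>a\<bar> powr \<sigma>) \<partial>lborel) * ennreal (1 / a\<^sup>2) \<le>
          ennreal (\<bar>a\<bar> powr (\<sigma> - 1 / 2)) * ennreal (C * (\<bar>a\<bar> * min (\<bar>a\<bar> ^ L) (1 / \<bar>a\<bar> ^ L))) * ennreal (1 / a\<^sup>2)"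
        by (rule mult_right_mono) simp
      also have "\<dots> = ennreal (C * (\<bar>a\<bar> powr (\<sigma> - 1 / 2) * (\<bar>a\<bar> * min (\<bar>a\<bar> ^ L) (1 / \<bar>a\<bar> ^ L)) * (1 / a\<^sup>2)))"
        using C(1) by (simp add: ennreal_mult[symmetric] mult_ac)
      also have "\<dots> \<le> ennreal (C * E a)"
      proof (intro ennreal_leI mult_left_mono C(1))
        have pow: "\<bar>a\<bar> ^ L = \<bar>a\<bar> powr L" "1 / \<bar>a\<bar> ^ L = \<bar>a\<bar> powr (- real L)" "1 / a\<^sup>2 = \<bar>a\<bar> powr (-2)" "\<bar>a\<bar> = \<bar>a\<bar> powr 1"
          using False by (auto simp: powr_realpow powr_minus_divide powr_numeral)
        have "\<bar>a\<bar> powr (\<sigma> - 1 / 2) * (\<bar>a\<bar> * \<bar>a\<bar> ^ L) * (1 / a\<^sup>2) = \<bar>a\<bar> powr (\<sigma> - 1 / 2) * (\<bar>a\<bar> powr 1 * \<bar>a\<bar> powr L) * \<bar>a\<bar> powr (-2)"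
          using False by (simp add: powr_realpow powr_minus_divide powr_numeral)
        also have "\<dots> = \<bar>a\<bar> powr e1"
          unfolding powr_add[symmetric] e1_def by (simp add: algebra_simps)
        finally have 1: "\<bar>a\<bar> powr (\<sigma> - 1 / 2) * (\<bar>a\<bar> * \<bar>a\<bar> ^ L) * (1 / a\<^sup>2) = \<bar>a\<bar> powr e1" .
        have "\<bar>a\<bar> powr (\<sigma> - 1 / 2) * (\<bar>a\<bar> * (1 / \<bar>a\<bar> ^ L)) * (1 / a\<^sup>2) = \<bar>a\<bar> powr (\<sigma> - 1 / 2) * (\<bar>a\<bar> powr 1 * \<bar>a\<bar> powr (- real L)) * \<bar>a\<bar> powr (-2)"
          using False by (simp add: powr_realpow powr_minus_divide powr_numeral)
        also have "\<dots> = \<bar>a\<bar> powr e2"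
          unfolding powr_add[symmetric] e2_def by (simp add: algebra_simps)
        finally have 2: "\<bar>a\<bar> powr (\<sigma> - 1 / 2) * (\<bar>a\<bar> * (1 / \<bar>a\<bar> ^ L)) * (1 / a\<^sup>2) = \<bar>a\<bar> powr e2" .
        have "\<bar>a\<bar> powr (\<sigma> - 1 / 2) * (\<bar>a\<bar> * min (\<bar>a\<bar> ^ L) (1 / \<bar>a\<bar> ^ L)) * (1 / a\<^sup>2) \<le> \<bar>a\<bar> powr e1"
          "\<bar>a\<bar> powr (\<sigma> - 1 / 2) * (\<bar>a\<bar> * min (\<bar>a\<bar> ^ L) (1 / \<bar>a\<bar> ^ L)) * (1 / a\<^sup>2) \<le> \<bar>a\<bar> powr e2"
          unfolding 1[symmetric] 2[symmetric] by (intro mult_right_mono mult_left_mono; simp)+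
        then show "\<bar>a\<bar> powr (\<sigma> - 1 / 2) * (\<bar>a\<bar> * min (\<bar>a\<bar> ^ L) (1 / \<bar>a\<bar> ^ L)) * (1 / a\<^sup>2) \<le> E a"
          by (auto simp: E_def)
      qed
      finally show ?thesis
        using C(1) by (simp add: ennreal_mult E_def)
    qed auto
  qed
  also have "\<dots> = ennreal C * (\<integral>\<^sup>+a. ennreal (E a) \<partial>lborel)"
    by (rule nn_integral_cmult) auto
  also have "\<dots> < \<infinity>"
    using nn_integral_powr_finite[OF e] by (simp add: E_def ennreal_mult_less_top)
  finally show ?thesis by (simp add: \<phi>_def)
qed

lemma wavelet_atom_row_bound:
  assumes w: "Im w \<noteq> 0" and m: "m \<ge> L + 2" and \<sigma>: "\<bar>\<sigma>\<bar> < L - 1 / 2"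
  obtains C where "C \<ge> 0" "\<And>j k. (\<integral>\<^sup>+z. ennreal (norm (L2_inner (wavelet \<psi> (j, k)) (wav_rep z (\<lambda>x. cnj (atom m w x)))) * \<bar>snd z\<bar> powr \<sigma>) \<partial>aff_haar)
    \<le> ennreal (C * 2 powr (- real_of_int j * \<sigma>))"
proof -
  define \<phi> where "\<phi> = (\<lambda>x. cnj (atom m w x))"
  have \<phi>: "\<phi> \<in> L2" unfolding \<phi>_def using m by (intro L2_cnj atom_L2 w) auto
  define I where "I = (\<integral>\<^sup>+z. ennreal (norm (wav_trans \<phi> \<psi> z) * \<bar>snd z\<bar> powr \<sigma>) \<partial>aff_haar)"
  have I: "I < \<infinity>" unfolding I_def \<phi>_def by (rule wav_trans_atom_integrable[OF w m \<sigma>])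
  show ?thesis
  proof (rule that[of "enn2real I"])
    show "(\<integral>\<^sup>+z. ennreal (norm (L2_inner (wavelet \<psi> (j, k)) (wav_rep z (\<lambda>x. cnj (atom m w x)))) * \<bar>snd z\<bar> powr \<sigma>) \<partial>aff_haar)
      \<le> ennreal (enn2real I * 2 powr (- real_of_int j * \<sigma>))" for j k
    proof -
      have "(\<integral>\<^sup>+z. ennreal (norm (L2_inner (wavelet \<psi> (j, k)) (wav_rep z \<phi>)) * \<bar>snd z\<bar> powr \<sigma>) \<partial>aff_haar) =
          ennreal (\<bar>2 powr - real_of_int j\<bar> powr \<sigma>) * I"
        unfolding wavelet_eq_wav_rep I_def by (rule nn_integral_wav_trans_covariant[OF \<psi>_L2 \<phi>]) simp
      also have "\<dots> = ennreal (2 powr (- real_of_int j * \<sigma>)) * ennreal (enn2real I)"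
        using I by (simp add: powr_powr)
      also have "\<dots> = ennreal (enn2real I * 2 powr (- real_of_int j * \<sigma>))"
        by (subst ennreal_mult[symmetric]) (auto simp: mult.commute)
      finally show ?thesis unfolding \<phi>_def by simp
    qed
  qed simp
qed

text \<open>Columns are sums over a discrete set, so invariance of the Haar measure gives nothing
  here. The sum over k is a periodisation at the scale u = 2^j |a|; what remains in j decays
  geometrically in both directions.\<close>

lemma wavelet_atom_column_bound:
  assumes w: "Im w \<noteq> 0" and m: "m \<ge> L + 2" and \<sigma>: "\<bar>\<sigma>\<bar> < L - 1 / 2"
  obtains C where "C \<ge> 0" "\<And>z. (\<integral>\<^sup>+i. ennreal (norm (L2_inner (wavelet \<psi> i) (wav_rep z (\<lambda>x. cnj (atom m w x)))) * 2 powr (- real_of_int (fst i) * \<sigma>)) \<partial>count_space UNIV)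
    \<le> ennreal (C * \<bar>snd z\<bar> powr \<sigma>)"
proof -
  define \<phi> where "\<phi> = (\<lambda>x. cnj (atom m w x))"
  define \<gamma> where "\<gamma> = real L - 1 / 2"
  \<comment> \<open>The decay in u that is left once the weight has been absorbed.\<close>
  define \<delta> where "\<delta> = \<gamma> - \<bar>\<sigma>\<bar>"
  have \<delta>: "\<delta> > 0" using \<sigma> by (simp add: \<delta>_def \<gamma>_def)
  obtain C where C: "C \<ge> 0" "\<And>a \<beta>. a \<noteq> 0 \<Longrightarrow>
    (\<integral>\<^sup>+k. ennreal (norm (cint w \<psi> m (\<beta> + real_of_int k) a)) \<partial>count_space UNIV) \<le>
      ennreal (C * ((\<bar>a\<bar> + 1) * min (\<bar>a\<bar> ^ L) (1 / \<bar>a\<bar> ^ L)))"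
    using cint_periodised_decay[OF w m] by blast
  obtain C' where C': "C' \<ge> 0" "\<And>t. t > 0 \<Longrightarrow>
    (\<integral>\<^sup>+j. ennreal (min ((2 powr real_of_int j * t) powr \<delta>) ((2 powr real_of_int j * t) powr - \<delta>)) \<partial>count_space UNIV) \<le> ennreal C'"
    using dyadic_sum_bound[OF \<delta>] by blast
  show ?thesis
  proof (rule that[of "2 * C * C'"])
    show "0 \<le> 2 * C * C'" using C C' by simp
    fix z :: "real \<times> real"
    obtain b a where z: "z = (b, a)" by (cases z)
    show "(\<integral>\<^sup>+i. ennreal (norm (L2_inner (wavelet \<psi> i) (wav_rep z (\<lambda>x. cnj (atom m w x)))) * 2 powr (- real_of_int (fst i) * \<sigma>)) \<partial>count_space UNIV)
      \<le> ennreal (2 * C * C' * \<bar>snd z\<bar> powr \<sigma>)"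
    proof (cases "a = 0")
      case True
      then show ?thesis by (simp add: z wav_rep_0 L2_inner_def)
    next
      case False
      define u where "u = (\<lambda>j. 2 powr real_of_int j * \<bar>a\<bar>)"
      have u: "u j > 0" for j using False by (simp add: u_def)
      have absu: "\<bar>2 powr real_of_int j * a\<bar> = u j" for j by (simp add: u_def abs_mult)
      \<comment> \<open>u + 1 is at most 2 for u \<le> 1 and at most 2 u otherwise. Without the
        weight this leaves \<open>u powr \<gamma>\<close> for small and
        \<open>u powr (- \<gamma>)\<close> for large u, with \<gamma> = L - 1/2 in both
        cases.\<close>
      have key: "u j powr (- 1 / 2) * ((u j + 1) * min (u j ^ L) (1 / u j ^ L)) * 2 powr (- real_of_int j * \<sigma>) \<le>
          2 * \<bar>a\<bar> powr \<sigma> * min (u j powr \<delta>) (u j powr - \<delta>)" for j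
      proof -
        define v where "v = u j"
        have v: "v > 0" using u by (simp add: v_def)
        have 1: "2 powr (- real_of_int j * \<sigma>) = \<bar>a\<bar> powr \<sigma> * v powr (- \<sigma>)"
          using False by (simp add: v_def u_def powr_mult powr_powr powr_minus_divide)
        have 2: "v powr (- 1 / 2) * ((v + 1) * min (v ^ L) (1 / v ^ L)) * v powr (- \<sigma>) \<le> 2 * min (v powr \<delta>) (v powr - \<delta>)"
        proof (cases "v \<le> 1")
          case True
          have "v powr (- 1 / 2) * ((v + 1) * min (v ^ L) (1 / v ^ L)) * v powr (- \<sigma>) \<le> v powr (- 1 / 2) * (2 * v powr L) * v powr (- \<sigma>)"
            using True v by (intro mult_right_mono mult_left_mono mult_mono) (auto simp: powr_realpow)
          also have "\<dots> = 2 * v powr (\<gamma> - \<sigma>)"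
            by (simp add: \<gamma>_def powr_diff powr_minus_divide)
          also have "v powr (\<gamma> - \<sigma>) \<le> v powr \<delta>"
            using True v by (intro powr_mono') (auto simp: \<delta>_def)
          also have "v powr \<delta> = min (v powr \<delta>) (v powr - \<delta>)"
            using powr_mono'[of "- \<delta>" \<delta> v] True v \<delta> by simp
          finally show ?thesis by simp
        next
          case v1: False
          have "v powr (- 1 / 2) * ((v + 1) * min (v ^ L) (1 / v ^ L)) * v powr (- \<sigma>) \<le> v powr (- 1 / 2) * ((2 * v) * v powr (- real L)) * v powr (- \<sigma>)"
            using v1 v by (intro mult_right_mono mult_left_mono mult_mono) (auto simp: powr_realpow powr_minus_divide)
          also have "\<dots> = 2 * (v powr (- 1 / 2) * (v powr 1 * v powr (- real L)) * v powr (- \<sigma>))"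
            using v by simp
          also have "\<dots> = 2 * v powr (- \<gamma> - \<sigma>)"
            unfolding powr_add[symmetric] by (simp add: \<gamma>_def algebra_simps)
          also have "v powr (- \<gamma> - \<sigma>) \<le> v powr - \<delta>"
            using v1 v by (intro powr_mono) (auto simp: \<delta>_def)
          also have "v powr - \<delta> = min (v powr \<delta>) (v powr - \<delta>)"
            using powr_mono[of "- \<delta>" \<delta> v] v1 v \<delta> by simp
          finally show ?thesis by simp
        qed
        show ?thesis
          using mult_left_mono[OF 2, of "\<bar>a\<bar> powr \<sigma>"] unfolding v_def[symmetric] 1
          by (simp add: mult_ac)
      qed
      have "(\<integral>\<^sup>+i. ennreal (norm (L2_inner (wavelet \<psi> i) (wav_rep z \<phi>)) * 2 powr (- real_of_int (fst i) * \<sigma>)) \<partial>count_space UNIV) =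
          (\<integral>\<^sup>+j. \<integral>\<^sup>+k. ennreal (norm (L2_inner (wavelet \<psi> (j, k)) (wav_rep z \<phi>)) * 2 powr (- real_of_int j * \<sigma>)) \<partial>count_space UNIV \<partial>count_space UNIV)"
        by (subst nn_integral_count_space_int_prod[symmetric]) simp
      also have "\<dots> \<le> (\<integral>\<^sup>+j. ennreal (2 * C * \<bar>a\<bar> powr \<sigma>) * ennreal (min (u j powr \<delta>) (u j powr - \<delta>)) \<partial>count_space UNIV)"
      proof (rule nn_integral_mono)
        fix j :: int
        define c where "c = u j powr (- 1 / 2) * 2 powr (- real_of_int j * \<sigma>)"
        have c: "c \<ge> 0" by (simp add: c_def)
        have "(\<integral>\<^sup>+k. ennreal (norm (L2_inner (wavelet \<psi> (j, k)) (wav_rep z \<phi>)) * 2 powr (- real_of_int j * \<sigma>)) \<partial>count_space UNIV) =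
            (\<integral>\<^sup>+k. ennreal c * ennreal (norm (cint w \<psi> m (2 powr real_of_int j * b + real_of_int k) (2 powr real_of_int j * a))) \<partial>count_space UNIV)"
          unfolding z wavelet_covariant \<phi>_def norm_wav_trans_atom absu c_def
          by (simp add: ennreal_mult[symmetric] mult_ac)
        also have "\<dots> = ennreal c * (\<integral>\<^sup>+k. ennreal (norm (cint w \<psi> m (2 powr real_of_int j * b + real_of_int k) (2 powr real_of_int j * a))) \<partial>count_space UNIV)"
          by (rule nn_integral_cmult) auto
        also have "\<dots> \<le> ennreal c * ennreal (C * ((u j + 1) * min (u j ^ L) (1 / u j ^ L)))"
          unfolding absu[symmetric] by (intro mult_left_mono C) (use False in auto)
        also have "\<dots> = ennreal (C * (u j powr (- 1 / 2) * ((u j + 1) * min (u j ^ L) (1 / u j ^ L)) * 2 powr (- real_of_int j * \<sigma>)))"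
          using C(1) u[of j] by (simp add: ennreal_mult[symmetric] c_def mult_ac)
        also have "\<dots> \<le> ennreal (C * (2 * \<bar>a\<bar> powr \<sigma> * min (u j powr \<delta>) (u j powr - \<delta>)))"
          by (intro ennreal_leI mult_left_mono key C)
        also have "\<dots> = ennreal (2 * C * \<bar>a\<bar> powr \<sigma>) * ennreal (min (u j powr \<delta>) (u j powr - \<delta>))"
          using C(1) by (simp add: ennreal_mult[symmetric] mult_ac)
        finally show "(\<integral>\<^sup>+k. ennreal (norm (L2_inner (wavelet \<psi> (j, k)) (wav_rep z \<phi>)) * 2 powr (- real_of_int j * \<sigma>)) \<partial>count_space UNIV) \<le> \<dots>" .
      qed
      also have "\<dots> = ennreal (2 * C * \<bar>a\<bar> powr \<sigma>) * (\<integral>\<^sup>+j. ennreal (min (u j powr \<delta>) (u j powr - \<delta>)) \<partial>count_space UNIV)"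
        by (rule nn_integral_cmult) auto
      also have "\<dots> \<le> ennreal (2 * C * \<bar>a\<bar> powr \<sigma>) * ennreal C'"
        unfolding u_def by (intro mult_left_mono C') (use False in auto)
      also have "\<dots> = ennreal (2 * C * C' * \<bar>snd z\<bar> powr \<sigma>)"
        using C(1) C'(1) by (simp add: ennreal_mult[symmetric] z mult_ac)
      finally show ?thesis unfolding \<phi>_def .
    qed
  qed
qed

end

section \<open>A singular integral of atoms\<close>

text \<open>Here F has limits at both ends but need not be integrable, so the interval [-n, n] is
  exhausted by dominated convergence.\<close>

lemma FTC_line:
  fixes F :: "real \<Rightarrow> complex"
  assumes F: "\<And>x. (F has_vector_derivative F' x) (at x)" and F': "integrable lborel F'"
    and A: "(F \<longlongrightarrow> A) at_bot" and B: "(F \<longlongrightarrow> B) at_top"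
  shows "(\<integral>x. F' x \<partial>lborel) = B - A"
proof (rule LIMSEQ_unique)
  have [measurable]: "F' \<in> borel_measurable borel" using F' by auto
  show "(\<lambda>n. \<integral>x. indicator {- real n..real n} x *\<^sub>R F' x \<partial>lborel) \<longlonglongrightarrow> (\<integral>x. F' x \<partial>lborel)"
  proof (rule integral_dominated_convergence[where w="\<lambda>x. norm (F' x)"])
    show "AE x in lborel. (\<lambda>n. indicator {- real n..real n} x *\<^sub>R F' x) \<longlonglongrightarrow> F' x"
    proof (intro AE_I2 tendsto_eventually)
      fix x :: real
      show "\<forall>\<^sub>F n in sequentially. indicator {- real n..real n} x *\<^sub>R F' x = F' x"
        using eventually_ge_at_top[of "nat \<lceil>\<bar>x\<bar>\<rceil>"]
        by eventually_elim (auto simp: indicator_def nat_le_iff ceiling_le_iff abs_le_iff)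
    qed
  qed (use F' in \<open>auto simp: indicator_def\<close>)
  have "(\<lambda>n. F (real n) - F (- real n)) \<longlonglongrightarrow> B - A"
    by (intro tendsto_diff filterlim_compose[OF B] filterlim_compose[OF A]) real_asymp+
  moreover have "(\<integral>x. indicator {- real n..real n} x *\<^sub>R F' x \<partial>lborel) = F (real n) - F (- real n)" for n
    by (rule FTC_indicator[OF _ F]) (use F' in \<open>auto simp: set_integrable_def intro!: integrable_mult_indicator\<close>)
  ultimately show "(\<lambda>n. \<integral>x. indicator {- real n..real n} x *\<^sub>R F' x \<partial>lborel) \<longlonglongrightarrow> B - A"
    by simp
qed

text \<open>The half-line version is meant for functions of v / a, which are differentiable only
  away from a = 0.\<close>

lemma FTC_Ici:
  fixes F :: "real \<Rightarrow> complex"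
  assumes F: "\<And>x. e \<le> x \<Longrightarrow> (F has_vector_derivative F' x) (at x)"
    and F': "integrable lborel (\<lambda>x. indicator {e..} x *\<^sub>R F' x)" and B: "(F \<longlongrightarrow> B) at_top"
  shows "(\<integral>x. indicator {e..} x *\<^sub>R F' x \<partial>lborel) = B - F e"
proof (rule LIMSEQ_unique)
  let ?G = "\<lambda>x. indicator {e..} x *\<^sub>R F' x"
  have [measurable]: "?G \<in> borel_measurable borel" using F' by auto
  show "(\<lambda>n. \<integral>x. indicator {e..e + real n} x *\<^sub>R ?G x \<partial>lborel) \<longlonglongrightarrow> (\<integral>x. ?G x \<partial>lborel)"
  proof (rule integral_dominated_convergence[where w="\<lambda>x. norm (?G x)"])
    show "AE x in lborel. (\<lambda>n. indicator {e..e + real n} x *\<^sub>R ?G x) \<longlonglongrightarrow> ?G x"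
    proof (intro AE_I2 tendsto_eventually)
      fix x :: real
      show "\<forall>\<^sub>F n in sequentially. indicator {e..e + real n} x *\<^sub>R ?G x = ?G x"
        using eventually_ge_at_top[of "nat \<lceil>\<bar>x - e\<bar>\<rceil>"]
        by eventually_elim (auto simp: indicator_def nat_le_iff ceiling_le_iff abs_le_iff)
    qed
    show "integrable lborel (\<lambda>x. norm (?G x))" by (rule integrable_norm[OF F'])
    show "AE x in lborel. norm (indicator {e..e + real i} x *\<^sub>R ?G x) \<le> norm (?G x)" for i
      by (auto simp: indicator_def)
  qed measurable
  have "(\<lambda>n. F (e + real n) - F e) \<longlonglongrightarrow> B - F e"
    by (intro tendsto_diff filterlim_compose[OF B] tendsto_const) real_asymp
  moreover have "(\<integral>x. indicator {e..e + real n} x *\<^sub>R ?G x \<partial>lborel) = F (e + real n) - F e" for n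
  proof -
    have si: "set_integrable lborel {e..e + real n} F'"
      unfolding set_integrable_def
      using integrable_mult_indicator[OF _ F', of "{e..e + real n}"]
      by (rule Bochner_Integration.integrable_cong[THEN iffD1, rotated 2]) (auto simp: indicator_def)
    have "(F' has_integral (F (e + real n) - F e)) {e..e + real n}"
      using F by (intro fundamental_theorem_of_calculus) (auto intro: has_vector_derivative_at_within)
    moreover have "(LINT x : {e..e + real n} | lborel. F' x) = integral {e..e + real n} F'"
      by (rule set_borel_integral_eq_integral[OF si])
    moreover have "(\<integral>x. indicator {e..e + real n} x *\<^sub>R ?G x \<partial>lborel) = (LINT x : {e..e + real n} | lborel. F' x)"
      unfolding set_lebesgue_integral_def by (intro Bochner_Integration.integral_cong) (auto simp: indicator_def)
    ultimately show ?thesis by (simp add: integral_unique)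
  qed
  ultimately show "(\<lambda>n. \<integral>x. indicator {e..e + real n} x *\<^sub>R ?G x \<partial>lborel) \<longlonglongrightarrow> B - F e"
    by simp
qed

lemma atom_tendsto_0:
  assumes w: "Im w \<noteq> 0" and n: "n \<ge> 1"
  shows "(atom n w \<longlongrightarrow> 0) at_top" "(atom n w \<longlongrightarrow> 0) at_bot"
proof -
  obtain C where C: "C \<ge> 1" "\<And>x. (norm (atom n w x))\<^sup>2 \<le> C / (1 + x\<^sup>2)"
    using atom_bounded[OF w, of n] n by metis
  have "norm (atom n w x) \<le> sqrt (C / (1 + x\<^sup>2))" for x
    using C(2)[of x] by (rule real_le_rsqrt)
  then have le: "eventually (\<lambda>x. norm (atom n w x) \<le> sqrt (C / (1 + x\<^sup>2))) F" for F
    by (simp add: always_eventually)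
  have "((\<lambda>x. sqrt (C / (1 + x\<^sup>2))) \<longlongrightarrow> 0) at_top" "((\<lambda>x. sqrt (C / (1 + x\<^sup>2))) \<longlongrightarrow> 0) at_bot"
    using C(1) by real_asymp+
  then show "(atom n w \<longlongrightarrow> 0) at_top" "(atom n w \<longlongrightarrow> 0) at_bot"
    by (auto intro: Lim_null_comparison[OF le])
qed

text \<open>From order 2 on, an atom is a multiple of the derivative of an atom that vanishes at
  both ends.\<close>

lemma integral_atom_eq_0:
  assumes w: "Im w \<noteq> 0" and n: "n \<ge> 1"
  shows "(\<integral>x. atom (Suc n) w x \<partial>lborel) = 0"
proof -
  have "(\<integral>x. - of_nat n * atom (Suc n) w x \<partial>lborel) = 0 - 0"
  proof (rule FTC_line[of "atom n w"])
    show "(atom n w has_vector_derivative - of_nat n * atom (Suc n) w x) (at x)" for x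
      using atom_deriv[OF w, of n 0 1 x UNIV] by simp
  qed (use atom_tendsto_0[OF w n] atom_integrable[OF w, of "Suc n"] n in auto)
  then show ?thesis using n by simp
qed

text \<open>
  Up to a factor, the integral of \<open>atom (Suc n) w (s - v / a)\<close> over the scales \<open>\<bar>a\<bar> \<ge> 1\<close> with weight \<open>1 / a\<^sup>2\<close>.
  Its integral in \<open>v\<close> is the Hilbert transform of an atom, which is again an atom.
\<close>

definition atom_diff :: "nat \<Rightarrow> complex \<Rightarrow> real \<Rightarrow> real \<Rightarrow> complex" where
  "atom_diff n w s v = (atom n w (s - v) - atom n w (s + v)) / of_real v"

text \<open>Partial fractions with A = s - w:
  \<open>1 / ((A - v) v) = (1 / A) (1 / v + 1 / (A - v))\<close>, and likewise for -v. Raising the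
  order thus multiplies by \<open>atom 1 w s\<close>, up to two translated atoms whose integrals
  over v vanish as soon as their order is at least 2.\<close>

lemma atom_diff_Suc:
  assumes w: "Im w \<noteq> 0" and v: "v \<noteq> 0"
  shows "atom_diff (Suc n) w s v = atom 1 w s * (atom_diff n w s v + atom (Suc n) w (s - v) + atom (Suc n) w (s + v))"
proof -
  define A where "A = of_real s - w"
  have nz: "A \<noteq> 0" "A - of_real v \<noteq> 0" "A + of_real v \<noteq> 0"
    using atom_nz[OF w, of s] atom_nz[OF w, of "s - v"] atom_nz[OF w, of "s + v"] by (auto simp: A_def algebra_simps)
  have e: "of_real (s - v) - w = A - of_real v" "of_real (s + v) - w = A + of_real v"
    by (auto simp: A_def)
  define p where "p = (A - of_real v) ^ n"
  define q where "q = (A + of_real v) ^ n"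
  have pq: "p \<noteq> 0" "q \<noteq> 0" using nz by (auto simp: p_def q_def)
  have 1: "1 / ((A - of_real v) * p) / of_real v = (1 / A) * (1 / p / of_real v + 1 / ((A - of_real v) * p))"
    using nz pq v by (simp add: divide_simps)
  have 2: "1 / ((A + of_real v) * q) / of_real v = (1 / A) * (1 / q / of_real v - 1 / ((A + of_real v) * q))"
    using nz pq v by (simp add: divide_simps)
  show ?thesis
    unfolding atom_diff_def atom_def e power_Suc p_def[symmetric] q_def[symmetric] diff_divide_distrib 1 2 A_def[symmetric]
    by (simp add: algebra_simps)
qed

text \<open>The product form shows integrability, being a product of two L2 functions. The sum form,
  after division by \<open>atom 1 w s\<close>, has an elementary antiderivative.\<close>

lemma atom_diff_1:
  assumes w: "Im w \<noteq> 0" and v: "v \<noteq> 0"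
  shows "atom_diff 1 w s v = 2 * (atom 1 w (s - v) * atom 1 w (s + v))"
    "atom_diff 1 w s v = atom 1 w s * (atom 1 w (s - v) + atom 1 w (s + v))"
proof -
  show "atom_diff 1 w s v = atom 1 w s * (atom 1 w (s - v) + atom 1 w (s + v))"
    using atom_diff_Suc[OF w v, of 0 s] by (simp add: atom_diff_def[of 0] atom_def)
  define A where "A = of_real s - w"
  have nz: "A \<noteq> 0" "A - of_real v \<noteq> 0" "A + of_real v \<noteq> 0"
    using atom_nz[OF w, of s] atom_nz[OF w, of "s - v"] atom_nz[OF w, of "s + v"] by (auto simp: A_def algebra_simps)
  have e: "of_real (s - v) - w = A - of_real v" "of_real (s + v) - w = A + of_real v"
    by (auto simp: A_def)
  show "atom_diff 1 w s v = 2 * (atom 1 w (s - v) * atom 1 w (s + v))"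
    unfolding atom_diff_def atom_def e using nz v by (simp add: divide_simps)
qed

lemma AE_neq_0: "AE v in lborel. v \<noteq> (0::real)"
  by (rule AE_lborel_singleton)

lemma atom_diff_1_integral:
  assumes w: "Im w \<noteq> 0"
  shows "integrable lborel (atom_diff 1 w s)"
    "(\<integral>v. atom_diff 1 w s v \<partial>lborel) = of_real (2 * pi * sgn (Im w)) * \<i> * atom 1 w s"
proof -
  have m[measurable]: "atom_diff 1 w s \<in> borel_measurable borel"
    unfolding atom_diff_def[abs_def] by measurable
  have i1: "integrable lborel (\<lambda>v. atom 1 w (s - v) * atom 1 w (s + v))"
    using L2_mult_integrable[OF L2_affine[OF atom_L2[OF w], of 1 "-1" s] L2_affine[OF atom_L2[OF w], of 1 "1" s]] by simp
  have i2: "integrable lborel (\<lambda>v. 2 * (atom 1 w (s - v) * atom 1 w (s + v)))"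
    by (intro integrable_mult_right i1)
  have ae: "AE v in lborel. 2 * (atom 1 w (s - v) * atom 1 w (s + v)) = atom_diff 1 w s v"
    using AE_neq_0 by eventually_elim (rule atom_diff_1(1)[OF w, symmetric])
  show int: "integrable lborel (atom_diff 1 w s)"
    by (rule integrable_cong_AE_imp[OF i2 _ ae]) (use m in simp)
  define \<alpha> where "\<alpha> = s - Re w"
  define \<beta> where "\<beta> = - Im w"
  have \<beta>: "\<beta> \<noteq> 0" using w by (simp add: \<beta>_def)
  \<comment> \<open>Up to a constant, real and imaginary part of log (s + v - w) - log (s - v - w),
    with the argument written through arctan so that it is smooth in v on the whole line.\<close>
  define F where "F = (\<lambda>v. Complex ((ln ((\<alpha> + v)\<^sup>2 + \<beta>\<^sup>2) - ln ((\<alpha> - v)\<^sup>2 + \<beta>\<^sup>2)) / 2)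
      (- arctan ((v - \<alpha>) / \<beta>) - arctan ((v + \<alpha>) / \<beta>)))"
  define F' where "F' = (\<lambda>v. atom 1 w (s - v) + atom 1 w (s + v))"
  have as: "atom 1 w s \<noteq> 0" using atom_nz[OF w, of s] by (simp add: atom_def)
  have ae2: "AE v in lborel. (1 / atom 1 w s) * atom_diff 1 w s v = F' v"
    using AE_neq_0
  proof eventually_elim
    case (elim v)
    show ?case unfolding atom_diff_1(2)[OF w elim] F'_def using as by simp
  qed
  have [measurable]: "F' \<in> borel_measurable borel" unfolding F'_def by measurable
  have intF': "integrable lborel F'"
    by (rule integrable_cong_AE_imp[OF integrable_mult_right[OF int] _ ae2]) simp
  have pos: "(\<alpha> + v)\<^sup>2 + \<beta>\<^sup>2 > 0" "(\<alpha> - v)\<^sup>2 + \<beta>\<^sup>2 > 0" for v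
    using \<beta> by (auto intro: add_nonneg_pos)
  \<comment> \<open>The logarithms cancel at both ends; the two arctangents together jump by 2
    \<pi>, with the sign of Im w because \<beta> = - Im w.\<close>
  have "(\<integral>v. F' v \<partial>lborel) = Complex 0 (- pi * sgn \<beta>) - Complex 0 (pi * sgn \<beta>)"
  proof (rule FTC_line[OF _ intF'])
    fix v
    have at: "1 + ((v - \<alpha>) / \<beta>)\<^sup>2 = ((\<alpha> - v)\<^sup>2 + \<beta>\<^sup>2) / \<beta>\<^sup>2" "1 + ((v + \<alpha>) / \<beta>)\<^sup>2 = ((\<alpha> + v)\<^sup>2 + \<beta>\<^sup>2) / \<beta>\<^sup>2"
      using \<beta> by (simp_all add: field_simps power2_commute[of v \<alpha>] add.commute[of v \<alpha>])
    have re: "((\<lambda>v. (ln ((\<alpha> + v)\<^sup>2 + \<beta>\<^sup>2) - ln ((\<alpha> - v)\<^sup>2 + \<beta>\<^sup>2)) / 2) has_real_derivative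
        ((\<alpha> + v) / ((\<alpha> + v)\<^sup>2 + \<beta>\<^sup>2) + (\<alpha> - v) / ((\<alpha> - v)\<^sup>2 + \<beta>\<^sup>2))) (at v)"
    proof -
      have "((\<lambda>v. ln ((\<alpha> + v)\<^sup>2 + \<beta>\<^sup>2)) has_real_derivative 2 * (\<alpha> + v) / ((\<alpha> + v)\<^sup>2 + \<beta>\<^sup>2)) (at v)"
        "((\<lambda>v. ln ((\<alpha> - v)\<^sup>2 + \<beta>\<^sup>2)) has_real_derivative - (2 * (\<alpha> - v) / ((\<alpha> - v)\<^sup>2 + \<beta>\<^sup>2))) (at v)"
        using pos[of v] by (auto intro!: derivative_eq_intros) (metis minus_diff_eq minus_divide_left)
      note DERIV_cdivide[OF DERIV_diff[OF this], of 2]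
      moreover have "(2 * x / P - - (2 * y / Q)) / 2 = x / P + y / Q" for x y P Q :: real
        by (simp add: add_divide_distrib)
      ultimately show ?thesis by (simp only:)
    qed
    have im: "((\<lambda>v. - arctan ((v - \<alpha>) / \<beta>) - arctan ((v + \<alpha>) / \<beta>)) has_real_derivative
        (- \<beta> / ((\<alpha> - v)\<^sup>2 + \<beta>\<^sup>2) - \<beta> / ((\<alpha> + v)\<^sup>2 + \<beta>\<^sup>2))) (at v)"
      using \<beta> by (auto intro!: derivative_eq_intros simp: inverse_eq_divide at)
        (simp add: power2_eq_square)
    have F'v: "F' v = Complex ((\<alpha> + v) / ((\<alpha> + v)\<^sup>2 + \<beta>\<^sup>2) + (\<alpha> - v) / ((\<alpha> - v)\<^sup>2 + \<beta>\<^sup>2))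
        (- \<beta> / ((\<alpha> - v)\<^sup>2 + \<beta>\<^sup>2) - \<beta> / ((\<alpha> + v)\<^sup>2 + \<beta>\<^sup>2))"
      unfolding F'_def atom_def
      by (simp add: complex_eq_iff Re_divide Im_divide \<alpha>_def \<beta>_def algebra_simps)
    show "(F has_vector_derivative F' v) (at v)"
      using re im unfolding F_def has_vector_derivative_complex_iff F'v by simp
  next
    have l: "((\<lambda>v. (ln ((\<alpha> + v)\<^sup>2 + \<beta>\<^sup>2) - ln ((\<alpha> - v)\<^sup>2 + \<beta>\<^sup>2)) / 2) \<longlongrightarrow> 0) at_bot"
      "((\<lambda>v. (ln ((\<alpha> + v)\<^sup>2 + \<beta>\<^sup>2) - ln ((\<alpha> - v)\<^sup>2 + \<beta>\<^sup>2)) / 2) \<longlongrightarrow> 0) at_top"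
      by real_asymp+
    have "((\<lambda>v. - arctan ((v - \<alpha>) / \<beta>) - arctan ((v + \<alpha>) / \<beta>)) \<longlongrightarrow> pi * sgn \<beta>) at_bot"
      "((\<lambda>v. - arctan ((v - \<alpha>) / \<beta>) - arctan ((v + \<alpha>) / \<beta>)) \<longlongrightarrow> - pi * sgn \<beta>) at_top"
      using \<beta> by (cases "\<beta> > 0"; simp; real_asymp)+
    with l show "(F \<longlongrightarrow> Complex 0 (pi * sgn \<beta>)) at_bot" "(F \<longlongrightarrow> Complex 0 (- pi * sgn \<beta>)) at_top"
      unfolding F_def by (auto intro!: tendsto_Complex)
  qed
  also have "(\<integral>v. F' v \<partial>lborel) = (\<integral>v. (1 / atom 1 w s) * atom_diff 1 w s v \<partial>lborel)"
  proof (rule integral_cong_AE)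
    show "AE v in lborel. F' v = (1 / atom 1 w s) * atom_diff 1 w s v"
      using ae2 by eventually_elim simp
  qed measurable
  finally have "(1 / atom 1 w s) * (\<integral>v. atom_diff 1 w s v \<partial>lborel) = Complex 0 (- 2 * pi * sgn \<beta>)"
    by (simp add: complex_eq_iff)
  then show "(\<integral>v. atom_diff 1 w s v \<partial>lborel) = of_real (2 * pi * sgn (Im w)) * \<i> * atom 1 w s"
    using as by (simp add: field_simps \<beta>_def sgn_minus) (simp add: complex_eq_iff)
qed

text \<open>An atom extends holomorphically to the half-plane that does not contain w, and on such
  functions the Hilbert transform acts as a scalar, \<i> or -\<i>. This is why the constant is the
  same for every order.\<close>

lemma atom_diff_integral:
  assumes w: "Im w \<noteq> 0" and n: "n \<ge> 1"
  shows "integrable lborel (atom_diff n w s) \<and>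
    (\<integral>v. atom_diff n w s v \<partial>lborel) = of_real (2 * pi * sgn (Im w)) * \<i> * atom n w s"
  using n
proof (induction n rule: nat_induct_at_least)
  case base
  show ?case using atom_diff_1_integral[OF w] by blast
next
  case (Suc n)
  let ?G = "\<lambda>v. atom 1 w s * (atom_diff n w s v + atom (Suc n) w (s + -1 * v) + atom (Suc n) w (s + 1 * v))"
  have ia: "integrable lborel (atom (Suc n) w)" using Suc.hyps by (intro atom_integrable w) simp
  note i = lborel_integrable_real_affine[OF ia, of "-1" s] lborel_integrable_real_affine[OF ia, of 1 s]
  have z: "(\<integral>v. atom (Suc n) w (s + -1 * v) \<partial>lborel) = 0" "(\<integral>v. atom (Suc n) w (s + 1 * v) \<partial>lborel) = 0"
    using lborel_integral_real_affine[of "-1" "atom (Suc n) w" s] lborel_integral_real_affine[of "1" "atom (Suc n) w" s]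
      integral_atom_eq_0[OF w Suc.hyps] by auto
  have iG: "integrable lborel ?G"
    using Suc.IH i by (intro integrable_mult_right Bochner_Integration.integrable_add) auto
  have [measurable]: "atom_diff k w s \<in> borel_measurable borel" for k
    unfolding atom_diff_def[abs_def] by measurable
  have ae: "AE v in lborel. ?G v = atom_diff (Suc n) w s v"
    using AE_neq_0 by eventually_elim (simp add: atom_diff_Suc[OF w])
  have "integrable lborel (atom_diff (Suc n) w s)"
    by (rule integrable_cong_AE_imp[OF iG _ ae]) simp
  moreover have "(\<integral>v. atom_diff (Suc n) w s v \<partial>lborel) = (\<integral>v. ?G v \<partial>lborel)"
    by (rule integral_cong_AE) (use ae in auto)
  moreover have "(\<integral>v. ?G v \<partial>lborel) = atom 1 w s * ((\<integral>v. atom_diff n w s v \<partial>lborel) + 0 + 0)"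
    unfolding integral_mult_right_zero
    by (subst Bochner_Integration.integral_add Bochner_Integration.integral_add; (use Suc.IH i z in simp)?)+
  ultimately show ?case
    using Suc.IH by (simp add: atom_def)
qed

text \<open>Near v = 0 the quotient is controlled by the derivative, whose order n + 1 is at least
  2; so the decay \<open>1 / (1 + s^2)\<close> is available even for n = 1.\<close>

lemma atom_diff_bound:
  assumes w: "Im w \<noteq> 0" and n: "n \<ge> 1"
  obtains C where "C \<ge> 0" "\<And>s v. \<bar>v\<bar> \<le> 1 \<Longrightarrow> norm (atom_diff n w s v) \<le> C / (1 + s\<^sup>2)"
proof -
  obtain C where C: "C \<ge> 1" "\<And>x. norm (atom (Suc n) w x) \<le> C / (1 + x\<^sup>2)"
    using atom_bounded[OF w, of "Suc n"] n by (metis Suc_le_mono numeral_2_eq_2 One_nat_def)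
  show ?thesis
  \<comment> \<open>3 compares \<open>1 + s^2\<close> with \<open>1 + x^2\<close> for |x - s| \<le>
    1, 2 is the distance from s - v to s + v in units of |v|, and n comes from the
    derivative.\<close>
  proof (rule that[of "6 * n * C"])
    show "0 \<le> 6 * n * C" using C by simp
    fix s v :: real assume v: "\<bar>v\<bar> \<le> 1"
    show "norm (atom_diff n w s v) \<le> 6 * n * C / (1 + s\<^sup>2)"
    proof (cases "v = 0")
      case False
      have "norm (atom n w (s - v) - atom n w (s + v)) \<le> (3 * n * C / (1 + s\<^sup>2)) * norm ((s - v) - (s + v))"
      proof (rule differentiable_bound[of "{s - 1..s + 1}" "atom n w" "\<lambda>x h. h *\<^sub>R (- of_nat n * atom (Suc n) w x)"])
        fix x assume x: "x \<in> {s - 1..s + 1}"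
        show "(atom n w has_derivative (\<lambda>h. h *\<^sub>R (- of_nat n * atom (Suc n) w x))) (at x within {s - 1..s + 1})"
          using atom_deriv[OF w, of n 0 1 x "{s - 1..s + 1}"] by (simp add: has_vector_derivative_def)
        have "(x - s)\<^sup>2 \<le> 1"
          using x by (simp add: abs_square_le_1 abs_le_iff)
        moreover have "0 \<le> (2 * x - s)\<^sup>2" "0 \<le> x\<^sup>2" by simp_all
        moreover have "(x - s)\<^sup>2 = x\<^sup>2 - 2 * (x * s) + s\<^sup>2" "(2 * x - s)\<^sup>2 = 4 * x\<^sup>2 - 4 * (x * s) + s\<^sup>2"
          by (simp_all add: power2_diff power_mult_distrib)
        ultimately have "1 + s\<^sup>2 \<le> 3 * (1 + x\<^sup>2)"
          by argo
        then have "C * (1 + s\<^sup>2) \<le> C * (3 * (1 + x\<^sup>2))"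
          using C by (intro mult_left_mono) auto
        then have "C / (1 + x\<^sup>2) \<le> 3 * C / (1 + s\<^sup>2)"
          using C by (simp add: field_simps add_pos_nonneg)
        then have le: "norm (atom (Suc n) w x) \<le> 3 * C / (1 + s\<^sup>2)"
          using C(2)[of x] by simp
        show "onorm (\<lambda>h. h *\<^sub>R (- of_nat n * atom (Suc n) w x)) \<le> 3 * n * C / (1 + s\<^sup>2)"
        proof (rule onorm_bound)
          fix h :: real
          have "norm (h *\<^sub>R (- of_nat n * atom (Suc n) w x)) = n * norm (atom (Suc n) w x) * norm h"
            by (simp add: norm_mult)
          also have "\<dots> \<le> n * (3 * C / (1 + s\<^sup>2)) * norm h"
            by (intro mult_right_mono mult_left_mono le) auto
          finally show "norm (h *\<^sub>R (- of_nat n * atom (Suc n) w x)) \<le> 3 * n * C / (1 + s\<^sup>2) * norm h"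
            by (simp add: mult_ac)
        qed (use C in auto)
      qed (use v in auto)
      also have "norm ((s - v) - (s + v)) = 2 * \<bar>v\<bar>"
        by (simp add: abs_mult)
      finally have "norm (atom n w (s - v) - atom n w (s + v)) / \<bar>v\<bar> \<le> (3 * n * C / (1 + s\<^sup>2)) * (2 * \<bar>v\<bar>) / \<bar>v\<bar>"
        by (rule divide_right_mono) simp
      then have "norm (atom_diff n w s v) \<le> (3 * n * C / (1 + s\<^sup>2)) * (2 * \<bar>v\<bar>) / \<bar>v\<bar>"
        by (simp add: atom_diff_def norm_divide)
      also have "\<dots> = 6 * n * C / (1 + s\<^sup>2)"
        using False by simp
      finally show ?thesis .
    qed (use C in \<open>simp add: atom_diff_def\<close>)
  qed
qed

section \<open>The reproducing formula\<close>

lemma integral_aff_haar: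
  fixes F :: "real \<times> real \<Rightarrow> complex"
  assumes F: "integrable aff_haar F"
  shows "integrable lborel (\<lambda>a. (1 / a\<^sup>2) *\<^sub>R (\<integral>b. F (b, a) \<partial>lborel))"
    "(\<integral>z. F z \<partial>aff_haar) = (\<integral>a. (1 / a\<^sup>2) *\<^sub>R (\<integral>b. F (b, a) \<partial>lborel) \<partial>lborel)"
proof -
  have [measurable]: "F \<in> borel_measurable borel"
    using borel_measurable_integrable[OF F] by (simp cong: measurable_cong_sets)
  have d: "aff_haar = density lborel (\<lambda>z. ennreal (1 / (snd z)\<^sup>2))"
    unfolding aff_haar_def by (rule arg_cong[where f="density lborel"]) (rule ext, simp add: case_prod_beta)
  have eq: "(\<lambda>(b::real, a). (1 / a\<^sup>2) *\<^sub>R F (b, a)) = (\<lambda>z. (1 / (snd z)\<^sup>2) *\<^sub>R F z)"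
    by (rule ext) (simp add: case_prod_beta)
  have m[measurable]: "(\<lambda>z::real\<times>real. 1 / (snd z)\<^sup>2) \<in> borel_measurable borel"
    unfolding borel_prod[symmetric] by measurable
  have i: "integrable (lborel \<Otimes>\<^sub>M lborel) (\<lambda>(b::real, a). (1 / a\<^sup>2) *\<^sub>R F (b, a))"
    using F unfolding d lborel_prod eq by (subst (asm) integrable_density) auto
  have "(\<integral>z. F z \<partial>aff_haar) = (\<integral>z. (case z of (b, a) \<Rightarrow> (1 / a\<^sup>2) *\<^sub>R F (b, a)) \<partial>(lborel \<Otimes>\<^sub>M lborel))"
    unfolding d lborel_prod eq by (subst integral_density) auto
  also have "\<dots> = (\<integral>a. (\<integral>b. (1 / a\<^sup>2) *\<^sub>R F (b, a) \<partial>lborel) \<partial>lborel)"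
    using lborel_pair.integral_snd[OF i] by simp
  finally show "(\<integral>z. F z \<partial>aff_haar) = (\<integral>a. (1 / a\<^sup>2) *\<^sub>R (\<integral>b. F (b, a) \<partial>lborel) \<partial>lborel)"
    by simp
  show "integrable lborel (\<lambda>a. (1 / a\<^sup>2) *\<^sub>R (\<integral>b. F (b, a) \<partial>lborel))"
    using lborel_pair.integrable_snd[OF i] by simp
qed

lemma l2_affine_inverse:
  assumes "a \<noteq> 0"
  shows "l2 (\<lambda>v. f (r + v / a)) = sqrt \<bar>a\<bar> * l2 f"
proof -
  have "(l2 (\<lambda>v. f (r + (1 / a) * v)))\<^sup>2 = (sqrt \<bar>a\<bar> * l2 f)\<^sup>2"
    using assms by (subst l2_affine) (auto simp: power_mult_distrib)
  then show ?thesis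
    by (simp add: power2_eq_iff_nonneg)
qed

lemma nn_integral_translate:
  fixes f :: "real \<Rightarrow> ennreal"
  assumes [measurable]: "f \<in> borel_measurable borel"
  shows "(\<integral>\<^sup>+v. f (s - v) \<partial>lborel) = (\<integral>\<^sup>+v. f v \<partial>lborel)" "(\<integral>\<^sup>+v. f (s + v) \<partial>lborel) = (\<integral>\<^sup>+v. f v \<partial>lborel)"
    "(\<integral>\<^sup>+v. f (v - s) \<partial>lborel) = (\<integral>\<^sup>+v. f v \<partial>lborel)" "(\<integral>\<^sup>+v. f (v + s) \<partial>lborel) = (\<integral>\<^sup>+v. f v \<partial>lborel)"
  using nn_integral_real_affine[of f "-1" s] nn_integral_real_affine[of f 1 s] nn_integral_real_affine[of f 1 "-s"]
  by (simp_all add: add.commute)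

lemma mult_le_sum_squares:
  fixes x y :: real
  assumes "0 \<le> x" "0 \<le> y"
  shows "x * y \<le> x\<^sup>2 + y\<^sup>2"
  using sum_squares_bound[of x y] mult_nonneg_nonneg[OF assms] by linarith

text \<open>Joint integrability allows the Hilbert integral to be taken under the pairing with
  \<eta>, which is only square integrable. Near v = 0 the cancellation in the difference is used;
  further out the two atoms are estimated separately.\<close>

lemma atom_diff_double_integrable:
  assumes w: "Im w \<noteq> 0" and n: "n \<ge> 2" and \<eta>: "\<eta> \<in> L2"
  shows "integrable (lborel \<Otimes>\<^sub>M lborel) (\<lambda>(s, v). \<eta> s * atom_diff n w s v)"
proof (rule pair_integrableI[OF sigma_finite_lborel sigma_finite_lborel])
  note [measurable] = L2_measurable[OF \<eta>]
  show "(\<lambda>(s, v). \<eta> s * atom_diff n w s v) \<in> borel_measurable (lborel \<Otimes>\<^sub>M lborel)"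
    unfolding atom_diff_def by measurable
  obtain C where C: "C \<ge> 0" "\<And>s v. \<bar>v\<bar> \<le> 1 \<Longrightarrow> norm (atom_diff n w s v) \<le> C / (1 + s\<^sup>2)"
    using atom_diff_bound[OF w, of n] n by (metis One_nat_def Suc_1 Suc_leD)
  \<comment> \<open>The tail \<open>1 / v^2\<close> arises from bounding
    \<open>|\<eta> s| / |v|\<close> by \<open>|\<eta> s|^2 + 1 / v^2\<close>. Each summand is then
    integrated against an integrable atom, first in the variable on which the summand does not
    depend.\<close>
  define P where "P = (\<lambda>v::real. if \<bar>v\<bar> \<le> 1 then 0 else 1 / v\<^sup>2)"
  have [measurable]: "P \<in> borel_measurable borel" unfolding P_def by measurable
  define A where "A = (\<lambda>v. ennreal (norm (atom n w v)))"
  have [measurable]: "A \<in> borel_measurable borel" unfolding A_def by measurable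
  have A: "(\<integral>\<^sup>+v. A v \<partial>lborel) < \<infinity>"
    using atom_integrable[OF w n] by (simp add: A_def integrable_iff_bounded)
  define E where "E = (\<lambda>s. ennreal ((norm (\<eta> s))\<^sup>2))"
  have [measurable]: "E \<in> borel_measurable borel" unfolding E_def by measurable
  have E: "(\<integral>\<^sup>+v. E v \<partial>lborel) < \<infinity>"
    unfolding E_def L2_nn_integral[OF \<eta>] by simp
  have P: "(\<integral>\<^sup>+v. ennreal (P v) \<partial>lborel) < \<infinity>"
  proof -
    have "(\<integral>\<^sup>+v. ennreal (P v) \<partial>lborel) \<le> (\<integral>\<^sup>+v. ennreal (if \<bar>v\<bar> \<le> 1 then \<bar>v\<bar> powr 0 else \<bar>v\<bar> powr (-2)) \<partial>lborel)"
      by (intro nn_integral_mono ennreal_leI) (auto simp: P_def powr_minus_divide powr_numeral)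
    also have "\<dots> < \<infinity>" by (rule nn_integral_powr_finite) auto
    finally show ?thesis .
  qed
  define Q where "Q = (\<lambda>s. ennreal (C * ((norm (\<eta> s))\<^sup>2 + 1 / (1 + s\<^sup>2))))"
  have [measurable]: "Q \<in> borel_measurable borel" unfolding Q_def by measurable
  have Q: "(\<integral>\<^sup>+s. Q s \<partial>lborel) < \<infinity>"
  proof -
    have "integrable lborel (\<lambda>s. C * ((norm (\<eta> s))\<^sup>2 + 1 / (1 + s\<^sup>2)))"
      using \<eta> integrable_1_div_1_plus_square by (intro integrable_mult_right Bochner_Integration.integrable_add) (auto simp: L2_iff)
    then show ?thesis
      using C(1) unfolding Q_def by (subst nn_integral_eq_integral) (auto simp: add_nonneg_nonneg)
  qed
  have pt: "ennreal (norm (\<eta> s * atom_diff n w s v)) \<le> indicator {-1..1} v * Q s +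
      (A (s - v) * (E s + ennreal (P v)) + A (s + v) * (E s + ennreal (P v)))" for s v
  proof (cases "\<bar>v\<bar> \<le> 1")
    case True
    have "norm (\<eta> s * atom_diff n w s v) \<le> norm (\<eta> s) * (C / (1 + s\<^sup>2))"
      unfolding norm_mult by (intro mult_left_mono C(2) True) auto
    also have "\<dots> = C * (norm (\<eta> s) * (1 / (1 + s\<^sup>2)))" by simp
    also have "\<dots> \<le> C * ((norm (\<eta> s))\<^sup>2 + 1 / (1 + s\<^sup>2))"
    proof (intro mult_left_mono C)
      define y where "y = 1 / (1 + s\<^sup>2)"
      have y: "0 \<le> y" "y \<le> 1" by (auto simp: y_def divide_simps add_pos_nonneg)
      have "norm (\<eta> s) * y \<le> (norm (\<eta> s))\<^sup>2 + y\<^sup>2"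
        using mult_le_sum_squares[of "norm (\<eta> s)" y] y by simp
      also have "y\<^sup>2 \<le> y" using y by (simp add: power2_eq_square mult_left_le)
      finally show "norm (\<eta> s) * (1 / (1 + s\<^sup>2)) \<le> (norm (\<eta> s))\<^sup>2 + 1 / (1 + s\<^sup>2)"
        by (simp add: y_def)
    qed
    finally have "ennreal (norm (\<eta> s * atom_diff n w s v)) \<le> Q s"
      unfolding Q_def by (rule ennreal_leI)
    moreover have "v \<in> {-1..1}" using True by auto
    ultimately show ?thesis by (simp add: add_increasing2)
  next
    case False
    define y where "y = 1 / \<bar>v\<bar>"
    have y: "y \<ge> 0" "y\<^sup>2 = P v" using False by (auto simp: y_def P_def power_divide)
    have "norm (\<eta> s) * y \<le> (norm (\<eta> s))\<^sup>2 + P v"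
      using mult_le_sum_squares[of "norm (\<eta> s)" y] y by simp
    then have "ennreal (norm (\<eta> s) * y) \<le> ennreal ((norm (\<eta> s))\<^sup>2 + P v)"
      by (rule ennreal_leI)
    also have "\<dots> = E s + ennreal (P v)"
      unfolding E_def by (rule ennreal_plus) (auto simp: P_def)
    finally have le: "ennreal (norm (\<eta> s) * y) \<le> E s + ennreal (P v)" .
    have "norm (\<eta> s * atom_diff n w s v) = norm (atom n w (s - v) - atom n w (s + v)) * (norm (\<eta> s) * y)"
      by (simp add: atom_diff_def norm_mult norm_divide y_def mult_ac)
    also have "\<dots> \<le> (norm (atom n w (s - v)) + norm (atom n w (s + v))) * (norm (\<eta> s) * y)"
      using y by (intro mult_right_mono norm_triangle_ineq4) auto
    finally have "ennreal (norm (\<eta> s * atom_diff n w s v)) \<le> (A (s - v) + A (s + v)) * ennreal (norm (\<eta> s) * y)"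
      using y unfolding A_def by (subst ennreal_plus[symmetric] ennreal_mult[symmetric], simp, simp)+ (auto intro: ennreal_leI)
    also have "\<dots> \<le> (A (s - v) + A (s + v)) * (E s + ennreal (P v))"
      by (intro mult_left_mono le) simp
    also have "\<dots> \<le> indicator {-1..1} v * Q s + (A (s - v) + A (s + v)) * (E s + ennreal (P v))"
      by (simp add: add_increasing)
    finally show ?thesis by (simp add: distrib_right)
  qed
  have IA: "(\<integral>\<^sup>+s. \<integral>\<^sup>+v. A (s - v) * (E s + ennreal (P v)) \<partial>lborel \<partial>lborel) < \<infinity>"
    "(\<integral>\<^sup>+s. \<integral>\<^sup>+v. A (s + v) * (E s + ennreal (P v)) \<partial>lborel \<partial>lborel) < \<infinity>"
  proof -
    have "(\<integral>\<^sup>+s. \<integral>\<^sup>+v. A (s - v) * (E s + ennreal (P v)) \<partial>lborel \<partial>lborel) =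
        (\<integral>\<^sup>+s. (\<integral>\<^sup>+v. A (s - v) * E s \<partial>lborel) \<partial>lborel) + (\<integral>\<^sup>+s. (\<integral>\<^sup>+v. A (s - v) * ennreal (P v) \<partial>lborel) \<partial>lborel)"
      unfolding distrib_left by (subst nn_integral_add[symmetric]) (auto simp: nn_integral_add)
    also have "(\<integral>\<^sup>+s. (\<integral>\<^sup>+v. A (s - v) * ennreal (P v) \<partial>lborel) \<partial>lborel) = (\<integral>\<^sup>+v. (\<integral>\<^sup>+s. A (s - v) * ennreal (P v) \<partial>lborel) \<partial>lborel)"
      by (rule lborel_pair.Fubini'[symmetric]) measurable
    finally show "(\<integral>\<^sup>+s. \<integral>\<^sup>+v. A (s - v) * (E s + ennreal (P v)) \<partial>lborel \<partial>lborel) < \<infinity>"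
      using A E P by (simp add: nn_integral_multc nn_integral_cmult nn_integral_translate ennreal_mult_less_top)
    have "(\<integral>\<^sup>+s. \<integral>\<^sup>+v. A (s + v) * (E s + ennreal (P v)) \<partial>lborel \<partial>lborel) =
        (\<integral>\<^sup>+s. (\<integral>\<^sup>+v. A (s + v) * E s \<partial>lborel) \<partial>lborel) + (\<integral>\<^sup>+s. (\<integral>\<^sup>+v. A (s + v) * ennreal (P v) \<partial>lborel) \<partial>lborel)"
      unfolding distrib_left by (subst nn_integral_add[symmetric]) (auto simp: nn_integral_add)
    also have "(\<integral>\<^sup>+s. (\<integral>\<^sup>+v. A (s + v) * ennreal (P v) \<partial>lborel) \<partial>lborel) = (\<integral>\<^sup>+v. (\<integral>\<^sup>+s. A (s + v) * ennreal (P v) \<partial>lborel) \<partial>lborel)"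
      by (rule lborel_pair.Fubini'[symmetric]) measurable
    finally show "(\<integral>\<^sup>+s. \<integral>\<^sup>+v. A (s + v) * (E s + ennreal (P v)) \<partial>lborel \<partial>lborel) < \<infinity>"
      using A E P by (simp add: nn_integral_multc nn_integral_cmult nn_integral_translate ennreal_mult_less_top)
  qed
  have "(\<integral>\<^sup>+s. \<integral>\<^sup>+v. ennreal (norm (\<eta> s * atom_diff n w s v)) \<partial>lborel \<partial>lborel) \<le>
      (\<integral>\<^sup>+s. \<integral>\<^sup>+v. indicator {-1..1} v * Q s +
      (A (s - v) * (E s + ennreal (P v)) + A (s + v) * (E s + ennreal (P v))) \<partial>lborel \<partial>lborel)"
    by (intro nn_integral_mono pt)
  also have "\<dots> = (\<integral>\<^sup>+s. (\<integral>\<^sup>+v. indicator {-1..1::real} v * Q s \<partial>lborel) \<partial>lborel) +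
      ((\<integral>\<^sup>+s. \<integral>\<^sup>+v. A (s - v) * (E s + ennreal (P v)) \<partial>lborel \<partial>lborel) + (\<integral>\<^sup>+s. \<integral>\<^sup>+v. A (s + v) * (E s + ennreal (P v)) \<partial>lborel \<partial>lborel))"
    by (simp add: nn_integral_add)
  also have "\<dots> < \<infinity>"
    using Q IA by (simp add: nn_integral_multc nn_integral_cmult ennreal_mult_less_top)
  finally show "(\<integral>\<^sup>+s. \<integral>\<^sup>+v. ennreal (norm (\<eta> s * atom_diff n w s v)) \<partial>lborel \<partial>lborel) < \<infinity>" .
qed

text \<open>The integrand is an exact derivative in a, since differentiating
  \<open>atom n w (s - v / a)\<close> in a produces \<open>v / a^2\<close> times the next atom.
  Positive and negative scales contribute the value \<open>atom n w s\<close> at infinite scale with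
  opposite signs; it cancels and leaves the symmetric difference.\<close>

lemma atom_scale_integral:
  assumes w: "Im w \<noteq> 0" and n: "n \<ge> 1" and \<epsilon>: "\<epsilon> > 0" and v: "v \<noteq> 0"
  shows "(\<integral>a. indicator {a. \<epsilon> \<le> \<bar>a\<bar>} a *\<^sub>R (1 / a\<^sup>2) *\<^sub>R atom (Suc n) w (s - v / a) \<partial>lborel) =
    of_real (1 / (n * \<epsilon>)) * atom_diff n w s (v / \<epsilon>)"
proof -
  obtain C where C: "C \<ge> 1" "\<And>x. norm (atom (Suc n) w x) \<le> C"
    using atom_bounded[OF w, of "Suc n"] by metis
  define G where "G = (\<lambda>v a. indicator {\<epsilon>..} a *\<^sub>R (1 / a\<^sup>2) *\<^sub>R atom (Suc n) w (s - v / a))"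
  have [measurable]: "G v \<in> borel_measurable borel" for v unfolding G_def by measurable
  have i2: "integrable lborel (\<lambda>a. indicator {\<epsilon>..} a * (1 / a\<^sup>2))"
  proof -
    have "(\<integral>\<^sup>+a. ennreal (indicator {\<epsilon>..} a * a powr (-2)) \<partial>lborel) = ennreal (-(\<epsilon> powr (-2 + 1)) / (-2 + 1))"
      by (rule nn_integral_has_integral_lebesgue[OF _ has_integral_powr_to_inf]) (use \<epsilon> in auto)
    also have "(\<lambda>a. indicator {\<epsilon>..} a * a powr (-2)) = (\<lambda>a. indicator {\<epsilon>..} a * (1 / a\<^sup>2))"
      using \<epsilon> by (auto simp: fun_eq_iff indicator_def powr_minus_divide powr_numeral)
    finally show ?thesis
      by (simp add: integrable_iff_bounded)
  qed
  have iG: "integrable lborel (G v)" for v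
    by (rule Bochner_Integration.integrable_bound[OF integrable_mult_right[OF i2, of C]])
       (use C in \<open>auto simp: G_def indicator_def intro!: divide_right_mono\<close>)
  have J: "(\<integral>a. G v a \<partial>lborel) = of_real (1 / (n * v)) * (atom n w (s - v / \<epsilon>) - atom n w s)" if v: "v \<noteq> 0" for v :: real
  proof -
    have "(\<integral>a. G v a \<partial>lborel) = - (of_real (1 / (n * v)) * atom n w s) - - (of_real (1 / (n * v)) * atom n w (s - v / \<epsilon>))"
      unfolding G_def
    proof (rule FTC_Ici)
      show "integrable lborel (\<lambda>a. indicator {\<epsilon>..} a *\<^sub>R (1 / a\<^sup>2) *\<^sub>R atom (Suc n) w (s - v / a))"
        using iG[of v] by (simp add: G_def)
      fix a assume a: "\<epsilon> \<le> a"
      have d1: "((\<lambda>a. s - v / a) has_vector_derivative (v / a\<^sup>2)) (at a)"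
        unfolding has_real_derivative_iff_has_vector_derivative[symmetric]
        using a \<epsilon> by (auto intro!: derivative_eq_intros simp: power2_eq_square)
      have d2: "(atom n w has_vector_derivative - of_nat n * atom (Suc n) w (s - v / a)) (at (s - v / a))"
        using atom_deriv[OF w, of n 0 1 "s - v / a" UNIV] by simp
      from vector_diff_chain_at[OF d1 d2]
      have "((\<lambda>a. atom n w (s - v / a)) has_vector_derivative (v / a\<^sup>2) *\<^sub>R (- of_nat n * atom (Suc n) w (s - v / a))) (at a)"
        by (simp add: o_def)
      then have "((\<lambda>a. - (of_real (1 / (n * v)) * atom n w (s - v / a))) has_vector_derivative
          - (of_real (1 / (n * v)) * ((v / a\<^sup>2) *\<^sub>R (- of_nat n * atom (Suc n) w (s - v / a))))) (at a)"
        by (intro derivative_intros)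
      also have "- (of_real (1 / (n * v)) * ((v / a\<^sup>2) *\<^sub>R (- of_nat n * atom (Suc n) w (s - v / a)))) = (1 / a\<^sup>2) *\<^sub>R atom (Suc n) w (s - v / a)"
        using v n by (simp add: scaleR_conv_of_real)
      finally show "((\<lambda>a. - (of_real (1 / (n * v)) * atom n w (s - v / a))) has_vector_derivative (1 / a\<^sup>2) *\<^sub>R atom (Suc n) w (s - v / a)) (at a)" .
    next
      have "((\<lambda>a. s - v / a) \<longlongrightarrow> s) at_top" by real_asymp
      moreover have "isCont (atom n w) s"
        using atom_deriv[OF w, of n 0 1 s UNIV] by (auto intro: has_vector_derivative_continuous)
      ultimately have "((\<lambda>a. atom n w (s - v / a)) \<longlongrightarrow> atom n w s) at_top"
        by (rule isCont_tendsto_compose[rotated])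
      then show "((\<lambda>a. - (of_real (1 / (n * v)) * atom n w (s - v / a))) \<longlongrightarrow> - (of_real (1 / (n * v)) * atom n w s)) at_top"
        by (intro tendsto_intros)
    qed
    then show ?thesis by (simp add: right_diff_distrib)
  qed
  have "(\<integral>a. indicator {a. \<epsilon> \<le> \<bar>a\<bar>} a *\<^sub>R (1 / a\<^sup>2) *\<^sub>R atom (Suc n) w (s - v / a) \<partial>lborel) = (\<integral>a. G v a + G (- v) (0 + (-1) * a) \<partial>lborel)"
    by (intro Bochner_Integration.integral_cong refl) (use \<epsilon> in \<open>auto simp: G_def indicator_def\<close>)
  also have "\<dots> = (\<integral>a. G v a \<partial>lborel) + (\<integral>a. G (- v) (0 + (-1) * a) \<partial>lborel)"
    by (intro Bochner_Integration.integral_add iG lborel_integrable_real_affine) auto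
  also have "(\<integral>a. G (- v) (0 + (-1) * a) \<partial>lborel) = (\<integral>a. G (- v) a \<partial>lborel)"
    using lborel_integral_real_affine[of "-1" "G (- v)" 0] by simp
  also have "(\<integral>a. G v a \<partial>lborel) + (\<integral>a. G (- v) a \<partial>lborel) = of_real (1 / (n * \<epsilon>)) * atom_diff n w s (v / \<epsilon>)"
    using v \<epsilon> n by (simp add: J atom_diff_def field_simps)
  finally show ?thesis .
qed

section \<open>The reproducing integral with an atom as window\<close>

locale reproducing_setup =
  fixes w :: complex and n :: nat and \<eta> h \<xi> :: "real \<Rightarrow> complex"
  assumes w: "Im w \<noteq> 0" and n: "n \<ge> 2" and \<eta>: "\<eta> \<in> L2" and h: "h \<in> L2"
    and \<xi>: "\<xi> \<in> L2" "integrable lborel \<xi>"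
begin

definition g :: "real \<Rightarrow> complex" where "g = atom (Suc n) w"

definition \<phi> :: "real \<Rightarrow> complex" where "\<phi> = (\<lambda>x. cnj (g x))"

text \<open>At scale a the integral over b collapses to a pairing of two cross-correlations:
  \<open>X\<close>, of \<xi> with h, and \<open>\<Phi>\<close>, of the atom with \<eta>, the latter
  dilated by a.\<close>

definition \<Phi> :: "real \<Rightarrow> complex" where "\<Phi> y = (\<integral>r. g r * \<eta> (r + y) \<partial>lborel)"

definition X :: "real \<Rightarrow> complex" where "X v = (\<integral>x. \<xi> x * cnj (h (x + v)) \<partial>lborel)"

text \<open>For y \<noteq> 0 this is the integral of \<open>\<Phi> (y / a) / a^2\<close> over |a|
  \<ge> 1. A cutoff \<epsilon> in place of 1 gives the dilate
  \<open>\<kappa> (y / \<epsilon>) / \<epsilon>\<close>.\<close>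

definition \<kappa> :: "real \<Rightarrow> complex" where
  "\<kappa> y = of_real (1 / n) * (\<integral>s. \<eta> s * atom_diff n w s y \<partial>lborel)"

definition S :: "real \<Rightarrow> real \<Rightarrow> complex" where "S a b = L2_inner (wav_rep (b, a) \<eta>) h"

definition N\<xi> :: real where "N\<xi> = enn2real (\<integral>\<^sup>+x. ennreal (norm (\<xi> x)) \<partial>lborel)"

definition Ng :: real where "Ng = enn2real (\<integral>\<^sup>+x. ennreal (norm (g x)) \<partial>lborel)"

lemma data_measurable [measurable]:
  "\<eta> \<in> borel_measurable borel" "h \<in> borel_measurable borel" "\<xi> \<in> borel_measurable borel"
  using L2_measurable \<eta> h \<xi>(1) by auto

lemma g_measurable [measurable]: "g \<in> borel_measurable borel" "\<phi> \<in> borel_measurable borel"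
  unfolding g_def \<phi>_def by measurable

lemma g_integrable: "integrable lborel g" and g_L2: "g \<in> L2"
  unfolding g_def using n by (auto intro!: atom_integrable atom_L2 w)

lemma N\<xi>: "(\<integral>\<^sup>+x. ennreal (norm (\<xi> x)) \<partial>lborel) = ennreal N\<xi>"
  using \<xi>(2) by (simp add: N\<xi>_def integrable_iff_bounded)

lemma Ng: "(\<integral>\<^sup>+x. ennreal (norm (g x)) \<partial>lborel) = ennreal Ng"
  using g_integrable by (simp add: Ng_def integrable_iff_bounded)

lemma L1_norms_nonneg: "N\<xi> \<ge> 0" "Ng \<ge> 0"
  by (auto simp: N\<xi>_def Ng_def)

lemma wav_rep_inner_measurable: "(\<lambda>z. L2_inner (wav_rep z \<eta>) h) \<in> borel_measurable borel"
proof -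
  have "(\<lambda>z. cnj (wav_trans \<eta> h z)) \<in> borel_measurable borel"
    using wav_trans_measurable[of h \<eta>] by measurable
  then show ?thesis by (simp add: wav_trans_def L2_inner_cnj)
qed

lemma S_measurable [measurable]: "S a \<in> borel_measurable borel"
  using wav_rep_inner_measurable unfolding S_def[abs_def] borel_prod[symmetric] by measurable

lemma wav_rep_inner_bound: "norm (L2_inner (wav_rep z \<eta>) h) \<le> l2 \<eta> * l2 h"
  using wav_trans_bound[OF h \<eta>, of z] by (simp add: wav_trans_def L2_inner_norm_commute[of h] mult.commute)

lemma \<Phi>X\<kappa>_measurable [measurable]:
  "\<Phi> \<in> borel_measurable borel" "X \<in> borel_measurable borel" "\<kappa> \<in> borel_measurable borel"
  unfolding \<Phi>_def[abs_def] X_def[abs_def] \<kappa>_def[abs_def] atom_diff_def by measurable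

lemma nn_integral_dilated_product_le:
  assumes a: "a \<noteq> 0"
  shows "(\<integral>\<^sup>+v. ennreal (norm (\<eta> (r + v / a)) * norm (h (x + v))) \<partial>lborel) \<le> ennreal (sqrt \<bar>a\<bar> * (l2 \<eta> * l2 h))"
proof -
  have 1: "(\<lambda>v. \<eta> (r + v / a)) \<in> L2" using L2_affine[OF \<eta>, of "1 / a" r] a by simp
  have 2: "(\<lambda>v. h (x + v)) \<in> L2" using L2_affine[OF h, of 1 x] by simp
  have 3: "l2 (\<lambda>v. h (x + v)) = l2 h" using l2_affine_inverse[of 1 h x] by simp
  show ?thesis using L2_nn_Cauchy_Schwarz[OF 1 2] unfolding 3 l2_affine_inverse[OF a] by (simp add: mult.assoc)
qed

lemma nn_integral_averaged_product_le:
  assumes a: "a \<noteq> 0"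
  shows "(\<integral>\<^sup>+v. ennreal (norm (h (x + v))) * (\<integral>\<^sup>+r. ennreal (norm (g r) * norm (\<eta> (r + v / a))) \<partial>lborel) \<partial>lborel)
    \<le> ennreal (Ng * (sqrt \<bar>a\<bar> * (l2 \<eta> * l2 h)))"
proof -
  have "(\<integral>\<^sup>+v. ennreal (norm (h (x + v))) * (\<integral>\<^sup>+r. ennreal (norm (g r) * norm (\<eta> (r + v / a))) \<partial>lborel) \<partial>lborel) =
      (\<integral>\<^sup>+v. (\<integral>\<^sup>+r. ennreal (norm (g r)) * ennreal (norm (\<eta> (r + v / a)) * norm (h (x + v))) \<partial>lborel) \<partial>lborel)"
    by (subst nn_integral_cmult[symmetric]) (auto simp: ennreal_mult mult_ac)
  also have "\<dots> = (\<integral>\<^sup>+r. (\<integral>\<^sup>+v. ennreal (norm (g r)) * ennreal (norm (\<eta> (r + v / a)) * norm (h (x + v))) \<partial>lborel) \<partial>lborel)"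
    by (rule lborel_pair.Fubini') measurable
  also have "\<dots> \<le> (\<integral>\<^sup>+r. ennreal (norm (g r)) * ennreal (sqrt \<bar>a\<bar> * (l2 \<eta> * l2 h)) \<partial>lborel)"
    by (intro nn_integral_mono, subst nn_integral_cmult) (auto intro!: mult_left_mono nn_integral_dilated_product_le a)
  also have "\<dots> = ennreal (Ng * (sqrt \<bar>a\<bar> * (l2 \<eta> * l2 h)))"
    by (subst nn_integral_multc) (auto simp: Ng L1_norms_nonneg ennreal_mult)
  finally show ?thesis .
qed

lemma \<Phi>_le: "ennreal (norm (\<Phi> y)) \<le> (\<integral>\<^sup>+r. ennreal (norm (g r) * norm (\<eta> (r + y))) \<partial>lborel)"
proof -
  have "integrable lborel (\<lambda>r. g r * \<eta> (r + y))"
    using L2_mult_integrable[OF g_L2 L2_affine[OF \<eta>, of 1 y]] by (simp add: add.commute)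
  from integral_norm_bound_ennreal[OF this] show ?thesis by (simp add: \<Phi>_def norm_mult)
qed

text \<open>Cauchy-Schwarz bounds a slice by a multiple of \<open>sqrt |a|\<close>. Against
  \<open>1 / a^2\<close> this bound is integrable at large scales but not at small ones, which is
  why the scale integral is truncated before the order of integration is changed.\<close>

lemma
  assumes a: "a \<noteq> 0"
  shows correlation_pair_integrable: "integrable (lborel \<Otimes>\<^sub>M lborel) (\<lambda>(x, v). \<xi> x * (cnj (h (x + v)) * \<Phi> (v / a)))"
  and correlation_nn_integral_le: "(\<integral>\<^sup>+v. ennreal (norm (X v * \<Phi> (v / a))) \<partial>lborel) \<le> ennreal (N\<xi> * (Ng * (l2 \<eta> * l2 h)) * sqrt \<bar>a\<bar>)"
proof -
  have le: "(\<integral>\<^sup>+x. \<integral>\<^sup>+v. ennreal (norm (\<xi> x * (cnj (h (x + v)) * \<Phi> (v / a)))) \<partial>lborel \<partial>lborel) \<le>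
      ennreal (N\<xi> * (Ng * (l2 \<eta> * l2 h)) * sqrt \<bar>a\<bar>)"
  proof -
    have "(\<integral>\<^sup>+x. \<integral>\<^sup>+v. ennreal (norm (\<xi> x * (cnj (h (x + v)) * \<Phi> (v / a)))) \<partial>lborel \<partial>lborel) \<le>
        (\<integral>\<^sup>+x. \<integral>\<^sup>+v. ennreal (norm (\<xi> x)) * (ennreal (norm (h (x + v))) * (\<integral>\<^sup>+r. ennreal (norm (g r) * norm (\<eta> (r + v / a))) \<partial>lborel)) \<partial>lborel \<partial>lborel)"
    proof (intro nn_integral_mono)
      fix x v
      have "ennreal (norm (\<xi> x * (cnj (h (x + v)) * \<Phi> (v / a)))) = ennreal (norm (\<xi> x)) * (ennreal (norm (h (x + v))) * ennreal (norm (\<Phi> (v / a))))"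
        by (simp add: norm_mult ennreal_mult)
      also have "\<dots> \<le> ennreal (norm (\<xi> x)) * (ennreal (norm (h (x + v))) * (\<integral>\<^sup>+r. ennreal (norm (g r) * norm (\<eta> (r + v / a))) \<partial>lborel))"
        by (intro mult_left_mono \<Phi>_le) auto
      finally show "ennreal (norm (\<xi> x * (cnj (h (x + v)) * \<Phi> (v / a)))) \<le> \<dots>" .
    qed
    also have "\<dots> = (\<integral>\<^sup>+x. ennreal (norm (\<xi> x)) * (\<integral>\<^sup>+v. ennreal (norm (h (x + v))) * (\<integral>\<^sup>+r. ennreal (norm (g r) * norm (\<eta> (r + v / a))) \<partial>lborel) \<partial>lborel) \<partial>lborel)"
      by (intro nn_integral_cong nn_integral_cmult) measurable
    also have "\<dots> \<le> (\<integral>\<^sup>+x. ennreal (norm (\<xi> x)) * ennreal (Ng * (sqrt \<bar>a\<bar> * (l2 \<eta> * l2 h))) \<partial>lborel)"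
      by (intro nn_integral_mono mult_left_mono nn_integral_averaged_product_le a) auto
    also have "\<dots> = ennreal (N\<xi> * (Ng * (l2 \<eta> * l2 h)) * sqrt \<bar>a\<bar>)"
      by (subst nn_integral_multc) (auto simp: N\<xi> L1_norms_nonneg ennreal_mult[symmetric] mult_ac)
    finally show ?thesis .
  qed
  show "integrable (lborel \<Otimes>\<^sub>M lborel) (\<lambda>(x, v). \<xi> x * (cnj (h (x + v)) * \<Phi> (v / a)))"
  proof (rule pair_integrableI[OF sigma_finite_lborel sigma_finite_lborel])
    show "(\<integral>\<^sup>+x. \<integral>\<^sup>+v. ennreal (norm (\<xi> x * (cnj (h (x + v)) * \<Phi> (v / a)))) \<partial>lborel \<partial>lborel) < \<infinity>"
      using le by (rule le_less_trans) simp
  qed measurable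
  have "(\<integral>\<^sup>+v. ennreal (norm (X v * \<Phi> (v / a))) \<partial>lborel) \<le>
      (\<integral>\<^sup>+v. \<integral>\<^sup>+x. ennreal (norm (\<xi> x * (cnj (h (x + v)) * \<Phi> (v / a)))) \<partial>lborel \<partial>lborel)"
  proof (rule nn_integral_mono)
    fix v
    have "integrable lborel (\<lambda>x. \<xi> x * cnj (h (x + v)))"
      using L2_mult_cnj_integrable[OF \<xi>(1) L2_affine[OF h, of 1 v]] by (simp add: add.commute)
    from integral_norm_bound_ennreal[OF this]
    have "ennreal (norm (X v)) * ennreal (norm (\<Phi> (v / a))) \<le> (\<integral>\<^sup>+x. ennreal (norm (\<xi> x * cnj (h (x + v)))) \<partial>lborel) * ennreal (norm (\<Phi> (v / a)))"
      by (intro mult_right_mono) (auto simp: X_def)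
    also have "\<dots> = (\<integral>\<^sup>+x. ennreal (norm (\<xi> x * (cnj (h (x + v)) * \<Phi> (v / a)))) \<partial>lborel)"
      by (subst nn_integral_multc[symmetric]) (auto simp: norm_mult ennreal_mult mult_ac)
    finally show "ennreal (norm (X v * \<Phi> (v / a))) \<le> (\<integral>\<^sup>+x. ennreal (norm (\<xi> x * (cnj (h (x + v)) * \<Phi> (v / a)))) \<partial>lborel)"
      by (simp add: norm_mult ennreal_mult)
  qed
  also have "\<dots> = (\<integral>\<^sup>+x. \<integral>\<^sup>+v. ennreal (norm (\<xi> x * (cnj (h (x + v)) * \<Phi> (v / a)))) \<partial>lborel \<partial>lborel)"
    by (rule lborel_pair.Fubini') measurable
  also note le
  finally show "(\<integral>\<^sup>+v. ennreal (norm (X v * \<Phi> (v / a))) \<partial>lborel) \<le> ennreal (N\<xi> * (Ng * (l2 \<eta> * l2 h)) * sqrt \<bar>a\<bar>)" .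
qed

text \<open>Substituting b = x - a r in the group variable and t = x + v inside the inner product
  turns the slice into correlations. The first exchange of integrals rests on the boundedness of
  \<open>S\<close> and on the integrability of \<xi> and g.\<close>

lemma scale_slice_integral:
  assumes a: "a \<noteq> 0"
  shows "(\<integral>b. wav_trans \<phi> \<xi> (b, a) * S a b \<partial>lborel) = (\<integral>v. X v * \<Phi> (v / a) \<partial>lborel)"
proof -
  define c where "c = complex_of_real (\<bar>a\<bar> powr (- 1 / 2))"
  \<comment> \<open>The two normalisations \<open>|a| powr (- 1/2)\<close> cancel the Jacobian of b
    = x - a r.\<close>
  have cc: "c * (of_real \<bar>a\<bar> * c) = 1"
    using a by (simp add: c_def powr_add[symmetric] powr_minus_divide flip: of_real_mult)
  have "(\<integral>b. wav_trans \<phi> \<xi> (b, a) * S a b \<partial>lborel) = (\<integral>b. (\<integral>x. \<xi> x * (c * (g ((x - b) / a) * S a b)) \<partial>lborel) \<partial>lborel)"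
  proof (intro Bochner_Integration.integral_cong refl)
    fix b
    have "wav_trans \<phi> \<xi> (b, a) * S a b = (\<integral>x. \<xi> x * g ((x - b) / a) \<partial>lborel) * (c * S a b)"
      by (simp add: wav_trans_apply \<phi>_def c_def)
    also have "\<dots> = (\<integral>x. \<xi> x * (c * (g ((x - b) / a) * S a b)) \<partial>lborel)"
      by (subst integral_mult_left_zero[symmetric]) (simp add: mult_ac)
    finally show "wav_trans \<phi> \<xi> (b, a) * S a b = \<dots>" .
  qed
  also have "\<dots> = (\<integral>x. (\<integral>b. \<xi> x * (c * (g ((x - b) / a) * S a b)) \<partial>lborel) \<partial>lborel)"
  proof (rule integrable_iterated_integral(3)[symmetric, OF sigma_finite_lborel sigma_finite_lborel pair_integrableI[OF sigma_finite_lborel sigma_finite_lborel]])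
    have "(\<integral>\<^sup>+x. \<integral>\<^sup>+b. ennreal (norm (\<xi> x * (c * (g ((x - b) / a) * S a b)))) \<partial>lborel \<partial>lborel) \<le>
        (\<integral>\<^sup>+x. \<integral>\<^sup>+b. ennreal (norm (\<xi> x)) * (ennreal (norm c * (l2 \<eta> * l2 h)) * ennreal (norm (g ((x - b) / a)))) \<partial>lborel \<partial>lborel)"
    proof (intro nn_integral_mono)
      fix x b
      have "norm (\<xi> x * (c * (g ((x - b) / a) * S a b))) \<le> norm (\<xi> x) * (norm c * (norm (g ((x - b) / a)) * (l2 \<eta> * l2 h)))"
        unfolding norm_mult S_def by (intro mult_left_mono wav_rep_inner_bound) auto
      then show "ennreal (norm (\<xi> x * (c * (g ((x - b) / a) * S a b)))) \<le>
          ennreal (norm (\<xi> x)) * (ennreal (norm c * (l2 \<eta> * l2 h)) * ennreal (norm (g ((x - b) / a))))"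
        by (simp add: ennreal_mult[symmetric] mult_ac ennreal_leI)
    qed
    also have "\<dots> = (\<integral>\<^sup>+x. ennreal (norm (\<xi> x)) * (ennreal (norm c * (l2 \<eta> * l2 h)) * (ennreal \<bar>a\<bar> * ennreal Ng)) \<partial>lborel)"
      unfolding Ng[symmetric] g_def
      by (intro nn_integral_cong, subst nn_integral_cmult, measurable, subst nn_integral_cmult, measurable)
         (simp only: nn_integral_atom_affine[OF a])
    also have "\<dots> < \<infinity>"
      by (subst nn_integral_multc) (auto simp: N\<xi> ennreal_mult_less_top)
    finally show "(\<integral>\<^sup>+x. \<integral>\<^sup>+b. ennreal (norm (\<xi> x * (c * (g ((x - b) / a) * S a b)))) \<partial>lborel \<partial>lborel) < \<infinity>" .
    have "(\<lambda>p. S a (snd p)) \<in> borel_measurable (borel \<Otimes>\<^sub>M borel)" by measurable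
    then show "(\<lambda>(x, b). \<xi> x * (c * (g ((x - b) / a) * S a b))) \<in> borel_measurable (lborel \<Otimes>\<^sub>M lborel)"
      by measurable
  qed
  also have "\<dots> = (\<integral>x. (\<integral>v. \<xi> x * (cnj (h (x + v)) * \<Phi> (v / a)) \<partial>lborel) \<partial>lborel)"
  proof (rule Bochner_Integration.integral_cong[OF refl])
    fix x
    have Sx: "of_real \<bar>a\<bar> * (c * S a (x - a * r)) = (\<integral>v. of_real \<bar>a\<bar> * (c * c) * (\<eta> (r + v / a) * cnj (h (x + v))) \<partial>lborel)" for r
    proof -
      have "S a (x - a * r) = (\<integral>t. c * \<eta> ((t - (x - a * r)) / a) * cnj (h t) \<partial>lborel)"
        by (simp add: S_def L2_inner_def wav_rep_apply c_def)
      also have "\<dots> = (\<integral>v. c * \<eta> ((x + 1 * v - (x - a * r)) / a) * cnj (h (x + 1 * v)) \<partial>lborel)"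
        by (subst lborel_integral_real_affine[of 1 _ x]) auto
      also have "\<dots> = (\<integral>v. c * (\<eta> (r + v / a) * cnj (h (x + v))) \<partial>lborel)"
        using a by (intro Bochner_Integration.integral_cong) (auto simp: add_divide_distrib mult.assoc add.commute)
      finally show ?thesis by (simp add: mult_ac)
    qed
    have "(\<integral>b. \<xi> x * (c * (g ((x - b) / a) * S a b)) \<partial>lborel) =
        \<bar>- a\<bar> *\<^sub>R (\<integral>r. \<xi> x * (c * (g ((x - (x + (- a) * r)) / a) * S a (x + (- a) * r))) \<partial>lborel)"
      by (rule lborel_integral_real_affine) (use a in simp)
    also have "\<dots> = (\<integral>r. \<bar>- a\<bar> *\<^sub>R (\<xi> x * (c * (g ((x - (x + (- a) * r)) / a) * S a (x + (- a) * r)))) \<partial>lborel)"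
      by (rule integral_scaleR_right[symmetric])
    also have "\<dots> = (\<integral>r. \<xi> x * (g r * (of_real \<bar>a\<bar> * (c * S a (x - a * r)))) \<partial>lborel)"
      using a by (intro Bochner_Integration.integral_cong) (auto simp: scaleR_conv_of_real)
    also have "\<dots> = (\<integral>r. \<xi> x * (\<integral>v. g r * (\<eta> (r + v / a) * cnj (h (x + v))) \<partial>lborel) \<partial>lborel)"
      unfolding Sx using cc by (simp add: mult_ac)
    also have "\<dots> = \<xi> x * (\<integral>r. (\<integral>v. g r * (\<eta> (r + v / a) * cnj (h (x + v))) \<partial>lborel) \<partial>lborel)"
      by (rule integral_mult_right_zero)
    also have "(\<integral>r. (\<integral>v. g r * (\<eta> (r + v / a) * cnj (h (x + v))) \<partial>lborel) \<partial>lborel) =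
        (\<integral>v. (\<integral>r. g r * (\<eta> (r + v / a) * cnj (h (x + v))) \<partial>lborel) \<partial>lborel)"
    proof (rule integrable_iterated_integral(3)[OF sigma_finite_lborel sigma_finite_lborel pair_integrableI[OF sigma_finite_lborel sigma_finite_lborel]])
      have "(\<integral>\<^sup>+r. \<integral>\<^sup>+v. ennreal (norm (g r * (\<eta> (r + v / a) * cnj (h (x + v))))) \<partial>lborel \<partial>lborel) =
          (\<integral>\<^sup>+r. ennreal (norm (g r)) * (\<integral>\<^sup>+v. ennreal (norm (\<eta> (r + v / a)) * norm (h (x + v))) \<partial>lborel) \<partial>lborel)"
        by (intro nn_integral_cong, subst nn_integral_cmult[symmetric]) (auto simp: norm_mult ennreal_mult)
      also have "\<dots> \<le> (\<integral>\<^sup>+r. ennreal (norm (g r)) * ennreal (sqrt \<bar>a\<bar> * (l2 \<eta> * l2 h)) \<partial>lborel)"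
        by (intro nn_integral_mono mult_left_mono nn_integral_dilated_product_le a) auto
      also have "\<dots> < \<infinity>"
        by (subst nn_integral_multc) (auto simp: Ng ennreal_mult_less_top)
      finally show "(\<integral>\<^sup>+r. \<integral>\<^sup>+v. ennreal (norm (g r * (\<eta> (r + v / a) * cnj (h (x + v))))) \<partial>lborel \<partial>lborel) < \<infinity>" .
    qed measurable
    also have "\<dots> = (\<integral>v. cnj (h (x + v)) * \<Phi> (v / a) \<partial>lborel)"
      unfolding \<Phi>_def by (subst integral_mult_right_zero[symmetric]) (simp add: mult_ac)
    also have "\<xi> x * \<dots> = (\<integral>v. \<xi> x * (cnj (h (x + v)) * \<Phi> (v / a)) \<partial>lborel)"
      by (rule integral_mult_right_zero[symmetric])
    finally show "(\<integral>b. \<xi> x * (c * (g ((x - b) / a) * S a b)) \<partial>lborel) = \<dots>" .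
  qed
  also have "\<dots> = (\<integral>v. (\<integral>x. \<xi> x * (cnj (h (x + v)) * \<Phi> (v / a)) \<partial>lborel) \<partial>lborel)"
    by (rule integrable_iterated_integral(3)[OF sigma_finite_lborel sigma_finite_lborel correlation_pair_integrable[OF a]])
  also have "\<dots> = (\<integral>v. X v * \<Phi> (v / a) \<partial>lborel)"
    unfolding X_def by (subst integral_mult_left_zero[symmetric]) (simp add: mult_ac)
  finally show ?thesis .
qed

text \<open>
  The slice at scale \<open>a\<close> of the reproducing integral. Its integral over \<open>\<bar>a\<bar> \<ge> \<epsilon>\<close> is the average of \<open>X\<close>
  against the approximate identity generated by \<open>\<kappa>\<close>, which tends to \<open>X 0 = \<langle>\<xi>, h\<rangle>\<close> times the integral of \<open>\<kappa>\<close>.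
\<close>

definition I :: "real \<Rightarrow> complex" where
  "I a = (1 / a\<^sup>2) *\<^sub>R (\<integral>v. X v * \<Phi> (v / a) \<partial>lborel)"

lemma I_measurable [measurable]: "I \<in> borel_measurable borel"
  unfolding I_def[abs_def] by measurable

lemma truncated_integral_eq:
  assumes \<epsilon>: "\<epsilon> > 0"
  shows "(\<integral>a. indicator {a. \<epsilon> \<le> \<bar>a\<bar>} a *\<^sub>R I a \<partial>lborel) = (\<integral>y. X (\<epsilon> * y) * \<kappa> y \<partial>lborel)"
proof -
  define J where "J = (\<lambda>a::real. indicator {a. \<epsilon> \<le> \<bar>a\<bar>} a * (1 / a\<^sup>2))"
  have Jm[measurable]: "J \<in> borel_measurable borel" unfolding J_def by measurable
  have J0: "J a \<ge> 0" for a by (simp add: J_def)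
  \<comment> \<open>One estimate covers both exchanges below: J alone for the integral over s at
    fixed v, and J times \<open>sqrt |a|\<close> for the integral over v.\<close>
  have Jsq: "(\<integral>\<^sup>+a. ennreal (J a * (1 + sqrt \<bar>a\<bar>)) \<partial>lborel) < \<infinity>"
  proof -
    \<comment> \<open>For |a| \<le> 1 the cutoff bounds J by \<open>1 / \<epsilon>^2\<close>, and 1
      + sqrt |a| is at most 2; for |a| > 1 the latter is at most 2 sqrt |a|.\<close>
    define K where "K = (1 / \<epsilon>\<^sup>2) * (1 + 1) + 2"
    have K: "K \<ge> 0" "K \<ge> 2" by (auto simp: K_def)
    have "(\<integral>\<^sup>+a. ennreal (J a * (1 + sqrt \<bar>a\<bar>)) \<partial>lborel) \<le>
        (\<integral>\<^sup>+a. ennreal K * ennreal (if \<bar>a\<bar> \<le> 1 then \<bar>a\<bar> powr 0 else \<bar>a\<bar> powr (- 3 / 2)) \<partial>lborel)"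
    proof (rule nn_integral_mono)
      fix a :: real
      have "J a * (1 + sqrt \<bar>a\<bar>) \<le> K * (if \<bar>a\<bar> \<le> 1 then \<bar>a\<bar> powr 0 else \<bar>a\<bar> powr (- 3 / 2))"
      proof (cases "\<epsilon> \<le> \<bar>a\<bar>")
        case True
        then have a0: "a \<noteq> 0" using \<epsilon> by auto
        show ?thesis
        proof (cases "\<bar>a\<bar> \<le> 1")
          case le: True
          have "\<epsilon>\<^sup>2 \<le> a\<^sup>2" using True \<epsilon> by (metis abs_of_pos abs_le_square_iff)
          then have "J a \<le> 1 / \<epsilon>\<^sup>2" using True \<epsilon> a0 by (simp add: J_def frac_le)
          then have "J a * (1 + sqrt \<bar>a\<bar>) \<le> (1 / \<epsilon>\<^sup>2) * (1 + 1)"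
            using le by (intro mult_mono add_mono) auto
          then show ?thesis using le a0 by (simp add: K_def)
        next
          case gt: False
          have "J a * (1 + sqrt \<bar>a\<bar>) \<le> \<bar>a\<bar> powr (-2) * (2 * \<bar>a\<bar> powr (1 / 2))"
          proof (intro mult_mono)
            show "J a \<le> \<bar>a\<bar> powr (-2)" using True a0 by (simp add: J_def powr_minus_divide powr_numeral)
            show "1 + sqrt \<bar>a\<bar> \<le> 2 * \<bar>a\<bar> powr (1 / 2)" using gt by (simp add: powr_half_sqrt)
          qed (use gt in auto)
          also have "\<dots> = 2 * \<bar>a\<bar> powr (- 3 / 2)"
            by (simp add: powr_add[symmetric])
          also have "\<dots> \<le> K * \<bar>a\<bar> powr (- 3 / 2)"
            using K by (intro mult_right_mono) auto
          finally show ?thesis using gt by simp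
        qed
      qed (use K in \<open>auto simp: J_def\<close>)
      then show "ennreal (J a * (1 + sqrt \<bar>a\<bar>)) \<le> ennreal K * ennreal (if \<bar>a\<bar> \<le> 1 then \<bar>a\<bar> powr 0 else \<bar>a\<bar> powr (- 3 / 2))"
        using K by (subst ennreal_mult[symmetric]) (auto intro: ennreal_leI)
    qed
    also have "\<dots> = ennreal K * (\<integral>\<^sup>+a. ennreal (if \<bar>a\<bar> \<le> 1 then \<bar>a\<bar> powr 0 else \<bar>a\<bar> powr (- 3 / 2)) \<partial>lborel)"
      by (rule nn_integral_cmult) measurable
    also have "\<dots> < \<infinity>"
      using nn_integral_powr_finite[of 0 "- 3 / 2"] by (simp add: ennreal_mult_less_top)
    finally show ?thesis .
  qed
  have Jnn: "(\<integral>\<^sup>+a. ennreal (J a) \<partial>lborel) < \<infinity>" "(\<integral>\<^sup>+a. ennreal (J a * sqrt \<bar>a\<bar>) \<partial>lborel) < \<infinity>"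
    by (rule le_less_trans[OF nn_integral_mono Jsq], rule ennreal_leI, simp add: distrib_left J0)+
  have "(\<integral>a. indicator {a. \<epsilon> \<le> \<bar>a\<bar>} a *\<^sub>R I a \<partial>lborel) = (\<integral>a. (\<integral>v. J a *\<^sub>R (X v * \<Phi> (v / a)) \<partial>lborel) \<partial>lborel)"
    by (simp add: I_def J_def)
  also have "\<dots> = (\<integral>v. (\<integral>a. J a *\<^sub>R (X v * \<Phi> (v / a)) \<partial>lborel) \<partial>lborel)"
  proof (rule integrable_iterated_integral(3)[OF sigma_finite_lborel sigma_finite_lborel pair_integrableI[OF sigma_finite_lborel sigma_finite_lborel]])
    have "(\<integral>\<^sup>+a. \<integral>\<^sup>+v. ennreal (norm (J a *\<^sub>R (X v * \<Phi> (v / a)))) \<partial>lborel \<partial>lborel) \<le>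
        (\<integral>\<^sup>+a. ennreal (N\<xi> * (Ng * (l2 \<eta> * l2 h))) * ennreal (J a * sqrt \<bar>a\<bar>) \<partial>lborel)"
    proof (rule nn_integral_mono)
      fix a
      show "(\<integral>\<^sup>+v. ennreal (norm (J a *\<^sub>R (X v * \<Phi> (v / a)))) \<partial>lborel) \<le> ennreal (N\<xi> * (Ng * (l2 \<eta> * l2 h))) * ennreal (J a * sqrt \<bar>a\<bar>)"
      proof (cases "a = 0")
        case False
        have "(\<integral>\<^sup>+v. ennreal (norm (J a *\<^sub>R (X v * \<Phi> (v / a)))) \<partial>lborel) = ennreal (J a) * (\<integral>\<^sup>+v. ennreal (norm (X v * \<Phi> (v / a))) \<partial>lborel)"
          using J0[of a] by (subst nn_integral_cmult[symmetric]) (auto simp: ennreal_mult)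
        also have "\<dots> \<le> ennreal (J a) * ennreal (N\<xi> * (Ng * (l2 \<eta> * l2 h)) * sqrt \<bar>a\<bar>)"
          by (intro mult_left_mono correlation_nn_integral_le False) simp
        finally show ?thesis
          using J0[of a] L1_norms_nonneg by (simp add: ennreal_mult[symmetric] mult_ac)
      qed (simp add: J_def)
    qed
    also have "\<dots> = ennreal (N\<xi> * (Ng * (l2 \<eta> * l2 h))) * (\<integral>\<^sup>+a. ennreal (J a * sqrt \<bar>a\<bar>) \<partial>lborel)"
      by (rule nn_integral_cmult) measurable
    also have "\<dots> < \<infinity>"
      using Jnn by (simp add: ennreal_mult_less_top)
    finally show "(\<integral>\<^sup>+a. \<integral>\<^sup>+v. ennreal (norm (J a *\<^sub>R (X v * \<Phi> (v / a)))) \<partial>lborel \<partial>lborel) < \<infinity>" .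
  qed measurable
  also have "\<dots> = (\<integral>v. X v * (of_real (1 / \<epsilon>) * \<kappa> (v / \<epsilon>)) \<partial>lborel)"
  proof (rule integral_cong_AE)
    show "AE v in lborel. (\<integral>a. J a *\<^sub>R (X v * \<Phi> (v / a)) \<partial>lborel) = X v * (of_real (1 / \<epsilon>) * \<kappa> (v / \<epsilon>))"
      using AE_neq_0
    proof eventually_elim
      case (elim v)
      \<comment> \<open>The shift moves from \<eta> to the atom, so that the integral over scales
        acts on an explicit function.\<close>
      have \<Phi>2: "\<Phi> y = (\<integral>s. \<eta> s * g (s - y) \<partial>lborel)" for y
        unfolding \<Phi>_def by (subst lborel_integral_real_affine[of 1 "\<lambda>r. g r * \<eta> (r + y)" "- y"]) (auto simp: mult.commute)
      have "(\<integral>a. J a *\<^sub>R \<Phi> (v / a) \<partial>lborel) = (\<integral>a. (\<integral>s. \<eta> s * (J a *\<^sub>R g (s - v / a)) \<partial>lborel) \<partial>lborel)"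
        unfolding \<Phi>2 by (simp flip: integral_scaleR_right)
      also have "\<dots> = (\<integral>s. (\<integral>a. \<eta> s * (J a *\<^sub>R g (s - v / a)) \<partial>lborel) \<partial>lborel)"
      proof (rule integrable_iterated_integral(3)[OF sigma_finite_lborel sigma_finite_lborel pair_integrableI[OF sigma_finite_lborel sigma_finite_lborel]])
        have "(\<integral>\<^sup>+a. \<integral>\<^sup>+s. ennreal (norm (\<eta> s * (J a *\<^sub>R g (s - v / a)))) \<partial>lborel \<partial>lborel) \<le>
            (\<integral>\<^sup>+a. ennreal (J a) * ennreal (l2 \<eta> * l2 g) \<partial>lborel)"
        proof (rule nn_integral_mono)
          fix a
          have 1: "(\<lambda>s. g (s - v / a)) \<in> L2" using L2_affine[OF g_L2, of 1 "- v / a"] by (simp add: add.commute)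
          have 2: "l2 (\<lambda>s. g (s - v / a)) = l2 g" using l2_affine_inverse[of 1 g "- v / a"] by (simp add: add.commute)
          have "(\<integral>\<^sup>+s. ennreal (norm (\<eta> s * (J a *\<^sub>R g (s - v / a)))) \<partial>lborel) =
              ennreal (J a) * (\<integral>\<^sup>+s. ennreal (norm (\<eta> s) * norm (g (s - v / a))) \<partial>lborel)"
            using J0[of a] by (subst nn_integral_cmult[symmetric]) (auto simp: norm_mult ennreal_mult mult_ac)
          also have "\<dots> \<le> ennreal (J a) * ennreal (l2 \<eta> * l2 g)"
            using L2_nn_Cauchy_Schwarz[OF \<eta> 1] unfolding 2 by (intro mult_left_mono) auto
          finally show "(\<integral>\<^sup>+s. ennreal (norm (\<eta> s * (J a *\<^sub>R g (s - v / a)))) \<partial>lborel) \<le> ennreal (J a) * ennreal (l2 \<eta> * l2 g)" .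
        qed
        also have "\<dots> < \<infinity>"
          using Jnn by (subst nn_integral_multc) (auto simp: ennreal_mult_less_top)
        finally show "(\<integral>\<^sup>+a. \<integral>\<^sup>+s. ennreal (norm (\<eta> s * (J a *\<^sub>R g (s - v / a)))) \<partial>lborel \<partial>lborel) < \<infinity>" .
      qed measurable
      also have "\<dots> = (\<integral>s. \<eta> s * (of_real (1 / (n * \<epsilon>)) * atom_diff n w s (v / \<epsilon>)) \<partial>lborel)"
      proof (intro Bochner_Integration.integral_cong refl)
        fix s
        have "(\<integral>a. J a *\<^sub>R g (s - v / a) \<partial>lborel) = of_real (1 / (n * \<epsilon>)) * atom_diff n w s (v / \<epsilon>)"
          using atom_scale_integral[OF w _ \<epsilon> elim, of n s] n by (simp add: J_def g_def)
        then show "(\<integral>a. \<eta> s * (J a *\<^sub>R g (s - v / a)) \<partial>lborel) = \<eta> s * (of_real (1 / (n * \<epsilon>)) * atom_diff n w s (v / \<epsilon>))"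
          by (simp only: integral_mult_right_zero)
      qed
      also have "\<dots> = (\<integral>s. of_real (1 / (n * \<epsilon>)) * (\<eta> s * atom_diff n w s (v / \<epsilon>)) \<partial>lborel)"
        by (simp add: mult_ac)
      also have "\<dots> = of_real (1 / \<epsilon>) * \<kappa> (v / \<epsilon>)"
        unfolding integral_mult_right_zero \<kappa>_def by simp
      finally have "(\<integral>a. J a *\<^sub>R \<Phi> (v / a) \<partial>lborel) = of_real (1 / \<epsilon>) * \<kappa> (v / \<epsilon>)" .
      moreover have "(\<integral>a. J a *\<^sub>R (X v * \<Phi> (v / a)) \<partial>lborel) = X v * (\<integral>a. J a *\<^sub>R \<Phi> (v / a) \<partial>lborel)"
        by (subst integral_mult_right_zero[symmetric]) simp
      ultimately show ?case by simp
    qed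
  qed measurable
  also have "\<dots> = \<bar>\<epsilon>\<bar> *\<^sub>R (\<integral>y. X (0 + \<epsilon> * y) * (of_real (1 / \<epsilon>) * \<kappa> ((0 + \<epsilon> * y) / \<epsilon>)) \<partial>lborel)"
    by (rule lborel_integral_real_affine) (use \<epsilon> in simp)
  also have "\<dots> = (\<integral>y. \<bar>\<epsilon>\<bar> *\<^sub>R (X (0 + \<epsilon> * y) * (of_real (1 / \<epsilon>) * \<kappa> ((0 + \<epsilon> * y) / \<epsilon>))) \<partial>lborel)"
    by (rule integral_scaleR_right[symmetric])
  also have "\<dots> = (\<integral>y. X (\<epsilon> * y) * \<kappa> y \<partial>lborel)"
    using \<epsilon> by (intro Bochner_Integration.integral_cong) (auto simp: scaleR_conv_of_real)
  finally show ?thesis .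
qed

lemma atom_diff_pair_integrable: "integrable (lborel \<Otimes>\<^sub>M lborel) (\<lambda>(s, v). \<eta> s * atom_diff n w s v)"
  by (rule atom_diff_double_integrable[OF w n \<eta>])

lemma \<kappa>_integrable: "integrable lborel \<kappa>"
  unfolding \<kappa>_def by (intro integrable_mult_right integrable_iterated_integral(2)[OF sigma_finite_lborel sigma_finite_lborel atom_diff_pair_integrable])

text \<open>The Hilbert transform evaluates the inner integral. The order drops from n + 1 in the
  window to n here; the coefficient of \<eta> that appears is the one kept away from 0 by the choice
  of w.\<close>

lemma integral_\<kappa>: "(\<integral>y. \<kappa> y \<partial>lborel) = of_real (2 * pi * sgn (Im w) / n) * \<i> * (\<integral>s. \<eta> s * atom n w s \<partial>lborel)"
proof -
  have "(\<integral>y. \<kappa> y \<partial>lborel) = of_real (1 / n) * (\<integral>y. (\<integral>s. \<eta> s * atom_diff n w s y \<partial>lborel) \<partial>lborel)"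
    unfolding \<kappa>_def by (rule integral_mult_right_zero)
  also have "(\<integral>y. (\<integral>s. \<eta> s * atom_diff n w s y \<partial>lborel) \<partial>lborel) = (\<integral>s. (\<integral>y. \<eta> s * atom_diff n w s y \<partial>lborel) \<partial>lborel)"
    by (rule integrable_iterated_integral(3)[symmetric, OF sigma_finite_lborel sigma_finite_lborel atom_diff_pair_integrable])
  also have "\<dots> = (\<integral>s. (of_real (2 * pi * sgn (Im w)) * \<i>) * (\<eta> s * atom n w s) \<partial>lborel)"
    using atom_diff_integral[OF w, of n] n by (simp add: mult_ac)
  also have "\<dots> = (of_real (2 * pi * sgn (Im w)) * \<i>) * (\<integral>s. \<eta> s * atom n w s \<partial>lborel)"
    by (rule integral_mult_right_zero)
  finally show ?thesis by simp
qed

lemma X_bound: "norm (X v) \<le> l2 \<xi> * l2 h"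
proof -
  have 1: "(\<lambda>x. cnj (h (x + v))) \<in> L2" using L2_cnj[OF L2_affine[OF h, of 1 v]] by (simp add: add.commute)
  have 2: "l2 (\<lambda>x. cnj (h (x + v))) = l2 h" using l2_affine_inverse[of 1 h v] by (simp add: add.commute)
  show ?thesis using L2_mult_bound[OF \<xi>(1) 1] unfolding 2 X_def .
qed

text \<open>The shift is carried by \<xi> instead of h: h is an arbitrary L2 function, whereas for a
  wavelet the continuity of translation follows from one integrable derivative.\<close>

lemma X_tendsto:
  assumes tc: "((\<lambda>d. l2 (\<lambda>x. \<xi> (x - d) - \<xi> x)) \<longlongrightarrow> 0) (at 0)"
  shows "(X \<longlongrightarrow> X 0) (at 0)"
proof -
  have \<xi>s: "(\<lambda>x. \<xi> (x - v)) \<in> L2" for v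
    using L2_affine[OF \<xi>(1), of 1 "- v"] by (simp add: add.commute)
  have Xs: "X v = L2_inner (\<lambda>x. \<xi> (x - v)) h" for v
    unfolding X_def L2_inner_def by (subst lborel_integral_real_affine[of 1 "\<lambda>x. \<xi> x * cnj (h (x + v))" "- v"]) auto
  have d: "norm (X v - X 0) \<le> l2 (\<lambda>x. \<xi> (x - v) - \<xi> x) * l2 h" for v
  proof -
    have m: "(\<lambda>x. - 1 * \<xi> x) \<in> L2" by (intro L2_cmult \<xi>)
    have "X v - X 0 = L2_inner (\<lambda>x. \<xi> (x - v)) h + L2_inner (\<lambda>x. - 1 * \<xi> x) h"
      unfolding Xs L2_inner_cmult_left by simp
    also have "\<dots> = L2_inner (\<lambda>x. \<xi> (x - v) + - 1 * \<xi> x) h"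
      by (rule L2_inner_add_left[symmetric, OF \<xi>s m h])
    finally have "norm (X v - X 0) \<le> l2 (\<lambda>x. \<xi> (x - v) + - 1 * \<xi> x) * l2 h"
      using L2_inner_bound[OF L2_add[OF \<xi>s m] h] by simp
    then show ?thesis by simp
  qed
  have "((\<lambda>v. l2 (\<lambda>x. \<xi> (x - v) - \<xi> x) * l2 h) \<longlongrightarrow> 0) (at 0)"
    using tendsto_mult_left_zero[OF tc] .
  then have "((\<lambda>v. X v - X 0) \<longlongrightarrow> 0) (at 0)"
    by (rule Lim_null_comparison[rotated]) (simp add: d always_eventually)
  then show ?thesis by (simp add: LIM_zero_iff)
qed

text \<open>Hypothesis \<open>W\<close> makes the integrand integrable over the whole group, since
  the factor with \<eta> and h is bounded. Dominated convergence then removes the cutoff from the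
  scale integral, while on the other side \<open>X (\<epsilon> y)\<close> tends to
  \<open>X 0\<close> under the integrable majorant given by \<kappa>.\<close>

lemma reproducing:
  assumes tc: "((\<lambda>d. l2 (\<lambda>x. \<xi> (x - d) - \<xi> x)) \<longlongrightarrow> 0) (at 0)"
    and W: "(\<integral>\<^sup>+z. ennreal (norm (wav_trans (\<lambda>x. cnj (atom (Suc n) w x)) \<xi> z)) \<partial>aff_haar) < \<infinity>"
  shows "(\<integral>z. wav_trans (\<lambda>x. cnj (atom (Suc n) w x)) \<xi> z * L2_inner (wav_rep z \<eta>) h \<partial>aff_haar) =
    of_real (2 * pi * sgn (Im w) / n) * \<i> * (\<integral>s. \<eta> s * atom n w s \<partial>lborel) * L2_inner \<xi> h"
proof -
  define F where "F = (\<lambda>z. wav_trans \<phi> \<xi> z * L2_inner (wav_rep z \<eta>) h)"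
  have Fi: "integrable aff_haar F"
  proof (rule Bochner_Integration.integrable_bound)
    have [measurable]: "wav_trans \<phi> \<xi> \<in> borel_measurable borel"
      by (rule wav_trans_measurable) measurable
    have "integrable aff_haar (wav_trans \<phi> \<xi>)"
    proof (rule integrableI_bounded)
      show "(\<integral>\<^sup>+z. ennreal (norm (wav_trans \<phi> \<xi> z)) \<partial>aff_haar) < \<infinity>"
        using W by (simp add: \<phi>_def[abs_def] g_def)
    qed measurable
    then show "integrable aff_haar (\<lambda>z. (l2 \<eta> * l2 h) *\<^sub>R wav_trans \<phi> \<xi> z)"
      by simp
    show "F \<in> borel_measurable aff_haar"
      unfolding F_def using wav_rep_inner_measurable by measurable
    show "AE z in aff_haar. norm (F z) \<le> norm ((l2 \<eta> * l2 h) *\<^sub>R wav_trans \<phi> \<xi> z)"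
      by (auto simp: F_def norm_mult mult.commute[of "norm (wav_trans _ _ _)"] abs_mult intro!: mult_right_mono wav_rep_inner_bound)
  qed
  have aeI: "AE a in lborel. (1 / a\<^sup>2) *\<^sub>R (\<integral>b. F (b, a) \<partial>lborel) = I a"
    using AE_neq_0 by eventually_elim (use scale_slice_integral in \<open>simp add: F_def I_def S_def\<close>)
  have intI: "integrable lborel I"
    by (rule integrable_cong_AE_imp[OF integral_aff_haar(1)[OF Fi] _ aeI]) simp
  have FI: "(\<integral>z. F z \<partial>aff_haar) = (\<integral>a. I a \<partial>lborel)"
    unfolding integral_aff_haar(2)[OF Fi]
    by (rule integral_cong_AE) (use aeI borel_measurable_integrable[OF integral_aff_haar(1)[OF Fi]] in auto)
  define e where "e = (\<lambda>N::nat. 1 / real (Suc N))"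
  have e: "e N > 0" for N by (simp add: e_def)
  have e0: "e \<longlonglongrightarrow> 0" unfolding e_def by real_asymp
  have lim1: "(\<lambda>N. \<integral>a. indicator {a. e N \<le> \<bar>a\<bar>} a *\<^sub>R I a \<partial>lborel) \<longlonglongrightarrow> (\<integral>a. I a \<partial>lborel)"
  proof (rule integral_dominated_convergence[where w="\<lambda>a. norm (I a)"])
    show "AE a in lborel. (\<lambda>N. indicator {a. e N \<le> \<bar>a\<bar>} a *\<^sub>R I a) \<longlonglongrightarrow> I a"
      using AE_neq_0
    proof eventually_elim
      case (elim a)
      have "eventually (\<lambda>N. e N < \<bar>a\<bar>) sequentially"
        using e0 elim by (intro order_tendstoD(2)) auto
      then have "eventually (\<lambda>N. indicator {a. e N \<le> \<bar>a\<bar>} a *\<^sub>R I a = I a) sequentially"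
        by eventually_elim (auto simp: indicator_def)
      then show ?case
        by (rule tendsto_eventually)
    qed
    show "integrable lborel (\<lambda>a. norm (I a))" by (rule integrable_norm[OF intI])
    show "AE a in lborel. norm (indicator {a. e i \<le> \<bar>a\<bar>} a *\<^sub>R I a) \<le> norm (I a)" for i
      by (auto simp: indicator_def)
  qed measurable
  have lim2: "(\<lambda>N. \<integral>y. X (e N * y) * \<kappa> y \<partial>lborel) \<longlonglongrightarrow> (\<integral>y. X 0 * \<kappa> y \<partial>lborel)"
  proof (rule integral_dominated_convergence[where w="\<lambda>y. (l2 \<xi> * l2 h) * norm (\<kappa> y)"])
    show "AE y in lborel. (\<lambda>N. X (e N * y) * \<kappa> y) \<longlonglongrightarrow> X 0 * \<kappa> y"
      using AE_neq_0
    proof eventually_elim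
      case (elim y)
      have "filterlim (\<lambda>N. e N * y) (at 0) sequentially"
        unfolding filterlim_at using elim e tendsto_mult_left_zero[OF e0, of y]
        by (auto simp: less_imp_neq[OF e, symmetric])
      from filterlim_compose[OF X_tendsto[OF tc] this] show ?case
        by (intro tendsto_mult) auto
    qed
    show "integrable lborel (\<lambda>y. (l2 \<xi> * l2 h) * norm (\<kappa> y))"
      by (intro integrable_mult_right integrable_norm \<kappa>_integrable)
    show "AE y in lborel. norm (X (e i * y) * \<kappa> y) \<le> (l2 \<xi> * l2 h) * norm (\<kappa> y)" for i
      by (auto simp: norm_mult intro!: mult_right_mono X_bound)
  qed measurable
  have "(\<integral>a. I a \<partial>lborel) = (\<integral>y. X 0 * \<kappa> y \<partial>lborel)"
    using LIMSEQ_unique[OF lim1] lim2 unfolding truncated_integral_eq[OF e] by blast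
  also have "\<dots> = X 0 * (\<integral>y. \<kappa> y \<partial>lborel)"
    by (rule integral_mult_right_zero)
  also have "X 0 = L2_inner \<xi> h"
    by (simp add: X_def L2_inner_def)
  finally show ?thesis
    using FI unfolding integral_\<kappa> F_def \<phi>_def g_def by (simp add: mult_ac)
qed

end

section \<open>Non-vanishing of an atom coefficient\<close>

text \<open>\<open>ennreal\<close> truncates at 0, so \<open>ennreal (f y)\<close> and
  \<open>ennreal (- f y)\<close> are the positive and negative parts of f. As densities they define
  finite measures that agree on all rays, hence everywhere, and densities are unique almost
  everywhere.\<close>

lemma AE_eq_0_if_integral_Ioi_eq_0:
  fixes f :: "real \<Rightarrow> real"
  assumes f: "integrable lborel f" and z: "\<And>x. (\<integral>y. indicator {x<..} y *\<^sub>R f y \<partial>lborel) = 0"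
  shows "AE x in lborel. f x = 0"
proof -
  note [measurable] = borel_measurable_integrable[OF f]
  have fin: "(\<integral>\<^sup>+y. ennreal (c * f y) \<partial>lborel) < \<infinity>" if "\<bar>c\<bar> = 1" for c
  proof -
    have "(\<integral>\<^sup>+y. ennreal (c * f y) \<partial>lborel) \<le> (\<integral>\<^sup>+y. ennreal (norm (f y)) \<partial>lborel)"
      using that by (intro nn_integral_mono ennreal_leI) (auto simp: abs_if split: if_splits)
    also have "\<dots> < \<infinity>" using f by (simp add: integrable_iff_bounded)
    finally show ?thesis .
  qed
  have "density lborel (\<lambda>y. ennreal (f y)) = density lborel (\<lambda>y. ennreal (- f y))"
  proof (rule measure_eqI_lessThan)
    fix x
    have i: "integrable lborel (\<lambda>y. indicator {x<..} y *\<^sub>R f y)"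
      by (rule integrable_mult_indicator[OF _ f]) simp
    have eq: "emeasure (density lborel (\<lambda>y. ennreal (c * f y))) {x<..} = (\<integral>\<^sup>+y. ennreal (c * (indicator {x<..} y *\<^sub>R f y)) \<partial>lborel)" for c
      by (subst emeasure_density) (auto intro!: nn_integral_cong simp: indicator_def)
    have le: "(\<integral>\<^sup>+y. ennreal (c * (indicator {x<..} y *\<^sub>R f y)) \<partial>lborel) < \<infinity>" if "\<bar>c\<bar> = 1" for c
    proof -
      have "(\<integral>\<^sup>+y. ennreal (c * (indicator {x<..} y *\<^sub>R f y)) \<partial>lborel) \<le> (\<integral>\<^sup>+y. ennreal (c * f y) \<partial>lborel)"
        by (intro nn_integral_mono) (auto simp: indicator_def)
      then show ?thesis using fin[OF that] by (rule le_less_trans)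
    qed
    show "emeasure (density lborel (\<lambda>y. ennreal (f y))) {x<..} < \<infinity>"
      using eq[of 1] le[of 1] by simp
    have "enn2real (\<integral>\<^sup>+y. ennreal (1 * (indicator {x<..} y *\<^sub>R f y)) \<partial>lborel) =
        enn2real (\<integral>\<^sup>+y. ennreal (- 1 * (indicator {x<..} y *\<^sub>R f y)) \<partial>lborel)"
      using z[of x] real_lebesgue_integral_def[OF i] by simp
    then have "(\<integral>\<^sup>+y. ennreal (1 * (indicator {x<..} y *\<^sub>R f y)) \<partial>lborel) = (\<integral>\<^sup>+y. ennreal (- 1 * (indicator {x<..} y *\<^sub>R f y)) \<partial>lborel)"
      using le[of 1] le[of "-1"] by (subst (1 2) ennreal_enn2real[symmetric]) (simp_all del: ennreal_enn2real)
    then show "emeasure (density lborel (\<lambda>y. ennreal (f y))) {x<..} = emeasure (density lborel (\<lambda>y. ennreal (- f y))) {x<..}"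
      using eq[of 1] eq[of "-1"] by simp
  qed auto
  then have "AE y in lborel. ennreal (f y) = ennreal (- f y)"
    by (subst (asm) sigma_finite_measure.density_unique_iff[OF sigma_finite_lborel]) auto
  then show ?thesis
  proof eventually_elim
    case (elim y)
    then show ?case
      by (cases "0 \<le> f y") (simp_all add: ennreal_neg ennreal_eq_0_iff)
  qed
qed

text \<open>A square integrable function need only be integrable on bounded sets, so its real and
  imaginary parts are cut off to (-M, M), and countably many M exhaust the line.\<close>

lemma AE_eq_0_if_interval_integrals_eq_0:
  assumes \<eta>: "\<eta> \<in> L2" and z: "\<And>p q. p < q \<Longrightarrow> (\<integral>s. indicator {p<..<q} s *\<^sub>R \<eta> s \<partial>lborel) = 0"
  shows "AE x in lborel. \<eta> x = 0"
proof -
  note [measurable] = L2_measurable[OF \<eta>]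
  have ind: "(\<lambda>s. indicator {p<..<q} s) \<in> L2" for p q :: real
  proof -
    have "(\<lambda>s. (norm (indicator {p<..<q} s :: complex))\<^sup>2) = indicator {p<..<q}"
      by (auto simp: indicator_def fun_eq_iff)
    then show ?thesis unfolding L2_iff 
      by simp (intro integrable_real_indicator emeasure_bounded_finite bounded_subset[OF bounded_closed_interval[of p q]], auto)
  qed
  have int: "integrable lborel (\<lambda>s. indicator {p<..<q} s *\<^sub>R \<eta> s)" for p q
    using L2_mult_integrable[OF ind[of p q] \<eta>]
    by (rule Bochner_Integration.integrable_cong[THEN iffD1, rotated 2]) (auto simp: indicator_def)
  have part: "AE x in lborel. indicator {- M<..<M} x * T (\<eta> x) = 0"
    if T: "bounded_linear T" for M :: real and T :: "complex \<Rightarrow> real"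
  proof (rule AE_eq_0_if_integral_Ioi_eq_0)
    interpret T: bounded_linear T by (rule T)
    have i: "integrable lborel (\<lambda>s. T (indicator {p<..<q} s *\<^sub>R \<eta> s))" for p q
      by (rule integrable_bounded_linear[OF T int])
    then show "integrable lborel (\<lambda>x. indicator {- M<..<M} x * T (\<eta> x))"
      by (simp add: T.scaleR)
    fix x
    have "(\<integral>y. indicator {x<..} y *\<^sub>R (indicator {- M<..<M} y * T (\<eta> y)) \<partial>lborel) =
        (\<integral>y. T (indicator {max x (- M)<..<M} y *\<^sub>R \<eta> y) \<partial>lborel)"
      by (intro Bochner_Integration.integral_cong refl) (auto simp: indicator_def T.zero)
    also have "\<dots> = T (\<integral>y. indicator {max x (- M)<..<M} y *\<^sub>R \<eta> y \<partial>lborel)"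
      by (rule integral_bounded_linear[OF T int])
    also have "\<dots> = 0"
    proof (cases "max x (- M) < M")
      case True
      then show ?thesis by (simp only: z T.zero)
    next
      case False
      then have "{max x (- M)<..<M} = {}" by auto
      then show ?thesis by (simp only:) (simp add: T.zero)
    qed
    finally show "(\<integral>y. indicator {x<..} y *\<^sub>R (indicator {- M<..<M} y * T (\<eta> y)) \<partial>lborel) = 0" .
  qed
  have "AE x in lborel. \<forall>N::nat. indicator {- real N<..<real N} x * Re (\<eta> x) = 0 \<and> indicator {- real N<..<real N} x * Im (\<eta> x) = 0"
    unfolding AE_all_countable AE_conj_iff using part[OF bounded_linear_Re] part[OF bounded_linear_Im] by blast
  then show ?thesis
  proof eventually_elim
    case (elim x)
    obtain N :: nat where "\<bar>x\<bar> < real N" using reals_Archimedean2 by blast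
    with spec[OF elim, of N] show ?case
      by (auto simp: complex_eq_iff indicator_def split: if_splits)
  qed
qed

text \<open>In contrast to \<open>atom_deriv\<close> the base moves in a complex direction d; the
  application is to vertical motion of the pole.\<close>

lemma inverse_power_vector_derivative:
  fixes A d :: complex
  assumes nz: "A + d * of_real t \<noteq> 0"
  shows "((\<lambda>u. 1 / (A + d * of_real u) ^ n) has_vector_derivative (- d * of_nat n * (1 / (A + d * of_real t) ^ Suc n))) (at t)"
proof (cases n)
  case (Suc m)
  define u where "u = inverse (A + d * of_real t)"
  have "((\<lambda>z. inverse (A + d * z)) has_field_derivative - (u * d * u)) (at (of_real t))"
    using nz by (auto intro!: derivative_eq_intros simp: u_def)
  from has_vector_derivative_real_field[OF DERIV_power_Suc[OF this, of m]]
  have "((\<lambda>x. inverse (A + d * of_real x) ^ Suc m) has_vector_derivative (1 + of_nat m) * (- (u * d * u) * u ^ m)) (at t)"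
    by (simp add: u_def)
  moreover have "(1 + of_nat m) * (- (u * d * u) * u ^ m) = - d * of_nat n * u ^ Suc n"
    by (simp add: Suc algebra_simps)
  ultimately show ?thesis
    by (simp add: Suc u_def inverse_eq_divide power_divide)
qed simp

text \<open>Moving the pole vertically away from the real axis increases its distance to every real
  point, so one atom dominates a whole ray of poles.\<close>

lemma norm_atom_shift_le:
  assumes w: "Im w \<noteq> 0" and T: "T \<ge> 0"
  shows "norm (atom n (w + \<i> * of_real (sgn (Im w) * T)) s) \<le> norm (atom n w s)"
proof -
  have "norm (of_real s - w) \<le> norm (of_real s - (w + \<i> * of_real (sgn (Im w) * T)))"
  proof -
    have "\<bar>Im w\<bar> \<le> \<bar>Im w + sgn (Im w) * T\<bar>"
      using w T by (cases "Im w > 0") auto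
    then have "(Im w)\<^sup>2 \<le> (Im w + sgn (Im w) * T)\<^sup>2"
      by (simp add: abs_le_square_iff)
    then show ?thesis
      by (simp add: cmod_def power2_commute[of "- Im w"] power2_eq_square algebra_simps)
  qed
  moreover have "norm (of_real s - w) > 0" using atom_nz[OF w] by simp
  ultimately show ?thesis
    by (simp add: atom_def norm_divide norm_power frac_le power_mono)
qed

text \<open>The w-derivative of the order n coefficient is n times the coefficient of order n + 1,
  which vanishes. So the coefficient is constant along the vertical ray leading from w away from the
  real axis, and it tends to 0 along that ray.\<close>

lemma atom_coefficient_descent:
  assumes \<eta>: "\<eta> \<in> L2" and n: "n \<ge> 1"
    and z: "\<And>w. Im w \<noteq> 0 \<Longrightarrow> (\<integral>s. \<eta> s * atom (Suc n) w s \<partial>lborel) = 0" and w: "Im w \<noteq> 0"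
  shows "(\<integral>s. \<eta> s * atom n w s \<partial>lborel) = 0"
proof -
  note [measurable] = L2_measurable[OF \<eta>]
  define \<sigma> where "\<sigma> = sgn (Im w)"
  have \<sigma>: "\<bar>\<sigma>\<bar> = 1" using w by (simp add: \<sigma>_def sgn_if)
  \<comment> \<open>The sign of Im w directs the ray away from the real axis, so no pole on it
    becomes real.\<close>
  define W where "W = (\<lambda>T. w + \<i> * of_real (\<sigma> * T))"
  have ImW: "Im (W T) \<noteq> 0" if "T \<ge> 0" for T
    using w that by (cases "Im w > 0") (auto simp: W_def \<sigma>_def)
  have le: "norm (atom k (W T) s) \<le> norm (atom k w s)" if "T \<ge> 0" for k T s
    unfolding W_def \<sigma>_def by (rule norm_atom_shift_le[OF w that])
  have int: "integrable lborel (\<lambda>s. \<eta> s * atom k (W T) s)" if "T \<ge> 0" "k \<ge> 1" for k T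
    using that by (intro L2_mult_integrable \<eta> atom_L2 ImW)
  have eq: "atom k (W u) s = 1 / ((of_real s - w) + (- \<i> * of_real \<sigma>) * of_real u) ^ k" for k u s
    by (simp add: atom_def W_def algebra_simps)
  have const: "(\<integral>s. \<eta> s * atom n (W T) s \<partial>lborel) = (\<integral>s. \<eta> s * atom n w s \<partial>lborel)" if T: "T \<ge> 0" for T
  proof -
    define c where "c = \<i> * of_real \<sigma> * of_nat n"
    have W0: "W 0 = w" by (simp add: W_def)
    have mW[measurable]: "(\<lambda>p. atom k (W (snd p)) (fst p)) \<in> borel_measurable (borel \<Otimes>\<^sub>M borel)" for k
      unfolding atom_def W_def by measurable
    have FT: "(\<integral>u. indicator {0..T} u *\<^sub>R (c * atom (Suc n) (W u) s) \<partial>lborel) = atom n (W T) s - atom n w s" for s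
    proof -
      have d: "((\<lambda>u. atom n (W u) s) has_vector_derivative c * atom (Suc n) (W u) s) (at u)" if "u \<in> {0..T}" for u
      proof -
        have nz: "(of_real s - w) + (- \<i> * of_real \<sigma>) * of_real u \<noteq> 0"
          using atom_nz[OF ImW[of u], of s] that by (simp add: W_def algebra_simps)
        show ?thesis
          using inverse_power_vector_derivative[OF nz, of n] unfolding eq by (simp add: c_def)
      qed
      have cont: "continuous_on {0..T} (\<lambda>u. c * atom (Suc n) (W u) s)"
      proof -
        have "(of_real s - w) + (- \<i> * of_real \<sigma>) * of_real u \<noteq> 0" if "u \<in> {0..T}" for u
          using atom_nz[OF ImW[of u], of s] that by (simp add: W_def algebra_simps)
        then show ?thesis unfolding eq by (intro continuous_intros) auto
      qed
      have si: "set_integrable lborel {0..T} (\<lambda>u. c * atom (Suc n) (W u) s)"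
        by (rule borel_integrable_atLeastAtMost'[OF cont])
      have "((\<lambda>u. c * atom (Suc n) (W u) s) has_integral (atom n (W T) s - atom n (W 0) s)) {0..T}"
        using T d by (intro fundamental_theorem_of_calculus) (auto intro: has_vector_derivative_at_within)
      then have "integral {0..T} (\<lambda>u. c * atom (Suc n) (W u) s) = atom n (W T) s - atom n w s"
        unfolding W0 by (rule integral_unique)
      with set_borel_integral_eq_integral(2)[OF si] show ?thesis
        by (simp only: set_lebesgue_integral_def)
    qed
    have "(\<integral>s. \<eta> s * atom n (W T) s \<partial>lborel) - (\<integral>s. \<eta> s * atom n w s \<partial>lborel) =
        (\<integral>s. \<eta> s * (atom n (W T) s - atom n w s) \<partial>lborel)"
      using int[OF T n] int[of 0 n] n W0 by (simp add: right_diff_distrib)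
    also have "\<dots> = (\<integral>s. (\<integral>u. \<eta> s * (indicator {0..T} u *\<^sub>R (c * atom (Suc n) (W u) s)) \<partial>lborel) \<partial>lborel)"
      by (simp only: FT[symmetric] integral_mult_right_zero)
    also have "\<dots> = (\<integral>u. (\<integral>s. \<eta> s * (indicator {0..T} u *\<^sub>R (c * atom (Suc n) (W u) s)) \<partial>lborel) \<partial>lborel)"
    proof (rule integrable_iterated_integral(3)[OF sigma_finite_lborel sigma_finite_lborel pair_integrableI[OF sigma_finite_lborel sigma_finite_lborel]])
      have "(\<integral>\<^sup>+s. \<integral>\<^sup>+u. ennreal (norm (\<eta> s * (indicator {0..T} u *\<^sub>R (c * atom (Suc n) (W u) s)))) \<partial>lborel \<partial>lborel) \<le>
          (\<integral>\<^sup>+s. \<integral>\<^sup>+u. ennreal (norm c * (norm (\<eta> s) * norm (atom (Suc n) w s))) * indicator {0..T} u \<partial>lborel \<partial>lborel)"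
      proof (intro nn_integral_mono)
        fix s u
        show "ennreal (norm (\<eta> s * (indicator {0..T} u *\<^sub>R (c * atom (Suc n) (W u) s)))) \<le>
            ennreal (norm c * (norm (\<eta> s) * norm (atom (Suc n) w s))) * indicator {0..T} u"
        proof (cases "u \<in> {0..T}")
          case True
          have "norm (\<eta> s * (c * atom (Suc n) (W u) s)) = norm c * (norm (\<eta> s) * norm (atom (Suc n) (W u) s))"
            by (simp add: norm_mult mult_ac)
          also have "\<dots> \<le> norm c * (norm (\<eta> s) * norm (atom (Suc n) w s))"
            using True by (intro mult_left_mono le) auto
          finally show ?thesis using True by (simp add: ennreal_leI)
        qed auto
      qed
      also have "\<dots> = ennreal (norm c) * (\<integral>\<^sup>+s. ennreal (norm (\<eta> s) * norm (atom (Suc n) w s)) \<partial>lborel) * ennreal T"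
        using T by (simp add: nn_integral_cmult_indicator ennreal_mult[of "norm c"] nn_integral_multc nn_integral_cmult del: ennreal_mult)
      also have "\<dots> < \<infinity>"
        using L2_nn_Cauchy_Schwarz[OF \<eta> atom_L2[OF w, of "Suc n"]] by (auto simp: ennreal_mult_less_top intro: le_less_trans)
      finally show "(\<integral>\<^sup>+s. \<integral>\<^sup>+u. ennreal (norm (\<eta> s * (indicator {0..T} u *\<^sub>R (c * atom (Suc n) (W u) s)))) \<partial>lborel \<partial>lborel) < \<infinity>" .
      show "(\<lambda>(s, u). \<eta> s * (indicator {0..T} u *\<^sub>R (c * atom (Suc n) (W u) s))) \<in> borel_measurable (lborel \<Otimes>\<^sub>M lborel)"
        using mW by measurable
    qed
    also have "\<dots> = (\<integral>u. 0 \<partial>(lborel :: real measure))"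
    proof (rule Bochner_Integration.integral_cong[OF refl])
      fix u
      show "(\<integral>s. \<eta> s * (indicator {0..T} u *\<^sub>R (c * atom (Suc n) (W u) s)) \<partial>lborel) = 0"
      proof (cases "u \<in> {0..T}")
        case True
        have "(\<integral>s. \<eta> s * (indicator {0..T} u *\<^sub>R (c * atom (Suc n) (W u) s)) \<partial>lborel) = (\<integral>s. c * (\<eta> s * atom (Suc n) (W u) s) \<partial>lborel)"
          using True by (simp add: mult_ac)
        also have "\<dots> = c * (\<integral>s. \<eta> s * atom (Suc n) (W u) s \<partial>lborel)"
          by (rule integral_mult_right_zero)
        finally show ?thesis using z[OF ImW[of u]] True by simp
      qed simp
    qed
    finally show ?thesis by simp
  qed
  have "(\<lambda>N. \<integral>s. \<eta> s * atom n (W (real N)) s \<partial>lborel) \<longlonglongrightarrow> (\<integral>s. 0 \<partial>(lborel :: real measure))"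
  proof (rule integral_dominated_convergence[where w="\<lambda>s. norm (\<eta> s) * norm (atom n w s)"])
    show "integrable lborel (\<lambda>s. norm (\<eta> s) * norm (atom n w s))"
      using integrable_norm[OF int[of 0 n]] n by (simp add: norm_mult W_def)
    show "AE s in lborel. norm (\<eta> s * atom n (W (real N)) s) \<le> norm (\<eta> s) * norm (atom n w s)" for N
      by (auto simp: norm_mult intro!: mult_left_mono le)
    show "AE s in lborel. (\<lambda>N. \<eta> s * atom n (W (real N)) s) \<longlonglongrightarrow> 0"
    proof (rule AE_I2)
      fix s
      have "norm (atom n (W (real N)) s) \<le> 1 / real N" if "N \<ge> 1" for N
      proof -
        have "real N \<le> \<bar>Im (of_real s - W (real N))\<bar>"
          using w by (cases "Im w > 0") (auto simp: W_def \<sigma>_def)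
        also have "\<dots> \<le> norm (of_real s - W (real N))" by (rule abs_Im_le_cmod)
        finally have N: "real N \<le> norm (of_real s - W (real N))" .
        have "real N ^ 1 \<le> real N ^ n" using that n by (intro power_increasing) auto
        also have "\<dots> \<le> norm (of_real s - W (real N)) ^ n" using N by (intro power_mono) auto
        finally show ?thesis
          using that by (auto simp: atom_def norm_divide norm_power intro!: divide_left_mono mult_pos_pos)
      qed
      then have "eventually (\<lambda>N. norm (atom n (W (real N)) s) \<le> 1 / real N) sequentially"
        by (auto simp: eventually_sequentially)
      moreover have "(\<lambda>N. 1 / real N) \<longlonglongrightarrow> 0" by real_asymp
      ultimately have "(\<lambda>N. atom n (W (real N)) s) \<longlonglongrightarrow> 0"
        by (rule Lim_null_comparison)
      then show "(\<lambda>N. \<eta> s * atom n (W (real N)) s) \<longlonglongrightarrow> 0"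
        by (rule tendsto_mult_right_zero)
    qed
  qed measurable
  then have "(\<lambda>N::nat. \<integral>s. \<eta> s * atom n w s \<partial>lborel) \<longlonglongrightarrow> 0"
    by (simp add: const)
  then show ?thesis by (simp add: LIMSEQ_const_iff)
qed

text \<open>The difference is the integral over [p, q] of \<pi> times the Poisson kernel at height 1
  / (N + 1). The endpoints are excluded because the limit there is \<pi> / 2; they form a null
  set.\<close>

lemma Poisson_interval_limit:
  fixes p q s :: real
  assumes "s \<noteq> p" "s \<noteq> q" "p < q"
  shows "(\<lambda>N. arctan ((q - s) * real (Suc N)) - arctan ((p - s) * real (Suc N))) \<longlonglongrightarrow> pi * indicator {p<..<q} s"
proof -
  have lim: "(\<lambda>N. arctan (c * real (Suc N))) \<longlonglongrightarrow> pi / 2 * sgn c" for c :: real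
  proof -
    consider "c > 0" | "c = 0" | "c < 0" by linarith
    then show ?thesis
    proof cases
      case 1 then show ?thesis by simp real_asymp
    next
      case 3 then show ?thesis by simp real_asymp
    qed simp
  qed
  have "(\<lambda>N. arctan ((q - s) * real (Suc N)) - arctan ((p - s) * real (Suc N))) \<longlonglongrightarrow> pi / 2 * sgn (q - s) - pi / 2 * sgn (p - s)"
    by (intro tendsto_diff lim)
  also have "pi / 2 * sgn (q - s) - pi / 2 * sgn (p - s) = pi * indicator {p<..<q} s"
    using assms by (auto simp: indicator_def sgn_if)
  finally show ?thesis .
qed

text \<open>The bound is uniform in M and decays like \<open>1 / (1 + s^2)\<close>, so its product
  with a square integrable function is an integrable majorant. Near the interval the trivial bound
  \<pi> suffices; far away the mean value theorem gives the decay.\<close>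

lemma arctan_difference_bound:
  fixes p q s M :: real
  assumes pq: "p < q" and M: "M \<ge> 1"
  defines "R \<equiv> \<bar>p\<bar> + \<bar>q\<bar> + 1"
  shows "\<bar>arctan ((q - s) * M) - arctan ((p - s) * M)\<bar> \<le> (pi * (1 + 4 * R\<^sup>2) + 8 * (q - p)) / (1 + s\<^sup>2)"
proof (cases "\<bar>s\<bar> \<le> 2 * R")
  case True
  have "\<bar>arctan ((q - s) * M) - arctan ((p - s) * M)\<bar> \<le> pi"
    using arctan_bounded[of "(q - s) * M"] arctan_bounded[of "(p - s) * M"] by (auto simp: abs_le_iff)
  also have "pi \<le> pi * (1 + 4 * R\<^sup>2) / (1 + s\<^sup>2)"
  proof -
    have "s\<^sup>2 \<le> (2 * R)\<^sup>2"
      using True by (intro abs_le_square_iff[THEN iffD1]) simp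
    then show ?thesis
      by (simp add: pos_le_divide_eq add_pos_nonneg power_mult_distrib)
  qed
  also have "\<dots> \<le> (pi * (1 + 4 * R\<^sup>2) + 8 * (q - p)) / (1 + s\<^sup>2)"
    using pq by (intro divide_right_mono) auto
  finally show ?thesis .
next
  case False
  have R: "R \<ge> 1" by (simp add: R_def)
  have s1: "s\<^sup>2 \<ge> 1"
    using False R by (simp add: abs_le_square_iff[of 1 s, simplified, symmetric])
  have "\<exists>b. p < b \<and> b < q \<and> arctan ((q - s) * M) - arctan ((p - s) * M) = (q - p) * (inverse (1 + ((b - s) * M)\<^sup>2) * M)"
    by (rule MVT2[OF pq]) (auto intro!: derivative_eq_intros)
  then obtain b where b: "p < b" "b < q"
    "arctan ((q - s) * M) - arctan ((p - s) * M) = (q - p) * (inverse (1 + ((b - s) * M)\<^sup>2) * M)" by blast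
  \<comment> \<open>The intermediate point lies between p and q, and |s| > 2 R keeps it at distance
    at least |s| / 2 from s.\<close>
  have "\<bar>b\<bar> \<le> R" using b by (auto simp: R_def)
  then have "\<bar>s\<bar> / 2 \<le> \<bar>b - s\<bar>" using False by linarith
  then have "(\<bar>s\<bar> / 2)\<^sup>2 \<le> \<bar>b - s\<bar>\<^sup>2" by (intro power_mono) auto
  then have "s\<^sup>2 / 4 \<le> (b - s)\<^sup>2" by (simp add: power_divide)
  then have "s\<^sup>2 / 4 * M\<^sup>2 \<le> ((b - s) * M)\<^sup>2"
    unfolding power_mult_distrib by (rule mult_right_mono) simp
  moreover have "s\<^sup>2 / 4 * M \<le> s\<^sup>2 / 4 * M\<^sup>2"
    using M by (intro mult_left_mono) (auto simp: power2_eq_square)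
  moreover define E where "E = 1 + ((b - s) * M)\<^sup>2"
  ultimately have "s\<^sup>2 * M \<le> 4 * E" by simp
  moreover have "E > 0" by (simp add: E_def add_pos_nonneg)
  ultimately have ME: "M \<le> 4 * E / s\<^sup>2"
    using s1 by (subst pos_le_divide_eq) (auto simp: mult.commute)
  have "inverse E * M \<le> inverse E * (4 * E / s\<^sup>2)"
    using \<open>E > 0\<close> by (intro mult_left_mono ME) simp
  also have "inverse E * (4 * E / s\<^sup>2) = (inverse E * E) * (4 / s\<^sup>2)"
    by (simp add: mult_ac)
  finally have "inverse E * M \<le> 4 / s\<^sup>2"
    using \<open>E > 0\<close> by simp
  then have "inverse (1 + ((b - s) * M)\<^sup>2) * M \<le> 4 / s\<^sup>2"
    by (simp add: E_def)
  also have "4 / s\<^sup>2 \<le> 8 / (1 + s\<^sup>2)"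
  proof -
    have "8 / (2 * s\<^sup>2) \<le> 8 / (1 + s\<^sup>2)"
      using s1 by (intro divide_left_mono mult_pos_pos add_pos_nonneg) auto
    then show ?thesis by simp
  qed
  finally have "(q - p) * (inverse (1 + ((b - s) * M)\<^sup>2) * M) \<le> (q - p) * (8 / (1 + s\<^sup>2))"
    using pq by (intro mult_left_mono) auto
  moreover have "0 \<le> (q - p) * (inverse (1 + ((b - s) * M)\<^sup>2) * M)"
    using pq M by (intro mult_nonneg_nonneg) auto
  ultimately have "\<bar>arctan ((q - s) * M) - arctan ((p - s) * M)\<bar> \<le> 8 * (q - p) / (1 + s\<^sup>2)"
    unfolding b(3) by (simp add: mult.commute)
  also have "\<dots> \<le> (pi * (1 + 4 * R\<^sup>2) + 8 * (q - p)) / (1 + s\<^sup>2)"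
    by (intro divide_right_mono) auto
  finally show ?thesis .
qed

text \<open>The Poisson kernel is a difference of first order atoms at \<open>w\<close> and \<open>cnj w\<close>.\<close>

lemma AE_eq_0_if_atom_1_coefficients_eq_0:
  assumes \<eta>: "\<eta> \<in> L2" and z: "\<And>w. Im w \<noteq> 0 \<Longrightarrow> (\<integral>s. \<eta> s * atom 1 w s \<partial>lborel) = 0"
  shows "AE x in lborel. \<eta> x = 0"
proof (rule AE_eq_0_if_interval_integrals_eq_0[OF \<eta>])
  note [measurable] = L2_measurable[OF \<eta>]
  fix p q :: real assume pq: "p < q"
  \<comment> \<open>\<pi> times the Poisson kernel at height 1 / M.\<close>
  define P where "P = (\<lambda>M b s :: real. M / (1 + ((b - s) * M)\<^sup>2))"
  have Pm[measurable]: "(\<lambda>x. P M (fst x) (snd x)) \<in> borel_measurable (borel \<Otimes>\<^sub>M borel)" for M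
    unfolding P_def by measurable
  have Pm2[measurable]: "(\<lambda>b. P M b s) \<in> borel_measurable borel" for M s
    unfolding P_def by measurable
  have Pz: "(\<integral>s. \<eta> s * of_real (P M b s) \<partial>lborel) = 0" if M: "M \<ge> 1" for M b
  proof -
    define v where "v = 1 / M"
    have v: "v > 0" using M by (simp add: v_def)
    have eq: "\<eta> s * of_real (P M b s) = (1 / (2 * \<i>)) * (\<eta> s * atom 1 (Complex b v) s - \<eta> s * atom 1 (Complex b (- v)) s)" for s
    proof -
      define c where "c = of_real (s - b) - \<i> * of_real v"
      define d where "d = of_real (s - b) + \<i> * of_real v"
      have nz: "c \<noteq> 0" "d \<noteq> 0" using v by (auto simp: c_def d_def complex_eq_iff)
      have cd: "c * d = of_real ((s - b)\<^sup>2 + v\<^sup>2)"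
        by (simp add: c_def d_def algebra_simps power2_eq_square)
      have "atom 1 (Complex b v) s - atom 1 (Complex b (- v)) s = 1 / c - 1 / d"
        by (simp add: atom_def c_def d_def Complex_eq algebra_simps)
      also have "\<dots> = (d - c) / (c * d)" using nz by (simp add: field_simps)
      also have "d - c = 2 * \<i> * of_real v" by (simp add: c_def d_def)
      finally have "(1 / (2 * \<i>)) * (atom 1 (Complex b v) s - atom 1 (Complex b (- v)) s) = of_real (v / ((s - b)\<^sup>2 + v\<^sup>2))"
        by (simp add: cd)
      also have "v / ((s - b)\<^sup>2 + v\<^sup>2) = P M b s"
      proof -
        have "(s - b)\<^sup>2 + v\<^sup>2 = (1 + ((b - s) * M)\<^sup>2) / M\<^sup>2"
          using M by (simp add: v_def power_mult_distrib power2_commute[of s b] add_divide_distrib power_divide)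
        then show ?thesis using M by (simp add: P_def v_def power2_eq_square)
      qed
      finally show ?thesis by (simp add: right_diff_distrib[symmetric] mult_ac del: right_diff_distrib)
    qed
    have i: "integrable lborel (\<lambda>s. \<eta> s * atom 1 (Complex b v) s)" "integrable lborel (\<lambda>s. \<eta> s * atom 1 (Complex b (- v)) s)"
      using v by (intro L2_mult_integrable \<eta> atom_L2; simp)+
    show ?thesis
      unfolding eq integral_mult_right_zero Bochner_Integration.integral_diff[OF i]
      using z[of "Complex b v"] z[of "Complex b (- v)"] v by simp
  qed
  have Pi: "(\<integral>b. indicator {p..q} b *\<^sub>R P M b s \<partial>lborel) = arctan ((q - s) * M) - arctan ((p - s) * M)"
    and Pint: "integrable lborel (\<lambda>b. indicator {p..q} b *\<^sub>R P M b s)" if M: "M \<ge> 1" for M s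
  proof -
    have d: "((\<lambda>b. arctan ((b - s) * M)) has_real_derivative P M b s) (at b)" for b
      by (auto intro!: derivative_eq_intros simp: P_def inverse_eq_divide)
    have c: "continuous_on {p..q} (\<lambda>b. P M b s)"
      unfolding P_def by (intro continuous_intros) (auto simp: add_nonneg_eq_0_iff)
    show i: "integrable lborel (\<lambda>b. indicator {p..q} b *\<^sub>R P M b s)"
      using borel_integrable_atLeastAtMost'[OF c] by (simp add: set_integrable_def)
    have "((\<lambda>b. P M b s) has_integral (arctan ((q - s) * M) - arctan ((p - s) * M))) {p..q}"
      using pq d by (intro fundamental_theorem_of_calculus)
        (auto intro: has_vector_derivative_at_within simp: has_real_derivative_iff_has_vector_derivative)
    with set_borel_integral_eq_integral(2)[of "{p..q}" "\<lambda>b. P M b s"] i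
    show "(\<integral>b. indicator {p..q} b *\<^sub>R P M b s \<partial>lborel) = arctan ((q - s) * M) - arctan ((p - s) * M)"
      by (simp add: set_lebesgue_integral_def set_integrable_def integral_unique)
  qed
  have P0: "P M b s \<ge> 0" if "M \<ge> 1" for M b s
    using that by (simp add: P_def)
  define K where "K = pi * (1 + 4 * (\<bar>p\<bar> + \<bar>q\<bar> + 1)\<^sup>2) + 8 * (q - p)"
  have K: "K \<ge> 0" using pq by (auto simp: K_def)
  have Kint: "integrable lborel (\<lambda>s. norm (\<eta> s) * (K / (1 + s\<^sup>2)))"
  proof (rule Bochner_Integration.integrable_bound)
    show "integrable lborel (\<lambda>s. K * ((norm (\<eta> s))\<^sup>2 + 1 / (1 + s\<^sup>2)))"
      using \<eta> integrable_1_div_1_plus_square by (intro integrable_mult_right Bochner_Integration.integrable_add) (auto simp: L2_iff)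
    show "AE s in lborel. norm (norm (\<eta> s) * (K / (1 + s\<^sup>2))) \<le> norm (K * ((norm (\<eta> s))\<^sup>2 + 1 / (1 + s\<^sup>2)))"
    proof (rule AE_I2)
      fix s :: real
      define y where "y = 1 / (1 + s\<^sup>2)"
      have y: "0 \<le> y" "y \<le> 1" by (auto simp: y_def divide_simps add_pos_nonneg)
      have "norm (\<eta> s) * y \<le> (norm (\<eta> s))\<^sup>2 + y\<^sup>2"
        by (rule mult_le_sum_squares) (use y in auto)
      also have "y\<^sup>2 \<le> y" using y by (simp add: power2_eq_square mult_left_le)
      finally have "K * (norm (\<eta> s) * y) \<le> K * ((norm (\<eta> s))\<^sup>2 + y)"
        using K by (intro mult_left_mono) auto
      then show "norm (norm (\<eta> s) * (K / (1 + s\<^sup>2))) \<le> norm (K * ((norm (\<eta> s))\<^sup>2 + 1 / (1 + s\<^sup>2)))"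
        using K y by (simp add: y_def mult_ac)
    qed
  qed measurable
  have zero: "(\<integral>s. \<eta> s * of_real (arctan ((q - s) * M) - arctan ((p - s) * M)) \<partial>lborel) = 0" if M: "M \<ge> 1" for M
  proof -
    have "(\<integral>s. \<eta> s * of_real (arctan ((q - s) * M) - arctan ((p - s) * M)) \<partial>lborel) =
        (\<integral>s. (\<integral>b. \<eta> s * of_real (indicator {p..q} b *\<^sub>R P M b s) \<partial>lborel) \<partial>lborel)"
      unfolding Pi[OF M, symmetric] by (simp only: integral_mult_right_zero integral_complex_of_real)
    also have "\<dots> = (\<integral>b. (\<integral>s. \<eta> s * of_real (indicator {p..q} b *\<^sub>R P M b s) \<partial>lborel) \<partial>lborel)"
    proof (rule integrable_iterated_integral(3)[OF sigma_finite_lborel sigma_finite_lborel pair_integrableI[OF sigma_finite_lborel sigma_finite_lborel]])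
      have "(\<integral>\<^sup>+s. \<integral>\<^sup>+b. ennreal (norm (\<eta> s * of_real (indicator {p..q} b *\<^sub>R P M b s))) \<partial>lborel \<partial>lborel) =
          (\<integral>\<^sup>+s. ennreal (norm (\<eta> s)) * ennreal (arctan ((q - s) * M) - arctan ((p - s) * M)) \<partial>lborel)"
      proof (rule nn_integral_cong)
        fix s
        have "(\<integral>\<^sup>+b. ennreal (norm (\<eta> s * of_real (indicator {p..q} b *\<^sub>R P M b s))) \<partial>lborel) =
            ennreal (norm (\<eta> s)) * (\<integral>\<^sup>+b. ennreal (indicator {p..q} b *\<^sub>R P M b s) \<partial>lborel)"
          using P0[OF M] by (subst nn_integral_cmult[symmetric])
            (auto simp: norm_mult ennreal_mult[symmetric] abs_mult)
        also have "(\<integral>\<^sup>+b. ennreal (indicator {p..q} b *\<^sub>R P M b s) \<partial>lborel) = ennreal (arctan ((q - s) * M) - arctan ((p - s) * M))"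
          using P0[OF M] by (subst nn_integral_eq_integral[OF Pint[OF M]]) (auto simp: Pi[OF M, simplified])
        finally show "(\<integral>\<^sup>+b. ennreal (norm (\<eta> s * of_real (indicator {p..q} b *\<^sub>R P M b s))) \<partial>lborel) =
            ennreal (norm (\<eta> s)) * ennreal (arctan ((q - s) * M) - arctan ((p - s) * M))" .
      qed
      also have "\<dots> \<le> (\<integral>\<^sup>+s. ennreal (norm (\<eta> s) * (K / (1 + s\<^sup>2))) \<partial>lborel)"
      proof (rule nn_integral_mono)
        fix s
        have "arctan ((q - s) * M) - arctan ((p - s) * M) \<le> K / (1 + s\<^sup>2)"
          using arctan_difference_bound[OF pq M, of s] unfolding K_def by (rule order_trans[OF abs_ge_self])
        then have "ennreal (norm (\<eta> s)) * ennreal (arctan ((q - s) * M) - arctan ((p - s) * M)) \<le> ennreal (norm (\<eta> s)) * ennreal (K / (1 + s\<^sup>2))"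
          by (intro mult_left_mono ennreal_leI) auto
        then show "ennreal (norm (\<eta> s)) * ennreal (arctan ((q - s) * M) - arctan ((p - s) * M)) \<le> ennreal (norm (\<eta> s) * (K / (1 + s\<^sup>2)))"
          using K by (subst ennreal_mult) auto
      qed
      also have "\<dots> < \<infinity>"
        using integrableD(2)[OF Kint] K by (simp add: integrable_iff_bounded abs_mult less_top)
      finally show "(\<integral>\<^sup>+s. \<integral>\<^sup>+b. ennreal (norm (\<eta> s * of_real (indicator {p..q} b *\<^sub>R P M b s))) \<partial>lborel \<partial>lborel) < \<infinity>" .
      show "(\<lambda>(s, b). \<eta> s * complex_of_real (indicator {p..q} b *\<^sub>R P M b s)) \<in> borel_measurable (lborel \<Otimes>\<^sub>M lborel)"
        unfolding P_def by measurable
    qed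
    also have "\<dots> = (\<integral>b. 0 \<partial>(lborel :: real measure))"
    proof (rule Bochner_Integration.integral_cong[OF refl])
      fix b
      have "(\<integral>s. \<eta> s * of_real (indicator {p..q} b *\<^sub>R P M b s) \<partial>lborel) = (\<integral>s. of_real (indicator {p..q} b) * (\<eta> s * of_real (P M b s)) \<partial>lborel)"
        by (simp add: mult_ac)
      also have "\<dots> = of_real (indicator {p..q} b) * (\<integral>s. \<eta> s * of_real (P M b s) \<partial>lborel)"
        by (rule integral_mult_right_zero)
      finally show "(\<integral>s. \<eta> s * of_real (indicator {p..q} b *\<^sub>R P M b s) \<partial>lborel) = 0"
        using Pz[OF M] by simp
    qed
    finally show ?thesis by simp
  qed
  have "(\<lambda>N. \<integral>s. \<eta> s * of_real (arctan ((q - s) * real (Suc N)) - arctan ((p - s) * real (Suc N))) \<partial>lborel) \<longlonglongrightarrow>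
      (\<integral>s. \<eta> s * of_real (pi * indicator {p<..<q} s) \<partial>lborel)"
  proof (rule integral_dominated_convergence[OF _ _ Kint])
    show "AE s in lborel. (\<lambda>N. \<eta> s * of_real (arctan ((q - s) * real (Suc N)) - arctan ((p - s) * real (Suc N)))) \<longlonglongrightarrow> \<eta> s * of_real (pi * indicator {p<..<q} s)"
      using AE_lborel_singleton[of p] AE_lborel_singleton[of q]
      by eventually_elim (intro tendsto_mult tendsto_const tendsto_of_real Poisson_interval_limit pq)
    show "AE s in lborel. norm (\<eta> s * of_real (arctan ((q - s) * real (Suc N)) - arctan ((p - s) * real (Suc N)))) \<le> norm (\<eta> s) * (K / (1 + s\<^sup>2))" for N
    proof (rule AE_I2)
      fix s
      have "norm (complex_of_real (arctan ((q - s) * real (Suc N)) - arctan ((p - s) * real (Suc N)))) \<le> K / (1 + s\<^sup>2)"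
        unfolding norm_of_real K_def by (rule arctan_difference_bound[OF pq]) simp
      then show "norm (\<eta> s * of_real (arctan ((q - s) * real (Suc N)) - arctan ((p - s) * real (Suc N)))) \<le> norm (\<eta> s) * (K / (1 + s\<^sup>2))"
        unfolding norm_mult by (rule mult_left_mono) simp
    qed
  qed measurable
  then have "(\<integral>s. \<eta> s * of_real (pi * indicator {p<..<q} s) \<partial>lborel) = 0"
    unfolding zero[of "real (Suc _)", simplified] using zero[of "real (Suc _)"] by (simp add: LIMSEQ_const_iff)
  also have "(\<integral>s. \<eta> s * of_real (pi * indicator {p<..<q} s) \<partial>lborel) = (\<integral>s. of_real pi * (indicator {p<..<q} s *\<^sub>R \<eta> s) \<partial>lborel)"
    by (intro Bochner_Integration.integral_cong refl) (auto simp: indicator_def)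
  also have "\<dots> = of_real pi * (\<integral>s. indicator {p<..<q} s *\<^sub>R \<eta> s \<partial>lborel)"
    by (rule integral_mult_right_zero)
  finally show "(\<integral>s. indicator {p<..<q} s *\<^sub>R \<eta> s \<partial>lborel) = 0"
    by simp
qed

text \<open>The induction concerns the implication from vanishing of all order n coefficients to
  \<eta> = 0, with the poles quantified inside, because the descent from order n + 1 uses a whole
  ray of poles.\<close>

lemma ex_atom_coefficient_neq_0:
  assumes \<eta>: "\<eta> \<in> L2" and nz: "\<not> (AE x in lborel. \<eta> x = 0)" and n: "n \<ge> 1"
  obtains w where "Im w \<noteq> 0" "(\<integral>s. \<eta> s * atom n w s \<partial>lborel) \<noteq> 0"
proof -
  have "AE x in lborel. \<eta> x = 0" if "\<And>w. Im w \<noteq> 0 \<Longrightarrow> (\<integral>s. \<eta> s * atom n w s \<partial>lborel) = 0"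
    using n that
  proof (induction n rule: nat_induct_at_least)
    case base
    then show ?case by (intro AE_eq_0_if_atom_1_coefficients_eq_0[OF \<eta>])
  next
    case (Suc n)
    then show ?case using atom_coefficient_descent[OF \<eta>] by blast
  qed
  with nz that show ?thesis by blast
qed

section \<open>Lebesgue spaces\<close>

text \<open>The graph of u^q lies above its tangent at \<tau>; after scaling by \<tau> this is
  Young's inequality for u / \<tau> and 1. Both Minkowski's inequality and Schur's test are derived
  from it.\<close>

lemma powr_tangent:
  fixes u \<tau> q :: real
  assumes q: "q \<ge> 1" and u: "u \<ge> 0" and \<tau>: "\<tau> > 0"
  shows "\<tau> powr q + q * \<tau> powr (q - 1) * (u - \<tau>) \<le> u powr q"
proof (cases "q = 1")
  case False
  then have q1: "q > 1" using q by simp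
  define q' where "q' = q / (q - 1)"
  have q': "q' > 1" "1 / q + 1 / q' = 1"
    using q1 by (auto simp: q'_def field_simps)
  have "u / \<tau> * 1 \<le> (u / \<tau>) powr q / q + 1 powr q' / q'"
    using u \<tau> by (intro Youngs_inequality q1 q') auto
  then have "u / \<tau> \<le> (u / \<tau>) powr q / q + (1 - 1 / q)"
    using q'(2) by simp
  then have "q * (u / \<tau>) \<le> q * ((u / \<tau>) powr q / q + (1 - 1 / q))"
    using q1 by (intro mult_left_mono) auto
  then have "1 + q * (u / \<tau> - 1) \<le> (u / \<tau>) powr q"
    using q1 by (simp add: algebra_simps)
  then have "\<tau> powr q * (1 + q * (u / \<tau> - 1)) \<le> \<tau> powr q * (u / \<tau>) powr q"
    by (intro mult_left_mono) auto
  also have "\<tau> powr q * (u / \<tau>) powr q = u powr q"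
    using u \<tau> by (simp add: powr_mult[symmetric])
  also have "\<tau> powr q * (1 + q * (u / \<tau> - 1)) = \<tau> powr q + q * (\<tau> powr q / \<tau>) * (u - \<tau>)"
    using \<tau> by (simp add: field_simps)
  also have "\<tau> powr q / \<tau> = \<tau> powr (q - 1)"
    using \<tau> by (simp add: powr_diff)
  finally show ?thesis .
qed (use u \<tau> in simp)

lemma powr_convex_combination:
  fixes x y t q :: real
  assumes q: "q \<ge> 1" and xy: "x \<ge> 0" "y \<ge> 0" and t: "0 < t" "t < 1"
  shows "(t * x + (1 - t) * y) powr q \<le> t * x powr q + (1 - t) * y powr q"
proof (cases "t * x + (1 - t) * y = 0")
  case False
  define \<tau> where "\<tau> = t * x + (1 - t) * y"
  have \<tau>: "\<tau> > 0" using False xy t by (simp add: \<tau>_def less_le)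
  define D where "D = q * \<tau> powr (q - 1)"
  have "t * (\<tau> powr q + D * (x - \<tau>)) + (1 - t) * (\<tau> powr q + D * (y - \<tau>)) \<le> t * x powr q + (1 - t) * y powr q"
    unfolding D_def using t xy by (intro add_mono mult_left_mono powr_tangent q \<tau>) auto
  also have "t * (\<tau> powr q + D * (x - \<tau>)) + (1 - t) * (\<tau> powr q + D * (y - \<tau>)) = \<tau> powr q + D * (t * x + (1 - t) * y - \<tau>)"
    by (simp add: algebra_simps)
  finally show ?thesis by (simp add: \<tau>_def)
qed (use xy t in simp)

text \<open>The estimates below end in an explicit bound B. This rule turns such a bound into
  membership and norm estimate at once, for finite and infinite exponents.\<close>

lemma Lp_spaceI:
  assumes F: "F \<in> borel_measurable M" and B: "B \<ge> 0" and p: "1 \<le> p"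
    and fin: "p \<noteq> \<infinity> \<Longrightarrow> (\<integral>\<^sup>+x. ennreal (norm (F x) powr enn2real p) \<partial>M) \<le> ennreal (B powr enn2real p)"
    and inf: "p = \<infinity> \<Longrightarrow> AE x in M. norm (F x) \<le> B"
  shows "F \<in> Lp_space p M" "Lp_norm p M F \<le> B"
proof -
  note [measurable] = F
  have "F \<in> Lp_space p M \<and> Lp_norm p M F \<le> B"
  proof (cases "p = \<infinity>")
    case True
    have "esssup M (\<lambda>x. ennreal (norm (F x))) \<le> ennreal B"
      using inf[OF True] by (intro esssup_I) (auto elim!: eventually_mono intro: ennreal_leI)
    then have "esssup M (\<lambda>x. ennreal (norm (F x))) < \<infinity>" "enn2real (esssup M (\<lambda>x. ennreal (norm (F x)))) \<le> B"
      using B by (auto simp: less_top[symmetric] top_unique intro!: enn2real_leI)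
    then show ?thesis using F True by (simp add: Lp_space_def Lp_norm_def)
  next
    case False
    define q where "q = enn2real p"
    have q: "q \<ge> 1"
      using p False by (cases p rule: ennreal_cases) (auto simp: q_def)
    have le: "(\<integral>\<^sup>+x. ennreal (norm (F x) powr q) \<partial>M) \<le> ennreal (B powr q)"
      using fin[OF False] by (simp add: q_def)
    then have i: "integrable M (\<lambda>x. norm (F x) powr q)"
      by (auto simp: integrable_iff_bounded intro: le_less_trans)
    have "(\<integral>x. norm (F x) powr q \<partial>M) \<le> B powr q"
      using le by (subst (asm) nn_integral_eq_integral[OF i]) auto
    then have "(\<integral>x. norm (F x) powr q \<partial>M) powr (1 / q) \<le> (B powr q) powr (1 / q)"
      using q by (intro powr_mono2 integral_nonneg_AE) auto
    also have "(B powr q) powr (1 / q) = B" using B q by (simp add: powr_powr)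
    finally show ?thesis
      using F False i by (simp add: Lp_space_def Lp_norm_def q_def)
  qed
  then show "F \<in> Lp_space p M" "Lp_norm p M F \<le> B" by auto
qed

lemma Lp_norm_nonneg: "0 \<le> Lp_norm p M F"
  by (simp add: Lp_norm_def)

lemma Lp_measurable: "F \<in> Lp_space p M \<Longrightarrow> F \<in> borel_measurable M"
  by (simp add: Lp_space_def)

lemma Lp_space_nn_integral:
  assumes F: "F \<in> Lp_space p M" and p: "1 \<le> p" "p \<noteq> \<infinity>"
  shows "(\<integral>\<^sup>+x. ennreal (norm (F x) powr enn2real p) \<partial>M) = ennreal (Lp_norm p M F powr enn2real p)"
proof -
  have q: "enn2real p \<ge> 1"
    using p by (cases p rule: ennreal_cases) auto
  have i: "integrable M (\<lambda>x. norm (F x) powr enn2real p)"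
    using F p by (simp add: Lp_space_def)
  have "(\<integral>x. norm (F x) powr enn2real p \<partial>M) = Lp_norm p M F powr enn2real p"
    using p q by (simp add: Lp_norm_def powr_powr integral_nonneg_AE)
  then show ?thesis by (subst nn_integral_eq_integral[OF i]) auto
qed

lemma Lp_space_AE:
  assumes F: "F \<in> Lp_space \<infinity> M"
  shows "AE x in M. norm (F x) \<le> Lp_norm \<infinity> M F"
proof -
  have "AE x in M. ennreal (norm (F x)) \<le> esssup M (\<lambda>x. ennreal (norm (F x)))"
    by (rule esssup_AE)
  then show ?thesis
  proof eventually_elim
    case (elim x)
    then show ?case
      using enn2real_mono[OF elim] F by (simp add: Lp_space_def Lp_norm_def less_top)
  qed
qed

lemma Lp_space_add:
  assumes p: "1 \<le> p" and f: "f \<in> Lp_space p M" and g: "g \<in> Lp_space p M"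
  shows "(\<lambda>x. f x + g x) \<in> Lp_space p M" "Lp_norm p M (\<lambda>x. f x + g x) \<le> Lp_norm p M f + Lp_norm p M g"
proof -
  note [measurable] = Lp_measurable[OF f] Lp_measurable[OF g]
  define A where "A = Lp_norm p M f"
  define B where "B = Lp_norm p M g"
  have AB: "A \<ge> 0" "B \<ge> 0" by (auto simp: A_def B_def Lp_norm_nonneg)
  have key: "(\<lambda>x. f x + g x) \<in> Lp_space p M \<and> Lp_norm p M (\<lambda>x. f x + g x) \<le> A + B + e" if e: "e > 0" for e
  proof -
    \<comment> \<open>The slack e keeps both normalising constants positive when a norm is 0. The
      functions divided by \<alpha> and \<beta> have norm at most 1 and are combined with weights
      proportional to \<alpha> and \<beta>, which is where convexity applies.\<close>
    define \<alpha> where "\<alpha> = A + e / 2"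
    define \<beta> where "\<beta> = B + e / 2"
    have ab: "\<alpha> > 0" "\<beta> > 0" "A \<le> \<alpha>" "B \<le> \<beta>" "\<alpha> + \<beta> = A + B + e"
      using AB e by (auto simp: \<alpha>_def \<beta>_def)
    have fin: "(\<integral>\<^sup>+x. ennreal (norm (f x + g x) powr enn2real p) \<partial>M) \<le> ennreal ((A + B + e) powr enn2real p)" if pf: "p \<noteq> \<infinity>"
    proof -
      define q where "q = enn2real p"
      have q: "q \<ge> 1"
        using p pf by (cases p rule: ennreal_cases) (auto simp: q_def)
      define t where "t = \<alpha> / (\<alpha> + \<beta>)"
      have t: "0 < t" "t < 1" and t1: "1 - t = \<beta> / (\<alpha> + \<beta>)" using ab by (auto simp: t_def field_simps)
      define S where "S = (\<alpha> + \<beta>) powr q"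
      have S: "S \<ge> 0" by (simp add: S_def)
      define cf where "cf = S * t / \<alpha> powr q"
      define cg where "cg = S * (1 - t) / \<beta> powr q"
      have c: "cf \<ge> 0" "cg \<ge> 0" using t S by (auto simp: cf_def cg_def)
      have pt: "norm (f x + g x) powr q \<le> cf * norm (f x) powr q + cg * norm (g x) powr q" for x
      proof -
        have "norm (f x + g x) powr q \<le> (norm (f x) + norm (g x)) powr q"
          using q by (intro powr_mono2 norm_triangle_ineq) auto
        also have "norm (f x) + norm (g x) = (\<alpha> + \<beta>) * (t * (norm (f x) / \<alpha>) + (1 - t) * (norm (g x) / \<beta>))"
          unfolding t1 using ab by (simp add: t_def distrib_left)
        also have "\<dots> powr q = S * (t * (norm (f x) / \<alpha>) + (1 - t) * (norm (g x) / \<beta>)) powr q"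
          unfolding S_def by (rule powr_mult)
        also have "\<dots> \<le> S * (t * (norm (f x) / \<alpha>) powr q + (1 - t) * (norm (g x) / \<beta>) powr q)"
          using ab t S by (intro mult_left_mono powr_convex_combination q) auto
        also have "\<dots> = cf * norm (f x) powr q + cg * norm (g x) powr q"
          using ab by (simp add: powr_divide cf_def cg_def distrib_left)
        finally show ?thesis .
      qed
      have "(\<integral>\<^sup>+x. ennreal (norm (f x + g x) powr q) \<partial>M) \<le>
          (\<integral>\<^sup>+x. ennreal cf * ennreal (norm (f x) powr q) + ennreal cg * ennreal (norm (g x) powr q) \<partial>M)"
      proof (rule nn_integral_mono)
        fix x
        have "ennreal (norm (f x + g x) powr q) \<le> ennreal (cf * norm (f x) powr q + cg * norm (g x) powr q)"
          by (rule ennreal_leI[OF pt])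
        also have "\<dots> = ennreal cf * ennreal (norm (f x) powr q) + ennreal cg * ennreal (norm (g x) powr q)"
          using c by (simp add: ennreal_mult)
        finally show "ennreal (norm (f x + g x) powr q) \<le> \<dots>" .
      qed
      also have "\<dots> = ennreal cf * ennreal (A powr q) + ennreal cg * ennreal (B powr q)"
        using Lp_space_nn_integral[OF f p pf] Lp_space_nn_integral[OF g p pf]
        by (subst nn_integral_add) (auto simp: nn_integral_cmult A_def B_def q_def)
      also have "\<dots> = ennreal (cf * A powr q + cg * B powr q)"
        using c by (simp add: ennreal_mult)
      also have "\<dots> \<le> ennreal S"
      proof (rule ennreal_leI)
        have "cf * A powr q \<le> cf * \<alpha> powr q" "cg * B powr q \<le> cg * \<beta> powr q"
          using ab AB c q by (auto intro!: mult_left_mono powr_mono2)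
        then have "cf * A powr q + cg * B powr q \<le> cf * \<alpha> powr q + cg * \<beta> powr q" by simp
        also have "\<dots> = S"
        proof -
          have cancel: "x / y * y = x" if "y \<noteq> 0" for x y :: real using that by simp
          have ne: "\<alpha> powr q \<noteq> 0" "\<beta> powr q \<noteq> 0" using ab by auto
          show ?thesis
            unfolding cf_def cg_def cancel[OF ne(1)] cancel[OF ne(2)] by (simp add: algebra_simps)
        qed
        finally show "cf * A powr q + cg * B powr q \<le> S" .
      qed
      finally show ?thesis using ab by (simp add: S_def q_def)
    qed
    have inf: "AE x in M. norm (f x + g x) \<le> A + B + e" if pi: "p = \<infinity>"
      using Lp_space_AE[OF f[unfolded pi]] Lp_space_AE[OF g[unfolded pi]]
    proof eventually_elim
      case (elim x)
      then show ?case
        using norm_triangle_ineq[of "f x" "g x"] e by (simp add: A_def B_def pi)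
    qed
    show ?thesis
      using Lp_spaceI[of "\<lambda>x. f x + g x" M "A + B + e" p] AB e p fin inf by simp
  qed
  show "(\<lambda>x. f x + g x) \<in> Lp_space p M" using key[of 1] by simp
  show "Lp_norm p M (\<lambda>x. f x + g x) \<le> Lp_norm p M f + Lp_norm p M g"
    by (rule field_le_epsilon) (use key in \<open>simp add: A_def B_def\<close>)
qed

lemma Lp_space_cmult_le:
  assumes p: "1 \<le> p" and f: "f \<in> Lp_space p M"
  shows "(\<lambda>x. c * f x) \<in> Lp_space p M" "Lp_norm p M (\<lambda>x. c * f x) \<le> norm c * Lp_norm p M f"
proof -
  note [measurable] = Lp_measurable[OF f]
  have fin: "(\<integral>\<^sup>+x. ennreal (norm (c * f x) powr enn2real p) \<partial>M) \<le> ennreal ((norm c * Lp_norm p M f) powr enn2real p)" if pf: "p \<noteq> \<infinity>"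
    using Lp_space_nn_integral[OF f p pf]
    by (simp add: norm_mult powr_mult ennreal_mult nn_integral_cmult Lp_norm_nonneg)
  have inf: "AE x in M. norm (c * f x) \<le> norm c * Lp_norm p M f" if pi: "p = \<infinity>"
    using Lp_space_AE[OF f[unfolded pi]]
    by eventually_elim (simp add: norm_mult pi mult_left_mono)
  show "(\<lambda>x. c * f x) \<in> Lp_space p M" "Lp_norm p M (\<lambda>x. c * f x) \<le> norm c * Lp_norm p M f"
    using Lp_spaceI[of "\<lambda>x. c * f x" M "norm c * Lp_norm p M f" p] p fin inf by (auto simp: Lp_norm_nonneg)
qed

lemma Lp_norm_zero [simp]: "1 \<le> p \<Longrightarrow> Lp_norm p M (\<lambda>_. 0) = 0" and Lp_space_zero: "1 \<le> p \<Longrightarrow> (\<lambda>_. 0) \<in> Lp_space p M"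
  using Lp_spaceI[of "\<lambda>_. 0" M 0 p] Lp_norm_nonneg[of p M "\<lambda>_. 0"] by auto

lemma Lp_norm_cmult:
  assumes p: "1 \<le> p" and f: "f \<in> Lp_space p M"
  shows "Lp_norm p M (\<lambda>x. c * f x) = norm c * Lp_norm p M f"
proof (cases "c = 0")
  case False
  have "Lp_norm p M (\<lambda>x. (1 / c) * (c * f x)) \<le> norm (1 / c) * Lp_norm p M (\<lambda>x. c * f x)"
    by (rule Lp_space_cmult_le(2)[OF p Lp_space_cmult_le(1)[OF p f]])
  then have "norm c * Lp_norm p M f \<le> Lp_norm p M (\<lambda>x. c * f x)"
    using False by (simp add: norm_divide field_simps)
  with Lp_space_cmult_le(2)[OF p f, of c] show ?thesis by simp
qed (use p in simp)

text \<open>With a common constant A for rows and columns the operator bound is A for every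
  exponent. F enters through a pointwise domination, so the test applies to sums, to group integrals
  and to values of functionals alike.\<close>

lemma Schur_test:
  fixes k :: "'a \<Rightarrow> 'b \<Rightarrow> real" and F :: "'a \<Rightarrow> complex" and f :: "'b \<Rightarrow> complex"
  assumes M: "sigma_finite_measure M" and N: "sigma_finite_measure N"
    and k[measurable]: "case_prod k \<in> borel_measurable (M \<Otimes>\<^sub>M N)" and k0: "\<And>x y. k x y \<ge> 0"
    and A: "A > 0" and row: "\<And>x. x \<in> space M \<Longrightarrow> (\<integral>\<^sup>+y. ennreal (k x y) \<partial>N) \<le> ennreal A"
    and col: "\<And>y. y \<in> space N \<Longrightarrow> (\<integral>\<^sup>+x. ennreal (k x y) \<partial>M) \<le> ennreal A"
    and p: "1 \<le> p" and f: "f \<in> Lp_space p N" and F[measurable]: "F \<in> borel_measurable M"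
    and Fle: "\<And>x. x \<in> space M \<Longrightarrow> ennreal (norm (F x)) \<le> (\<integral>\<^sup>+y. ennreal (k x y * norm (f y)) \<partial>N)"
  shows "F \<in> Lp_space p M" "Lp_norm p M F \<le> A * Lp_norm p N f"
proof -
  interpret pair_sigma_finite M N using M N by (simp add: pair_sigma_finite_def)
  note [measurable] = Lp_measurable[OF f]
  define B where "B = Lp_norm p N f"
  have B: "B \<ge> 0" by (simp add: B_def Lp_norm_nonneg)
  have fin: "(\<integral>\<^sup>+x. ennreal (norm (F x) powr enn2real p) \<partial>M) \<le> ennreal ((A * B) powr enn2real p)" if pf: "p \<noteq> \<infinity>"
  proof -
    define q where "q = enn2real p"
    have q: "q \<ge> 1"
      using p pf by (cases p rule: ennreal_cases) (auto simp: q_def)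
    have pt: "ennreal (norm (F x) powr q) \<le> ennreal (A powr (q - 1)) * (\<integral>\<^sup>+y. ennreal (k x y * norm (f y) powr q) \<partial>N)" if x: "x \<in> space M" for x
    proof (cases "F x = 0 \<or> (\<integral>\<^sup>+y. ennreal (k x y * norm (f y) powr q) \<partial>N) = \<infinity>")
      case True
      then show ?thesis using A by (auto simp: ennreal_mult_top)
    next
      case False
      define u where "u = norm (F x)"
      have u: "u > 0" using False by (simp add: u_def)
      obtain J where J: "J \<ge> 0" "(\<integral>\<^sup>+y. ennreal (k x y * norm (f y) powr q) \<partial>N) = ennreal J"
        using False by (cases "\<integral>\<^sup>+y. ennreal (k x y * norm (f y) powr q) \<partial>N" rule: ennreal_cases) auto
      have [measurable]: "k x \<in> borel_measurable N"
        using measurable_Pair2[OF k x] by simp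
      \<comment> \<open>The tangents at this \<tau> are integrated against the row, whose mass is at
        most A: the terms without J then add up to at most (q - 1) u, and what remains is Jensen's
        inequality \<open>u^q \<le> A^(q - 1) J\<close>.\<close>
      define \<tau> where "\<tau> = u / A"
      have \<tau>: "\<tau> > 0" using u A by (simp add: \<tau>_def)
      define D where "D = \<tau> powr (1 - q)"
      have D: "D > 0" using \<tau> by (simp add: D_def)
      have D1: "D * \<tau> powr q = \<tau>" "D * \<tau> powr (q - 1) = 1"
        using \<tau> by (simp_all add: D_def powr_add[symmetric])
      have yv: "q * v \<le> (q - 1) * \<tau> + D * v powr q" if "v \<ge> 0" for v
      proof -
        have "D * (\<tau> powr q + q * \<tau> powr (q - 1) * (v - \<tau>)) \<le> D * v powr q"
          using powr_tangent[OF q that \<tau>] D by (intro mult_left_mono) auto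
        also have "D * (\<tau> powr q + q * \<tau> powr (q - 1) * (v - \<tau>)) = D * \<tau> powr q + q * (D * \<tau> powr (q - 1)) * (v - \<tau>)"
          by (simp add: algebra_simps)
        finally show ?thesis unfolding D1 by (simp add: algebra_simps)
      qed
      have "ennreal (q * u) \<le> ennreal q * (\<integral>\<^sup>+y. ennreal (k x y * norm (f y)) \<partial>N)"
        using Fle[OF x] q by (simp add: ennreal_mult u_def mult_left_mono)
      also have "\<dots> = (\<integral>\<^sup>+y. ennreal q * ennreal (k x y * norm (f y)) \<partial>N)"
        by (rule nn_integral_cmult[symmetric]) measurable
      also have "\<dots> \<le> (\<integral>\<^sup>+y. ennreal ((q - 1) * \<tau>) * ennreal (k x y) + ennreal D * ennreal (k x y * norm (f y) powr q) \<partial>N)"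
      proof (rule nn_integral_mono)
        fix y
        have "k x y * (q * norm (f y)) \<le> k x y * ((q - 1) * \<tau> + D * norm (f y) powr q)"
          by (intro mult_left_mono yv k0) auto
        then have "ennreal (q * (k x y * norm (f y))) \<le> ennreal ((q - 1) * \<tau> * k x y + D * (k x y * norm (f y) powr q))"
          by (intro ennreal_leI) (simp add: algebra_simps)
        also have "\<dots> = ennreal ((q - 1) * \<tau>) * ennreal (k x y) + ennreal D * ennreal (k x y * norm (f y) powr q)"
          using q \<tau> D k0[of x y] by (simp add: ennreal_mult)
        finally show "ennreal q * ennreal (k x y * norm (f y)) \<le> \<dots>"
          using q k0[of x y] by (simp add: ennreal_mult)
      qed
      also have "\<dots> = ennreal ((q - 1) * \<tau>) * (\<integral>\<^sup>+y. ennreal (k x y) \<partial>N) + ennreal D * ennreal J"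
        by (subst nn_integral_add) (auto simp: nn_integral_cmult J(2)[symmetric])
      also have "\<dots> \<le> ennreal ((q - 1) * \<tau>) * ennreal A + ennreal D * ennreal J"
        by (intro add_right_mono mult_left_mono row x) auto
      also have "\<dots> = ennreal ((q - 1) * u + D * J)"
        using q \<tau> A D J by (simp add: ennreal_mult[symmetric] \<tau>_def ennreal_plus[symmetric] u less_imp_le del: ennreal_plus)
      finally have "q * u \<le> (q - 1) * u + D * J"
        using D J q u by (subst (asm) ennreal_le_iff) auto
      then have "u \<le> D * J" by (simp add: algebra_simps)
      then have "\<tau> powr (q - 1) * u \<le> \<tau> powr (q - 1) * (D * J)"
        by (intro mult_left_mono) auto
      also have "\<dots> = J" using D1(2) by (simp add: mult_ac)
      also have "\<tau> powr (q - 1) * u = u powr q / A powr (q - 1)"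
        using u A by (simp add: \<tau>_def powr_divide powr_diff)
      finally have "u powr q \<le> A powr (q - 1) * J"
        using A by (simp add: pos_divide_le_eq mult.commute)
      then show ?thesis
        unfolding J(2) u_def[symmetric] using J(1) by (subst ennreal_mult[symmetric]) (auto intro: ennreal_leI)
    qed
    have "(\<integral>\<^sup>+x. ennreal (norm (F x) powr q) \<partial>M) \<le>
        (\<integral>\<^sup>+x. ennreal (A powr (q - 1)) * (\<integral>\<^sup>+y. ennreal (k x y * norm (f y) powr q) \<partial>N) \<partial>M)"
      by (intro nn_integral_mono pt)
    also have "\<dots> = ennreal (A powr (q - 1)) * (\<integral>\<^sup>+x. (\<integral>\<^sup>+y. ennreal (k x y * norm (f y) powr q) \<partial>N) \<partial>M)"
      by (rule nn_integral_cmult) measurable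
    also have "(\<integral>\<^sup>+x. (\<integral>\<^sup>+y. ennreal (k x y * norm (f y) powr q) \<partial>N) \<partial>M) = (\<integral>\<^sup>+y. (\<integral>\<^sup>+x. ennreal (k x y * norm (f y) powr q) \<partial>M) \<partial>N)"
      by (rule Fubini'[symmetric]) measurable
    also have "\<dots> \<le> (\<integral>\<^sup>+y. ennreal A * ennreal (norm (f y) powr q) \<partial>N)"
    proof (rule nn_integral_mono)
      fix y assume y: "y \<in> space N"
      have [measurable]: "(\<lambda>x. k x y) \<in> borel_measurable M"
        using measurable_Pair1[OF k y] by simp
      have "(\<integral>\<^sup>+x. ennreal (k x y * norm (f y) powr q) \<partial>M) = (\<integral>\<^sup>+x. ennreal (k x y) \<partial>M) * ennreal (norm (f y) powr q)"
        using k0 by (subst nn_integral_multc[symmetric]) (auto simp: ennreal_mult)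
      also have "\<dots> \<le> ennreal A * ennreal (norm (f y) powr q)"
        by (intro mult_right_mono col y) simp
      finally show "(\<integral>\<^sup>+x. ennreal (k x y * norm (f y) powr q) \<partial>M) \<le> \<dots>" .
    qed
    also have "\<dots> = ennreal A * ennreal (B powr q)"
      using Lp_space_nn_integral[OF f p pf] by (simp add: nn_integral_cmult B_def q_def)
    finally have "(\<integral>\<^sup>+x. ennreal (norm (F x) powr q) \<partial>M) \<le> ennreal (A powr (q - 1)) * (ennreal A * ennreal (B powr q))"
      by (simp add: mult_left_mono)
    also have "\<dots> = ennreal ((A powr (q - 1) * A) * B powr q)"
      using A by (simp add: ennreal_mult mult_ac)
    also have "A powr (q - 1) * A = A powr q"
      using A by (simp add: powr_diff)
    also have "A powr q * B powr q = (A * B) powr q"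
      using A B by (simp add: powr_mult)
    finally show ?thesis by (simp add: q_def)
  qed
  have inf: "AE x in M. norm (F x) \<le> A * B" if pi: "p = \<infinity>"
  proof (rule AE_I2)
    fix x assume x: "x \<in> space M"
    have [measurable]: "k x \<in> borel_measurable N"
      using measurable_Pair2[OF k x] by simp
    have "ennreal (norm (F x)) \<le> (\<integral>\<^sup>+y. ennreal (k x y * norm (f y)) \<partial>N)" by (rule Fle[OF x])
    also have "\<dots> \<le> (\<integral>\<^sup>+y. ennreal (k x y) * ennreal B \<partial>N)"
    proof (rule nn_integral_mono_AE)
      show "AE y in N. ennreal (k x y * norm (f y)) \<le> ennreal (k x y) * ennreal B"
        using Lp_space_AE[OF f[unfolded pi]]
        by eventually_elim (use k0 B in \<open>auto simp: ennreal_mult[symmetric] B_def pi intro!: ennreal_leI mult_left_mono\<close>)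
    qed
    also have "\<dots> = (\<integral>\<^sup>+y. ennreal (k x y) \<partial>N) * ennreal B"
      by (rule nn_integral_multc) measurable
    also have "\<dots> \<le> ennreal A * ennreal B"
      by (intro mult_right_mono row x) simp
    finally show "norm (F x) \<le> A * B"
      using A B by (simp add: ennreal_mult[symmetric] ennreal_le_iff)
  qed
  show "F \<in> Lp_space p M" "Lp_norm p M F \<le> A * Lp_norm p N f"
    using Lp_spaceI[of F M "A * B" p] p fin inf A B by (auto simp: B_def)
qed

subsection \<open>Sequence spaces\<close>

lemma Lp_count_space_le:
  fixes f :: "'a :: countable \<Rightarrow> complex"
  assumes p: "1 \<le> p" and f: "f \<in> Lp_space p (count_space UNIV)"
  shows "norm (f i) \<le> Lp_norm p (count_space UNIV) f"
proof (cases "p = \<infinity>")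
  case True
  then show ?thesis
    using Lp_space_AE[of f "count_space UNIV"] f by (simp add: AE_count_space)
next
  case False
  define q where "q = enn2real p"
  have q: "q \<ge> 1"
    using p False by (cases p rule: ennreal_cases) (auto simp: q_def)
  have "ennreal (norm (f i) powr q) = (\<integral>\<^sup>+j. ennreal (norm (f j) powr q) * indicator {i} j \<partial>count_space UNIV)"
    by (subst nn_integral_count_space_indicator[symmetric]) (auto simp: nn_integral_count_space_finite)
  also have "\<dots> \<le> (\<integral>\<^sup>+j. ennreal (norm (f j) powr q) \<partial>count_space UNIV)"
    by (intro nn_integral_mono) (auto simp: indicator_def)
  also have "\<dots> = ennreal (Lp_norm p (count_space UNIV) f powr q)"
    using Lp_space_nn_integral[OF f p False] by (simp add: q_def)
  finally have "norm (f i) powr q \<le> Lp_norm p (count_space UNIV) f powr q"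
    by simp
  then have "\<not> Lp_norm p (count_space UNIV) f < norm (f i)"
    using q powr_less_mono2[of q "Lp_norm p (count_space UNIV) f" "norm (f i)"] by (auto simp: Lp_norm_nonneg)
  then show ?thesis by simp
qed

text \<open>Coordinates are bounded by the norm, so a Cauchy sequence converges pointwise, and
  Fatou's lemma passes the norm estimate to the limit. For p = \<infinity> the estimate passes to
  the limit in each coordinate.\<close>

lemma Lp_count_space_complete:
  fixes u :: "nat \<Rightarrow> 'a :: countable \<Rightarrow> complex"
  assumes p: "1 \<le> p" and u: "\<And>n. u n \<in> Lp_space p (count_space UNIV)"
    and C: "\<And>e. e > 0 \<Longrightarrow> \<exists>K. \<forall>m\<ge>K. \<forall>n\<ge>K. Lp_norm p (count_space UNIV) (\<lambda>x. u m x - u n x) < e"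
  obtains l where "l \<in> Lp_space p (count_space UNIV)" "(\<lambda>n. Lp_norm p (count_space UNIV) (\<lambda>x. u n x - l x)) \<longlonglongrightarrow> 0"
proof -
  let ?M = "count_space (UNIV :: 'a set)"
  have diff: "(\<lambda>x. u m x - u n x) \<in> Lp_space p ?M" for m n
    using Lp_space_add(1)[OF p u[of m] Lp_space_cmult_le(1)[OF p u[of n], of "-1"]] by simp
  have "Cauchy (\<lambda>n. u n x)" for x
  proof (rule CauchyI)
    fix e :: real assume "e > 0"
    then obtain K where "\<forall>m\<ge>K. \<forall>n\<ge>K. Lp_norm p ?M (\<lambda>x. u m x - u n x) < e" using C by blast
    then show "\<exists>K. \<forall>m\<ge>K. \<forall>n\<ge>K. norm (u m x - u n x) < e"
      using Lp_count_space_le[OF p diff] by (meson le_less_trans)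
  qed
  then have "\<exists>l. (\<lambda>n. u n x) \<longlonglongrightarrow> l" for x
    by (simp add: Cauchy_convergent_iff convergent_def)
  then obtain l where l: "\<And>x. (\<lambda>n. u n x) \<longlonglongrightarrow> l x" by metis
  have key: "\<exists>K. \<forall>n\<ge>K. (\<lambda>x. u n x - l x) \<in> Lp_space p ?M \<and> Lp_norm p ?M (\<lambda>x. u n x - l x) \<le> e" if e: "e > 0" for e
  proof -
    obtain K where K: "\<And>m n. m \<ge> K \<Longrightarrow> n \<ge> K \<Longrightarrow> Lp_norm p ?M (\<lambda>x. u m x - u n x) < e" using C[OF e] by blast
    have "(\<lambda>x. u n x - l x) \<in> Lp_space p ?M \<and> Lp_norm p ?M (\<lambda>x. u n x - l x) \<le> e" if n: "n \<ge> K" for n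
    proof -
      have lim: "(\<lambda>m. norm (u n x - u m x)) \<longlonglongrightarrow> norm (u n x - l x)" for x
        by (intro tendsto_intros l)
      have fin: "(\<integral>\<^sup>+x. ennreal (norm (u n x - l x) powr enn2real p) \<partial>?M) \<le> ennreal (e powr enn2real p)" if pf: "p \<noteq> \<infinity>"
      proof -
        define q where "q = enn2real p"
        have q: "q \<ge> 1"
          using p pf by (cases p rule: ennreal_cases) (auto simp: q_def)
        have "(\<integral>\<^sup>+x. ennreal (norm (u n x - l x) powr q) \<partial>?M) = (\<integral>\<^sup>+x. liminf (\<lambda>m. ennreal (norm (u n x - u m x) powr q)) \<partial>?M)"
        proof (rule nn_integral_cong)
          fix x
          have "(\<lambda>m. norm (u n x - u m x) powr q) \<longlonglongrightarrow> norm (u n x - l x) powr q"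
            using q by (intro tendsto_powr2 lim tendsto_const) auto
          then have "(\<lambda>m. ennreal (norm (u n x - u m x) powr q)) \<longlonglongrightarrow> ennreal (norm (u n x - l x) powr q)"
            by (rule tendsto_ennrealI)
          then show "ennreal (norm (u n x - l x) powr q) = liminf (\<lambda>m. ennreal (norm (u n x - u m x) powr q))"
            by (intro lim_imp_Liminf[symmetric]) auto
        qed
        also have "\<dots> \<le> liminf (\<lambda>m. \<integral>\<^sup>+x. ennreal (norm (u n x - u m x) powr q) \<partial>?M)"
          by (rule nn_integral_liminf) auto
        also have "\<dots> \<le> ennreal (e powr q)"
        proof (rule Liminf_le)
          show "\<forall>\<^sub>F m in sequentially. (\<integral>\<^sup>+x. ennreal (norm (u n x - u m x) powr q) \<partial>?M) \<le> ennreal (e powr q)"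
            using eventually_ge_at_top[of K]
          proof eventually_elim
            case (elim m)
            have "(\<integral>\<^sup>+x. ennreal (norm (u n x - u m x) powr q) \<partial>?M) = ennreal (Lp_norm p ?M (\<lambda>x. u n x - u m x) powr q)"
              using Lp_space_nn_integral[OF diff p pf] by (simp add: q_def)
            also have "\<dots> \<le> ennreal (e powr q)"
              using K[OF n elim] q by (intro ennreal_leI powr_mono2) (auto simp: Lp_norm_nonneg)
            finally show ?case .
          qed
        qed simp
        finally show ?thesis by (simp add: q_def)
      qed
      have "norm (u n x - l x) \<le> e" for x
      proof (rule tendsto_upperbound[OF lim])
        show "\<forall>\<^sub>F m in sequentially. norm (u n x - u m x) \<le> e"
          using eventually_ge_at_top[of K]
          by eventually_elim (rule order_trans[OF Lp_count_space_le[OF p diff] less_imp_le[OF K[OF n]]])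
      qed simp
      then have "AE x in ?M. norm (u n x - l x) \<le> e" by simp
      then show ?thesis
        using Lp_spaceI[of "\<lambda>x. u n x - l x" ?M e p] e p fin by auto
    qed
    then show ?thesis by blast
  qed
  obtain K where K: "(\<lambda>x. u K x - l x) \<in> Lp_space p ?M" using key[of 1] by auto
  have "(\<lambda>x. u K x + -1 * (u K x - l x)) \<in> Lp_space p ?M"
    by (rule Lp_space_add(1)[OF p u Lp_space_cmult_le(1)[OF p K]])
  then have "l \<in> Lp_space p ?M" by simp
  moreover have "(\<lambda>n. Lp_norm p ?M (\<lambda>x. u n x - l x)) \<longlonglongrightarrow> 0"
  proof (rule LIMSEQ_I)
    fix e :: real assume "e > 0"
    then obtain K where "\<forall>n\<ge>K. Lp_norm p ?M (\<lambda>x. u n x - l x) \<le> e / 2" using key[of "e / 2"] by auto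
    with \<open>e > 0\<close> show "\<exists>K. \<forall>n\<ge>K. norm (Lp_norm p ?M (\<lambda>x. u n x - l x) - 0) < e"
      by (intro exI[of _ K]) (auto simp: Lp_norm_nonneg intro: le_less_trans)
  qed
  ultimately show ?thesis using that by blast
qed

text \<open>The value of \<open>wt_m s\<close> at the sampling scale \<open>2^-j\<close>.\<close>

definition dyadic_weight :: "real \<Rightarrow> int \<times> int \<Rightarrow> real" where
  "dyadic_weight s i = 2 powr (real_of_int (fst i) * s)"

text \<open>As a weighted Lp space of the counting measure, the sequence space fits both sides of
  Schur's test. Summability of reals is absolute and the counting measure has no non-empty null
  sets, so sums become integrals and suprema essential suprema.\<close>

lemma dyadic_seq_space_eq:
  assumes p: "1 \<le> p"
  shows "dyadic_seq_space p s = {c. (\<lambda>i. c i * of_real (dyadic_weight s i)) \<in> Lp_space p (count_space UNIV)}" (is "_ = ?S")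
    and "c \<in> dyadic_seq_space p s \<Longrightarrow> dyadic_seq_norm p s c = Lp_norm p (count_space UNIV) (\<lambda>i. c i * of_real (dyadic_weight s i))"
proof -
  have nw: "norm (c i * of_real (dyadic_weight s i)) = norm (c i) * 2 powr (real_of_int (fst i) * s)" for c :: "int \<times> int \<Rightarrow> complex" and i
    by (simp add: norm_mult dyadic_weight_def)
  have main: "(c \<in> dyadic_seq_space p s \<longleftrightarrow> c \<in> ?S) \<and>
      (c \<in> dyadic_seq_space p s \<longrightarrow> dyadic_seq_norm p s c = Lp_norm p (count_space UNIV) (\<lambda>i. c i * of_real (dyadic_weight s i)))" for c
  proof (cases "p = \<infinity>")
    case True
    define F where "F = (\<lambda>i. c i * of_real (dyadic_weight s i))"
    define f where "f = (\<lambda>i. norm (F i))"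
    have f: "(\<lambda>(j, k). norm (c (j, k)) * 2 powr (real_of_int j * s)) = f"
      by (auto simp: f_def F_def nw fun_eq_iff)
    have 1: "F \<in> Lp_space \<infinity> (count_space UNIV) \<and> Lp_norm \<infinity> (count_space UNIV) F = (SUP i. f i)" if bd: "bdd_above (range f)"
    proof -
      define B where "B = (SUP i. f i)"
      have le: "norm (F i) \<le> B" for i
        using cSUP_upper[OF _ bd, of i] unfolding B_def f_def by simp
      have nn: "0 \<le> B" using le[of undefined] norm_ge_zero by (rule order_trans[rotated])
      have ae: "AE i in count_space UNIV. norm (F i) \<le> B" using le by (intro AE_I2)
      have F1: "F \<in> Lp_space \<infinity> (count_space UNIV)"
        by (rule Lp_spaceI(1)[OF _ nn _ _ ae]) simp_all
      have F2: "Lp_norm \<infinity> (count_space UNIV) F \<le> B"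
        by (rule Lp_spaceI(2)[OF _ nn _ _ ae]) simp_all
      have "B \<le> Lp_norm \<infinity> (count_space UNIV) F"
        unfolding B_def
      proof (rule cSUP_least)
        show "f i \<le> Lp_norm \<infinity> (count_space UNIV) F" for i
          unfolding f_def by (rule Lp_count_space_le[OF _ F1]) simp
      qed simp
      with F1 F2 show ?thesis unfolding B_def by (intro conjI antisym)
    qed
    have 2: "bdd_above (range f)" if "F \<in> Lp_space \<infinity> (count_space UNIV)"
    proof (rule bdd_aboveI2)
      show "f i \<le> Lp_norm \<infinity> (count_space UNIV) F" for i
        unfolding f_def by (rule Lp_count_space_le[OF _ that]) simp
    qed
    have m: "c \<in> dyadic_seq_space p s \<longleftrightarrow> bdd_above (range f)"
      by (simp add: dyadic_seq_space_def True f)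
    have n: "dyadic_seq_norm p s c = (SUP i. f i)"
      by (simp add: dyadic_seq_norm_def True f)
    show ?thesis
      using 1 2 m n unfolding True F_def[symmetric] mem_Collect_eq by metis
  next
    case False
    define q where "q = enn2real p"
    define F where "F = (\<lambda>i. c i * of_real (dyadic_weight s i))"
    define f where "f = (\<lambda>i. norm (F i) powr q)"
    have f: "(\<lambda>(j, k). norm (c (j, k)) powr q * 2 powr (real_of_int j * s * q)) = f"
      by (auto simp: f_def F_def nw fun_eq_iff powr_mult powr_powr)
    have s: "f summable_on UNIV \<longleftrightarrow> integrable (count_space UNIV) f"
    proof -
      have "f summable_on UNIV \<longleftrightarrow> Infinite_Sum.abs_summable_on f UNIV"
        by (rule summable_on_iff_abs_summable_on_real)
      also have "\<dots> \<longleftrightarrow> integrable (count_space UNIV) f"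
        unfolding abs_summable_equivalent Infinite_Set_Sum.abs_summable_on_def ..
      finally show ?thesis .
    qed
    have "infsum f UNIV = (\<integral>i. f i \<partial>count_space UNIV)" if "integrable (count_space UNIV) f"
      using that by (subst infsetsum_infsum[symmetric]) (auto simp: Infinite_Set_Sum.abs_summable_on_def infsetsum_def)
    moreover have "c \<in> dyadic_seq_space p s \<longleftrightarrow> f summable_on UNIV"
      using False by (simp add: dyadic_seq_space_def f q_def[symmetric])
    moreover have "dyadic_seq_norm p s c = infsum f UNIV powr (1 / q)"
      using False by (simp add: dyadic_seq_norm_def f q_def[symmetric])
    moreover have "F \<in> Lp_space p (count_space UNIV) \<longleftrightarrow> integrable (count_space UNIV) f"
      using False by (simp add: Lp_space_def f_def q_def)
    moreover have "Lp_norm p (count_space UNIV) F = (\<integral>i. f i \<partial>count_space UNIV) powr (1 / q)"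
      using False by (simp add: Lp_norm_def f_def q_def)
    ultimately show ?thesis
      using s unfolding F_def[symmetric] mem_Collect_eq by metis
  qed
  show "dyadic_seq_space p s = ?S" using main by blast
  show "c \<in> dyadic_seq_space p s \<Longrightarrow> dyadic_seq_norm p s c = Lp_norm p (count_space UNIV) (\<lambda>i. c i * of_real (dyadic_weight s i))"
    using main by blast
qed

lemma banach_dyadic_seq_space:
  assumes p: "1 \<le> p"
  shows "banach_fun_space (dyadic_seq_space p s) (dyadic_seq_norm p s)"
proof -
  let ?M = "count_space (UNIV :: (int \<times> int) set)"
  let ?V = "dyadic_seq_space p s"
  define J :: "(int \<times> int \<Rightarrow> complex) \<Rightarrow> int \<times> int \<Rightarrow> complex" where "J c = (\<lambda>i. c i * of_real (dyadic_weight s i))" for c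
  have V: "c \<in> ?V \<longleftrightarrow> J c \<in> Lp_space p ?M" for c
    using dyadic_seq_space_eq(1)[OF p, of s] by (auto simp: J_def)
  have N: "dyadic_seq_norm p s c = Lp_norm p ?M (J c)" if "c \<in> ?V" for c
    using dyadic_seq_space_eq(2)[OF p that] by (simp add: J_def)
  have Ja: "J (\<lambda>x. u x + v x) = (\<lambda>x. J u x + J v x)" "J (\<lambda>x. u x - v x) = (\<lambda>x. J u x - J v x)" "J (\<lambda>x. a * u x) = (\<lambda>x. a * J u x)" for u v a
    by (auto simp: J_def algebra_simps)
  have w0: "dyadic_weight s i \<noteq> 0" for i by (simp add: dyadic_weight_def)
  have diff: "(\<lambda>x. u x - v x) \<in> ?V" if "u \<in> ?V" "v \<in> ?V" for u v
    using Lp_space_add(1)[OF p _ Lp_space_cmult_le(1)[OF p, of _ _ "-1"], of "J u" ?M "J v"] that by (simp add: V Ja)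
  have add: "(\<lambda>x. u x + v x) \<in> ?V" "dyadic_seq_norm p s (\<lambda>x. u x + v x) \<le> dyadic_seq_norm p s u + dyadic_seq_norm p s v" if "u \<in> ?V" "v \<in> ?V" for u v
  proof -
    show uv: "(\<lambda>x. u x + v x) \<in> ?V"
      using Lp_space_add(1)[OF p] that by (simp add: V Ja)
    show "dyadic_seq_norm p s (\<lambda>x. u x + v x) \<le> dyadic_seq_norm p s u + dyadic_seq_norm p s v"
      using Lp_space_add(2)[OF p] that by (simp add: N uv Ja) (simp add: V)
  qed
  have cm: "(\<lambda>x. a * u x) \<in> ?V" "dyadic_seq_norm p s (\<lambda>x. a * u x) = norm a * dyadic_seq_norm p s u" if "u \<in> ?V" for a u
  proof -
    show au: "(\<lambda>x. a * u x) \<in> ?V"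
      using Lp_space_cmult_le(1)[OF p] that by (simp add: V Ja)
    show "dyadic_seq_norm p s (\<lambda>x. a * u x) = norm a * dyadic_seq_norm p s u"
      using Lp_norm_cmult[OF p] that by (simp add: N au Ja) (simp add: V)
  qed
  have J0: "J (\<lambda>_. 0) = (\<lambda>_. 0)" by (simp add: J_def)
  have zV: "(\<lambda>_. 0) \<in> ?V"
    using Lp_space_zero[OF p] by (simp add: V J0)
  have zero: "0 \<le> dyadic_seq_norm p s u \<and> (dyadic_seq_norm p s u = 0 \<longleftrightarrow> u = (\<lambda>_. 0))" if u: "u \<in> ?V" for u
  proof (intro conjI iffI)
    show "0 \<le> dyadic_seq_norm p s u" by (simp add: N[OF u] Lp_norm_nonneg)
    show "dyadic_seq_norm p s u = 0" if "u = (\<lambda>_. 0)"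
      unfolding that N[OF zV] J0 using p by simp
    assume "dyadic_seq_norm p s u = 0"
    then have "norm (J u i) \<le> 0" for i
      using Lp_count_space_le[OF p, of "J u" i] u by (simp add: N[OF u] V)
    then show "u = (\<lambda>_. 0)" by (simp add: J_def fun_eq_iff w0)
  qed
  have complete: "\<exists>l\<in>?V. (\<lambda>n. dyadic_seq_norm p s (\<lambda>x. u n x - l x)) \<longlonglongrightarrow> 0"
    if u: "\<And>n. u n \<in> ?V" and C: "\<And>e. e > 0 \<Longrightarrow> \<exists>K. \<forall>m\<ge>K. \<forall>n\<ge>K. dyadic_seq_norm p s (\<lambda>x. u m x - u n x) < e" for u :: "nat \<Rightarrow> _"
  proof -
    obtain l where l: "l \<in> Lp_space p ?M" "(\<lambda>n. Lp_norm p ?M (\<lambda>x. J (u n) x - l x)) \<longlonglongrightarrow> 0"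
    proof (rule Lp_count_space_complete[OF p, of "\<lambda>n. J (u n)"])
      show "J (u n) \<in> Lp_space p ?M" for n using u V by blast
      show "\<exists>K. \<forall>m\<ge>K. \<forall>n\<ge>K. Lp_norm p ?M (\<lambda>x. J (u m) x - J (u n) x) < e" if "e > 0" for e
        using C[OF that] by (simp add: N diff u Ja)
    qed blast
    define l' where "l' = (\<lambda>i. l i / of_real (dyadic_weight s i))"
    have Jl: "J l' = l" by (simp add: J_def l'_def fun_eq_iff w0)
    have "l' \<in> ?V" using l(1) by (simp add: V Jl)
    moreover have "(\<lambda>n. dyadic_seq_norm p s (\<lambda>x. u n x - l' x)) \<longlonglongrightarrow> 0"
      using l(2) by (simp add: N diff u \<open>l' \<in> ?V\<close> Ja Jl)
    ultimately show ?thesis by blast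
  qed
  show ?thesis
    unfolding banach_fun_space_def normed_fun_space_def
    using zV add cm zero complete by auto
qed

section \<open>Wavelet coefficients and coorbit spaces\<close>

text \<open>If f is not integrable, its integral is 0 by convention and the inequality is
  trivial.\<close>

lemma ennreal_norm_integral_le:
  fixes f :: "'a \<Rightarrow> complex"
  shows "ennreal (norm (\<integral>x. f x \<partial>M)) \<le> (\<integral>\<^sup>+x. ennreal (norm (f x)) \<partial>M)"
proof (cases "integrable M f")
  case True
  then show ?thesis by (rule integral_norm_bound_ennreal)
qed (simp add: not_integrable_integral_eq)

lemma polarization:
  fixes a b :: complex
  shows "4 * (a * cnj b) = of_real ((norm (a + b))\<^sup>2) - of_real ((norm (a - b))\<^sup>2) +
    \<i> * of_real ((norm (a + \<i> * b))\<^sup>2) - \<i> * of_real ((norm (a - \<i> * b))\<^sup>2)"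
  unfolding complex_norm_square by (simp add: algebra_simps)

lemma snd_measurable [measurable]: "(snd :: real \<times> real \<Rightarrow> real) \<in> borel_measurable borel"
  unfolding borel_prod[symmetric] by measurable

lemma finite_to_nat_less: "finite {i :: 'a :: countable. to_nat i < n}"
  by (rule finite_imageD[of to_nat]) (auto intro: finite_subset[of _ "{..<n}"] inj_on_subset[OF inj_to_nat])

text \<open>
  The auxiliary window \<open>\<phi>\<close> need not be \<open>\<eta>\<close>: the kernel of the transform from \<open>\<eta>\<close>-coefficients to frame
  coefficients involves only \<open>\<phi>\<close>, so no regularity of \<open>\<eta>\<close> beyond \<open>\<eta>row\<close> enters.
\<close>

locale coorbit_frame =
  fixes \<psi> \<eta> \<phi> :: "real \<Rightarrow> complex" and K :: complex and c \<rho> :: real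
  assumes \<psi>: "\<psi> \<in> L2" and \<eta>: "\<eta> \<in> L2" and \<phi>: "\<phi> \<in> L2" and c: "c > 0" and K: "K \<noteq> 0" and \<rho>: "\<rho> \<ge> 0"
    and tight: "\<And>f. f \<in> L2 \<Longrightarrow> (\<lambda>i. (norm (L2_inner f (wavelet \<psi> i)))\<^sup>2) summable_on UNIV \<and>
      c * l2 f = sqrt (\<Sum>\<^sub>\<infinity>i. (norm (L2_inner f (wavelet \<psi> i)))\<^sup>2)"
    and repro: "\<And>i h. h \<in> L2 \<Longrightarrow>
      (\<integral>z. L2_inner (wavelet \<psi> i) (wav_rep z \<phi>) * L2_inner (wav_rep z \<eta>) h \<partial>aff_haar) = K * L2_inner (wavelet \<psi> i) h"
    and row: "\<And>\<sigma>. \<bar>\<sigma>\<bar> \<le> \<rho> \<Longrightarrow> \<exists>C\<ge>0. \<forall>i. (\<integral>\<^sup>+z. ennreal (norm (L2_inner (wavelet \<psi> i) (wav_rep z \<phi>)) * \<bar>snd z\<bar> powr \<sigma>) \<partial>aff_haar)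
      \<le> ennreal (C * 2 powr (- real_of_int (fst i) * \<sigma>))"
    and col: "\<And>\<sigma>. \<bar>\<sigma>\<bar> \<le> \<rho> \<Longrightarrow> \<exists>C\<ge>0. \<forall>z. (\<integral>\<^sup>+i. ennreal (norm (L2_inner (wavelet \<psi> i) (wav_rep z \<phi>)) * 2 powr (- real_of_int (fst i) * \<sigma>)) \<partial>count_space UNIV)
      \<le> ennreal (C * \<bar>snd z\<bar> powr \<sigma>)"
    and \<eta>row: "\<And>\<sigma>. \<bar>\<sigma>\<bar> \<le> \<rho> \<Longrightarrow> (\<integral>\<^sup>+z. ennreal (norm (wav_trans \<eta> \<eta> z) * \<bar>snd z\<bar> powr \<sigma>) \<partial>aff_haar) < \<infinity>"
begin

abbreviation P :: "int \<times> int \<Rightarrow> real \<Rightarrow> complex" where "P \<equiv> wavelet \<psi>"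
abbreviation E :: "real \<times> real \<Rightarrow> real \<Rightarrow> complex" where "E z \<equiv> wav_rep z \<eta>"
abbreviation kk :: "int \<times> int \<Rightarrow> real \<times> real \<Rightarrow> complex" where "kk i z \<equiv> L2_inner (P i) (wav_rep z \<phi>)"
abbreviation HH :: "int \<times> int \<Rightarrow> real \<times> real \<Rightarrow> complex" where "HH i z \<equiv> L2_inner (P i) (E z)"
abbreviation aw :: "real \<Rightarrow> int \<times> int \<Rightarrow> real" where "aw \<sigma> i \<equiv> 2 powr (- real_of_int (fst i) * \<sigma>)"
abbreviation cnt :: "(int \<times> int) measure" where "cnt \<equiv> count_space UNIV"

lemma P_L2: "P i \<in> L2"
  using wav_rep_L2[OF \<psi>] by (cases i) (simp add: wavelet_eq_wav_rep)

lemma E_L2: "E z \<in> L2"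
  by (rule wav_rep_L2[OF \<eta>])

lemma kk_meas [measurable]: "(\<lambda>z. kk i z) \<in> borel_measurable borel"
  using wav_trans_measurable[OF L2_measurable[OF P_L2] L2_measurable[OF \<phi>]] by (simp add: wav_trans_def[abs_def])

lemma trans_meas: "g \<in> L2 \<Longrightarrow> (\<lambda>z. L2_inner g (E z)) \<in> borel_measurable borel"
  using wav_trans_measurable[OF L2_measurable L2_measurable[OF \<eta>]] by (simp add: wav_trans_def[abs_def])

lemma HH_meas [measurable]: "(\<lambda>z. HH i z) \<in> borel_measurable borel"
  by (rule trans_meas[OF P_L2])

lemma E_rev_meas: "g \<in> L2 \<Longrightarrow> (\<lambda>z. L2_inner (E z) g) \<in> borel_measurable borel"
  using trans_meas[of g] L2_inner_cnj[of g] by (simp flip: L2_inner_cnj[of g])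

lemma GG_meas [measurable]: "(\<lambda>p. L2_inner (E (fst p)) (E (snd p))) \<in> borel_measurable (borel \<Otimes>\<^sub>M borel)"
proof -
  note [measurable] = wav_rep_measurable[OF L2_measurable[OF \<eta>]]
  have "(\<lambda>p. \<integral>t. (case (fst p, t) of (z, x) \<Rightarrow> E z x) * cnj (case (snd p, t) of (z, x) \<Rightarrow> E z x) \<partial>lborel) \<in> borel_measurable (borel \<Otimes>\<^sub>M borel)"
    by measurable
  then show ?thesis by (simp add: L2_inner_def)
qed

lemma GG_meas' [measurable]: "(\<lambda>p. L2_inner (E (snd p)) (E (fst p))) \<in> borel_measurable (borel \<Otimes>\<^sub>M borel)"
  using measurable_compose[OF GG_meas borel_measurable_cnj] by (simp only: L2_inner_cnj)

lemma sigma_cnt: "sigma_finite_measure cnt"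
  by (rule sigma_finite_measure_count_space)

lemma cnt_pair_meas: "(\<And>i. (\<lambda>z. f i z) \<in> borel_measurable borel) \<Longrightarrow> (\<lambda>(i, z). f i z) \<in> borel_measurable (cnt \<Otimes>\<^sub>M aff_haar)"
  by (rule measurable_pair_measure_countable1) auto

lemma cnt_Tonelli:
  fixes f :: "int \<times> int \<Rightarrow> real \<times> real \<Rightarrow> ennreal"
  assumes "\<And>i. (\<lambda>z. f i z) \<in> borel_measurable borel"
  shows "(\<integral>\<^sup>+i. \<integral>\<^sup>+z. f i z \<partial>aff_haar \<partial>cnt) = (\<integral>\<^sup>+z. \<integral>\<^sup>+i. f i z \<partial>cnt \<partial>aff_haar)"
proof -
  interpret pair_sigma_finite cnt aff_haar
    by (simp add: pair_sigma_finite_def sigma_cnt sigma_finite_aff_haar)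
  show ?thesis
    by (rule Fubini'[symmetric]) (rule measurable_pair_measure_countable1, use assms in auto)
qed

text \<open>Frame sums are rewritten as integrals over the counting measure, so that Tonelli and
  Fubini can exchange them with group integrals.\<close>

lemma frame_sum_norm:
  assumes f: "f \<in> L2"
  shows "integrable cnt (\<lambda>i. (norm (L2_inner f (P i)))\<^sup>2)" "(\<integral>i. (norm (L2_inner f (P i)))\<^sup>2 \<partial>cnt) = c\<^sup>2 * (l2 f)\<^sup>2"
proof -
  let ?f = "\<lambda>i. (norm (L2_inner f (P i)))\<^sup>2"
  have s: "?f summable_on UNIV" and e: "c * l2 f = sqrt (infsum ?f UNIV)"
    using tight[OF f] by auto
  have "Infinite_Sum.abs_summable_on ?f UNIV"
    using s by (rule summable_on_iff_abs_summable_on_real[THEN iffD1])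
  then have a: "Infinite_Set_Sum.abs_summable_on ?f UNIV"
    unfolding abs_summable_equivalent .
  then show i: "integrable cnt ?f"
    unfolding Infinite_Set_Sum.abs_summable_on_def .
  have "(\<integral>i. ?f i \<partial>cnt) = infsum ?f UNIV"
    using infsetsum_infsum[OF a] by (simp add: infsetsum_def)
  moreover have "(c * l2 f)\<^sup>2 = infsum ?f UNIV"
    unfolding e by (intro real_sqrt_pow2 infsum_nonneg) simp
  ultimately show "(\<integral>i. ?f i \<partial>cnt) = c\<^sup>2 * (l2 f)\<^sup>2"
    by (simp add: power_mult_distrib)
qed

text \<open>Polarisation of the tight frame identity: both sides are sesquilinear and are recovered
  from four squared norms.\<close>

lemma frame_identity:
  assumes g: "g \<in> L2" and h: "h \<in> L2"
  shows "integrable cnt (\<lambda>i. L2_inner g (P i) * L2_inner (P i) h)"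
    "(\<integral>i. L2_inner g (P i) * L2_inner (P i) h \<partial>cnt) = of_real (c\<^sup>2) * L2_inner g h"
proof -
  define a where "a = (\<lambda>i. L2_inner g (P i))"
  define b where "b = (\<lambda>i. L2_inner h (P i))"
  have ab: "L2_inner g (P i) * L2_inner (P i) h = a i * cnj (b i)" for i
    by (simp add: a_def b_def L2_inner_cnj)
  have lin: "L2_inner (\<lambda>x. g x + u * h x) (P i) = a i + u * b i" for u i
    using L2_inner_add_left[OF g L2_cmult[OF h, of u] P_L2] by (simp add: a_def b_def L2_inner_cmult_left)
  have gh: "(\<lambda>x. g x + u * h x) \<in> L2" for u by (intro L2_add L2_cmult g h)
  have I: "integrable cnt (\<lambda>i. complex_of_real ((norm (a i + u * b i))\<^sup>2))"
    "(\<integral>i. complex_of_real ((norm (a i + u * b i))\<^sup>2) \<partial>cnt) = of_real (c\<^sup>2 * (l2 (\<lambda>x. g x + u * h x))\<^sup>2)" for u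
    using frame_sum_norm[OF gh, of u] unfolding lin by (simp_all only: integrable_of_real integral_complex_of_real)
  have J: "integrable lborel (\<lambda>x. complex_of_real ((norm (g x + u * h x))\<^sup>2))"
    "(\<integral>x. complex_of_real ((norm (g x + u * h x))\<^sup>2) \<partial>lborel) = of_real ((l2 (\<lambda>x. g x + u * h x))\<^sup>2)" for u
    using gh[of u] unfolding L2_iff l2_power2 by (simp_all only: integrable_of_real integral_complex_of_real)
  have pol: "x * cnj y = (1 / 4) * (of_real ((norm (x + 1 * y))\<^sup>2) - of_real ((norm (x + (- 1) * y))\<^sup>2) +
      \<i> * of_real ((norm (x + \<i> * y))\<^sup>2) - \<i> * of_real ((norm (x + (- \<i>) * y))\<^sup>2))" for x y
    using polarization[of x y] by (simp add: field_simps)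
  show "integrable cnt (\<lambda>i. L2_inner g (P i) * L2_inner (P i) h)"
    unfolding ab pol by (intro integrable_mult_right Bochner_Integration.integrable_add Bochner_Integration.integrable_diff I)
  have "(\<integral>i. a i * cnj (b i) \<partial>cnt) = (1 / 4) * (of_real (c\<^sup>2 * (l2 (\<lambda>x. g x + 1 * h x))\<^sup>2) - of_real (c\<^sup>2 * (l2 (\<lambda>x. g x + (- 1) * h x))\<^sup>2) +
      \<i> * of_real (c\<^sup>2 * (l2 (\<lambda>x. g x + \<i> * h x))\<^sup>2) - \<i> * of_real (c\<^sup>2 * (l2 (\<lambda>x. g x + (- \<i>) * h x))\<^sup>2))"
    unfolding pol integral_mult_right_zero
    by (subst Bochner_Integration.integral_diff Bochner_Integration.integral_add,
        (intro integrable_mult_right Bochner_Integration.integrable_add Bochner_Integration.integrable_diff I)+)+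
       (simp only: integral_mult_right_zero I)
  moreover have "(\<integral>x. g x * cnj (h x) \<partial>lborel) = (1 / 4) * (of_real ((l2 (\<lambda>x. g x + 1 * h x))\<^sup>2) - of_real ((l2 (\<lambda>x. g x + (- 1) * h x))\<^sup>2) +
      \<i> * of_real ((l2 (\<lambda>x. g x + \<i> * h x))\<^sup>2) - \<i> * of_real ((l2 (\<lambda>x. g x + (- \<i>) * h x))\<^sup>2))"
    unfolding pol integral_mult_right_zero
    by (subst Bochner_Integration.integral_diff Bochner_Integration.integral_add,
        (intro integrable_mult_right Bochner_Integration.integrable_add Bochner_Integration.integrable_diff J)+)+
       (simp only: integral_mult_right_zero J)
  moreover have "(1 / 4) * (of_real (c\<^sup>2 * t1) - of_real (c\<^sup>2 * t2) + \<i> * of_real (c\<^sup>2 * t3) - \<i> * of_real (c\<^sup>2 * t4)) =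
      of_real (c\<^sup>2) * ((1 / 4) * (of_real t1 - of_real t2 + \<i> * of_real t3 - \<i> * of_real t4))" for t1 t2 t3 t4 :: real
    by (simp add: algebra_simps)
  ultimately show "(\<integral>i. L2_inner g (P i) * L2_inner (P i) h \<partial>cnt) = of_real (c\<^sup>2) * L2_inner g h"
    unfolding ab L2_inner_def[of g h] by (simp only:)
qed

lemma coefficient_le:
  assumes g: "g \<in> L2"
  shows "ennreal (norm (L2_inner (P i) g)) \<le> ennreal (1 / norm K) * (\<integral>\<^sup>+z. ennreal (norm (kk i z) * norm (L2_inner g (E z))) \<partial>aff_haar)"
proof -
  have "ennreal (norm K * norm (L2_inner (P i) g)) = ennreal (norm (\<integral>z. kk i z * L2_inner (E z) g \<partial>aff_haar))"
    unfolding repro[OF g] by (simp add: norm_mult)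
  also have "\<dots> \<le> (\<integral>\<^sup>+z. ennreal (norm (kk i z * L2_inner (E z) g)) \<partial>aff_haar)"
    by (rule ennreal_norm_integral_le)
  also have "\<dots> = (\<integral>\<^sup>+z. ennreal (norm (kk i z) * norm (L2_inner g (E z))) \<partial>aff_haar)"
    by (simp add: norm_mult L2_inner_norm_commute[of g])
  finally have "ennreal (1 / norm K) * ennreal (norm K * norm (L2_inner (P i) g)) \<le> ennreal (1 / norm K) * \<dots>"
    by (rule mult_left_mono) simp
  then show ?thesis using K by (simp add: ennreal_mult[symmetric])
qed

text \<open>\<open>aw \<sigma> i\<close> is \<open>|a| powr \<sigma>\<close> at the sampling point
  of i. After the coefficients are expanded by the reproducing formula, summing over i first brings
  in the column bound; a weighted l1 norm of coefficients is thus controlled by the weighted L1 norm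
  of the transform.\<close>

lemma coefficient_sum:
  assumes \<sigma>: "\<bar>\<sigma>\<bar> \<le> \<rho>"
  obtains C where "C \<ge> 0" "\<And>g. g \<in> L2 \<Longrightarrow> (\<integral>\<^sup>+i. ennreal (norm (L2_inner (P i) g) * aw \<sigma> i) \<partial>cnt) \<le>
    ennreal C * (\<integral>\<^sup>+z. ennreal (norm (L2_inner g (E z)) * \<bar>snd z\<bar> powr \<sigma>) \<partial>aff_haar)"
proof -
  obtain C where C: "C \<ge> 0" "\<And>z. (\<integral>\<^sup>+i. ennreal (norm (kk i z) * aw \<sigma> i) \<partial>cnt) \<le> ennreal (C * \<bar>snd z\<bar> powr \<sigma>)"
    using col[OF \<sigma>] by blast
  show ?thesis
  proof (rule that[of "C / norm K"])
    show "0 \<le> C / norm K" using C by simp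
    fix g assume g: "g \<in> L2"
    note [measurable] = trans_meas[OF g]
    define G where "G = (\<lambda>z. ennreal (norm (L2_inner g (E z))))"
    have [measurable]: "G \<in> borel_measurable borel" unfolding G_def by measurable
    have "(\<integral>\<^sup>+i. ennreal (norm (L2_inner (P i) g) * aw \<sigma> i) \<partial>cnt) \<le>
        (\<integral>\<^sup>+i. ennreal (1 / norm K) * (\<integral>\<^sup>+z. ennreal (norm (kk i z) * aw \<sigma> i) * G z \<partial>aff_haar) \<partial>cnt)"
    proof (rule nn_integral_mono)
      fix i
      have "ennreal (norm (L2_inner (P i) g) * aw \<sigma> i) = ennreal (aw \<sigma> i) * ennreal (norm (L2_inner (P i) g))"
        by (simp add: ennreal_mult mult.commute)
      also have "\<dots> \<le> ennreal (aw \<sigma> i) * (ennreal (1 / norm K) * (\<integral>\<^sup>+z. ennreal (norm (kk i z) * norm (L2_inner g (E z))) \<partial>aff_haar))"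
        by (intro mult_left_mono coefficient_le g) simp
      also have "\<dots> = ennreal (1 / norm K) * (ennreal (aw \<sigma> i) * (\<integral>\<^sup>+z. ennreal (norm (kk i z) * norm (L2_inner g (E z))) \<partial>aff_haar))"
        by (simp only: mult.left_commute)
      also have "ennreal (aw \<sigma> i) * (\<integral>\<^sup>+z. ennreal (norm (kk i z) * norm (L2_inner g (E z))) \<partial>aff_haar) =
          (\<integral>\<^sup>+z. ennreal (norm (kk i z) * aw \<sigma> i) * G z \<partial>aff_haar)"
        by (subst nn_integral_cmult[symmetric]) (auto simp: ennreal_mult G_def mult_ac)
      finally show "ennreal (norm (L2_inner (P i) g) * aw \<sigma> i) \<le> ennreal (1 / norm K) * (\<integral>\<^sup>+z. ennreal (norm (kk i z) * aw \<sigma> i) * G z \<partial>aff_haar)" .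
    qed
    also have "\<dots> = ennreal (1 / norm K) * (\<integral>\<^sup>+z. \<integral>\<^sup>+i. ennreal (norm (kk i z) * aw \<sigma> i) * G z \<partial>cnt \<partial>aff_haar)"
      by (subst nn_integral_cmult) (auto simp: cnt_Tonelli)
    also have "\<dots> = ennreal (1 / norm K) * (\<integral>\<^sup>+z. (\<integral>\<^sup>+i. ennreal (norm (kk i z) * aw \<sigma> i) \<partial>cnt) * G z \<partial>aff_haar)"
      by (simp add: nn_integral_multc)
    also have "\<dots> \<le> ennreal (1 / norm K) * (\<integral>\<^sup>+z. ennreal (C * \<bar>snd z\<bar> powr \<sigma>) * G z \<partial>aff_haar)"
      by (intro mult_left_mono nn_integral_mono mult_right_mono C) auto
    also have "\<dots> = ennreal (1 / norm K) * (\<integral>\<^sup>+z. ennreal C * ennreal (norm (L2_inner g (E z)) * \<bar>snd z\<bar> powr \<sigma>) \<partial>aff_haar)"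
      using C(1) by (simp add: G_def ennreal_mult mult_ac)
    also have "\<dots> = ennreal (1 / norm K) * (ennreal C * (\<integral>\<^sup>+z. ennreal (norm (L2_inner g (E z)) * \<bar>snd z\<bar> powr \<sigma>) \<partial>aff_haar))"
      by (subst nn_integral_cmult) auto
    also have "\<dots> = ennreal (C / norm K) * (\<integral>\<^sup>+z. ennreal (norm (L2_inner g (E z)) * \<bar>snd z\<bar> powr \<sigma>) \<partial>aff_haar)"
      using C(1) by (simp add: mult.assoc[symmetric] ennreal_mult[symmetric])
    finally show "(\<integral>\<^sup>+i. ennreal (norm (L2_inner (P i) g) * aw \<sigma> i) \<partial>cnt) \<le> \<dots>" .
  qed
qed

text \<open>Left invariance transports the admissibility of \<eta> from the identity to every
  \<open>E x\<close>.\<close>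

lemma E_row:
  assumes \<sigma>: "\<bar>\<sigma>\<bar> \<le> \<rho>"
  obtains C where "C \<ge> 0" "\<And>x. (\<integral>\<^sup>+z. ennreal (norm (L2_inner (E x) (E z)) * \<bar>snd z\<bar> powr \<sigma>) \<partial>aff_haar) \<le> ennreal (C * \<bar>snd x\<bar> powr \<sigma>)"
proof -
  define I where "I = (\<integral>\<^sup>+z. ennreal (norm (wav_trans \<eta> \<eta> z) * \<bar>snd z\<bar> powr \<sigma>) \<partial>aff_haar)"
  have I: "I < \<infinity>" unfolding I_def by (rule \<eta>row[OF \<sigma>])
  show ?thesis
  proof (rule that[of "enn2real I"])
    fix x :: "real \<times> real"
    obtain b a where x: "x = (b, a)" by (cases x)
    show "(\<integral>\<^sup>+z. ennreal (norm (L2_inner (E x) (E z)) * \<bar>snd z\<bar> powr \<sigma>) \<partial>aff_haar) \<le> ennreal (enn2real I * \<bar>snd x\<bar> powr \<sigma>)"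
    proof (cases "a = 0")
      case True
      then show ?thesis by (simp add: x wav_rep_0 L2_inner_def)
    next
      case False
      have "(\<integral>\<^sup>+z. ennreal (norm (L2_inner (E x) (E z)) * \<bar>snd z\<bar> powr \<sigma>) \<partial>aff_haar) = ennreal (\<bar>a\<bar> powr \<sigma>) * I"
        unfolding x I_def by (rule nn_integral_wav_trans_covariant[OF \<eta> \<eta> False])
      also have "\<dots> = ennreal (\<bar>a\<bar> powr \<sigma>) * ennreal (enn2real I)"
        using I by simp
      also have "\<dots> = ennreal (enn2real I * \<bar>snd x\<bar> powr \<sigma>)"
        by (subst ennreal_mult[symmetric]) (auto simp: x mult.commute)
      finally show ?thesis by simp
    qed
  qed simp
qed

text \<open>The coefficient sum is applied to g = \<open>E x\<close>; the transform of this g is a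
  row of the Gram kernel of \<eta>.\<close>

lemma HH_col:
  assumes \<sigma>: "\<bar>\<sigma>\<bar> \<le> \<rho>"
  obtains C where "C \<ge> 0" "\<And>x. (\<integral>\<^sup>+i. ennreal (norm (HH i x) * aw \<sigma> i) \<partial>cnt) \<le> ennreal (C * \<bar>snd x\<bar> powr \<sigma>)"
proof -
  obtain C where C: "C \<ge> 0" "\<And>g. g \<in> L2 \<Longrightarrow> (\<integral>\<^sup>+i. ennreal (norm (L2_inner (P i) g) * aw \<sigma> i) \<partial>cnt) \<le>
    ennreal C * (\<integral>\<^sup>+z. ennreal (norm (L2_inner g (E z)) * \<bar>snd z\<bar> powr \<sigma>) \<partial>aff_haar)"
    using coefficient_sum[OF \<sigma>] by blast
  obtain C' where C': "C' \<ge> 0" "\<And>x. (\<integral>\<^sup>+z. ennreal (norm (L2_inner (E x) (E z)) * \<bar>snd z\<bar> powr \<sigma>) \<partial>aff_haar) \<le> ennreal (C' * \<bar>snd x\<bar> powr \<sigma>)"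
    using E_row[OF \<sigma>] by blast
  show ?thesis
  proof (rule that[of "C * C'"])
    show "0 \<le> C * C'" using C C' by simp
    fix x
    have "(\<integral>\<^sup>+i. ennreal (norm (HH i x) * aw \<sigma> i) \<partial>cnt) \<le> ennreal C * ennreal (C' * \<bar>snd x\<bar> powr \<sigma>)"
      by (rule order_trans[OF C(2)[OF E_L2] mult_left_mono[OF C'(2)]]) simp
    then show "(\<integral>\<^sup>+i. ennreal (norm (HH i x) * aw \<sigma> i) \<partial>cnt) \<le> ennreal (C * C' * \<bar>snd x\<bar> powr \<sigma>)"
      using C(1) C'(1) by (simp add: ennreal_mult[symmetric] mult.assoc)
  qed
qed

text \<open>The kernel against \<phi> is composed with the Gram kernel of \<eta>. Both row bounds
  carry the same weight exponent, so the composition keeps the full range of \<sigma>.\<close>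

lemma HH_row:
  assumes \<sigma>: "\<bar>\<sigma>\<bar> \<le> \<rho>"
  obtains C where "C \<ge> 0" "\<And>i. (\<integral>\<^sup>+x. ennreal (norm (HH i x) * \<bar>snd x\<bar> powr \<sigma>) \<partial>aff_haar) \<le> ennreal (C * aw \<sigma> i)"
proof -
  obtain C where C: "C \<ge> 0" "\<And>i. (\<integral>\<^sup>+z. ennreal (norm (kk i z) * \<bar>snd z\<bar> powr \<sigma>) \<partial>aff_haar) \<le> ennreal (C * aw \<sigma> i)"
    using row[OF \<sigma>] by blast
  obtain C' where C': "C' \<ge> 0" "\<And>x. (\<integral>\<^sup>+z. ennreal (norm (L2_inner (E x) (E z)) * \<bar>snd z\<bar> powr \<sigma>) \<partial>aff_haar) \<le> ennreal (C' * \<bar>snd x\<bar> powr \<sigma>)"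
    using E_row[OF \<sigma>] by blast
  interpret pair_sigma_finite aff_haar aff_haar
    by (simp add: pair_sigma_finite_def sigma_finite_aff_haar)
  show ?thesis
  proof (rule that[of "C * C' / norm K"])
    show "0 \<le> C * C' / norm K" using C C' by simp
    fix i
    have [measurable]: "(\<lambda>p. ennreal (norm (kk i (snd p)) * norm (L2_inner (E (fst p)) (E (snd p))))) \<in> borel_measurable (aff_haar \<Otimes>\<^sub>M aff_haar)"
      by measurable
    have "(\<integral>\<^sup>+x. ennreal (norm (HH i x) * \<bar>snd x\<bar> powr \<sigma>) \<partial>aff_haar) \<le>
        (\<integral>\<^sup>+x. ennreal (1 / norm K) * (\<integral>\<^sup>+z. ennreal (norm (kk i z)) * ennreal (norm (L2_inner (E z) (E x)) * \<bar>snd x\<bar> powr \<sigma>) \<partial>aff_haar) \<partial>aff_haar)"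
    proof (rule nn_integral_mono)
      fix x
      note [measurable] = trans_meas[OF E_L2] E_rev_meas[OF E_L2]
      have "ennreal (norm (HH i x) * \<bar>snd x\<bar> powr \<sigma>) = ennreal (norm (HH i x)) * ennreal (\<bar>snd x\<bar> powr \<sigma>)"
        by (simp add: ennreal_mult)
      also have "\<dots> \<le> (ennreal (1 / norm K) * (\<integral>\<^sup>+z. ennreal (norm (kk i z) * norm (L2_inner (E x) (E z))) \<partial>aff_haar)) * ennreal (\<bar>snd x\<bar> powr \<sigma>)"
        by (intro mult_right_mono coefficient_le E_L2) simp
      also have "\<dots> = ennreal (1 / norm K) * ((\<integral>\<^sup>+z. ennreal (norm (kk i z) * norm (L2_inner (E x) (E z))) \<partial>aff_haar) * ennreal (\<bar>snd x\<bar> powr \<sigma>))"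
        by (simp only: mult.assoc)
      also have "(\<integral>\<^sup>+z. ennreal (norm (kk i z) * norm (L2_inner (E x) (E z))) \<partial>aff_haar) * ennreal (\<bar>snd x\<bar> powr \<sigma>) =
          (\<integral>\<^sup>+z. ennreal (norm (kk i z)) * ennreal (norm (L2_inner (E z) (E x)) * \<bar>snd x\<bar> powr \<sigma>) \<partial>aff_haar)"
        unfolding L2_inner_norm_commute[of "E x"] by (subst nn_integral_multc[symmetric]) (auto simp: ennreal_mult mult_ac)
      finally show "ennreal (norm (HH i x) * \<bar>snd x\<bar> powr \<sigma>) \<le> ennreal (1 / norm K) * \<dots>" .
    qed
    also have "\<dots> = ennreal (1 / norm K) * (\<integral>\<^sup>+x. \<integral>\<^sup>+z. ennreal (norm (kk i z)) * ennreal (norm (L2_inner (E z) (E x)) * \<bar>snd x\<bar> powr \<sigma>) \<partial>aff_haar \<partial>aff_haar)"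
      by (rule nn_integral_cmult) measurable
    also have "(\<integral>\<^sup>+x. \<integral>\<^sup>+z. ennreal (norm (kk i z)) * ennreal (norm (L2_inner (E z) (E x)) * \<bar>snd x\<bar> powr \<sigma>) \<partial>aff_haar \<partial>aff_haar) =
        (\<integral>\<^sup>+z. \<integral>\<^sup>+x. ennreal (norm (kk i z)) * ennreal (norm (L2_inner (E z) (E x)) * \<bar>snd x\<bar> powr \<sigma>) \<partial>aff_haar \<partial>aff_haar)"
      by (rule Fubini') measurable
    also have "\<dots> \<le> (\<integral>\<^sup>+z. ennreal C' * ennreal (norm (kk i z) * \<bar>snd z\<bar> powr \<sigma>) \<partial>aff_haar)"
    proof (rule nn_integral_mono)
      fix z
      note [measurable] = trans_meas[OF E_L2]
      have "(\<integral>\<^sup>+x. ennreal (norm (kk i z)) * ennreal (norm (L2_inner (E z) (E x)) * \<bar>snd x\<bar> powr \<sigma>) \<partial>aff_haar) =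
          ennreal (norm (kk i z)) * (\<integral>\<^sup>+x. ennreal (norm (L2_inner (E z) (E x)) * \<bar>snd x\<bar> powr \<sigma>) \<partial>aff_haar)"
        by (rule nn_integral_cmult) measurable
      also have "\<dots> \<le> ennreal (norm (kk i z)) * ennreal (C' * \<bar>snd z\<bar> powr \<sigma>)"
        by (intro mult_left_mono C') simp
      also have "\<dots> = ennreal C' * ennreal (norm (kk i z) * \<bar>snd z\<bar> powr \<sigma>)"
        using C'(1) by (simp add: ennreal_mult mult_ac)
      finally show "(\<integral>\<^sup>+x. ennreal (norm (kk i z)) * ennreal (norm (L2_inner (E z) (E x)) * \<bar>snd x\<bar> powr \<sigma>) \<partial>aff_haar) \<le> \<dots>" .
    qed
    also have "\<dots> = ennreal C' * (\<integral>\<^sup>+z. ennreal (norm (kk i z) * \<bar>snd z\<bar> powr \<sigma>) \<partial>aff_haar)"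
      by (rule nn_integral_cmult) measurable
    also have "\<dots> \<le> ennreal C' * ennreal (C * aw \<sigma> i)"
      by (intro mult_left_mono C) simp
    finally have "(\<integral>\<^sup>+x. ennreal (norm (HH i x) * \<bar>snd x\<bar> powr \<sigma>) \<partial>aff_haar) \<le> ennreal (1 / norm K) * (ennreal C' * ennreal (C * aw \<sigma> i))"
      by (simp add: mult_left_mono)
    also have "\<dots> = ennreal (C * C' / norm K * aw \<sigma> i)"
      using C(1) C'(1) by (simp add: ennreal_mult[symmetric] mult_ac)
    finally show "(\<integral>\<^sup>+x. ennreal (norm (HH i x) * \<bar>snd x\<bar> powr \<sigma>) \<partial>aff_haar) \<le> \<dots>" .
  qed
qed

text \<open>The H1 norm with values in \<open>ennreal\<close>: membership in the space becomes
  finiteness, and estimates can precede integrability.\<close>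

definition nH :: "(real \<Rightarrow> complex) \<Rightarrow> ennreal" where
  "nH g = (\<integral>\<^sup>+z. ennreal (norm (L2_inner g (E z)) * wt_w \<rho> z) \<partial>aff_haar)"

text \<open>The values of \<open>wt_w \<rho>\<close> at the sampling points.\<close>

definition ww :: "int \<times> int \<Rightarrow> real" where "ww i = aw \<rho> i + aw (- \<rho>) i"

lemma ww_pos: "ww i > 0"
  by (simp add: ww_def add_pos_pos)

lemma wt_w_eq: "wt_w \<rho> z = \<bar>snd z\<bar> powr \<rho> + \<bar>snd z\<bar> powr (- \<rho>)"
  by (simp add: wt_w_def case_prod_beta)

lemma wt_w_nonneg: "wt_w \<rho> z \<ge> 0"
  by (simp add: wt_w_eq)

lemma wt_w_meas [measurable]: "wt_w \<rho> \<in> borel_measurable borel"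
  unfolding wt_w_eq[abs_def] by measurable

lemma nH_eq:
  assumes g: "g \<in> L2"
  shows "nH g = (\<integral>\<^sup>+z. ennreal (norm (L2_inner g (E z)) * \<bar>snd z\<bar> powr \<rho>) \<partial>aff_haar) +
    (\<integral>\<^sup>+z. ennreal (norm (L2_inner g (E z)) * \<bar>snd z\<bar> powr (- \<rho>)) \<partial>aff_haar)"
proof -
  note [measurable] = trans_meas[OF g]
  show ?thesis
    unfolding nH_def wt_w_eq by (subst nn_integral_add[symmetric]) (auto simp: distrib_left)
qed

lemma rho_bounds: "\<bar>\<rho>\<bar> \<le> \<rho>" "\<bar>- \<rho>\<bar> \<le> \<rho>"
  using \<rho> by auto

lemma H1_iff: "g \<in> H1_space \<eta> \<rho> \<longleftrightarrow> g \<in> L2 \<and> nH g < \<infinity>"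
  and H1_norm_eq: "g \<in> L2 \<Longrightarrow> H1_norm \<eta> \<rho> g = enn2real (nH g)"
proof -
  have n: "norm (wav_trans \<eta> g z * of_real (wt_w \<rho> z)) = norm (L2_inner g (E z)) * wt_w \<rho> z" for z
    using wt_w_nonneg by (simp add: norm_mult wav_trans_def)
  have m: "(\<lambda>z. wav_trans \<eta> g z * of_real (wt_w \<rho> z)) \<in> borel_measurable aff_haar" if g: "g \<in> L2"
    using trans_meas[OF g] by (simp add: wav_trans_def)
  show "g \<in> H1_space \<eta> \<rho> \<longleftrightarrow> g \<in> L2 \<and> nH g < \<infinity>"
  proof (cases "g \<in> L2")
    case True
    note [measurable] = trans_meas[OF True]
    have "g \<in> H1_space \<eta> \<rho> \<longleftrightarrow> integrable aff_haar (\<lambda>z. norm (L2_inner g (E z)) * wt_w \<rho> z)"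
      using True m[OF True] by (simp add: H1_space_def wLp_space_def Lp_space_def n)
    also have "\<dots> \<longleftrightarrow> nH g < \<infinity>"
      using wt_w_nonneg by (simp add: integrable_iff_bounded nH_def abs_mult)
    finally show ?thesis using True by simp
  qed (simp add: H1_space_def)
  show "H1_norm \<eta> \<rho> g = enn2real (nH g)" if g: "g \<in> L2"
  proof -
    note [measurable] = trans_meas[OF g]
    have "H1_norm \<eta> \<rho> g = (\<integral>z. norm (L2_inner g (E z)) * wt_w \<rho> z \<partial>aff_haar)"
      using wt_w_nonneg by (simp add: H1_norm_def wLp_norm_def Lp_norm_def n integral_nonneg_AE)
    also have "\<dots> = enn2real (nH g)"
      unfolding nH_def using wt_w_nonneg by (intro integral_eq_nn_integral) auto
    finally show ?thesis .
  qed
qed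

lemma nH_P:
  obtains C where "C \<ge> 0" "\<And>i. nH (P i) \<le> ennreal (C * ww i)"
proof -
  obtain C1 where C1: "C1 \<ge> 0" "\<And>i. (\<integral>\<^sup>+x. ennreal (norm (HH i x) * \<bar>snd x\<bar> powr \<rho>) \<partial>aff_haar) \<le> ennreal (C1 * aw \<rho> i)"
    using HH_row[OF rho_bounds(1)] by blast
  obtain C2 where C2: "C2 \<ge> 0" "\<And>i. (\<integral>\<^sup>+x. ennreal (norm (HH i x) * \<bar>snd x\<bar> powr (- \<rho>)) \<partial>aff_haar) \<le> ennreal (C2 * aw (- \<rho>) i)"
    using HH_row[OF rho_bounds(2)] by blast
  show ?thesis
  proof (rule that[of "C1 + C2"])
    show "0 \<le> C1 + C2" using C1 C2 by simp
    fix i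
    have "nH (P i) \<le> ennreal (C1 * aw \<rho> i) + ennreal (C2 * aw (- \<rho>) i)"
      unfolding nH_eq[OF P_L2] by (intro add_mono C1 C2)
    also have "\<dots> = ennreal (C1 * aw \<rho> i + C2 * aw (- \<rho>) i)"
      using C1(1) C2(1) by (intro ennreal_plus[symmetric]) auto
    also have "\<dots> \<le> ennreal ((C1 + C2) * ww i)"
      using C1(1) C2(1) by (intro ennreal_leI) (simp add: ww_def distrib_left distrib_right)
    finally show "nH (P i) \<le> ennreal ((C1 + C2) * ww i)" .
  qed
qed

lemma P_H1: "P i \<in> H1_space \<eta> \<rho>"
proof -
  obtain C where "nH (P i) \<le> ennreal (C * ww i)" using nH_P by blast
  then show ?thesis by (auto simp: H1_iff P_L2 intro: le_less_trans)
qed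

lemma E_H1: "E x \<in> H1_space \<eta> \<rho>"
proof -
  obtain C1 where C1: "\<And>x. (\<integral>\<^sup>+z. ennreal (norm (L2_inner (E x) (E z)) * \<bar>snd z\<bar> powr \<rho>) \<partial>aff_haar) \<le> ennreal (C1 * \<bar>snd x\<bar> powr \<rho>)"
    using E_row[OF rho_bounds(1)] by blast
  obtain C2 where C2: "\<And>x. (\<integral>\<^sup>+z. ennreal (norm (L2_inner (E x) (E z)) * \<bar>snd z\<bar> powr (- \<rho>)) \<partial>aff_haar) \<le> ennreal (C2 * \<bar>snd x\<bar> powr (- \<rho>))"
    using E_row[OF rho_bounds(2)] by blast
  have "nH (E x) < \<infinity>"
    unfolding nH_eq[OF E_L2] using C1[of x] C2[of x] by (auto simp: less_top[symmetric] top_unique)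
  then show ?thesis by (simp add: H1_iff E_L2)
qed

text \<open>The extreme exponents \<rho> and -\<rho> add up to the weight
  \<open>wt_w \<rho>\<close>, so analysis maps H1 boundedly into a weighted l1 space.\<close>

lemma weighted_coefficient_sum:
  obtains C where "C \<ge> 0" "\<And>g. g \<in> L2 \<Longrightarrow> (\<integral>\<^sup>+i. ennreal (norm (L2_inner (P i) g) * ww i) \<partial>cnt) \<le> ennreal C * nH g"
proof -
  obtain C1 where C1: "C1 \<ge> 0" "\<And>g. g \<in> L2 \<Longrightarrow> (\<integral>\<^sup>+i. ennreal (norm (L2_inner (P i) g) * aw \<rho> i) \<partial>cnt) \<le>
    ennreal C1 * (\<integral>\<^sup>+z. ennreal (norm (L2_inner g (E z)) * \<bar>snd z\<bar> powr \<rho>) \<partial>aff_haar)"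
    using coefficient_sum[OF rho_bounds(1)] by blast
  obtain C2 where C2: "C2 \<ge> 0" "\<And>g. g \<in> L2 \<Longrightarrow> (\<integral>\<^sup>+i. ennreal (norm (L2_inner (P i) g) * aw (- \<rho>) i) \<partial>cnt) \<le>
    ennreal C2 * (\<integral>\<^sup>+z. ennreal (norm (L2_inner g (E z)) * \<bar>snd z\<bar> powr (- \<rho>)) \<partial>aff_haar)"
    using coefficient_sum[OF rho_bounds(2)] by blast
  show ?thesis
  proof (rule that[of "max C1 C2"])
    show "0 \<le> max C1 C2" using C1 by simp
    fix g assume g: "g \<in> L2"
    have "(\<integral>\<^sup>+i. ennreal (norm (L2_inner (P i) g) * ww i) \<partial>cnt) =
        (\<integral>\<^sup>+i. ennreal (norm (L2_inner (P i) g) * aw \<rho> i) \<partial>cnt) + (\<integral>\<^sup>+i. ennreal (norm (L2_inner (P i) g) * aw (- \<rho>) i) \<partial>cnt)"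
      by (subst nn_integral_add[symmetric]) (auto simp: ww_def distrib_left)
    also have "\<dots> \<le> ennreal C1 * (\<integral>\<^sup>+z. ennreal (norm (L2_inner g (E z)) * \<bar>snd z\<bar> powr \<rho>) \<partial>aff_haar) +
        ennreal C2 * (\<integral>\<^sup>+z. ennreal (norm (L2_inner g (E z)) * \<bar>snd z\<bar> powr (- \<rho>)) \<partial>aff_haar)"
      by (intro add_mono C1 C2 g)
    also have "\<dots> \<le> ennreal (max C1 C2) * (\<integral>\<^sup>+z. ennreal (norm (L2_inner g (E z)) * \<bar>snd z\<bar> powr \<rho>) \<partial>aff_haar) +
        ennreal (max C1 C2) * (\<integral>\<^sup>+z. ennreal (norm (L2_inner g (E z)) * \<bar>snd z\<bar> powr (- \<rho>)) \<partial>aff_haar)"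
      by (intro add_mono mult_right_mono ennreal_leI) auto
    also have "\<dots> = ennreal (max C1 C2) * nH g"
      unfolding nH_eq[OF g] by (simp add: distrib_left)
    finally show "(\<integral>\<^sup>+i. ennreal (norm (L2_inner (P i) g) * ww i) \<partial>cnt) \<le> ennreal (max C1 C2) * nH g" .
  qed
qed

end

section \<open>Tails of absolutely convergent countable sums\<close>

lemma tail_tendsto_0:
  fixes w :: "'a :: countable \<Rightarrow> ennreal"
  assumes w: "(\<integral>\<^sup>+i. w i \<partial>count_space UNIV) < \<infinity>"
  shows "(\<lambda>n. \<integral>\<^sup>+i. w i * indicator (- {i. to_nat i < n}) i \<partial>count_space UNIV) \<longlonglongrightarrow> 0"
proof -
  have "(\<lambda>n. \<integral>\<^sup>+i. w i * indicator (- {i. to_nat i < n}) i \<partial>count_space UNIV) \<longlonglongrightarrow> (\<integral>\<^sup>+i. 0 \<partial>(count_space UNIV :: 'a measure))"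
  proof (rule nn_integral_dominated_convergence[OF _ _ _ _ w])
    show "AE i in count_space UNIV. (\<lambda>n. w i * indicator (- {i. to_nat i < n}) i) \<longlonglongrightarrow> 0"
    proof (intro AE_I2 tendsto_eventually)
      fix i :: 'a
      show "eventually (\<lambda>n. w i * indicator (- {i. to_nat i < n}) i = 0) sequentially"
        using eventually_gt_at_top[of "to_nat i"] by eventually_elim simp
    qed
  qed (auto simp: indicator_def)
  then show ?thesis by simp
qed

lemma integral_minus_sum:
  fixes h :: "'a \<Rightarrow> complex"
  assumes h: "integrable (count_space UNIV) h" and F: "finite F"
  shows "ennreal (norm ((\<integral>i. h i \<partial>count_space UNIV) - (\<Sum>i\<in>F. h i))) \<le>
    (\<integral>\<^sup>+i. ennreal (norm (h i)) * indicator (- F) i \<partial>count_space UNIV)"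
proof -
  have i: "integrable (count_space UNIV) (\<lambda>i. indicator F i *\<^sub>R h i)"
    by (rule integrable_mult_indicator[OF _ h]) simp
  have "(\<integral>i. indicator F i *\<^sub>R h i \<partial>count_space UNIV) = (\<Sum>i | i \<in> UNIV \<and> indicator F i *\<^sub>R h i \<noteq> 0. indicator F i *\<^sub>R h i)"
    by (rule lebesgue_integral_count_space_finite_support) (auto intro: finite_subset[OF _ F] simp: indicator_def)
  also have "\<dots> = (\<Sum>i\<in>F. h i)"
    using F by (intro sum.mono_neutral_cong_left) (auto simp: indicator_def split: if_splits)
  finally have "(\<integral>i. h i \<partial>count_space UNIV) - (\<Sum>i\<in>F. h i) = (\<integral>i. h i - indicator F i *\<^sub>R h i \<partial>count_space UNIV)"
    using h i by (subst Bochner_Integration.integral_diff) auto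
  also have "ennreal (norm \<dots>) \<le> (\<integral>\<^sup>+i. ennreal (norm (h i - indicator F i *\<^sub>R h i)) \<partial>count_space UNIV)"
    by (rule ennreal_norm_integral_le)
  also have "\<dots> = (\<integral>\<^sup>+i. ennreal (norm (h i)) * indicator (- F) i \<partial>count_space UNIV)"
    by (intro nn_integral_cong) (auto simp: indicator_def)
  finally show ?thesis .
qed

lemma sum_tendsto_integral:
  fixes h :: "'a :: countable \<Rightarrow> complex"
  assumes h: "integrable (count_space UNIV) h"
  shows "(\<lambda>n. \<Sum>i | to_nat i < n. h i) \<longlonglongrightarrow> (\<integral>i. h i \<partial>count_space UNIV)"
proof -
  have "(\<integral>\<^sup>+i. ennreal (norm (h i)) \<partial>count_space UNIV) < \<infinity>"
    using h by (simp add: integrable_iff_bounded)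
  from tendsto_sandwich[OF _ _ tendsto_const tail_tendsto_0[OF this]]
  have "(\<lambda>n. ennreal (norm ((\<integral>i. h i \<partial>count_space UNIV) - (\<Sum>i | to_nat i < n. h i)))) \<longlonglongrightarrow> 0"
    using integral_minus_sum[OF h finite_to_nat_less] by simp
  then have "(\<lambda>n. enn2real (ennreal (norm ((\<integral>i. h i \<partial>count_space UNIV) - (\<Sum>i | to_nat i < n. h i))))) \<longlonglongrightarrow> 0"
    by (intro tendsto_enn2real) simp_all
  then have "(\<lambda>n. (\<integral>i. h i \<partial>count_space UNIV) - (\<Sum>i | to_nat i < n. h i)) \<longlonglongrightarrow> 0"
    by (intro tendsto_norm_zero_cancel[of "\<lambda>n. (\<integral>i. h i \<partial>count_space UNIV) - (\<Sum>i | to_nat i < n. h i)"]) simp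
  from tendsto_diff[OF tendsto_const[of "\<integral>i. h i \<partial>count_space UNIV"] this] show ?thesis
    by simp
qed

section \<open>Functionals on H1 and their frame expansion\<close>

context coorbit_frame
begin

lemma nH_add: "g \<in> L2 \<Longrightarrow> h \<in> L2 \<Longrightarrow> nH (\<lambda>x. g x + h x) \<le> nH g + nH h"
proof -
  assume g: "g \<in> L2" and h: "h \<in> L2"
  note [measurable] = trans_meas[OF g] trans_meas[OF h]
  have "nH (\<lambda>x. g x + h x) \<le> (\<integral>\<^sup>+z. ennreal (norm (L2_inner g (E z)) * wt_w \<rho> z + norm (L2_inner h (E z)) * wt_w \<rho> z) \<partial>aff_haar)"
    unfolding nH_def using wt_w_nonneg
    by (intro nn_integral_mono ennreal_leI)
       (simp add: L2_inner_add_left[OF g h E_L2] mult_right_mono norm_triangle_ineq flip: distrib_right)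
  also have "\<dots> = nH g + nH h"
    unfolding nH_def using wt_w_nonneg by (subst nn_integral_add[symmetric]) auto
  finally show ?thesis .
qed

lemma nH_cmult: "g \<in> L2 \<Longrightarrow> nH (\<lambda>x. a * g x) = ennreal (norm a) * nH g"
proof -
  assume g: "g \<in> L2"
  note [measurable] = trans_meas[OF g]
  show ?thesis
    unfolding nH_def using wt_w_nonneg
    by (subst nn_integral_cmult[symmetric]) (auto simp: L2_inner_cmult_left norm_mult ennreal_mult mult.assoc)
qed

lemma H1_add: "g \<in> H1_space \<eta> \<rho> \<Longrightarrow> h \<in> H1_space \<eta> \<rho> \<Longrightarrow> (\<lambda>x. g x + h x) \<in> H1_space \<eta> \<rho>"
  using nH_add[of g h] by (auto simp: H1_iff L2_add intro: le_less_trans)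

lemma H1_cmult: "g \<in> H1_space \<eta> \<rho> \<Longrightarrow> (\<lambda>x. a * g x) \<in> H1_space \<eta> \<rho>"
  by (auto simp: H1_iff L2_cmult nH_cmult ennreal_mult_less_top)

lemma H1_zero: "(\<lambda>x. 0) \<in> H1_space \<eta> \<rho>"
  using H1_cmult[OF P_H1, of 0] by simp

lemma reservoir_add: "f \<in> reservoir \<eta> \<rho> \<Longrightarrow> g \<in> H1_space \<eta> \<rho> \<Longrightarrow> h \<in> H1_space \<eta> \<rho> \<Longrightarrow> f (\<lambda>x. g x + h x) = f g + f h"
  and reservoir_cmult: "f \<in> reservoir \<eta> \<rho> \<Longrightarrow> g \<in> H1_space \<eta> \<rho> \<Longrightarrow> f (\<lambda>x. a * g x) = cnj a * f g"
  and reservoir_0: "f \<in> reservoir \<eta> \<rho> \<Longrightarrow> g \<notin> H1_space \<eta> \<rho> \<Longrightarrow> f g = 0"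
  by (auto simp: reservoir_def)

lemma reservoir_zero: "f \<in> reservoir \<eta> \<rho> \<Longrightarrow> f (\<lambda>x. 0) = 0"
  using reservoir_cmult[of f "\<lambda>x. 0" 0] H1_zero by simp

lemma reservoir_bound:
  assumes f: "f \<in> reservoir \<eta> \<rho>"
  obtains B where "B \<ge> 0" "\<And>g. g \<in> H1_space \<eta> \<rho> \<Longrightarrow> norm (f g) \<le> B * enn2real (nH g)"
proof -
  obtain B where B: "\<And>g. g \<in> H1_space \<eta> \<rho> \<Longrightarrow> norm (f g) \<le> B * H1_norm \<eta> \<rho> g"
    using f unfolding reservoir_def by blast
  show ?thesis
  proof (rule that[of "max 0 B"])
    fix g assume g: "g \<in> H1_space \<eta> \<rho>"
    then have "norm (f g) \<le> B * enn2real (nH g)" using B[OF g] H1_norm_eq H1_iff by auto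
    also have "\<dots> \<le> max 0 B * enn2real (nH g)" by (intro mult_right_mono) auto
    finally show "norm (f g) \<le> \<dots>" .
  qed simp
qed

lemma reservoir_P_bound:
  assumes f: "f \<in> reservoir \<eta> \<rho>"
  obtains B where "B \<ge> 0" "\<And>i. norm (f (P i)) \<le> B * ww i"
proof -
  obtain B where B: "B \<ge> 0" "\<And>g. g \<in> H1_space \<eta> \<rho> \<Longrightarrow> norm (f g) \<le> B * enn2real (nH g)"
    using reservoir_bound[OF f] by blast
  obtain C where C: "C \<ge> 0" "\<And>i. nH (P i) \<le> ennreal (C * ww i)" using nH_P by blast
  show ?thesis
  proof (rule that[of "B * C"])
    fix i
    have "enn2real (nH (P i)) \<le> C * ww i"
      using C(1) C(2)[of i] ww_pos[of i] by (intro enn2real_leI) auto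
    then show "norm (f (P i)) \<le> B * C * ww i"
      using B(2)[OF P_H1, of i] mult_left_mono[OF _ B(1)] by (fastforce simp: mult.assoc intro: order_trans)
  qed (use B C in simp)
qed

text \<open>Functionals are antilinear, so coefficients leave them conjugated, whereas the inner
  product is linear in its first argument. The three facts share one induction because each step
  uses membership of the shorter sum.\<close>

lemma sum_P_H1:
  assumes F: "finite F"
  shows "(\<lambda>x. \<Sum>i\<in>F. a i * P i x) \<in> H1_space \<eta> \<rho>"
    and "f \<in> reservoir \<eta> \<rho> \<Longrightarrow> f (\<lambda>x. \<Sum>i\<in>F. a i * P i x) = (\<Sum>i\<in>F. cnj (a i) * f (P i))"
    and "h \<in> L2 \<Longrightarrow> L2_inner (\<lambda>x. \<Sum>i\<in>F. a i * P i x) h = (\<Sum>i\<in>F. a i * L2_inner (P i) h)"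
proof -
  have "(\<lambda>x. \<Sum>i\<in>F. a i * P i x) \<in> H1_space \<eta> \<rho> \<and>
    (f \<in> reservoir \<eta> \<rho> \<longrightarrow> f (\<lambda>x. \<Sum>i\<in>F. a i * P i x) = (\<Sum>i\<in>F. cnj (a i) * f (P i))) \<and>
    (h \<in> L2 \<longrightarrow> L2_inner (\<lambda>x. \<Sum>i\<in>F. a i * P i x) h = (\<Sum>i\<in>F. a i * L2_inner (P i) h))"
    using F
  proof induction
    case empty
    then show ?case by (auto simp: H1_zero reservoir_zero L2_inner_def)
  next
    case (insert i F)
    have 1: "(\<lambda>x. a i * P i x) \<in> H1_space \<eta> \<rho>" by (rule H1_cmult[OF P_H1])
    have 2: "(\<lambda>x. a i * P i x) \<in> L2" "(\<lambda>x. \<Sum>i\<in>F. a i * P i x) \<in> L2"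
      using 1 insert.IH by (auto simp: H1_iff)
    have 3: "f (\<lambda>x. a i * P i x + (\<Sum>i\<in>F. a i * P i x)) = f (\<lambda>x. a i * P i x) + f (\<lambda>x. \<Sum>i\<in>F. a i * P i x)"
      if "f \<in> reservoir \<eta> \<rho>"
      using insert.IH by (intro reservoir_add[OF that 1]) blast
    show ?case
      using insert 1 3 L2_inner_add_left[OF 2]
      by (auto simp: H1_add reservoir_add reservoir_cmult P_H1 L2_inner_cmult_left)
  qed
  then show "(\<lambda>x. \<Sum>i\<in>F. a i * P i x) \<in> H1_space \<eta> \<rho>"
    "f \<in> reservoir \<eta> \<rho> \<Longrightarrow> f (\<lambda>x. \<Sum>i\<in>F. a i * P i x) = (\<Sum>i\<in>F. cnj (a i) * f (P i))"
    "h \<in> L2 \<Longrightarrow> L2_inner (\<lambda>x. \<Sum>i\<in>F. a i * P i x) h = (\<Sum>i\<in>F. a i * L2_inner (P i) h)"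
    by auto
qed

text \<open>Sequences of growth \<open>ww\<close> pair with the weighted l1 space that contains the
  coefficients of g.\<close>

lemma coefficient_integrable:
  assumes g: "g \<in> H1_space \<eta> \<rho>" and u: "\<And>i. norm (u i) \<le> N * ww i" and N: "N \<ge> 0"
  shows "integrable cnt (\<lambda>i. L2_inner (P i) g * u i)"
proof -
  obtain C where C: "C \<ge> 0" "\<And>g. g \<in> L2 \<Longrightarrow> (\<integral>\<^sup>+i. ennreal (norm (L2_inner (P i) g) * ww i) \<partial>cnt) \<le> ennreal C * nH g"
    using weighted_coefficient_sum by blast
  have "(\<integral>\<^sup>+i. ennreal (norm (L2_inner (P i) g * u i)) \<partial>cnt) \<le> (\<integral>\<^sup>+i. ennreal N * ennreal (norm (L2_inner (P i) g) * ww i) \<partial>cnt)"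
  proof (rule nn_integral_mono)
    fix i
    have "norm (L2_inner (P i) g * u i) \<le> norm (L2_inner (P i) g) * (N * ww i)"
      unfolding norm_mult by (intro mult_left_mono u) simp
    then show "ennreal (norm (L2_inner (P i) g * u i)) \<le> ennreal N * ennreal (norm (L2_inner (P i) g) * ww i)"
      using N ww_pos[of i] by (simp add: ennreal_mult[symmetric] ennreal_leI mult_ac)
  qed
  also have "\<dots> \<le> ennreal N * (ennreal C * nH g)"
    using g by (subst nn_integral_cmult) (auto simp: H1_iff intro!: mult_left_mono C)
  also have "\<dots> < \<infinity>"
    using g by (auto simp: H1_iff ennreal_mult_less_top)
  finally show ?thesis by (simp add: integrable_iff_bounded)
qed

text \<open>Convergence of the frame expansion in L2 says nothing about a functional bounded only in
  the H1 norm. But the transform of the remainder at z is itself the tail of a series; integrated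
  over z, each \<open>P i\<close> costs its H1 norm, of size \<open>ww i\<close>, and the tail of
  the weighted l1 norm of the coefficients tends to 0.\<close>

lemma reservoir_expansion:
  assumes f: "f \<in> reservoir \<eta> \<rho>" and g: "g \<in> H1_space \<eta> \<rho>"
  shows "(\<integral>i. L2_inner (P i) g * f (P i) \<partial>cnt) = of_real (c\<^sup>2) * f g"
proof -
  have gL: "g \<in> L2" and gn: "nH g < \<infinity>" using g by (auto simp: H1_iff)
  obtain B where B: "B \<ge> 0" "\<And>g. g \<in> H1_space \<eta> \<rho> \<Longrightarrow> norm (f g) \<le> B * enn2real (nH g)"
    using reservoir_bound[OF f] by blast
  obtain B' where B': "B' \<ge> 0" "\<And>i. norm (f (P i)) \<le> B' * ww i"
    using reservoir_P_bound[OF f] by blast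
  obtain C where C: "C \<ge> 0" "\<And>i. nH (P i) \<le> ennreal (C * ww i)" using nH_P by blast
  obtain C' where C': "C' \<ge> 0" "\<And>g. g \<in> L2 \<Longrightarrow> (\<integral>\<^sup>+i. ennreal (norm (L2_inner (P i) g) * ww i) \<partial>cnt) \<le> ennreal C' * nH g"
    using weighted_coefficient_sum by blast
  define a where "a = (\<lambda>i. L2_inner g (P i))"
  have a: "cnj (a i) = L2_inner (P i) g" "norm (a i) = norm (L2_inner (P i) g)" for i
    by (simp_all add: a_def L2_inner_cnj L2_inner_norm_commute[of g])
  define F where "F = (\<lambda>n. {i :: int \<times> int. to_nat i < n})"
  have F: "finite (F n)" for n unfolding F_def by (rule finite_to_nat_less)
  \<comment> \<open>The remainder after the first n terms, scaled by \<open>c^2\<close> so that no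
    division enters.\<close>
  define u where "u = (\<lambda>n x. of_real (c\<^sup>2) * g x + (- 1) * (\<Sum>i\<in>F n. a i * P i x))"
  have u1: "(\<lambda>x. of_real (c\<^sup>2) * g x) \<in> H1_space \<eta> \<rho>" "(\<lambda>x. (- 1) * (\<Sum>i\<in>F n. a i * P i x)) \<in> H1_space \<eta> \<rho>" for n
    by (intro H1_cmult g sum_P_H1 F)+
  then have u2: "(\<lambda>x. of_real (c\<^sup>2) * g x) \<in> L2" "(\<lambda>x. (- 1) * (\<Sum>i\<in>F n. a i * P i x)) \<in> L2" for n
    by (simp_all only: H1_iff)
  have u: "u n \<in> H1_space \<eta> \<rho>" for n
    unfolding u_def by (rule H1_add[OF u1])
  have fu: "f (u n) = of_real (c\<^sup>2) * f g - (\<Sum>i\<in>F n. L2_inner (P i) g * f (P i))" for n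
    unfolding u_def reservoir_add[OF f u1] reservoir_cmult[OF f g] reservoir_cmult[OF f sum_P_H1(1)[OF F]] sum_P_H1(2)[OF F f] a
    by simp
  \<comment> \<open>By the frame identity against \<open>E z\<close> the full series equals
    \<open>c^2\<close> times the transform of g, so the difference is exactly the tail.\<close>
  have uE: "ennreal (norm (L2_inner (u n) (E z))) \<le> (\<integral>\<^sup>+i. ennreal (norm (a i) * norm (HH i z)) * indicator (- F n) i \<partial>cnt)" for n z
  proof -
    have "L2_inner (u n) (E z) = of_real (c\<^sup>2) * L2_inner g (E z) - (\<Sum>i\<in>F n. a i * HH i z)"
      unfolding u_def L2_inner_add_left[OF u2 E_L2] L2_inner_cmult_left sum_P_H1(3)[OF F E_L2] by simp
    also have "\<dots> = (\<integral>i. a i * HH i z \<partial>cnt) - (\<Sum>i\<in>F n. a i * HH i z)"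
      using frame_identity(2)[OF gL E_L2, of z] by (simp add: a_def)
    finally show ?thesis
      using integral_minus_sum[OF frame_identity(1)[OF gL E_L2, of z] F] by (simp add: a_def norm_mult)
  qed
  have un: "nH (u n) \<le> (\<integral>\<^sup>+i. ennreal (norm (a i) * (C * ww i)) * indicator (- F n) i \<partial>cnt)" for n
  proof -
    have "nH (u n) \<le> (\<integral>\<^sup>+z. (\<integral>\<^sup>+i. ennreal (norm (a i) * norm (HH i z)) * indicator (- F n) i \<partial>cnt) * ennreal (wt_w \<rho> z) \<partial>aff_haar)"
      unfolding nH_def ennreal_mult[OF norm_ge_zero wt_w_nonneg] by (intro nn_integral_mono mult_right_mono uE) simp
    also have "\<dots> = (\<integral>\<^sup>+z. \<integral>\<^sup>+i. ennreal (norm (a i) * norm (HH i z)) * indicator (- F n) i * ennreal (wt_w \<rho> z) \<partial>cnt \<partial>aff_haar)"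
      by (simp add: nn_integral_multc)
    also have "\<dots> = (\<integral>\<^sup>+i. \<integral>\<^sup>+z. ennreal (norm (a i) * norm (HH i z)) * indicator (- F n) i * ennreal (wt_w \<rho> z) \<partial>aff_haar \<partial>cnt)"
      by (rule cnt_Tonelli[symmetric]) measurable
    also have "\<dots> \<le> (\<integral>\<^sup>+i. ennreal (norm (a i) * (C * ww i)) * indicator (- F n) i \<partial>cnt)"
    proof (rule nn_integral_mono)
      fix i
      have "(\<integral>\<^sup>+z. ennreal (norm (a i) * norm (HH i z)) * indicator (- F n) i * ennreal (wt_w \<rho> z) \<partial>aff_haar) =
          (\<integral>\<^sup>+z. (ennreal (norm (a i)) * indicator (- F n) i) * ennreal (norm (HH i z) * wt_w \<rho> z) \<partial>aff_haar)"
        using wt_w_nonneg by (intro nn_integral_cong) (simp add: ennreal_mult mult_ac)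
      also have "\<dots> = (ennreal (norm (a i)) * indicator (- F n) i) * nH (P i)"
        unfolding nH_def by (rule nn_integral_cmult) measurable
      also have "\<dots> \<le> (ennreal (norm (a i)) * indicator (- F n) i) * ennreal (C * ww i)"
        by (intro mult_left_mono C) simp
      also have "\<dots> = ennreal (norm (a i) * (C * ww i)) * indicator (- F n) i"
        using C(1) ww_pos[of i] by (simp add: ennreal_mult mult_ac)
      finally show "(\<integral>\<^sup>+z. ennreal (norm (a i) * norm (HH i z)) * indicator (- F n) i * ennreal (wt_w \<rho> z) \<partial>aff_haar) \<le> \<dots>" .
    qed
    finally show ?thesis .
  qed
  have "(\<integral>\<^sup>+i. ennreal (norm (a i) * (C * ww i)) \<partial>cnt) = (\<integral>\<^sup>+i. ennreal C * ennreal (norm (L2_inner (P i) g) * ww i) \<partial>cnt)"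
    unfolding a using C(1) ww_pos by (intro nn_integral_cong) (simp add: ennreal_mult[symmetric] less_imp_le mult_ac)
  also have "\<dots> \<le> ennreal C * (ennreal C' * nH g)"
    by (subst nn_integral_cmult) (auto intro!: mult_left_mono C' gL)
  also have "\<dots> < \<infinity>" using gn by (auto simp: ennreal_mult_less_top)
  finally have "(\<integral>\<^sup>+i. ennreal (norm (a i) * (C * ww i)) \<partial>cnt) < \<infinity>" .
  from tendsto_sandwich[OF _ _ tendsto_const tail_tendsto_0[OF this]]
  have "(\<lambda>n. nH (u n)) \<longlonglongrightarrow> 0"
    using un unfolding F_def by simp
  then have "(\<lambda>n. enn2real (nH (u n))) \<longlonglongrightarrow> 0"
    by (intro tendsto_enn2real) simp_all
  then have "(\<lambda>n. B * enn2real (nH (u n))) \<longlonglongrightarrow> 0"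
    by (rule tendsto_mult_right_zero)
  then have "(\<lambda>n. f (u n)) \<longlonglongrightarrow> 0"
    by (rule Lim_null_comparison[rotated]) (use B(2)[OF u] in simp)
  from tendsto_diff[OF tendsto_const[of "of_real (c\<^sup>2) * f g"] this]
  have "(\<lambda>n. \<Sum>i\<in>F n. L2_inner (P i) g * f (P i)) \<longlonglongrightarrow> of_real (c\<^sup>2) * f g"
    unfolding fu by simp
  moreover have "(\<lambda>n. \<Sum>i\<in>F n. L2_inner (P i) g * f (P i)) \<longlonglongrightarrow> (\<integral>i. L2_inner (P i) g * f (P i) \<partial>cnt)"
    unfolding F_def by (rule sum_tendsto_integral[OF coefficient_integrable[OF g B'(2) B'(1)]])
  ultimately show ?thesis using LIMSEQ_unique by blast
qed

lemma ext_trans_eq: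
  assumes f: "f \<in> reservoir \<eta> \<rho>"
  shows "f (E z) = of_real (1 / c\<^sup>2) * (\<integral>j. HH j z * f (P j) \<partial>cnt)"
  using reservoir_expansion[OF f E_H1, of z] c by simp

lemma synthesis_trans_meas: "(\<lambda>z. \<integral>j. HH j z * u j \<partial>cnt) \<in> borel_measurable borel"
proof -
  have "(\<lambda>(z, j). HH j z * u j) \<in> borel_measurable (borel \<Otimes>\<^sub>M cnt)"
    by (subst measurable_pair_swap_iff)
       (auto simp: split_beta' intro!: measurable_pair_measure_countable1)
  then show ?thesis
    by (rule sigma_finite_measure.borel_measurable_lebesgue_integral[OF sigma_cnt])
qed

text \<open>An abstract functional gives no direct access to its values along the orbit as a
  function of z; the frame series exhibits them as a measurable function.\<close>

lemma ext_trans_meas: "f \<in> reservoir \<eta> \<rho> \<Longrightarrow> (\<lambda>z. f (E z)) \<in> borel_measurable borel"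
  unfolding ext_trans_eq using synthesis_trans_meas[of "\<lambda>j. f (P j)"] by measurable

lemma HH_ww:
  obtains C where "C \<ge> 0" "\<And>x. (\<integral>\<^sup>+i. ennreal (norm (HH i x) * ww i) \<partial>cnt) \<le> ennreal (C * wt_w \<rho> x)"
proof -
  obtain C1 where C1: "C1 \<ge> 0" "\<And>x. (\<integral>\<^sup>+i. ennreal (norm (HH i x) * aw \<rho> i) \<partial>cnt) \<le> ennreal (C1 * \<bar>snd x\<bar> powr \<rho>)"
    using HH_col[OF rho_bounds(1)] by blast
  obtain C2 where C2: "C2 \<ge> 0" "\<And>x. (\<integral>\<^sup>+i. ennreal (norm (HH i x) * aw (- \<rho>) i) \<partial>cnt) \<le> ennreal (C2 * \<bar>snd x\<bar> powr (- \<rho>))"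
    using HH_col[OF rho_bounds(2)] by blast
  show ?thesis
  proof (rule that[of "C1 + C2"])
    fix x
    have "(\<integral>\<^sup>+i. ennreal (norm (HH i x) * ww i) \<partial>cnt) = (\<integral>\<^sup>+i. ennreal (norm (HH i x) * aw \<rho> i) \<partial>cnt) + (\<integral>\<^sup>+i. ennreal (norm (HH i x) * aw (- \<rho>) i) \<partial>cnt)"
      by (subst nn_integral_add[symmetric]) (auto simp: ww_def distrib_left)
    also have "\<dots> \<le> ennreal (C1 * \<bar>snd x\<bar> powr \<rho>) + ennreal (C2 * \<bar>snd x\<bar> powr (- \<rho>))"
      by (intro add_mono C1 C2)
    also have "\<dots> = ennreal (C1 * \<bar>snd x\<bar> powr \<rho> + C2 * \<bar>snd x\<bar> powr (- \<rho>))"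
      using C1(1) C2(1) by (intro ennreal_plus[symmetric]) auto
    also have "\<dots> \<le> ennreal ((C1 + C2) * wt_w \<rho> x)"
      using C1(1) C2(1) by (intro ennreal_leI) (simp add: wt_w_eq distrib_left distrib_right)
    finally show "(\<integral>\<^sup>+i. ennreal (norm (HH i x) * ww i) \<partial>cnt) \<le> ennreal ((C1 + C2) * wt_w \<rho> x)" .
  qed (use C1 C2 in simp)
qed

lemma kk_wt: "(\<integral>\<^sup>+z. ennreal (norm (kk i z) * wt_w \<rho> z) \<partial>aff_haar) < \<infinity>"
proof -
  have fin: "(\<integral>\<^sup>+z. ennreal (norm (kk i z) * \<bar>snd z\<bar> powr \<sigma>) \<partial>aff_haar) < \<infinity>" if \<sigma>: "\<bar>\<sigma>\<bar> \<le> \<rho>" for \<sigma>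
  proof -
    obtain C where "(\<integral>\<^sup>+z. ennreal (norm (kk i z) * \<bar>snd z\<bar> powr \<sigma>) \<partial>aff_haar) \<le> ennreal (C * aw \<sigma> i)"
      using row[OF \<sigma>] by blast
    also have "\<dots> < \<infinity>" by simp
    finally show ?thesis .
  qed
  have "(\<integral>\<^sup>+z. ennreal (norm (kk i z) * wt_w \<rho> z) \<partial>aff_haar) =
      (\<integral>\<^sup>+z. ennreal (norm (kk i z) * \<bar>snd z\<bar> powr \<rho>) \<partial>aff_haar) + (\<integral>\<^sup>+z. ennreal (norm (kk i z) * \<bar>snd z\<bar> powr (- \<rho>)) \<partial>aff_haar)"
    by (subst nn_integral_add[symmetric]) (auto simp: wt_w_eq distrib_left)
  then show ?thesis using fin[OF rho_bounds(1)] fin[OF rho_bounds(2)] by simp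
qed

text \<open>The formula on L2 does not apply to a functional directly. Expanding
  \<open>f (E z)\<close> in the frame reduces the integral to the formula for each
  \<open>P j\<close>, and the expansion of f at \<open>P i\<close> sums the result up again. The
  conjugates come from antilinearity.\<close>

lemma reservoir_reproducing:
  assumes f: "f \<in> reservoir \<eta> \<rho>"
  shows "cnj K * f (P i) = (\<integral>z. cnj (kk i z) * f (E z) \<partial>aff_haar)"
proof -
  obtain B where B: "B \<ge> 0" "\<And>i. norm (f (P i)) \<le> B * ww i"
    using reservoir_P_bound[OF f] by blast
  obtain C where C: "C \<ge> 0" "\<And>x. (\<integral>\<^sup>+i. ennreal (norm (HH i x) * ww i) \<partial>cnt) \<le> ennreal (C * wt_w \<rho> x)"
    using HH_ww by blast
  \<comment> \<open>\<open>T\<close> is absolutely integrable because f grows at most like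
    \<open>ww\<close> on the frame, the columns of \<open>HH\<close> convert this into
    \<open>wt_w \<rho>\<close>, and the rows of \<open>kk\<close> are integrable against that
    weight.\<close>
  define T where "T = (\<lambda>j z. cnj (kk i z) * (HH j z * f (P j)))"
  have [measurable]: "(\<lambda>z. cnj (kk i z)) \<in> borel_measurable borel" by measurable
  have Tm: "(\<lambda>z. T j z) \<in> borel_measurable borel" for j unfolding T_def by measurable
  have "(\<integral>\<^sup>+j. \<integral>\<^sup>+z. ennreal (norm (T j z)) \<partial>aff_haar \<partial>cnt) = (\<integral>\<^sup>+z. \<integral>\<^sup>+j. ennreal (norm (T j z)) \<partial>cnt \<partial>aff_haar)"
    using Tm by (intro cnt_Tonelli) measurable
  also have "\<dots> \<le> (\<integral>\<^sup>+z. ennreal (B * C) * ennreal (norm (kk i z) * wt_w \<rho> z) \<partial>aff_haar)"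
  proof (rule nn_integral_mono)
    fix z
    have "(\<integral>\<^sup>+j. ennreal (norm (T j z)) \<partial>cnt) \<le> (\<integral>\<^sup>+j. ennreal (norm (kk i z) * B) * ennreal (norm (HH j z) * ww j) \<partial>cnt)"
    proof (rule nn_integral_mono)
      fix j
      have "norm (T j z) = norm (kk i z) * norm (HH j z) * norm (f (P j))" by (simp add: T_def norm_mult)
      also have "\<dots> \<le> norm (kk i z) * norm (HH j z) * (B * ww j)" by (intro mult_left_mono B) simp
      finally show "ennreal (norm (T j z)) \<le> ennreal (norm (kk i z) * B) * ennreal (norm (HH j z) * ww j)"
        using B(1) ww_pos[of j] by (simp add: ennreal_mult[symmetric] ennreal_leI mult_ac)
    qed
    also have "\<dots> = ennreal (norm (kk i z) * B) * (\<integral>\<^sup>+j. ennreal (norm (HH j z) * ww j) \<partial>cnt)"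
      by (rule nn_integral_cmult) simp
    also have "\<dots> \<le> ennreal (norm (kk i z) * B) * ennreal (C * wt_w \<rho> z)"
      by (intro mult_left_mono C) simp
    also have "\<dots> = ennreal (B * C) * ennreal (norm (kk i z) * wt_w \<rho> z)"
      using B(1) C(1) wt_w_nonneg by (simp add: ennreal_mult[symmetric] mult_ac)
    finally show "(\<integral>\<^sup>+j. ennreal (norm (T j z)) \<partial>cnt) \<le> \<dots>" .
  qed
  also have "\<dots> = ennreal (B * C) * (\<integral>\<^sup>+z. ennreal (norm (kk i z) * wt_w \<rho> z) \<partial>aff_haar)"
    by (rule nn_integral_cmult) measurable
  also have "\<dots> < \<infinity>" using kk_wt[of i] by (simp add: ennreal_mult_less_top)
  finally have fin: "(\<integral>\<^sup>+j. \<integral>\<^sup>+z. ennreal (norm (T j z)) \<partial>aff_haar \<partial>cnt) < \<infinity>" .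
  have int: "integrable (cnt \<Otimes>\<^sub>M aff_haar) (case_prod T)"
    by (rule pair_integrableI[OF sigma_cnt sigma_finite_aff_haar cnt_pair_meas[OF Tm] fin])
  have inner: "(\<integral>z. T j z \<partial>aff_haar) = cnj K * (L2_inner (P j) (P i) * f (P j))" for j
  proof -
    have "(\<integral>z. T j z \<partial>aff_haar) = (\<integral>z. cnj (kk i z * L2_inner (E z) (P j)) * f (P j) \<partial>aff_haar)"
      by (simp add: T_def L2_inner_cnj mult.assoc)
    also have "\<dots> = cnj (\<integral>z. kk i z * L2_inner (E z) (P j) \<partial>aff_haar) * f (P j)"
      by (simp only: integral_mult_left_zero Bochner_Integration.integral_cnj)
    also have "\<dots> = cnj K * (L2_inner (P j) (P i) * f (P j))"
      unfolding repro[OF P_L2] by (simp add: L2_inner_cnj mult.assoc)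
    finally show ?thesis .
  qed
  have "(\<integral>z. cnj (kk i z) * f (E z) \<partial>aff_haar) = of_real (1 / c\<^sup>2) * (\<integral>z. \<integral>j. T j z \<partial>cnt \<partial>aff_haar)"
    unfolding ext_trans_eq[OF f] T_def integral_mult_right_zero[symmetric] by (simp add: mult_ac)
  also have "(\<integral>z. \<integral>j. T j z \<partial>cnt \<partial>aff_haar) = (\<integral>j. \<integral>z. T j z \<partial>aff_haar \<partial>cnt)"
    by (rule integrable_iterated_integral(3)[OF sigma_cnt sigma_finite_aff_haar int, symmetric])
  also have "\<dots> = cnj K * (of_real (c\<^sup>2) * f (P i))"
    unfolding inner integral_mult_right_zero reservoir_expansion[OF f P_H1] ..
  also have "of_real (1 / c\<^sup>2) * \<dots> = cnj K * f (P i)"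
    using c by (simp add: field_simps)
  finally show ?thesis ..
qed

text \<open>The pointwise domination that Schur's test asks for in the analysis map.\<close>

lemma reservoir_coefficient_le:
  assumes f: "f \<in> reservoir \<eta> \<rho>"
  shows "ennreal (norm (f (P i))) \<le> (\<integral>\<^sup>+z. ennreal (norm (kk i z) / norm K * norm (f (E z))) \<partial>aff_haar)"
proof -
  note [measurable] = ext_trans_meas[OF f]
  have "ennreal (norm K * norm (f (P i))) \<le> (\<integral>\<^sup>+z. ennreal (norm (cnj (kk i z) * f (E z))) \<partial>aff_haar)"
    using ennreal_norm_integral_le[of aff_haar "\<lambda>z. cnj (kk i z) * f (E z)"]
    by (simp add: norm_mult flip: reservoir_reproducing[OF f])
  then have "ennreal (1 / norm K) * ennreal (norm K * norm (f (P i))) \<le> ennreal (1 / norm K) * \<dots>"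
    by (rule mult_left_mono) simp
  also have "\<dots> = (\<integral>\<^sup>+z. ennreal (norm (kk i z) / norm K * norm (f (E z))) \<partial>aff_haar)"
    by (subst nn_integral_cmult[symmetric]) (auto simp: norm_mult ennreal_mult[symmetric])
  finally show ?thesis using K by (simp add: ennreal_mult[symmetric])
qed

end

section \<open>Synthesis, weighted Schur bounds and the frame property\<close>

context coorbit_frame
begin

text \<open>The canonical dual of a tight frame is the frame divided by \<open>c^2\<close>. The
  value 0 off H1 follows the convention of \<open>reservoir\<close>, so that synthesis can return f
  as a function.\<close>

definition synthesis :: "(int \<times> int \<Rightarrow> complex) \<Rightarrow> (real \<Rightarrow> complex) \<Rightarrow> complex" where
  "synthesis u g = (if g \<in> H1_space \<eta> \<rho> then of_real (1 / c\<^sup>2) * (\<integral>i. L2_inner (P i) g * u i \<partial>cnt) else 0)"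

lemma synthesis_analysis:
  assumes f: "f \<in> reservoir \<eta> \<rho>"
  shows "synthesis (\<lambda>i. f (P i)) = f"
proof
  fix g
  show "synthesis (\<lambda>i. f (P i)) g = f g"
    using reservoir_expansion[OF f, of g] reservoir_0[OF f, of g] c by (simp add: synthesis_def)
qed

lemma synthesis_E: "synthesis u (E z) = of_real (1 / c\<^sup>2) * (\<integral>i. HH i z * u i \<partial>cnt)"
  by (simp add: synthesis_def E_H1)

lemma aw_le_ww: "\<bar>\<sigma>\<bar> \<le> \<rho> \<Longrightarrow> aw \<sigma> i \<le> ww i"
proof -
  assume \<sigma>: "\<bar>\<sigma>\<bar> \<le> \<rho>"
  have "- real_of_int (fst i) * \<sigma> \<le> \<bar>real_of_int (fst i)\<bar> * \<bar>\<sigma>\<bar>"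
    by (metis abs_ge_self abs_minus_cancel abs_mult)
  also have "\<dots> \<le> \<bar>real_of_int (fst i)\<bar> * \<rho>" using \<sigma> by (intro mult_left_mono) auto
  finally have "aw \<sigma> i \<le> 2 powr (\<bar>real_of_int (fst i)\<bar> * \<rho>)" by simp
  also have "\<dots> \<le> ww i"
    by (cases "fst i \<ge> 0") (auto simp: ww_def)
  finally show ?thesis .
qed

text \<open>Growth \<open>ww\<close> is dual to the weighted l1 bound on the coefficients of H1
  elements, and that bound is what makes the functional bounded.\<close>

lemma synthesis_reservoir:
  assumes u: "\<And>i. norm (u i) \<le> N * ww i" and N: "N \<ge> 0"
  shows "synthesis u \<in> reservoir \<eta> \<rho>"
proof -
  note int = coefficient_integrable[OF _ u N]
  obtain C where C: "C \<ge> 0" "\<And>g. g \<in> L2 \<Longrightarrow> (\<integral>\<^sup>+i. ennreal (norm (L2_inner (P i) g) * ww i) \<partial>cnt) \<le> ennreal C * nH g"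
    using weighted_coefficient_sum by blast
  have 1: "synthesis u (\<lambda>x. g x + h x) = synthesis u g + synthesis u h" if g: "g \<in> H1_space \<eta> \<rho>" and h: "h \<in> H1_space \<eta> \<rho>" for g h
  proof -
    have "g \<in> L2" "h \<in> L2" using g h by (auto simp: H1_iff)
    then have "(\<integral>i. L2_inner (P i) (\<lambda>x. g x + h x) * u i \<partial>cnt) = (\<integral>i. L2_inner (P i) g * u i + L2_inner (P i) h * u i \<partial>cnt)"
      by (simp add: L2_inner_add_right P_L2 distrib_right)
    also have "\<dots> = (\<integral>i. L2_inner (P i) g * u i \<partial>cnt) + (\<integral>i. L2_inner (P i) h * u i \<partial>cnt)"
      by (rule Bochner_Integration.integral_add[OF int[OF g] int[OF h]])
    finally show ?thesis using g h by (simp add: synthesis_def H1_add add_divide_distrib)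
  qed
  have 2: "synthesis u (\<lambda>x. a * g x) = cnj a * synthesis u g" if g: "g \<in> H1_space \<eta> \<rho>" for a g
  proof -
    have "(\<integral>i. L2_inner (P i) (\<lambda>x. a * g x) * u i \<partial>cnt) = cnj a * (\<integral>i. L2_inner (P i) g * u i \<partial>cnt)"
      by (simp add: L2_inner_cmult_right mult.assoc)
    then show ?thesis using g by (simp add: synthesis_def H1_cmult)
  qed
  have 3: "norm (synthesis u g) \<le> (1 / c\<^sup>2 * (N * C)) * H1_norm \<eta> \<rho> g" if g: "g \<in> H1_space \<eta> \<rho>" for g
  proof -
    have gL: "g \<in> L2" and n: "nH g < \<infinity>" using g by (auto simp: H1_iff)
    have "ennreal (norm (\<integral>i. L2_inner (P i) g * u i \<partial>cnt)) \<le> (\<integral>\<^sup>+i. ennreal (norm (L2_inner (P i) g * u i)) \<partial>cnt)"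
      by (rule ennreal_norm_integral_le)
    also have "\<dots> \<le> (\<integral>\<^sup>+i. ennreal N * ennreal (norm (L2_inner (P i) g) * ww i) \<partial>cnt)"
    proof (rule nn_integral_mono)
      fix i
      have "norm (L2_inner (P i) g * u i) \<le> norm (L2_inner (P i) g) * (N * ww i)"
        unfolding norm_mult by (intro mult_left_mono u) simp
      then show "ennreal (norm (L2_inner (P i) g * u i)) \<le> ennreal N * ennreal (norm (L2_inner (P i) g) * ww i)"
        using N ww_pos[of i] by (simp add: ennreal_mult[symmetric] ennreal_leI mult_ac)
    qed
    also have "\<dots> \<le> ennreal N * (ennreal C * nH g)"
      by (subst nn_integral_cmult) (auto intro!: mult_left_mono C gL)
    also have "\<dots> = ennreal (N * C * enn2real (nH g))"
      using n N C(1) by (simp add: ennreal_mult mult.assoc)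
    finally have "norm (\<integral>i. L2_inner (P i) g * u i \<partial>cnt) \<le> N * C * enn2real (nH g)"
      using N C(1) by (subst (asm) ennreal_le_iff) auto
    from mult_left_mono[OF this, of "1 / c\<^sup>2"] show ?thesis
      using g by (simp add: synthesis_def H1_norm_eq[OF gL] norm_mult norm_divide norm_power mult_ac)
  qed
  show ?thesis
    unfolding reservoir_def mem_Collect_eq
    by (intro conjI ballI allI impI exI[of _ "1 / c\<^sup>2 * (N * C)"] 1 2 3) (simp_all add: synthesis_def)
qed

lemma synthesis_add:
  assumes "\<And>i. norm (u i) \<le> N * ww i" "N \<ge> 0" "\<And>i. norm (v i) \<le> M * ww i" "M \<ge> 0"
  shows "synthesis (\<lambda>i. u i + v i) = (\<lambda>g. synthesis u g + synthesis v g)"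
proof
  fix g
  show "synthesis (\<lambda>i. u i + v i) g = synthesis u g + synthesis v g"
  proof (cases "g \<in> H1_space \<eta> \<rho>")
    case True
    have "(\<integral>i. L2_inner (P i) g * (u i + v i) \<partial>cnt) = (\<integral>i. L2_inner (P i) g * u i \<partial>cnt) + (\<integral>i. L2_inner (P i) g * v i \<partial>cnt)"
      unfolding distrib_left
      by (rule Bochner_Integration.integral_add[OF coefficient_integrable[OF True assms(1,2)] coefficient_integrable[OF True assms(3,4)]])
    then show ?thesis using True by (simp add: synthesis_def add_divide_distrib)
  qed (simp add: synthesis_def)
qed

lemma synthesis_cmult: "synthesis (\<lambda>i. a * u i) = (\<lambda>g. a * synthesis u g)"
  by (auto simp: synthesis_def mult.left_commute[of _ a])

lemma reservoir_zero_mem: "(\<lambda>_. 0) \<in> reservoir \<eta> \<rho>"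
  by (auto simp: reservoir_def intro: exI[of _ 0])

lemma reservoir_add_mem:
  assumes f: "f \<in> reservoir \<eta> \<rho>" and h: "h \<in> reservoir \<eta> \<rho>"
  shows "(\<lambda>g. f g + h g) \<in> reservoir \<eta> \<rho>"
proof -
  obtain A where A: "\<And>g. g \<in> H1_space \<eta> \<rho> \<Longrightarrow> norm (f g) \<le> A * H1_norm \<eta> \<rho> g" using f unfolding reservoir_def by blast
  obtain B where B: "\<And>g. g \<in> H1_space \<eta> \<rho> \<Longrightarrow> norm (h g) \<le> B * H1_norm \<eta> \<rho> g" using h unfolding reservoir_def by blast
  have "norm (f g + h g) \<le> (A + B) * H1_norm \<eta> \<rho> g" if "g \<in> H1_space \<eta> \<rho>" for g
    using norm_triangle_ineq[of "f g" "h g"] A[OF that] B[OF that] by (simp add: distrib_right)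
  then show ?thesis using f h by (auto simp: reservoir_def distrib_left)
qed

lemma reservoir_cmult_mem:
  assumes f: "f \<in> reservoir \<eta> \<rho>"
  shows "(\<lambda>g. a * f g) \<in> reservoir \<eta> \<rho>"
proof -
  obtain A where A: "\<And>g. g \<in> H1_space \<eta> \<rho> \<Longrightarrow> norm (f g) \<le> A * H1_norm \<eta> \<rho> g" using f unfolding reservoir_def by blast
  have "norm (a * f g) \<le> (norm a * A) * H1_norm \<eta> \<rho> g" if "g \<in> H1_space \<eta> \<rho>" for g
    using mult_left_mono[OF A[OF that], of "norm a"] by (simp add: norm_mult mult.assoc)
  then show ?thesis using f by (auto simp: reservoir_def distrib_left mult.left_commute)
qed

text \<open>Only an inequality, since the product is 0 at t = 0.\<close>

lemma powr_cancel_le: "t powr s * t powr (- s) \<le> (1 :: real)"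
  by (cases "t = 0") (auto simp flip: powr_add)

lemma aw_cancel: "aw s i * aw (- s) i = 1"
  by (simp flip: powr_add)

lemma analysis_bound:
  assumes s: "\<bar>s\<bar> \<le> \<rho>" and p: "1 \<le> p"
  obtains A where "A > 0"
    "\<And>f. f \<in> reservoir \<eta> \<rho> \<Longrightarrow> ext_wav_trans \<eta> f \<in> wLp_space p (wt_m s) aff_haar \<Longrightarrow>
      (\<lambda>i. f (P i)) \<in> dyadic_seq_space p s \<and>
      dyadic_seq_norm p s (\<lambda>i. f (P i)) \<le> A * wLp_norm p (wt_m s) aff_haar (ext_wav_trans \<eta> f)"
proof -
  have s': "\<bar>- s\<bar> \<le> \<rho>" using s by simp
  obtain C1 where C1: "C1 \<ge> 0" "\<And>i. (\<integral>\<^sup>+z. ennreal (norm (kk i z) * \<bar>snd z\<bar> powr s) \<partial>aff_haar) \<le> ennreal (C1 * aw s i)"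
    using row[OF s] by blast
  obtain C2 where C2: "C2 \<ge> 0" "\<And>z. (\<integral>\<^sup>+i. ennreal (norm (kk i z) * aw (- s) i) \<partial>cnt) \<le> ennreal (C2 * \<bar>snd z\<bar> powr (- s))"
    using col[OF s'] by blast
  \<comment> \<open>Schur's test takes a single positive constant: the sum dominates the row and the
    column bound, and the 1 keeps it positive.\<close>
  define A where "A = C1 / norm K + C2 / norm K + 1"
  \<comment> \<open>The kernel is conjugated by the two weights. Its rows are then controlled by the
    row bound with exponent s and its columns by the column bound with exponent -s, and in each case
    the remaining weight cancels the right-hand side.\<close>
  define k where "k = (\<lambda>i z. norm (kk i z) / norm K * aw (- s) i * \<bar>snd z\<bar> powr s)"
  have km: "case_prod k \<in> borel_measurable (cnt \<Otimes>\<^sub>M aff_haar)"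
    unfolding k_def by (intro cnt_pair_meas) measurable
  have A0: "A > 0" using C1 C2 unfolding A_def by (intro add_nonneg_pos add_nonneg_nonneg) auto
  have k_row: "(\<integral>\<^sup>+z. ennreal (k i z) \<partial>aff_haar) \<le> ennreal A" for i
  proof -
    have "(\<integral>\<^sup>+z. ennreal (k i z) \<partial>aff_haar) = (\<integral>\<^sup>+z. ennreal (aw (- s) i / norm K) * ennreal (norm (kk i z) * \<bar>snd z\<bar> powr s) \<partial>aff_haar)"
      by (intro nn_integral_cong) (simp add: k_def ennreal_mult[symmetric] mult_ac)
    also have "\<dots> = ennreal (aw (- s) i / norm K) * (\<integral>\<^sup>+z. ennreal (norm (kk i z) * \<bar>snd z\<bar> powr s) \<partial>aff_haar)"
      by (rule nn_integral_cmult) measurable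
    also have "\<dots> \<le> ennreal (aw (- s) i / norm K) * ennreal (C1 * aw s i)"
      by (intro mult_left_mono C1) simp
    also have "\<dots> = ennreal (C1 / norm K * (aw s i * aw (- s) i))"
      using C1(1) by (simp add: ennreal_mult[symmetric] mult_ac del: powr_minus)
    also have "\<dots> \<le> ennreal A"
      unfolding aw_cancel A_def using C2(1) by (intro ennreal_leI) simp
    finally show ?thesis .
  qed
  have k_col: "(\<integral>\<^sup>+i. ennreal (k i z) \<partial>cnt) \<le> ennreal A" for z
  proof -
    have "(\<integral>\<^sup>+i. ennreal (k i z) \<partial>cnt) = (\<integral>\<^sup>+i. ennreal (\<bar>snd z\<bar> powr s / norm K) * ennreal (norm (kk i z) * aw (- s) i) \<partial>cnt)"
      by (intro nn_integral_cong) (simp add: k_def ennreal_mult[symmetric] mult_ac)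
    also have "\<dots> = ennreal (\<bar>snd z\<bar> powr s / norm K) * (\<integral>\<^sup>+i. ennreal (norm (kk i z) * aw (- s) i) \<partial>cnt)"
      by (rule nn_integral_cmult) simp
    also have "\<dots> \<le> ennreal (\<bar>snd z\<bar> powr s / norm K) * ennreal (C2 * \<bar>snd z\<bar> powr (- s))"
      by (intro mult_left_mono C2) simp
    also have "\<dots> = ennreal (C2 / norm K * (\<bar>snd z\<bar> powr s * \<bar>snd z\<bar> powr (- s)))"
      using C2(1) by (simp add: ennreal_mult[symmetric] mult_ac)
    also have "\<dots> \<le> ennreal (C2 / norm K * 1)"
      using C2(1) by (intro ennreal_leI mult_left_mono powr_cancel_le) simp
    also have "\<dots> \<le> ennreal A"
      unfolding A_def using C1(1) by (intro ennreal_leI) simp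
    finally show ?thesis .
  qed
  show ?thesis
  proof (rule that[OF A0])
    fix f assume f: "f \<in> reservoir \<eta> \<rho>" and fL: "ext_wav_trans \<eta> f \<in> wLp_space p (wt_m s) aff_haar"
    define G where "G = (\<lambda>z. ext_wav_trans \<eta> f z * of_real (wt_m s z))"
    have G: "G \<in> Lp_space p aff_haar" using fL by (simp add: wLp_space_def G_def)
    define F where "F = (\<lambda>i. f (P i) * of_real (dyadic_weight s i))"
    have Fle: "ennreal (norm (F i)) \<le> (\<integral>\<^sup>+z. ennreal (k i z * norm (G z)) \<partial>aff_haar)" for i
    proof -
      note [measurable] = ext_trans_meas[OF f]
      have "ennreal (norm (F i)) = ennreal (aw (- s) i) * ennreal (norm (f (P i)))"
        by (simp add: F_def norm_mult dyadic_weight_def ennreal_mult mult.commute)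
      also have "\<dots> \<le> ennreal (aw (- s) i) * (\<integral>\<^sup>+z. ennreal (norm (kk i z) / norm K * norm (f (E z))) \<partial>aff_haar)"
        by (intro mult_left_mono reservoir_coefficient_le f) simp
      also have "\<dots> = (\<integral>\<^sup>+z. ennreal (aw (- s) i) * ennreal (norm (kk i z) / norm K * norm (f (E z))) \<partial>aff_haar)"
        by (rule nn_integral_cmult[symmetric]) measurable
      also have "\<dots> = (\<integral>\<^sup>+z. ennreal (k i z * norm (G z)) \<partial>aff_haar)"
      proof (rule nn_integral_cong)
        fix z :: "real \<times> real"
        obtain b a where z: "z = (b, a)" by (cases z)
        show "ennreal (aw (- s) i) * ennreal (norm (kk i z) / norm K * norm (f (E z))) = ennreal (k i z * norm (G z))"
        proof (cases "a = 0")
          case True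
          \<comment> \<open>On the line a = 0 the vector \<open>E z\<close> is 0, so f vanishes on
            it as well.\<close>
          then show ?thesis using reservoir_zero[OF f] by (simp add: z wav_rep_0 G_def ext_wav_trans_def)
        next
          case False
          then have "\<bar>a\<bar> powr s * \<bar>a\<bar> powr (- s) = 1" by (simp flip: powr_add)
          then have "k i z * norm (G z) = aw (- s) i * (norm (kk i z) / norm K * norm (f (E z)))"
            by (simp add: k_def G_def z ext_wav_trans_def wt_m_def norm_mult mult_ac del: powr_minus)
          then show ?thesis by (simp only:) (rule ennreal_mult[symmetric]; simp)
        qed
      qed
      finally show ?thesis .
    qed
    have Sch: "F \<in> Lp_space p cnt" "Lp_norm p cnt F \<le> A * Lp_norm p aff_haar G"
      by (rule Schur_test[OF sigma_cnt sigma_finite_aff_haar km _ A0 _ _ p G _ Fle]; use k_row k_col in \<open>simp add: k_def\<close>)+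
    have mem: "(\<lambda>i. f (P i)) \<in> dyadic_seq_space p s"
      unfolding dyadic_seq_space_eq(1)[OF p] using Sch(1) by (simp add: F_def)
    show "(\<lambda>i. f (P i)) \<in> dyadic_seq_space p s \<and>
      dyadic_seq_norm p s (\<lambda>i. f (P i)) \<le> A * wLp_norm p (wt_m s) aff_haar (ext_wav_trans \<eta> f)"
      using mem Sch(2) unfolding dyadic_seq_space_eq(2)[OF p mem] by (simp add: F_def G_def wLp_norm_def)
  qed
qed

text \<open>For every p a single entry is bounded by the norm, and |s| \<le> \<rho> turns the weight
  into \<open>ww\<close>. Hence synthesis of any such sequence lies in the antidual.\<close>

lemma dyadic_seq_bound:
  assumes s: "\<bar>s\<bar> \<le> \<rho>" and p: "1 \<le> p" and u: "u \<in> dyadic_seq_space p s"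
  shows "norm (u i) \<le> dyadic_seq_norm p s u * ww i" "0 \<le> dyadic_seq_norm p s u"
proof -
  let ?v = "\<lambda>i. u i * of_real (dyadic_weight s i)"
  have v: "?v \<in> Lp_space p cnt" using u unfolding dyadic_seq_space_eq(1)[OF p] by simp
  show 0: "0 \<le> dyadic_seq_norm p s u" unfolding dyadic_seq_space_eq(2)[OF p u] by (rule Lp_norm_nonneg)
  have "norm (u i) * aw (- s) i \<le> dyadic_seq_norm p s u"
    using Lp_count_space_le[OF p v, of i] unfolding dyadic_seq_space_eq(2)[OF p u] by (simp add: norm_mult dyadic_weight_def)
  then have "aw s i * (norm (u i) * aw (- s) i) \<le> aw s i * dyadic_seq_norm p s u"
    by (rule mult_left_mono) simp
  then have "norm (u i) \<le> dyadic_seq_norm p s u * aw s i"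
    by (simp only: mult.left_commute[of "aw s i" "norm (u i)"] aw_cancel mult_1_right mult.commute[of _ "aw s i"])
  also have "\<dots> \<le> dyadic_seq_norm p s u * ww i"
    by (intro mult_left_mono aw_le_ww s 0)
  finally show "norm (u i) \<le> \<dots>" .
qed

text \<open>The kernel is now \<open>HH\<close>, because membership in the coorbit space is tested
  with \<eta>. The group and the index set exchange roles: the group integral is taken with exponent
  -s and the sum over indices with exponent s.\<close>

lemma synthesis_bound:
  assumes s: "\<bar>s\<bar> \<le> \<rho>" and p: "1 \<le> p"
  obtains A where "A > 0"
    "\<And>u. u \<in> dyadic_seq_space p s \<Longrightarrow> ext_wav_trans \<eta> (synthesis u) \<in> wLp_space p (wt_m s) aff_haar \<and>
      wLp_norm p (wt_m s) aff_haar (ext_wav_trans \<eta> (synthesis u)) \<le> A * dyadic_seq_norm p s u"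
proof -
  have s': "\<bar>- s\<bar> \<le> \<rho>" using s by simp
  obtain C1 where C1: "C1 \<ge> 0" "\<And>i. (\<integral>\<^sup>+z. ennreal (norm (HH i z) * \<bar>snd z\<bar> powr (- s)) \<partial>aff_haar) \<le> ennreal (C1 * aw (- s) i)"
    using HH_row[OF s'] by blast
  obtain C2 where C2: "C2 \<ge> 0" "\<And>z. (\<integral>\<^sup>+i. ennreal (norm (HH i z) * aw s i) \<partial>cnt) \<le> ennreal (C2 * \<bar>snd z\<bar> powr s)"
    using HH_col[OF s] by blast
  define A where "A = C1 / c\<^sup>2 + C2 / c\<^sup>2 + 1"
  define k where "k = (\<lambda>z i. norm (HH i z) / c\<^sup>2 * aw s i * \<bar>snd z\<bar> powr (- s))"
  have km: "case_prod k \<in> borel_measurable (aff_haar \<Otimes>\<^sub>M cnt)"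
  proof -
    have "(\<lambda>(i, z). k z i) \<in> borel_measurable (cnt \<Otimes>\<^sub>M aff_haar)"
      unfolding k_def by (intro cnt_pair_meas) measurable
    then show ?thesis
      by (subst measurable_pair_swap_iff) (simp add: split_beta')
  qed
  have A0: "A > 0" using C1 C2 unfolding A_def by (intro add_nonneg_pos add_nonneg_nonneg) auto
  have k_col: "(\<integral>\<^sup>+z. ennreal (k z i) \<partial>aff_haar) \<le> ennreal A" for i
  proof -
    have "(\<integral>\<^sup>+z. ennreal (k z i) \<partial>aff_haar) = (\<integral>\<^sup>+z. ennreal (aw s i / c\<^sup>2) * ennreal (norm (HH i z) * \<bar>snd z\<bar> powr (- s)) \<partial>aff_haar)"
      by (intro nn_integral_cong) (simp add: k_def ennreal_mult[symmetric] mult_ac)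
    also have "\<dots> = ennreal (aw s i / c\<^sup>2) * (\<integral>\<^sup>+z. ennreal (norm (HH i z) * \<bar>snd z\<bar> powr (- s)) \<partial>aff_haar)"
      by (rule nn_integral_cmult) measurable
    also have "\<dots> \<le> ennreal (aw s i / c\<^sup>2) * ennreal (C1 * aw (- s) i)"
      by (intro mult_left_mono C1) simp
    also have "\<dots> = ennreal (C1 / c\<^sup>2 * (aw s i * aw (- s) i))"
      using C1(1) by (simp add: ennreal_mult[symmetric] mult_ac del: powr_minus)
    also have "\<dots> \<le> ennreal A"
      unfolding aw_cancel A_def using C2(1) by (intro ennreal_leI) simp
    finally show ?thesis .
  qed
  have k_row: "(\<integral>\<^sup>+i. ennreal (k z i) \<partial>cnt) \<le> ennreal A" for z
  proof -
    have "(\<integral>\<^sup>+i. ennreal (k z i) \<partial>cnt) = (\<integral>\<^sup>+i. ennreal (\<bar>snd z\<bar> powr (- s) / c\<^sup>2) * ennreal (norm (HH i z) * aw s i) \<partial>cnt)"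
      by (intro nn_integral_cong) (simp add: k_def ennreal_mult[symmetric] mult_ac)
    also have "\<dots> = ennreal (\<bar>snd z\<bar> powr (- s) / c\<^sup>2) * (\<integral>\<^sup>+i. ennreal (norm (HH i z) * aw s i) \<partial>cnt)"
      by (rule nn_integral_cmult) simp
    also have "\<dots> \<le> ennreal (\<bar>snd z\<bar> powr (- s) / c\<^sup>2) * ennreal (C2 * \<bar>snd z\<bar> powr s)"
      by (intro mult_left_mono C2) simp
    also have "\<dots> = ennreal (C2 / c\<^sup>2 * (\<bar>snd z\<bar> powr s * \<bar>snd z\<bar> powr (- s)))"
      using C2(1) by (simp add: ennreal_mult[symmetric] mult_ac)
    also have "\<dots> \<le> ennreal (C2 / c\<^sup>2 * 1)"
      using C2(1) by (intro ennreal_leI mult_left_mono powr_cancel_le) simp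
    also have "\<dots> \<le> ennreal A"
      unfolding A_def using C1(1) by (intro ennreal_leI) simp
    finally show ?thesis .
  qed
  show ?thesis
  proof (rule that[OF A0])
    fix u assume u: "u \<in> dyadic_seq_space p s"
    define G where "G = (\<lambda>i. u i * of_real (dyadic_weight s i))"
    have G: "G \<in> Lp_space p cnt" using u unfolding dyadic_seq_space_eq(1)[OF p] by (simp add: G_def)
    define F where "F = (\<lambda>z. ext_wav_trans \<eta> (synthesis u) z * of_real (wt_m s z))"
    have F: "F z = of_real (1 / c\<^sup>2) * (\<integral>i. HH i z * u i \<partial>cnt) * of_real (\<bar>snd z\<bar> powr (- s))" for z
      unfolding F_def ext_wav_trans_def synthesis_E by (simp add: wt_m_def split_beta)
    have Fm: "F \<in> borel_measurable aff_haar"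
      unfolding F[abs_def] using synthesis_trans_meas[of u] by measurable
    have Fle: "ennreal (norm (F z)) \<le> (\<integral>\<^sup>+i. ennreal (k z i * norm (G i)) \<partial>cnt)" for z
    proof -
      have "ennreal (norm (F z)) = ennreal (\<bar>snd z\<bar> powr (- s) / c\<^sup>2) * ennreal (norm (\<integral>i. HH i z * u i \<partial>cnt))"
        unfolding F by (simp add: norm_mult norm_divide norm_power ennreal_mult[symmetric] mult_ac)
      also have "\<dots> \<le> ennreal (\<bar>snd z\<bar> powr (- s) / c\<^sup>2) * (\<integral>\<^sup>+i. ennreal (norm (HH i z * u i)) \<partial>cnt)"
        by (intro mult_left_mono ennreal_norm_integral_le) simp
      also have "\<dots> = (\<integral>\<^sup>+i. ennreal (\<bar>snd z\<bar> powr (- s) / c\<^sup>2) * ennreal (norm (HH i z * u i)) \<partial>cnt)"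
        by (rule nn_integral_cmult[symmetric]) simp
      also have "\<dots> = (\<integral>\<^sup>+i. ennreal (k z i * norm (G i)) \<partial>cnt)"
      proof (rule nn_integral_cong)
        fix i
        have "k z i * norm (G i) = \<bar>snd z\<bar> powr (- s) / c\<^sup>2 * norm (HH i z * u i) * (aw s i * aw (- s) i)"
          by (simp add: k_def G_def norm_mult dyadic_weight_def mult_ac del: powr_minus)
        then show "ennreal (\<bar>snd z\<bar> powr (- s) / c\<^sup>2) * ennreal (norm (HH i z * u i)) = ennreal (k z i * norm (G i))"
          unfolding aw_cancel by (simp add: ennreal_mult[symmetric])
      qed
      finally show ?thesis .
    qed
    have Sch: "F \<in> Lp_space p aff_haar" "Lp_norm p aff_haar F \<le> A * Lp_norm p cnt G"
      by (rule Schur_test[OF sigma_finite_aff_haar sigma_cnt km _ A0 _ _ p G Fm Fle]; use k_row k_col in \<open>simp add: k_def\<close>)+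
    show "ext_wav_trans \<eta> (synthesis u) \<in> wLp_space p (wt_m s) aff_haar \<and>
      wLp_norm p (wt_m s) aff_haar (ext_wav_trans \<eta> (synthesis u)) \<le> A * dyadic_seq_norm p s u"
      unfolding dyadic_seq_space_eq(2)[OF p u] using Sch by (simp add: F_def G_def wLp_norm_def wLp_space_def)
  qed
qed

text \<open>Synthesis is a bounded left inverse of analysis on the coorbit space. The lower frame
  bound and the definiteness of the sequence norm both follow from this, and it is the required
  reconstruction operator.\<close>

theorem banach_frame_wavelet:
  assumes \<rho>: "\<rho> = \<bar>s\<bar> + 1" and p: "1 \<le> p"
  shows "banach_frame \<eta> p s (dyadic_seq_space p s) (dyadic_seq_norm p s) P"
proof -
  let ?V = "dyadic_seq_space p s" and ?N = "dyadic_seq_norm p s"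
  let ?D = "\<lambda>f i. f (P i) :: complex"
  have s: "\<bar>s\<bar> \<le> \<rho>" using \<rho> by simp
  have Co: "f \<in> Co_space \<eta> p s \<longleftrightarrow> f \<in> reservoir \<eta> \<rho> \<and> ext_wav_trans \<eta> f \<in> wLp_space p (wt_m s) aff_haar" for f
    by (simp add: Co_space_def \<rho>)
  obtain A where A: "A > 0" "\<And>f. f \<in> Co_space \<eta> p s \<Longrightarrow> ?D f \<in> ?V \<and> ?N (?D f) \<le> A * Co_norm \<eta> p s f"
    using analysis_bound[OF s p] unfolding Co Co_norm_def by metis
  obtain A' where A': "A' > 0" "\<And>u. u \<in> ?V \<Longrightarrow> ext_wav_trans \<eta> (synthesis u) \<in> wLp_space p (wt_m s) aff_haar \<and> Co_norm \<eta> p s (synthesis u) \<le> A' * ?N u"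
    using synthesis_bound[OF s p] unfolding Co_norm_def by metis
  have ban: "banach_fun_space ?V ?N" by (rule banach_dyadic_seq_space[OF p])
  then have nor: "normed_fun_space ?V ?N" by (simp add: banach_fun_space_def)
  have N_add: "\<And>u v. u \<in> ?V \<Longrightarrow> v \<in> ?V \<Longrightarrow> ?N (\<lambda>x. u x + v x) \<le> ?N u + ?N v"
    and N_cmult: "\<And>a u. u \<in> ?V \<Longrightarrow> ?N (\<lambda>x. a * u x) = norm a * ?N u"
    and N_nonneg: "\<And>u. u \<in> ?V \<Longrightarrow> 0 \<le> ?N u"
    and N_0: "\<And>u. u \<in> ?V \<Longrightarrow> ?N u = 0 \<Longrightarrow> u = (\<lambda>_. 0)" "?N (\<lambda>_. 0) = 0"
    using nor unfolding normed_fun_space_def by blast+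
  have SA: "synthesis (?D f) = f" if "f \<in> Co_space \<eta> p s" for f
    using that by (intro synthesis_analysis) (simp add: Co)
  have S: "synthesis u \<in> Co_space \<eta> p s" if u: "u \<in> ?V" for u
    using A'(2)[OF u] synthesis_reservoir[OF dyadic_seq_bound[OF s p u]] by (simp add: Co)
  have zero: "(\<lambda>_. 0) \<in> Co_space \<eta> p s"
    using Lp_space_zero[OF p] by (simp add: Co reservoir_zero_mem wLp_space_def ext_wav_trans_def)
  have add: "(\<lambda>g. f g + h g) \<in> Co_space \<eta> p s" if "f \<in> Co_space \<eta> p s" "h \<in> Co_space \<eta> p s" for f h
    using that Lp_space_add(1)[OF p, of "\<lambda>z. ext_wav_trans \<eta> f z * of_real (wt_m s z)" aff_haar "\<lambda>z. ext_wav_trans \<eta> h z * of_real (wt_m s z)"]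
    by (simp add: Co reservoir_add_mem wLp_space_def ext_wav_trans_def distrib_right)
  have cmult: "(\<lambda>g. a * f g) \<in> Co_space \<eta> p s" if "f \<in> Co_space \<eta> p s" for f a
    using that Lp_space_cmult_le(1)[OF p, of "\<lambda>z. ext_wav_trans \<eta> f z * of_real (wt_m s z)" aff_haar a]
    by (simp add: Co reservoir_cmult_mem wLp_space_def ext_wav_trans_def mult.assoc)
  have "normed_fun_space (Co_space \<eta> p s) (\<lambda>f. ?N (?D f))"
    unfolding normed_fun_space_def
  proof (intro conjI ballI allI zero add cmult iffI)
    fix f h assume f: "f \<in> Co_space \<eta> p s" and h: "h \<in> Co_space \<eta> p s"
    show "?N (\<lambda>i. f (P i) + h (P i)) \<le> ?N (?D f) + ?N (?D h)"
      using N_add[of "?D f" "?D h"] A(2)[OF f] A(2)[OF h] by blast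
  next
    fix a f assume f: "f \<in> Co_space \<eta> p s"
    show "?N (\<lambda>i. a * f (P i)) = norm a * ?N (?D f)"
      using N_cmult[of "?D f" a] A(2)[OF f] by blast
  next
    fix f assume f: "f \<in> Co_space \<eta> p s"
    show "0 \<le> ?N (?D f)" using N_nonneg A(2)[OF f] by blast
    assume "?N (?D f) = 0"
    then have "?D f = (\<lambda>_. 0)" using N_0(1) A(2)[OF f] by blast
    with SA[OF f] have "f = synthesis (\<lambda>_. 0)" by (simp only:)
    then show "f = (\<lambda>_. 0)" by (simp add: synthesis_def fun_eq_iff)
  next
    fix f :: "(real \<Rightarrow> complex) \<Rightarrow> complex" assume "f = (\<lambda>_. 0)"
    then show "?N (?D f) = 0" using N_0(2) by simp
  qed
  moreover have "1 / A' * Co_norm \<eta> p s f \<le> ?N (?D f)" if f: "f \<in> Co_space \<eta> p s" for f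
    using A'(2)[of "?D f"] A(2)[OF f] SA[OF f] A'(1) by (simp add: field_simps)
  then have "\<exists>A>0. \<exists>B>0. \<forall>f\<in>Co_space \<eta> p s. A * Co_norm \<eta> p s f \<le> ?N (?D f) \<and> ?N (?D f) \<le> B * Co_norm \<eta> p s f"
    using A A'(1) by (intro exI[of _ "1 / A'"] exI[of _ A] conjI) auto
  moreover have "bounded_linear_on ?V ?N (Co_space \<eta> p s) (Co_norm \<eta> p s) synthesis"
    unfolding bounded_linear_on_def
  proof (intro conjI ballI allI S synthesis_cmult)
    fix u v assume u: "u \<in> ?V" and v: "v \<in> ?V"
    show "synthesis (\<lambda>i. u i + v i) = (\<lambda>g. synthesis u g + synthesis v g)"
      by (rule synthesis_add[OF dyadic_seq_bound[OF s p u] dyadic_seq_bound[OF s p v]])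
  next
    show "\<exists>C. \<forall>u\<in>?V. Co_norm \<eta> p s (synthesis u) \<le> C * ?N u" using A' by blast
  qed
  ultimately show ?thesis
    unfolding banach_frame_def using ban A(2) SA P_H1 \<rho> by blast
qed

end

section \<open>Verification of the frame hypotheses for the wavelet system\<close>

context regular_wavelet
begin

text \<open>The increment is bounded by the integral of the derivative over the segment, written as
  a convolution with an interval so that Tonelli applies in x.\<close>

lemma \<psi>_difference:
  "ennreal (norm (\<psi> (x - d) - \<psi> x)) \<le> (\<integral>\<^sup>+t. indicator {min 0 d..max 0 d} (x - t) * ennreal (norm (D (Suc 0) t)) \<partial>lborel)"
proof -
  define a b where "a = min (x - d) x" and "b = max (x - d) x"
  have D: "(\<psi> has_vector_derivative D (Suc 0) x) (at x)" for x
    using Dd[of 0 x] L by (simp add: D0)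
  have Ds: "set_integrable lborel {a..b} (D (Suc 0))"
    unfolding set_integrable_def using Di[of "Suc 0"] L by (intro integrable_mult_indicator) auto
  have "norm (\<psi> (x - d) - \<psi> x) = norm (\<psi> b - \<psi> a)"
    by (auto simp: a_def b_def min_def max_def norm_minus_commute)
  also have "\<psi> b - \<psi> a = (\<integral>t. indicator {a..b} t *\<^sub>R D (Suc 0) t \<partial>lborel)"
    by (rule FTC_indicator[OF _ D Ds, symmetric]) (simp add: a_def b_def)
  also have "ennreal (norm \<dots>) \<le> (\<integral>\<^sup>+t. ennreal (norm (indicator {a..b} t *\<^sub>R D (Suc 0) t)) \<partial>lborel)"
    by (rule ennreal_norm_integral_le)
  also have "\<dots> = (\<integral>\<^sup>+t. indicator {min 0 d..max 0 d} (x - t) * ennreal (norm (D (Suc 0) t)) \<partial>lborel)"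
  proof (rule nn_integral_cong)
    fix t
    have "t \<in> {a..b} \<longleftrightarrow> x - t \<in> {min 0 d..max 0 d}"
      unfolding a_def b_def by (cases "d \<ge> 0") auto
    then show "ennreal (norm (indicator {a..b} t *\<^sub>R D (Suc 0) t)) = indicator {min 0 d..max 0 d} (x - t) * ennreal (norm (D (Suc 0) t))"
      by (cases "t \<in> {a..b}") (simp_all add: indicator_def del: atLeastAtMost_iff)
  qed
  finally show ?thesis .
qed

text \<open>One factor of the square is bounded by the L1 norm of the derivative; the other is
  integrated in x and contributes |d| times the same norm.\<close>

lemma l2_\<psi>_difference: "(l2 (\<lambda>x. \<psi> (x - d) - \<psi> x))\<^sup>2 \<le> \<bar>d\<bar> * (\<integral>t. norm (D (Suc 0) t) \<partial>lborel)\<^sup>2"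
  and \<psi>_difference_L2: "(\<lambda>x. \<psi> (x - d) - \<psi> x) \<in> L2"
proof -
  define N where "N = (\<integral>t. norm (D (Suc 0) t) \<partial>lborel)"
  have Di1: "integrable lborel (D (Suc 0))" using Di[of "Suc 0"] L by simp
  have [measurable]: "D (Suc 0) \<in> borel_measurable borel" using Di1 by simp
  have N: "(\<integral>\<^sup>+t. ennreal (norm (D (Suc 0) t)) \<partial>lborel) = ennreal N" and N0: "N \<ge> 0"
    using Di1 by (auto simp: N_def nn_integral_eq_integral)
  have le: "ennreal (norm (\<psi> (x - d) - \<psi> x)) \<le> ennreal N" for x
    unfolding N[symmetric] by (rule order_trans[OF \<psi>_difference]) (auto intro!: nn_integral_mono simp: indicator_def)
  have m: "(\<lambda>x. \<psi> (x - d)) \<in> L2" using L2_affine[OF \<psi>_L2, of 1 "- d"] by simp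
  show L: "(\<lambda>x. \<psi> (x - d) - \<psi> x) \<in> L2" using L2_add[OF m L2_cmult[OF \<psi>_L2, of "- 1"]] by simp
  have "ennreal ((l2 (\<lambda>x. \<psi> (x - d) - \<psi> x))\<^sup>2) = (\<integral>\<^sup>+x. ennreal ((norm (\<psi> (x - d) - \<psi> x))\<^sup>2) \<partial>lborel)"
    by (rule L2_nn_integral[OF L, symmetric])
  also have "\<dots> \<le> (\<integral>\<^sup>+x. ennreal N * (\<integral>\<^sup>+t. indicator {min 0 d..max 0 d} (x - t) * ennreal (norm (D (Suc 0) t)) \<partial>lborel) \<partial>lborel)"
    by (intro nn_integral_mono) (auto simp: power2_eq_square ennreal_mult intro!: mult_mono le \<psi>_difference)
  also have "\<dots> = ennreal N * (\<integral>\<^sup>+x. \<integral>\<^sup>+t. indicator {min 0 d..max 0 d} (x - t) * ennreal (norm (D (Suc 0) t)) \<partial>lborel \<partial>lborel)"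
    by (rule nn_integral_cmult) measurable
  also have "(\<integral>\<^sup>+x. \<integral>\<^sup>+t. indicator {min 0 d..max 0 d} (x - t) * ennreal (norm (D (Suc 0) t)) \<partial>lborel \<partial>lborel) =
      (\<integral>\<^sup>+t. \<integral>\<^sup>+x. indicator {min 0 d..max 0 d} (x - t) * ennreal (norm (D (Suc 0) t)) \<partial>lborel \<partial>lborel)"
    by (rule lborel_pair.Fubini') measurable
  also have "\<dots> = (\<integral>\<^sup>+t. ennreal \<bar>d\<bar> * ennreal (norm (D (Suc 0) t)) \<partial>lborel)"
  proof (rule nn_integral_cong)
    fix t
    have "(\<integral>\<^sup>+x. indicator {min 0 d..max 0 d} (x - t) * ennreal (norm (D (Suc 0) t)) \<partial>lborel) =
        (\<integral>\<^sup>+x. indicator {t + min 0 d..t + max 0 d} x \<partial>lborel) * ennreal (norm (D (Suc 0) t))"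
      by (subst nn_integral_multc[symmetric]) (auto intro!: nn_integral_cong simp: indicator_def)
    also have "(\<integral>\<^sup>+x. indicator {t + min 0 d..t + max 0 d} x \<partial>lborel) = ennreal \<bar>d\<bar>"
      by (simp add: min_def max_def)
    finally show "(\<integral>\<^sup>+x. indicator {min 0 d..max 0 d} (x - t) * ennreal (norm (D (Suc 0) t)) \<partial>lborel) = ennreal \<bar>d\<bar> * ennreal (norm (D (Suc 0) t))" .
  qed
  also have "\<dots> = ennreal \<bar>d\<bar> * ennreal N"
    unfolding N[symmetric] by (rule nn_integral_cmult) measurable
  finally have "ennreal ((l2 (\<lambda>x. \<psi> (x - d) - \<psi> x))\<^sup>2) \<le> ennreal (\<bar>d\<bar> * N\<^sup>2)"
    using N0 by (simp add: ennreal_mult[symmetric] power2_eq_square mult_ac)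
  then show "(l2 (\<lambda>x. \<psi> (x - d) - \<psi> x))\<^sup>2 \<le> \<bar>d\<bar> * (\<integral>t. norm (D (Suc 0) t) \<partial>lborel)\<^sup>2"
    by (simp add: N_def ennreal_le_iff)
qed

lemma wavelet_affine: "wavelet \<psi> (j, k) = (\<lambda>x. of_real (2 powr (j / 2)) * \<psi> (real_of_int k + 2 powr j * x))"
  by (simp add: wavelet_def add.commute)

lemma wavelet_translation_tendsto: "((\<lambda>d. l2 (\<lambda>x. wavelet \<psi> i (x - d) - wavelet \<psi> i x)) \<longlongrightarrow> 0) (at 0)"
proof -
  obtain j k where i: "i = (j, k)" by (cases i)
  define a :: real where "a = 2 powr j"
  have a: "a > 0" by (simp add: a_def)
  define N where "N = (\<integral>t. norm (D (Suc 0) t) \<partial>lborel)"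
  have "l2 (\<lambda>x. wavelet \<psi> i (x - d) - wavelet \<psi> i x) \<le> sqrt (a * \<bar>d\<bar> * N\<^sup>2)" for d
  proof -
    define g where "g = (\<lambda>x. \<psi> (x - a * d) - \<psi> x)"
    have "wavelet \<psi> i (x - d) - wavelet \<psi> i x = of_real (2 powr (j / 2)) * g (real_of_int k + a * x)" for x
    proof -
      have "real_of_int k + a * (x - d) = real_of_int k + a * x - a * d" by (simp add: right_diff_distrib)
      then show ?thesis by (simp only: i wavelet_affine a_def[symmetric] g_def right_diff_distrib)
    qed
    then have "(l2 (\<lambda>x. wavelet \<psi> i (x - d) - wavelet \<psi> i x))\<^sup>2 = (2 powr (j / 2))\<^sup>2 * ((l2 g)\<^sup>2 / a)"
      using a l2_affine[of a g "real_of_int k"] by (simp add: l2_cmult power_mult_distrib)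
    also have "(2 powr (j / 2))\<^sup>2 = a"
      unfolding a_def power2_eq_square powr_add[symmetric] by (rule arg_cong[of _ _ "(powr) 2"]) simp
    also have "a * ((l2 g)\<^sup>2 / a) = (l2 g)\<^sup>2" using a by simp
    also have "\<dots> \<le> a * \<bar>d\<bar> * N\<^sup>2"
      using l2_\<psi>_difference[of "a * d"] a by (simp add: g_def N_def abs_mult)
    finally show ?thesis by (rule real_le_rsqrt)
  qed
  moreover
  have "((\<lambda>d. sqrt (a * \<bar>d\<bar> * N\<^sup>2)) \<longlongrightarrow> sqrt (a * \<bar>0\<bar> * N\<^sup>2)) (at 0)"
    by (intro tendsto_intros)
  then have "((\<lambda>d. sqrt (a * \<bar>d\<bar> * N\<^sup>2)) \<longlongrightarrow> 0) (at 0)" by simp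
  ultimately show ?thesis
    by (elim Lim_null_comparison[rotated]) (auto simp: eventually_at intro: exI[of _ 1])
qed

lemma wavelet_integrable: "integrable lborel (wavelet \<psi> i)"
proof -
  obtain j k where i: "i = (j, k)" by (cases i)
  show ?thesis
    unfolding i wavelet_affine
    by (rule integrable_mult_right[OF lborel_integrable_real_affine[OF \<psi>_integrable]]) simp
qed

lemma wavelet_L2: "wavelet \<psi> i \<in> L2"
  using wav_rep_L2[OF \<psi>_L2] by (cases i) (simp add: wavelet_eq_wav_rep)

text \<open>The reproducing formula is used with n = L + 1. The window then has order L + 2, as the
  row and column bounds require, and the coefficient of \<eta> has order L + 1.\<close>

lemma coorbit_frame:
  assumes \<eta>: "\<eta> \<in> L2" and c: "c > 0" and \<rho>: "0 \<le> \<rho>" "\<rho> < L - 1 / 2"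
    and tight: "\<And>f. f \<in> L2 \<Longrightarrow> (\<lambda>i. (norm (L2_inner f (wavelet \<psi> i)))\<^sup>2) summable_on UNIV \<and>
      c * l2 f = sqrt (\<Sum>\<^sub>\<infinity>i. (norm (L2_inner f (wavelet \<psi> i)))\<^sup>2)"
    and \<eta>row: "\<And>\<sigma>. \<bar>\<sigma>\<bar> \<le> \<rho> \<Longrightarrow> (\<integral>\<^sup>+z. ennreal (norm (wav_trans \<eta> \<eta> z) * \<bar>snd z\<bar> powr \<sigma>) \<partial>aff_haar) < \<infinity>"
    and w: "Im w \<noteq> 0" and K: "(\<integral>s. \<eta> s * atom (Suc L) w s \<partial>lborel) \<noteq> 0"
  shows "coorbit_frame \<psi> \<eta> (\<lambda>x. cnj (atom (Suc (Suc L)) w x))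
    (of_real (2 * pi * sgn (Im w) / Suc L) * \<i> * (\<integral>s. \<eta> s * atom (Suc L) w s \<partial>lborel)) c \<rho>"
proof
  show "(\<lambda>x. cnj (atom (Suc (Suc L)) w x)) \<in> L2" using w by (intro L2_cnj atom_L2) auto
  show "of_real (2 * pi * sgn (Im w) / Suc L) * \<i> * (\<integral>s. \<eta> s * atom (Suc L) w s \<partial>lborel) \<noteq> 0"
    using K w by (simp add: sgn_if del: of_nat_Suc)
  fix \<sigma> assume "\<bar>\<sigma>\<bar> \<le> \<rho>"
  then have \<sigma>: "\<bar>\<sigma>\<bar> < L - 1 / 2" using \<rho> by simp
  have m: "L + 2 \<le> Suc (Suc L)" by simp
  show "\<exists>C\<ge>0. \<forall>i. (\<integral>\<^sup>+z. ennreal (norm (L2_inner (wavelet \<psi> i) (wav_rep z (\<lambda>x. cnj (atom (Suc (Suc L)) w x)))) * \<bar>snd z\<bar> powr \<sigma>) \<partial>aff_haar)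
      \<le> ennreal (C * 2 powr (- real_of_int (fst i) * \<sigma>))"
    by (rule wavelet_atom_row_bound[OF w m \<sigma>]) auto
  show "\<exists>C\<ge>0. \<forall>z. (\<integral>\<^sup>+i. ennreal (norm (L2_inner (wavelet \<psi> i) (wav_rep z (\<lambda>x. cnj (atom (Suc (Suc L)) w x)))) * 2 powr (- real_of_int (fst i) * \<sigma>)) \<partial>count_space UNIV)
      \<le> ennreal (C * \<bar>snd z\<bar> powr \<sigma>)"
    by (rule wavelet_atom_column_bound[OF w m \<sigma>]) auto
next
  fix i h assume h: "h \<in> L2"
  have m: "L + 2 \<le> Suc (Suc L)" by simp
  interpret reproducing_setup w "Suc L" \<eta> h "wavelet \<psi> i"
    using w \<eta> h L wavelet_L2 wavelet_integrable by unfold_locales auto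
  have "\<bar>0 :: real\<bar> < L - 1 / 2" using L by simp
  from wavelet_atom_row_bound[OF w m this]
  obtain C where "(\<integral>\<^sup>+z. ennreal (norm (L2_inner (wavelet \<psi> (fst i, snd i)) (wav_rep z (\<lambda>x. cnj (atom (Suc (Suc L)) w x)))) * \<bar>snd z\<bar> powr 0) \<partial>aff_haar)
      \<le> ennreal (C * 2 powr (- real_of_int (fst i) * 0))"
    by blast
  \<comment> \<open>The row bound at \<sigma> = 0 is the plain integral: \<open>|a| powr 0\<close>
    is 1 except at a = 0, where the transform vanishes anyway.\<close>
  moreover have "AE z in aff_haar. norm (L2_inner (wavelet \<psi> (fst i, snd i)) (wav_rep z (\<lambda>x. cnj (atom (Suc (Suc L)) w x)))) * \<bar>snd z\<bar> powr 0 =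
      norm (wav_trans (\<lambda>x. cnj (atom (Suc (Suc L)) w x)) (wavelet \<psi> i) z)"
  proof (rule AE_I2)
    fix z :: "real \<times> real"
    obtain b a where z: "z = (b, a)" by (cases z)
    show "norm (L2_inner (wavelet \<psi> (fst i, snd i)) (wav_rep z (\<lambda>x. cnj (atom (Suc (Suc L)) w x)))) * \<bar>snd z\<bar> powr 0 =
      norm (wav_trans (\<lambda>x. cnj (atom (Suc (Suc L)) w x)) (wavelet \<psi> i) z)"
      by (cases "a = 0") (simp_all add: z wav_rep_0 wav_trans_def L2_inner_def[of _ "\<lambda>_. 0"])
  qed
  ultimately have "(\<integral>\<^sup>+z. ennreal (norm (wav_trans (\<lambda>x. cnj (atom (Suc (Suc L)) w x)) (wavelet \<psi> i) z)) \<partial>aff_haar) \<le> ennreal C"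
    by (subst (asm) nn_integral_cong_AE) auto
  then have "(\<integral>\<^sup>+z. ennreal (norm (wav_trans (\<lambda>x. cnj (atom (Suc (Suc L)) w x)) (wavelet \<psi> i) z)) \<partial>aff_haar) < \<infinity>"
    by (rule le_less_trans) simp
  from reproducing[OF wavelet_translation_tendsto this]
  show "(\<integral>z. L2_inner (wavelet \<psi> i) (wav_rep z (\<lambda>x. cnj (atom (Suc (Suc L)) w x))) * L2_inner (wav_rep z \<eta>) h \<partial>aff_haar) =
      of_real (2 * pi * sgn (Im w) / Suc L) * \<i> * (\<integral>s. \<eta> s * atom (Suc L) w s \<partial>lborel) * L2_inner (wavelet \<psi> i) h"
    unfolding wav_trans_def .
qed (use assms \<psi>_L2 in auto)

end

lemma powr_le_wt_w:
  assumes "\<bar>\<sigma>\<bar> \<le> \<rho>"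
  shows "\<bar>snd z\<bar> powr \<sigma> \<le> wt_w \<rho> z"
proof (cases "\<bar>snd z\<bar> \<ge> 1")
  case True
  then have "\<bar>snd z\<bar> powr \<sigma> \<le> \<bar>snd z\<bar> powr \<rho>" using assms by (intro powr_mono) auto
  then show ?thesis by (simp add: wt_w_def split_beta add_increasing2)
next
  case False
  then have "\<bar>snd z\<bar> powr \<sigma> \<le> \<bar>snd z\<bar> powr (- \<rho>)" using assms by (intro powr_mono') auto
  then show ?thesis by (simp add: wt_w_def split_beta add_increasing)
qed

lemma analyzing_nn_integral:
  assumes \<eta>: "\<eta> \<in> analyzing \<rho>" and \<sigma>: "\<bar>\<sigma>\<bar> \<le> \<rho>"
  shows "(\<integral>\<^sup>+z. ennreal (norm (wav_trans \<eta> \<eta> z) * \<bar>snd z\<bar> powr \<sigma>) \<partial>aff_haar) < \<infinity>"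
proof -
  have w0: "0 \<le> wt_w \<rho> z" for z by (simp add: wt_w_def split_beta)
  have "integrable aff_haar (\<lambda>z. norm (wav_trans \<eta> \<eta> z * of_real (wt_w \<rho> z)))"
    using \<eta> by (simp add: analyzing_def wLp_space_def Lp_space_def)
  then have "(\<integral>\<^sup>+z. ennreal (norm (wav_trans \<eta> \<eta> z) * wt_w \<rho> z) \<partial>aff_haar) < \<infinity>"
    using w0 by (simp add: integrable_iff_bounded norm_mult)
  moreover have "(\<integral>\<^sup>+z. ennreal (norm (wav_trans \<eta> \<eta> z) * \<bar>snd z\<bar> powr \<sigma>) \<partial>aff_haar) \<le> (\<integral>\<^sup>+z. ennreal (norm (wav_trans \<eta> \<eta> z) * wt_w \<rho> z) \<partial>aff_haar)"
    by (intro nn_integral_mono ennreal_leI mult_left_mono powr_le_wt_w[OF \<sigma>]) simp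
  ultimately show ?thesis by (rule le_less_trans[rotated])
qed

lemma nderiv_has_vector_derivative:
  assumes "times_differentiable n f" "k < n"
  shows "(nderiv k f has_vector_derivative nderiv (Suc k) f x) (at x)"
  using assms by (auto simp: times_differentiable_def nderiv_def vector_derivative_works[symmetric])

theorem theorem6p1p7:
  fixes L :: nat and \<psi> \<eta> :: "real \<Rightarrow> complex" and s :: real and p :: ennreal
  assumes "L \<ge> 2"
    and "\<psi> \<in> L2"
    and "\<And>k. k \<le> L \<Longrightarrow> integrable lborel (\<lambda>t. \<bar>t\<bar> ^ k * norm (\<psi> t))"
    and "\<And>k. k < L \<Longrightarrow> (\<integral>t. of_real (t ^ k) * \<psi> t \<partial>lborel) = 0"
    and "times_differentiable L \<psi>"
    and "\<And>k. k \<le> L \<Longrightarrow> integrable lborel (nderiv k \<psi>)"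
    and "\<exists>U. compact_nbhd_one U \<and>
           (\<integral>\<^sup>+t. (SUP (\<delta>, \<tau>)\<in>U. ennreal (norm (nderiv L \<psi> (\<tau> * t + \<delta>)))) \<partial>lborel) < \<infinity>"
    and "tight_frame (wavelet \<psi>)"
    and "\<bar>s\<bar> < real L - 3 / 2"
    and "1 \<le> p"
    and "\<eta> \<in> analyzing (\<bar>s\<bar> + 1)"
    and "\<not> (AE x in lborel. \<eta> x = 0)"
  shows "banach_frame \<eta> p s (dyadic_seq_space p s) (dyadic_seq_norm p s) (wavelet \<psi>)"
proof -
  have \<eta>: "\<eta> \<in> L2" using assms(11) by (simp add: analyzing_def)
  interpret regular_wavelet L \<psi> "\<lambda>k. nderiv k \<psi>"
    using assms nderiv_has_vector_derivative[OF assms(5)]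
    by unfold_locales (auto simp: nderiv_def[of 0])
  obtain c where c: "c > 0" and tight: "\<And>f. f \<in> L2 \<Longrightarrow> (\<lambda>i. (norm (L2_inner f (wavelet \<psi> i)))\<^sup>2) summable_on UNIV \<and>
      c * l2 f = sqrt (\<Sum>\<^sub>\<infinity>i. (norm (L2_inner f (wavelet \<psi> i)))\<^sup>2)"
    using assms(8) unfolding tight_frame_def Lp_norm_2 by blast
  \<comment> \<open>The pole depends on \<eta>, and so do the frame constants; the statement fixes
    \<eta> before they are chosen.\<close>
  obtain w where w: "Im w \<noteq> 0" "(\<integral>s. \<eta> s * atom (Suc L) w s \<partial>lborel) \<noteq> 0"
    using ex_atom_coefficient_neq_0[OF \<eta> assms(12), of "Suc L"] by auto
  \<comment> \<open>The restriction |s| < L - 3/2 enters here, as |s| + 1 < L - 1/2.\<close>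
  interpret coorbit_frame \<psi> \<eta> "\<lambda>x. cnj (atom (Suc (Suc L)) w x)"
    "of_real (2 * pi * sgn (Im w) / Suc L) * \<i> * (\<integral>s. \<eta> s * atom (Suc L) w s \<partial>lborel)" c "\<bar>s\<bar> + 1"
    using assms(9) by (intro coorbit_frame \<eta> c tight w analyzing_nn_integral[OF assms(11)]) auto
  show ?thesis
    by (rule banach_frame_wavelet[OF refl assms(10)])
qed

end
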